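(* The monoid homomorphisms $\mathcal F^{zs}_{2q}(\Lambda)\cong\mathcal E l_{2q+1}(\Lambda)\hookrightarrow l_{2q+1}(\Lambda)$ (the first being $[v]\mapsto e([v])$, the second the inclusion) induce isomorphisms of the respective Grothendieck groups $$\mathrm{Gr}(\mathcal F^{zs}_{2q}(\Lambda))\cong\mathrm{Gr}(\mathcal E l_{2q+1}(\Lambda))\cong\mathrm{Gr}(l_{2q+1}(\Lambda)).$$
   Context: $\mathrm{Gr}(A)$ is the Grothendieck group of an abelian monoid $A$. $q\ge1$, $\epsilon=(-1)^q$, $\Lambda$ is a unital ring with involution $x\mapsto\bar x$, weakly finite (ranks of finitely generated free modules are well defined). Fix a subgroup $Z\subset\widetilde K_1(\Lambda)=\mathrm{coker}(K_1(\mathbb Z)\to K_1(\Lambda))$ invariant under $[f]\mapsto[f^*]$. A based module is a stably finitely generated free left $\Lambda$-module $M$ with an equivalence class of $s$-bases (bases of some $M\oplus\Lambda^m$; two are equivalent if after adding standard basis vectors the transformation matrix represents an element of $Z$). An isomorphism of based modules is simple if its torsion lies in $Z$. For a based module $M$ let $T_\epsilon$ act on $\mathrm{Hom}(M,M^* )$ by $(T_\epsilon\phi)(x)(y)=\epsilon\overline{\phi(y)(x)}$ and $Q_\epsilon(M)=\mathrm{coker}(1-T_\epsilon)$. An $\epsilon$-quadratic form is $(M,\psi)$ with $\psi\in Q_\epsilon(M)$; it is simple if $\psi+\epsilon\psi^*\colon M\to M^*$ is a simple isomorphism. Isometries are simple isomorphisms preserving $\psi$. $H_\epsilon(L)=(L\oplus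 L^*,\begin{pmatrix}0&1\\0&0\end{pmatrix})$. A Lagrangian is a based direct summand $L$ with $L=L^\perp$ (unbased, with respect to $\psi+\epsilon\psi^*$) and $\psi|_L=0\in Q_\epsilon(L)$; it is simple, for a simple form, if $0\to L\to M\to L^*\to0$ is a based exact sequence. $\mathcal F^{zs}_{2q}(\Lambda)$ is the abelian monoid (direct sum) of $0$-stabilised forms: classes $[v]$ of $\epsilon$-quadratic forms modulo isometry after adding zero forms $(P,0)$. A quasi-formation $(M,\psi;L,V)$ is a simple form with a simple Lagrangian $L$ and a based half-rank direct summand $V$. Isomorphisms are isometries carrying $L$ to $L'$, $V$ to $V'$ by simple isomorphisms. Trivial formations are $(H_\epsilon(P);P,P^* )$; stable isomorphism is isomorphism after adding trivial formations. $l_{2q+1}(\Lambda)$ is the abelian monoid (direct sum) of stable isomorphism classes of quasi-formations modulo $(M,\psi;K,L)\oplus(M,\psi;L,V)\sim(M,\psi;K,V)$ for simple Lagrangians $K,L$. An element is elementary if it is represented by a boundary $\delta(K,\rho)=(H_\epsilon(K);K,\begin{pmatrix}1\\\rho\end{pmatrix}K)$, $K$ based, $\rho\in\mathrm{Hom}(K,K^* )$ arbitrary; the elementary elements form a submonoid $\mathcal E l_{2q+1}(\Lambda)$. For $v=(V,\theta)$, $e([v])=[\delta(V,\rho)]$ with $\rho$ any representative of $\theta$; $[v]\mapsto e([v])$ is a monoid isomorphism $\mathcal F^{zs}_{2q}(\Lambda)\cong\mathcal E l_{2q+1}(\Lambda)$. *)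

theory Defs
  imports "HOL-Algebra.Module" "HOL-Algebra.Generated_Groups"
begin

section \<open>The Grothendieck group of an abelian monoid\<close>

definition Gr_rel :: "('x, 'y) monoid_scheme \<Rightarrow> (('x \<times> 'x) \<times> ('x \<times> 'x)) set" where
  "Gr_rel A = {((a, b), (c, d)). a \<in> carrier A \<and> b \<in> carrier A \<and> c \<in> carrier A \<and> d \<in> carrier A \<and>
     (\<exists>k\<in>carrier A. a \<otimes>\<^bsub>A\<^esub> d \<otimes>\<^bsub>A\<^esub> k = c \<otimes>\<^bsub>A\<^esub> b \<otimes>\<^bsub>A\<^esub> k)}"

text \<open>The class of \<open>(a, b)\<close> is the formal difference of \<open>a\<close> and \<open>b\<close>.\<close>

definition Gr :: "('x, 'y) monoid_scheme \<Rightarrow> ('x \<times> 'x) set monoid" where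
  "Gr A = \<lparr> carrier = (carrier A \<times> carrier A) // Gr_rel A,
     mult = (\<lambda>X Y. \<Union>(a, b)\<in>X. \<Union>(c, d)\<in>Y. Gr_rel A `` {(a \<otimes>\<^bsub>A\<^esub> c, b \<otimes>\<^bsub>A\<^esub> d)}),
     one = Gr_rel A `` {(\<one>\<^bsub>A\<^esub>, \<one>\<^bsub>A\<^esub>)} \<rparr>"

definition Gr_map :: "('w, 'z) monoid_scheme \<Rightarrow> ('x \<Rightarrow> 'w) \<Rightarrow> ('x \<times> 'x) set \<Rightarrow> ('w \<times> 'w) set" where
  "Gr_map B f X = (\<Union>(a, b)\<in>X. Gr_rel B `` {(f a, f b)})"


section \<open>Reduced first K-group\<close>

text \<open>
  \<open>GL\<close> is the infinite general linear group: its elements are infinite matrices which agree with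
  the identity outside a finite block.
\<close>

type_synonym 'a imat = "nat \<Rightarrow> nat \<Rightarrow> 'a"

definition finitary :: "'a::ring_1 imat \<Rightarrow> bool" where
  "finitary A \<longleftrightarrow> (\<exists>n. \<forall>i j. i \<ge> n \<or> j \<ge> n \<longrightarrow> A i j = (if i = j then 1 else 0))"

definition GL :: "'a::ring_1 imat monoid" where
  "GL = units_of \<lparr> carrier = {A. finitary A},
     mult = (\<lambda>A B i j. \<Sum>k | A i k \<noteq> 0. A i k * B k j),
     one = (\<lambda>i j. if i = j then 1 else 0) \<rparr>"

definition K1 :: "'a::ring_1 imat set monoid" where
  "K1 = GL Mod derived GL (carrier GL)"

definition K1_class :: "'a::ring_1 imat \<Rightarrow> 'a imat set" where
  "K1_class A = derived GL (carrier GL) #>\<^bsub>GL\<^esub> A"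

definition K1_of_int :: "int imat set \<Rightarrow> 'a::ring_1 imat set" where
  "K1_of_int X = (\<Union>A\<in>X. K1_class (\<lambda>i j. of_int (A i j)))"

definition K1_red :: "'a::ring_1 imat set set monoid" where
  "K1_red = K1 Mod (K1_of_int ` carrier K1)"

definition K1_red_class :: "'a::ring_1 imat \<Rightarrow> 'a imat set set" where
  "K1_red_class A = (K1_of_int ` carrier K1) #>\<^bsub>K1\<^esub> K1_class A"


section \<open>Left modules\<close>

text \<open>
  HOL-Algebra's locale \<open>module\<close> requires a commutative ring of scalars, so only its record type is
  used. The multiplicative fields \<open>mult\<close> and \<open>one\<close> of that record are irrelevant.
\<close>

definition left_module :: "('a::ring_1, 'm, 'z) module_scheme \<Rightarrow> bool" where
  "left_module M \<longleftrightarrow> abelian_group M \<and>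
     (\<forall>a. \<forall>x\<in>carrier M. a \<odot>\<^bsub>M\<^esub> x \<in> carrier M) \<and>
     (\<forall>a b. \<forall>x\<in>carrier M. (a + b) \<odot>\<^bsub>M\<^esub> x = a \<odot>\<^bsub>M\<^esub> x \<oplus>\<^bsub>M\<^esub> b \<odot>\<^bsub>M\<^esub> x) \<and>
     (\<forall>a. \<forall>x\<in>carrier M. \<forall>y\<in>carrier M. a \<odot>\<^bsub>M\<^esub> (x \<oplus>\<^bsub>M\<^esub> y) = a \<odot>\<^bsub>M\<^esub> x \<oplus>\<^bsub>M\<^esub> a \<odot>\<^bsub>M\<^esub> y) \<and>
     (\<forall>a b. \<forall>x\<in>carrier M. (a * b) \<odot>\<^bsub>M\<^esub> x = a \<odot>\<^bsub>M\<^esub> (b \<odot>\<^bsub>M\<^esub> x)) \<and>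
     (\<forall>x\<in>carrier M. 1 \<odot>\<^bsub>M\<^esub> x = x)"

text \<open>Homomorphisms are taken extensional, so that equality of homomorphisms is equality in HOL.\<close>

definition mhom :: "('a::ring_1, 'm, 'y) module_scheme \<Rightarrow> ('a, 'n, 'z) module_scheme \<Rightarrow> ('m \<Rightarrow> 'n) set" where
  "mhom M N = {f \<in> carrier M \<rightarrow>\<^sub>E carrier N.
     (\<forall>x\<in>carrier M. \<forall>y\<in>carrier M. f (x \<oplus>\<^bsub>M\<^esub> y) = f x \<oplus>\<^bsub>N\<^esub> f y) \<and>
     (\<forall>a. \<forall>x\<in>carrier M. f (a \<odot>\<^bsub>M\<^esub> x) = a \<odot>\<^bsub>N\<^esub> f x)}"

definition miso :: "('a::ring_1, 'm, 'y) module_scheme \<Rightarrow> ('a, 'n, 'z) module_scheme \<Rightarrow> ('m \<Rightarrow> 'n) set" where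
  "miso M N = {f \<in> mhom M N. bij_betw f (carrier M) (carrier N)}"

definition hom_group :: "('a::ring_1, 'm, 'y) module_scheme \<Rightarrow> ('a, 'n, 'z) module_scheme \<Rightarrow> ('m \<Rightarrow> 'n) monoid" where
  "hom_group M N = \<lparr> carrier = mhom M N,
     mult = (\<lambda>f g. \<lambda>x\<in>carrier M. f x \<oplus>\<^bsub>N\<^esub> g x),
     one = (\<lambda>x\<in>carrier M. \<zero>\<^bsub>N\<^esub>) \<rparr>"

definition ring_module :: "('a::ring_1, 'a) module" where
  "ring_module = \<lparr> carrier = UNIV, mult = undefined, one = undefined,
     zero = 0, add = (\<lambda>x y. x + y), smult = (\<lambda>a x. a * x) \<rparr>"

definition free_module :: "nat \<Rightarrow> ('a::ring_1, nat \<Rightarrow> 'a) module" where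
  "free_module n = \<lparr> carrier = {v. \<forall>i\<ge>n. v i = 0}, mult = undefined, one = undefined,
     zero = (\<lambda>i. 0), add = (\<lambda>v w i. v i + w i), smult = (\<lambda>a v i. a * v i) \<rparr>"

definition unit_vec :: "nat \<Rightarrow> nat \<Rightarrow> 'a::ring_1" where
  "unit_vec i = (\<lambda>j. if i = j then 1 else 0)"

definition msum :: "('a::ring_1, 'm, 'y) module_scheme \<Rightarrow> ('a, 'n, 'z) module_scheme \<Rightarrow> ('a, 'm \<times> 'n) module" where
  "msum M N = \<lparr> carrier = carrier M \<times> carrier N, mult = undefined, one = undefined,
     zero = (\<zero>\<^bsub>M\<^esub>, \<zero>\<^bsub>N\<^esub>),
     add = (\<lambda>(x, y) (x', y'). (x \<oplus>\<^bsub>M\<^esub> x', y \<oplus>\<^bsub>N\<^esub> y')),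
     smult = (\<lambda>a (x, y). (a \<odot>\<^bsub>M\<^esub> x, a \<odot>\<^bsub>N\<^esub> y)) \<rparr>"

definition is_submodule :: "('a::ring_1, 'm, 'y) module_scheme \<Rightarrow> ('a, 'm, 'z) module_scheme \<Rightarrow> bool" where
  "is_submodule L M \<longleftrightarrow> left_module L \<and> (\<lambda>x\<in>carrier L. x) \<in> mhom L M"

definition direct_summand :: "('a::ring_1, 'm, 'y) module_scheme \<Rightarrow> ('a, 'm, 'z) module_scheme \<Rightarrow> bool" where
  "direct_summand L M \<longleftrightarrow> is_submodule L M \<and>
     (\<exists>W :: ('a, 'm) module. is_submodule W M \<and>
        bij_betw (\<lambda>(x, w). x \<oplus>\<^bsub>M\<^esub> w) (carrier L \<times> carrier W) (carrier M))"

definition weakly_finite :: "'a::ring_1 itself \<Rightarrow> bool" where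
  "weakly_finite _ \<longleftrightarrow>
     (\<forall>m n. miso (free_module m :: ('a, nat \<Rightarrow> 'a) module) (free_module n) \<noteq> {} \<longrightarrow> m = n)"

definition lincomb :: "('a::ring_1, 'm, 'z) module_scheme \<Rightarrow> 'm list \<Rightarrow> (nat \<Rightarrow> 'a) \<Rightarrow> 'm" where
  "lincomb N bs c = (\<Oplus>\<^bsub>N\<^esub>i\<in>{..<length bs}. c i \<odot>\<^bsub>N\<^esub> bs ! i)"

definition is_basis :: "('a::ring_1, 'm, 'z) module_scheme \<Rightarrow> 'm list \<Rightarrow> bool" where
  "is_basis N bs \<longleftrightarrow> set bs \<subseteq> carrier N \<and>
     (\<forall>x\<in>carrier N. \<exists>!c. c \<in> carrier (free_module (length bs)) \<and> lincomb N bs c = x)"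

definition coords :: "('a::ring_1, 'm, 'z) module_scheme \<Rightarrow> 'm list \<Rightarrow> 'm \<Rightarrow> nat \<Rightarrow> 'a" where
  "coords N bs x = (THE c. c \<in> carrier (free_module (length bs)) \<and> lincomb N bs c = x)"

text \<open>Row \<open>i\<close> expresses \<open>xs ! i\<close> in the basis \<open>bs\<close>.\<close>

definition trans_mat :: "('a::ring_1, 'm, 'z) module_scheme \<Rightarrow> 'm list \<Rightarrow> 'm list \<Rightarrow> 'a imat" where
  "trans_mat N bs xs = (\<lambda>i. if i < length xs then coords N bs (xs ! i) else unit_vec i)"

text \<open>An s-basis \<open>(m, bs)\<close> of \<open>M\<close> is a basis \<open>bs\<close> of the sum of \<open>M\<close> with the free module of rank \<open>m\<close>.\<close>

type_synonym ('a, 'm) sbasis = "nat \<times> ('m \<times> (nat \<Rightarrow> 'a)) list"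

definition is_sbasis :: "('a::ring_1, 'm, 'z) module_scheme \<Rightarrow> ('a, 'm) sbasis \<Rightarrow> bool" where
  "is_sbasis M b \<longleftrightarrow> is_basis (msum M (free_module (fst b))) (snd b)"

text \<open>For \<open>k \<ge> m\<close>, the basis after stabilisation to the free summand of rank \<open>k\<close>.\<close>

definition stabilise :: "('a::ring_1, 'm, 'z) module_scheme \<Rightarrow> nat \<Rightarrow> ('a, 'm) sbasis \<Rightarrow> ('m \<times> (nat \<Rightarrow> 'a)) list" where
  "stabilise M k b = snd b @ map (\<lambda>i. (\<zero>\<^bsub>M\<^esub>, unit_vec i)) [fst b..<k]"

definition map_sbasis :: "('m \<Rightarrow> 'n) \<Rightarrow> ('a, 'm) sbasis \<Rightarrow> ('a, 'n) sbasis" where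
  "map_sbasis f b = (fst b, map (map_prod f id) (snd b))"

definition sum_sbasis :: "('a::ring_1, 'm, 'y) module_scheme \<Rightarrow> ('a, 'n, 'z) module_scheme \<Rightarrow>
    ('a, 'm) sbasis \<Rightarrow> ('a, 'n) sbasis \<Rightarrow> ('a, 'm \<times> 'n) sbasis" where
  "sum_sbasis M N b c = (fst b + fst c,
     map (\<lambda>(x, v). ((x, \<zero>\<^bsub>N\<^esub>), v)) (snd b) @
     map (\<lambda>(y, w). ((\<zero>\<^bsub>M\<^esub>, y), \<lambda>j. if j < fst b then 0 else w (j - fst b))) (snd c))"

record ('a, 'm) based_module = "('a, 'm) module" +
  sbases :: "('a, 'm) sbasis set"

definition with_sbases :: "('a, 'm, 'z) module_scheme \<Rightarrow> ('a, 'm) sbasis set \<Rightarrow> ('a, 'm) based_module" where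
  "with_sbases M B = \<lparr> carrier = carrier M, mult = undefined, one = undefined,
     zero = \<zero>\<^bsub>M\<^esub>, add = add M, smult = smult M, sbases = B \<rparr>"

definition push_based :: "('m \<Rightarrow> 'n) \<Rightarrow> ('a, 'm) based_module \<Rightarrow> ('a, 'n, 'z) module_scheme \<Rightarrow> ('a, 'n) based_module" where
  "push_based f P N = with_sbases (N\<lparr>carrier := f ` carrier P\<rparr>) (map_sbasis f ` sbases P)"

definition rank :: "('a, 'm) based_module \<Rightarrow> int" where
  "rank M = (let b = (SOME b. b \<in> sbases M) in int (length (snd b)) - int (fst b))"


section \<open>Rings with involution\<close>

definition ring_involution :: "('a::ring_1 \<Rightarrow> 'a) \<Rightarrow> bool" where
  "ring_involution bar \<longleftrightarrow>
     (\<forall>x y. bar (x + y) = bar x + bar y) \<and> (\<forall>x y. bar (x * y) = bar y * bar x) \<and>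
     (\<forall>x. bar (bar x) = x)"

text \<open>With respect to dual bases, the dual of a homomorphism has the conjugate transposed matrix.\<close>

definition star_invariant :: "('a::ring_1 \<Rightarrow> 'a) \<Rightarrow> 'a imat set set set \<Rightarrow> bool" where
  "star_invariant bar Z \<longleftrightarrow>
     (\<forall>A\<in>carrier GL. K1_red_class A \<in> Z \<longrightarrow> K1_red_class (\<lambda>i j. bar (A j i)) \<in> Z)"

type_synonym ('a, 'm) qform = "('a, 'm) based_module \<times> ('m \<Rightarrow> 'm \<Rightarrow> 'a) set"

text \<open>A tuple \<open>(M, \<theta>, L, V)\<close> stands for the quasi-formation \<open>(M, \<theta>; L, V)\<close>.\<close>

type_synonym ('a, 'm) qformation =
  "('a, 'm) based_module \<times> ('m \<Rightarrow> 'm \<Rightarrow> 'a) set \<times> ('a, 'm) based_module \<times> ('a, 'm) based_module"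

text \<open>
  The isomorphism classes below are formed from based modules whose elements lie in the type
  \<open>nat \<Rightarrow> 'a\<close>, with arbitrary operations. As a stably finitely generated free module embeds into
  some finitely generated free module, each of them is isomorphic to one in this universe.
  Isomorphisms may relate modules over different types, so that a sum or dual, which has another
  type, determines an isomorphism class in the universe.
\<close>

type_synonym 'a univ = "nat \<Rightarrow> 'a"

text \<open>The hypotheses on the parameters are not part of the locale.\<close>

locale l_theory =
  fixes bar :: "'a::ring_1 \<Rightarrow> 'a"
    and q :: nat
    and Z :: "'a imat set set set"
begin

definition eps :: 'a where
  "eps = (- 1) ^ q"

definition represents_Z :: "'a imat \<Rightarrow> bool" where
  "represents_Z A \<longleftrightarrow> A \<in> carrier GL \<and> K1_red_class A \<in> Z"


subsection \<open>Based modules\<close>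

definition s_equiv :: "('a, 'm, 'z) module_scheme \<Rightarrow> ('a, 'm) sbasis \<Rightarrow> ('a, 'm) sbasis \<Rightarrow> bool" where
  "s_equiv M b c \<longleftrightarrow> (\<exists>k. fst b \<le> k \<and> fst c \<le> k \<and>
     represents_Z (trans_mat (msum M (free_module k)) (stabilise M k b) (stabilise M k c)))"

definition s_class :: "('a, 'm, 'z) module_scheme \<Rightarrow> ('a, 'm) sbasis \<Rightarrow> ('a, 'm) sbasis set" where
  "s_class M b = {c. is_sbasis M c \<and> s_equiv M b c}"

definition is_based :: "('a, 'm) based_module \<Rightarrow> bool" where
  "is_based M \<longleftrightarrow> left_module M \<and> (\<exists>b. is_sbasis M b \<and> sbases M = s_class M b)"

text \<open>
  The torsion of \<open>f\<close> is the class of its matrix with respect to stabilised s-bases of \<open>M\<close> and \<open>N\<close>,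
  that is, of the transformation matrix from the s-basis of \<open>N\<close> to the image of that of \<open>M\<close>.
\<close>

definition simple_iso :: "('a, 'm) based_module \<Rightarrow> ('a, 'n) based_module \<Rightarrow> ('m \<Rightarrow> 'n) \<Rightarrow> bool" where
  "simple_iso M N f \<longleftrightarrow> f \<in> miso M N \<and>
     (\<exists>b\<in>sbases M. \<exists>c\<in>sbases N. s_equiv N c (map_sbasis f b))"

definition bsum :: "('a, 'm) based_module \<Rightarrow> ('a, 'n) based_module \<Rightarrow> ('a, 'm \<times> 'n) based_module" where
  "bsum M N = with_sbases (msum M N)
     (\<Union>b\<in>sbases M. \<Union>c\<in>sbases N. s_class (msum M N) (sum_sbasis M N b c))"

definition dual_module :: "('a, 'm, 'z) module_scheme \<Rightarrow> ('a, 'm \<Rightarrow> 'a) module" where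
  "dual_module M = \<lparr> carrier = mhom M ring_module, mult = undefined, one = undefined,
     zero = (\<lambda>x\<in>carrier M. 0),
     add = (\<lambda>f g. \<lambda>x\<in>carrier M. f x + g x),
     smult = (\<lambda>a f. \<lambda>x\<in>carrier M. f x * bar a) \<rparr>"

text \<open>
  The dual of a basis of the sum of \<open>M\<close> and a free module of rank \<open>m\<close>, where the dual of the free
  module is identified with the free module by \<open>f \<mapsto> (bar (f (unit_vec j)))\<^sub>j\<close>.
\<close>

definition dual_sbasis :: "('a, 'm, 'z) module_scheme \<Rightarrow> ('a, 'm) sbasis \<Rightarrow> ('a, 'm \<Rightarrow> 'a) sbasis" where
  "dual_sbasis M b = (let m = fst b; d = coords (msum M (free_module m)) (snd b) in
     (m, map (\<lambda>i. (\<lambda>x\<in>carrier M. d (x, \<lambda>j. 0) i,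
                   \<lambda>j. if j < m then bar (d (\<zero>\<^bsub>M\<^esub>, unit_vec j) i) else 0))
       [0..<length (snd b)]))"

definition dual :: "('a, 'm) based_module \<Rightarrow> ('a, 'm \<Rightarrow> 'a) based_module" where
  "dual M = with_sbases (dual_module M) (\<Union>b\<in>sbases M. s_class (dual_module M) (dual_sbasis M b))"

text \<open>The condition does not depend on the choice of the section \<open>s\<close>.\<close>

definition based_exact :: "('a, 'm) based_module \<Rightarrow> ('a, 'n) based_module \<Rightarrow> ('a, 'k) based_module \<Rightarrow>
    ('m \<Rightarrow> 'n) \<Rightarrow> ('n \<Rightarrow> 'k) \<Rightarrow> bool" where
  "based_exact L M N i p \<longleftrightarrow> i \<in> mhom L M \<and> p \<in> mhom M N \<and>
     inj_on i (carrier L) \<and> p ` carrier M = carrier N \<and>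
     i ` carrier L = {x \<in> carrier M. p x = \<zero>\<^bsub>N\<^esub>} \<and>
     (\<exists>s\<in>mhom N M. (\<forall>y\<in>carrier N. p (s y) = y) \<and>
        simple_iso (bsum L N) M (\<lambda>u\<in>carrier L \<times> carrier N. i (fst u) \<oplus>\<^bsub>M\<^esub> s (snd u)))"


subsection \<open>Quadratic forms\<close>

definition T_eps :: "('a, 'm, 'z) module_scheme \<Rightarrow> ('m \<Rightarrow> 'm \<Rightarrow> 'a) \<Rightarrow> 'm \<Rightarrow> 'm \<Rightarrow> 'a" where
  "T_eps M \<phi> = (\<lambda>x\<in>carrier M. \<lambda>y\<in>carrier M. eps * bar (\<phi> y x))"

definition Q_zero :: "('a, 'm, 'z) module_scheme \<Rightarrow> ('m \<Rightarrow> 'm \<Rightarrow> 'a) set" where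
  "Q_zero M = (\<lambda>\<phi>. \<lambda>x\<in>carrier M. \<lambda>y\<in>carrier M. \<phi> x y - T_eps M \<phi> x y) ` mhom M (dual_module M)"

definition Q_eps :: "('a, 'm, 'z) module_scheme \<Rightarrow> ('m \<Rightarrow> 'm \<Rightarrow> 'a) set monoid" where
  "Q_eps M = hom_group M (dual_module M) Mod Q_zero M"

definition Q_class :: "('a, 'm, 'z) module_scheme \<Rightarrow> ('m \<Rightarrow> 'm \<Rightarrow> 'a) \<Rightarrow> ('m \<Rightarrow> 'm \<Rightarrow> 'a) set" where
  "Q_class M \<phi> = Q_zero M #>\<^bsub>hom_group M (dual_module M)\<^esub> \<phi>"

definition Q_pull :: "('a, 'm, 'z) module_scheme \<Rightarrow> ('m \<Rightarrow> 'n) \<Rightarrow> ('n \<Rightarrow> 'n \<Rightarrow> 'a) set \<Rightarrow> ('m \<Rightarrow> 'm \<Rightarrow> 'a) set" where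
  "Q_pull M f \<theta> = (\<Union>\<phi>\<in>\<theta>. Q_class M (\<lambda>x\<in>carrier M. \<lambda>y\<in>carrier M. \<phi> (f x) (f y)))"

definition Q_sum :: "('a, 'm, 'y) module_scheme \<Rightarrow> ('a, 'n, 'z) module_scheme \<Rightarrow>
    ('m \<Rightarrow> 'm \<Rightarrow> 'a) set \<Rightarrow> ('n \<Rightarrow> 'n \<Rightarrow> 'a) set \<Rightarrow> ('m \<times> 'n \<Rightarrow> 'm \<times> 'n \<Rightarrow> 'a) set" where
  "Q_sum M N \<theta> \<eta> = (\<Union>\<phi>\<in>\<theta>. \<Union>\<chi>\<in>\<eta>. Q_class (msum M N)
     (\<lambda>u\<in>carrier (msum M N). \<lambda>v\<in>carrier (msum M N). \<phi> (fst u) (fst v) + \<chi> (snd u) (snd v)))"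

text \<open>The symmetrisation; it does not depend on the representative \<open>\<phi>\<close>.\<close>

definition symm :: "('a, 'm, 'z) module_scheme \<Rightarrow> ('m \<Rightarrow> 'm \<Rightarrow> 'a) set \<Rightarrow> 'm \<Rightarrow> 'm \<Rightarrow> 'a" where
  "symm M \<theta> = (let \<phi> = (SOME \<phi>. \<phi> \<in> \<theta>) in
     (\<lambda>x\<in>carrier M. \<lambda>y\<in>carrier M. \<phi> x y + T_eps M \<phi> x y))"

fun is_form :: "('a, 'm) qform \<Rightarrow> bool" where
  "is_form (M, \<theta>) \<longleftrightarrow> is_based M \<and> \<theta> \<in> carrier (Q_eps M)"

fun is_simple_form :: "('a, 'm) qform \<Rightarrow> bool" where
  "is_simple_form (M, \<theta>) \<longleftrightarrow> is_form (M, \<theta>) \<and> simple_iso M (dual M) (symm M \<theta>)"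

fun is_isometry :: "('a, 'm) qform \<Rightarrow> ('a, 'n) qform \<Rightarrow> ('m \<Rightarrow> 'n) \<Rightarrow> bool" where
  "is_isometry (M, \<theta>) (N, \<eta>) f \<longleftrightarrow> simple_iso M N f \<and> Q_pull M f \<eta> = \<theta>"

fun form_sum :: "('a, 'm) qform \<Rightarrow> ('a, 'n) qform \<Rightarrow> ('a, 'm \<times> 'n) qform" where
  "form_sum (M, \<theta>) (N, \<eta>) = (bsum M N, Q_sum M N \<theta> \<eta>)"

definition zero_form :: "('a, 'm) based_module \<Rightarrow> ('a, 'm) qform" where
  "zero_form P = (P, \<one>\<^bsub>Q_eps P\<^esub>)"

definition hyperbolic :: "('a, 'm) based_module \<Rightarrow> ('a, 'm \<times> ('m \<Rightarrow> 'a)) qform" where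
  "hyperbolic L = (let H = bsum L (dual L) in
     (H, Q_class H (\<lambda>u\<in>carrier H. \<lambda>v\<in>carrier H. snd u (fst v))))"

definition perp :: "('a, 'm) based_module \<Rightarrow> ('m \<Rightarrow> 'm \<Rightarrow> 'a) set \<Rightarrow> 'm set \<Rightarrow> 'm set" where
  "perp M \<theta> S = {x \<in> carrier M. \<forall>y\<in>S. symm M \<theta> x y = 0}"

fun is_lagrangian :: "('a, 'm) based_module \<Rightarrow> ('a, 'm) qform \<Rightarrow> bool" where
  "is_lagrangian L (M, \<theta>) \<longleftrightarrow> is_based L \<and> direct_summand L M \<and>
     carrier L = perp M \<theta> (carrier L) \<and> Q_pull L (\<lambda>x. x) \<theta> = \<one>\<^bsub>Q_eps L\<^esub>"

fun is_simple_lagrangian :: "('a, 'm) based_module \<Rightarrow> ('a, 'm) qform \<Rightarrow> bool" where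
  "is_simple_lagrangian L (M, \<theta>) \<longleftrightarrow> is_lagrangian L (M, \<theta>) \<and>
     based_exact L M (dual L) (\<lambda>x\<in>carrier L. x)
       (\<lambda>x\<in>carrier M. \<lambda>y\<in>carrier L. symm M \<theta> x y)"


subsection \<open>The monoid of 0-stabilised forms\<close>

definition zs_isometric :: "('a, 'm) qform \<Rightarrow> ('a, 'n) qform \<Rightarrow> bool" where
  "zs_isometric v w \<longleftrightarrow> (\<exists>(P :: ('a, 'a univ) based_module) (P' :: ('a, 'a univ) based_module) f.
     is_based P \<and> is_based P' \<and>
     is_isometry (form_sum v (zero_form P)) (form_sum w (zero_form P')) f)"

definition zs_class :: "('a, 'm) qform \<Rightarrow> ('a, 'a univ) qform set" where
  "zs_class v = {w. is_form w \<and> zs_isometric v w}"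

definition Fzs :: "('a, 'a univ) qform set monoid" where
  "Fzs = \<lparr> carrier = zs_class ` {v :: ('a, 'a univ) qform. is_form v},
     mult = (\<lambda>X Y. \<Union>v\<in>X. \<Union>w\<in>Y. zs_class (form_sum v w)),
     one = (\<Union>P\<in>{P :: ('a, 'a univ) based_module. is_based P}. zs_class (zero_form P)) \<rparr>"


subsection \<open>Quasi-formations and the l-monoid\<close>

fun is_qformation :: "('a, 'm) qformation \<Rightarrow> bool" where
  "is_qformation (M, \<theta>, L, V) \<longleftrightarrow> is_simple_form (M, \<theta>) \<and> is_simple_lagrangian L (M, \<theta>) \<and>
     is_based V \<and> direct_summand V M \<and> 2 * rank V = rank M"

fun qf_isomorphic :: "('a, 'm) qformation \<Rightarrow> ('a, 'n) qformation \<Rightarrow> bool" where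
  "qf_isomorphic (M, \<theta>, L, V) (M', \<theta>', L', V') \<longleftrightarrow> (\<exists>f. is_isometry (M, \<theta>) (M', \<theta>') f \<and>
     f ` carrier L = carrier L' \<and> simple_iso L L' (restrict f (carrier L)) \<and>
     f ` carrier V = carrier V' \<and> simple_iso V V' (restrict f (carrier V)))"

fun qf_sum :: "('a, 'm) qformation \<Rightarrow> ('a, 'n) qformation \<Rightarrow> ('a, 'm \<times> 'n) qformation" where
  "qf_sum (M, \<theta>, L, V) (M', \<theta>', L', V') = (bsum M M', Q_sum M M' \<theta> \<theta>', bsum L L', bsum V V')"

definition trivial_formation :: "('a, 'm) based_module \<Rightarrow> ('a, 'm \<times> ('m \<Rightarrow> 'a)) qformation" where
  "trivial_formation P = (let H = hyperbolic P in (fst H, snd H,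
     push_based (\<lambda>x. (x, \<zero>\<^bsub>dual P\<^esub>)) P (fst H),
     push_based (\<lambda>g. (\<zero>\<^bsub>P\<^esub>, g)) (dual P) (fst H)))"

definition boundary :: "('a, 'm) based_module \<Rightarrow> ('m \<Rightarrow> 'm \<Rightarrow> 'a) \<Rightarrow> ('a, 'm \<times> ('m \<Rightarrow> 'a)) qformation" where
  "boundary K \<rho> = (let H = hyperbolic K in (fst H, snd H,
     push_based (\<lambda>x. (x, \<zero>\<^bsub>dual K\<^esub>)) K (fst H),
     push_based (\<lambda>x. (x, \<rho> x)) K (fst H)))"

definition stably_isomorphic :: "('a, 'm) qformation \<Rightarrow> ('a, 'n) qformation \<Rightarrow> bool" where
  "stably_isomorphic x y \<longleftrightarrow> (\<exists>(P :: ('a, 'a univ) based_module) (P' :: ('a, 'a univ) based_module).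
     is_based P \<and> is_based P' \<and>
     qf_isomorphic (qf_sum x (trivial_formation P)) (qf_sum y (trivial_formation P')))"

text \<open>
  The congruence on the monoid of stable isomorphism classes generated by the relation
  \<open>(M, \<theta>; K, L) \<oplus> (M, \<theta>; L, V) \<sim> (M, \<theta>; K, V)\<close>, as a relation between quasi-formations.
\<close>

inductive l_equiv :: "('a, 'a univ) qformation \<Rightarrow> ('a, 'a univ) qformation \<Rightarrow> bool" where
  stable: "is_qformation x \<Longrightarrow> is_qformation y \<Longrightarrow> stably_isomorphic x y \<Longrightarrow> l_equiv x y"
| compose: "is_qformation (M, \<theta>, K, L) \<Longrightarrow> is_qformation (M, \<theta>, L, V) \<Longrightarrow> is_qformation z \<Longrightarrow>
    stably_isomorphic z (qf_sum (M, \<theta>, K, L) (M, \<theta>, L, V)) \<Longrightarrow> l_equiv z (M, \<theta>, K, V)"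
| sym: "l_equiv x y \<Longrightarrow> l_equiv y x"
| trans: "l_equiv x y \<Longrightarrow> l_equiv y z \<Longrightarrow> l_equiv x z"
| sum: "l_equiv x x' \<Longrightarrow> l_equiv y y' \<Longrightarrow> is_qformation z \<Longrightarrow> is_qformation z' \<Longrightarrow>
    stably_isomorphic z (qf_sum x y) \<Longrightarrow> stably_isomorphic z' (qf_sum x' y') \<Longrightarrow> l_equiv z z'"

definition l_class :: "('a, 'm) qformation \<Rightarrow> ('a, 'a univ) qformation set" where
  "l_class x = {z. \<exists>y. is_qformation y \<and> stably_isomorphic x y \<and> l_equiv y z}"

definition l_monoid :: "('a, 'a univ) qformation set monoid" where
  "l_monoid = \<lparr> carrier = l_class ` {x :: ('a, 'a univ) qformation. is_qformation x},
     mult = (\<lambda>X Y. \<Union>x\<in>X. \<Union>y\<in>Y. l_class (qf_sum x y)),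
     one = (\<Union>P\<in>{P :: ('a, 'a univ) based_module. is_based P}. l_class (trivial_formation P)) \<rparr>"

definition El_monoid :: "('a, 'a univ) qformation set monoid" where
  "El_monoid = l_monoid\<lparr>carrier := {l_class (boundary K \<rho>) | (K :: ('a, 'a univ) based_module) \<rho>.
     is_based K \<and> \<rho> \<in> mhom K (dual_module K)}\<rparr>"

text \<open>
  The map \<open>[(V, \<theta>)] \<mapsto> [boundary V \<rho>]\<close> with \<open>\<rho> \<in> \<theta>\<close>, as the union over all choices; it takes values
  in classes precisely if the choices do not matter.
\<close>

definition e_map :: "('a, 'a univ) qform set \<Rightarrow> ('a, 'a univ) qformation set" where
  "e_map X = (\<Union>(V, \<theta>)\<in>X. \<Union>\<rho>\<in>\<theta>. l_class (boundary V \<rho>))"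

end

end

theory Submission
  imports Defs
begin

text \<open>
  A Lagrangian \<open>L\<close> is handled together with a complementary Lagrangian \<open>D\<close> such that
  \<open>L \<oplus> D \<rightarrow> M\<close> is simple; if \<open>S\<close> is the graph of a map \<open>L \<rightarrow> D\<close>, then \<open>(M, \<psi>; L, S)\<close> is a boundary.

  Restriction of the form, \<open>(M, \<psi>; L, V) \<mapsto> (V, \<psi>|V)\<close>, respects the relations of the \<open>l\<close>-monoid and
  recovers \<open>v\<close> from \<open>e [v]\<close>. Hence \<open>e\<close> is injective, and the elementary elements are a retract
  of the \<open>l\<close>-monoid, which gives injectivity on Grothendieck groups.

  For surjectivity, every \<open>x = [M, \<psi>; L, V]\<close> satisfies \<open>x + a = b\<close> with \<open>a\<close> and \<open>b\<close> elementary. If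
  \<open>V \<oplus> W \<rightarrow> M\<close> is a simple isomorphism and \<open>L\<close>, \<open>L'\<close> are complementary, then
  \<open>[M, \<psi>; L, V] + [M, -\<psi>; L', W]\<close> is elementary, because in \<open>(M, \<psi>) \<oplus> (M, -\<psi>)\<close> the diagonal is a
  Lagrangian complement of \<open>L \<oplus> L'\<close>. After stabilisation \<open>V\<close> is simply isomorphic to a complement \<open>D\<close>
  of \<open>L\<close>. Let \<open>\<Gamma>\<close> be the graph of a map \<open>M \<rightarrow> V \<cong> D\<close> extending that isomorphism and
  put \<open>N = M \<oplus> M\<close> with the form \<open>\<psi> \<oplus> -\<psi>\<close>. With \<open>y = [-N; D \<oplus> L, \<Gamma>]\<close> and \<open>z = [N; L \<oplus> D, 0 \<oplus> M]\<close>
  the elements \<open>x + y\<close>, \<open>z + y\<close> and \<open>z\<close> are all elementary, so that \<open>x + (z + y) = (x + y) + z\<close> is the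
  required relation.
\<close>

subsection \<open>Matrices and torsion\<close>

text \<open>Restriction respects the relation of the \<open>l\<close>-monoid because the form
  vanishes on the Lagrangian \<open>L\<close>: \<open>(M; K, L)\<close> contributes a zero form,
  while \<open>(M; L, V)\<close> and \<open>(M; K, V)\<close> restrict to the same form on
  \<open>V\<close>.

  The obstacle to surjectivity is that the complementary formation, which makes \<open>x + y\<close>
  elementary, has no reason to be elementary itself. Doubling removes it: in
  \<open>M \<oplus> M\<close> the graph \<Gamma> complements \<open>0 \<oplus> M\<close> by a shear,
  and it complements \<open>V \<oplus> L\<close> because \<open>(v, l) \<mapsto> - h v + l\<close>
  is simple when \<open>h : V \<cong> D\<close> is. Thus one \<open>y\<close> serves both for
  \<open>x\<close> and for \<open>z\<close>, and the class of \<open>z\<close> is visibly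
  elementary. The half-rank condition enters only here, through the stable identification of
  \<open>V\<close> with \<open>D\<close>.

  Most of the length is bookkeeping of torsion. Bases are replaced by isomorphisms from free modules
  (frames) to stabilised modules, and duals by perfect pairings. The simplicity statements then come
  down to integral matrices, commutators, conjugates and conjugate transposes.\<close>

definition finitary_monoid :: "'a::ring_1 imat monoid" where
  "finitary_monoid = \<lparr> carrier = {A. finitary A},
     mult = (\<lambda>A B i j. \<Sum>k | A i k \<noteq> 0. A i k * B k j),
     one = (\<lambda>i j. if i = j then 1 else 0) \<rparr>"

lemma GL_units: "GL = units_of finitary_monoid"
  by (simp add: GL_def finitary_monoid_def)

definition finitary_upto :: "nat \<Rightarrow> 'a::ring_1 imat \<Rightarrow> bool" where
  "finitary_upto n A \<longleftrightarrow> (\<forall>i j. i \<ge> n \<or> j \<ge> n \<longrightarrow> A i j = (if i = j then 1 else 0))"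

lemma finitary_iff_upto: "finitary A \<longleftrightarrow> (\<exists>n. finitary_upto n A)"
  by (simp add: finitary_def finitary_upto_def)

lemma finitary_uptoD: "finitary_upto n A \<Longrightarrow> i \<ge> n \<or> j \<ge> n \<Longrightarrow> A i j = (if i = j then 1 else 0)"
  unfolding finitary_upto_def by blast

lemma finitary_upto_mono: "finitary_upto n A \<Longrightarrow> n \<le> m \<Longrightarrow> finitary_upto m A"
  unfolding finitary_upto_def using le_trans by blast

text \<open>The product of \<open>GL\<close> sums over the support of a row of \<open>A\<close>. Any
  range beyond the block bound gives the same value and no longer depends on \<open>A\<close>, so
  associativity becomes an exchange of finite sums.\<close>

lemma finitary_mult_eq:
  assumes "finitary_upto n A" "i < N" "n \<le> N"
  shows "(A \<otimes>\<^bsub>finitary_monoid\<^esub> B) i j = (\<Sum>k<N. A i k * B k j)"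
proof -
  have "{k. A i k \<noteq> 0} \<subseteq> {..<N}"
  proof
    fix k assume "k \<in> {k. A i k \<noteq> 0}"
    then have "\<not> (i \<ge> n \<or> k \<ge> n) \<or> i = k"
      using finitary_uptoD[OF assms(1), of i k] by (auto split: if_splits)
    then show "k \<in> {..<N}" using assms by auto
  qed
  then show ?thesis
    by (auto simp: finitary_monoid_def intro!: sum.mono_neutral_left)
qed

lemma finitary_upto_mult:
  assumes "finitary_upto n A" "finitary_upto n B"
  shows "finitary_upto n (A \<otimes>\<^bsub>finitary_monoid\<^esub> B)"
  unfolding finitary_upto_def
proof (intro allI impI)
  fix i j assume ij: "n \<le> i \<or> n \<le> j"
  \<comment> \<open>The range has to contain the block, the row \<open>i\<close> and the column
    \<open>j\<close>, so that the delta at \<open>i\<close> or \<open>j\<close> is met.\<close>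
  define N where "N = Suc (max n (max i j))"
  have N: "i < N" "j < N" "n \<le> N" by (auto simp: N_def)
  have "(A \<otimes>\<^bsub>finitary_monoid\<^esub> B) i j = (\<Sum>k<N. A i k * B k j)"
    by (rule finitary_mult_eq[OF assms(1)]) (use N in auto)
  also have "\<dots> = (\<Sum>k<N. if k = (if n \<le> i then i else j) then (if i = j then 1 else 0) else 0)"
  proof (rule sum.cong[OF refl])
    fix k
    show "A i k * B k j = (if k = (if n \<le> i then i else j) then (if i = j then 1 else 0) else 0)"
    proof (cases "n \<le> i")
      case True
      then show ?thesis
        using finitary_uptoD[OF assms(1), of i k] finitary_uptoD[OF assms(2), of i j] by auto
    next
      case False
      with ij have "n \<le> j" by auto
      with False show ?thesis
        using finitary_uptoD[OF assms(2), of k j] finitary_uptoD[OF assms(1), of i j] by auto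
    qed
  qed
  also have "\<dots> = (if i = j then 1 else 0)"
    using N by (subst sum.delta) auto
  finally show "(A \<otimes>\<^bsub>finitary_monoid\<^esub> B) i j = (if i = j then 1 else 0)" .
qed

lemma monoid_finitary_monoid: "monoid finitary_monoid"
proof (rule monoidI)
  fix A B :: "'a imat"
  assume "A \<in> carrier finitary_monoid" "B \<in> carrier finitary_monoid"
  then obtain n m where "finitary_upto n A" "finitary_upto m B"
    by (auto simp: finitary_monoid_def finitary_iff_upto)
  then have "finitary_upto (max n m) A" "finitary_upto (max n m) B"
    using finitary_upto_mono max.cobounded1 max.cobounded2 by blast+
  then have "finitary_upto (max n m) (A \<otimes>\<^bsub>finitary_monoid\<^esub> B)" by (rule finitary_upto_mult)
  then show "A \<otimes>\<^bsub>finitary_monoid\<^esub> B \<in> carrier finitary_monoid"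
    unfolding finitary_monoid_def by (auto simp: finitary_iff_upto)
next
  show "\<one>\<^bsub>finitary_monoid\<^esub> \<in> carrier (finitary_monoid :: 'a imat monoid)"
    unfolding finitary_monoid_def by (auto simp: finitary_def)
next
  fix A B C :: "'a imat"
  assume "A \<in> carrier finitary_monoid" "B \<in> carrier finitary_monoid" "C \<in> carrier finitary_monoid"
  then obtain n1 n2 where A: "finitary_upto n1 A" and B: "finitary_upto n2 B"
    by (auto simp: finitary_monoid_def finitary_iff_upto)
  define n where "n = max n1 n2"
  have A: "finitary_upto n A" and B: "finitary_upto n B"
    using finitary_upto_mono A B unfolding n_def using max.cobounded1 max.cobounded2 by blast+
  have AB: "finitary_upto n (A \<otimes>\<^bsub>finitary_monoid\<^esub> B)" by (rule finitary_upto_mult[OF A B])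
  show "A \<otimes>\<^bsub>finitary_monoid\<^esub> B \<otimes>\<^bsub>finitary_monoid\<^esub> C = A \<otimes>\<^bsub>finitary_monoid\<^esub> (B \<otimes>\<^bsub>finitary_monoid\<^esub> C)"
  proof (intro ext)
    fix i j
    define N where "N = Suc (max n i)"
    have N: "i < N" "n \<le> N" by (auto simp: N_def)
    have "(A \<otimes>\<^bsub>finitary_monoid\<^esub> B \<otimes>\<^bsub>finitary_monoid\<^esub> C) i j = (\<Sum>l<N. (\<Sum>k<N. A i k * B k l) * C l j)"
      using finitary_mult_eq[OF AB N] finitary_mult_eq[OF A N] by simp
    also have "\<dots> = (\<Sum>k<N. A i k * (\<Sum>l<N. B k l * C l j))"
      by (simp add: sum_distrib_left sum_distrib_right mult.assoc) (rule sum.swap)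
    also have "\<dots> = (A \<otimes>\<^bsub>finitary_monoid\<^esub> (B \<otimes>\<^bsub>finitary_monoid\<^esub> C)) i j"
      using finitary_mult_eq[OF A N] finitary_mult_eq[OF B _ N(2)] by simp
    finally show "(A \<otimes>\<^bsub>finitary_monoid\<^esub> B \<otimes>\<^bsub>finitary_monoid\<^esub> C) i j = (A \<otimes>\<^bsub>finitary_monoid\<^esub> (B \<otimes>\<^bsub>finitary_monoid\<^esub> C)) i j" .
  qed
next
  fix A :: "'a imat"
  have "(\<lambda>i j. if i = j then 1 else 0 :: 'a) = \<one>\<^bsub>finitary_monoid\<^esub>"
    by (simp add: finitary_monoid_def)
  moreover have "finitary_upto 0 (\<lambda>i j. if i = j then 1 else 0 :: 'a)"
    by (auto simp: finitary_upto_def)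
  ultimately have one: "finitary_upto 0 (\<one>\<^bsub>finitary_monoid\<^esub> :: 'a imat)" by simp
  show "\<one>\<^bsub>finitary_monoid\<^esub> \<otimes>\<^bsub>finitary_monoid\<^esub> A = A"
  proof (intro ext)
    fix i j
    show "(\<one>\<^bsub>finitary_monoid\<^esub> \<otimes>\<^bsub>finitary_monoid\<^esub> A) i j = A i j"
      using finitary_mult_eq[OF one, of i "Suc i" A j]
      by (simp add: finitary_monoid_def if_distrib[of "\<lambda>x. x * _"] cong: if_cong)
  qed
next
  fix A :: "'a imat"
  assume "A \<in> carrier finitary_monoid"
  then obtain n where n: "finitary_upto n A"
    by (auto simp: finitary_monoid_def finitary_iff_upto)
  show "A \<otimes>\<^bsub>finitary_monoid\<^esub> \<one>\<^bsub>finitary_monoid\<^esub> = A"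
  proof (intro ext)
    fix i j
    have "(A \<otimes>\<^bsub>finitary_monoid\<^esub> \<one>\<^bsub>finitary_monoid\<^esub>) i j
        = (\<Sum>k<Suc (max n (max i j)). A i k * \<one>\<^bsub>finitary_monoid\<^esub> k j)"
      by (rule finitary_mult_eq[OF n]) auto
    also have "\<dots> = A i j"
      by (simp add: finitary_monoid_def if_distrib[of "\<lambda>x. _ * x"] cong: if_cong)
    finally show "(A \<otimes>\<^bsub>finitary_monoid\<^esub> \<one>\<^bsub>finitary_monoid\<^esub>) i j = A i j" .
  qed
qed

lemma group_GL: "group GL"
  unfolding GL_units by (rule monoid.units_group[OF monoid_finitary_monoid])

lemma GL_mult: "A \<otimes>\<^bsub>GL\<^esub> B = A \<otimes>\<^bsub>finitary_monoid\<^esub> B"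
  by (simp add: GL_units units_of_mult)

lemma GL_one: "\<one>\<^bsub>GL\<^esub> = (\<lambda>i j. if i = j then 1 else 0)"
  by (simp add: GL_units units_of_one finitary_monoid_def)

lemma finitary_GL: "A \<in> carrier GL \<Longrightarrow> finitary A"
  by (auto simp: GL_units units_of_carrier Units_def finitary_monoid_def)

lemma GL_I:
  assumes "finitary A" "finitary B"
    "A \<otimes>\<^bsub>finitary_monoid\<^esub> B = (\<lambda>i j. if i = j then 1 else 0)"
    "B \<otimes>\<^bsub>finitary_monoid\<^esub> A = (\<lambda>i j. if i = j then 1 else 0)"
  shows "A \<in> carrier GL"
  unfolding GL_units units_of_carrier Units_def using assms
  by (auto simp: finitary_monoid_def intro!: exI[of _ B])

lemma of_int_mult:
  assumes "finitary A"
  shows "(\<lambda>i j. of_int ((A \<otimes>\<^bsub>finitary_monoid\<^esub> B) i j)) =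
    (\<lambda>i j. of_int (A i j)) \<otimes>\<^bsub>finitary_monoid\<^esub> (\<lambda>i j. of_int (B i j) :: 'a::ring_1)"
proof (intro ext)
  fix i j
  obtain n where n: "finitary_upto n A" using assms finitary_iff_upto by blast
  then have n': "finitary_upto n (\<lambda>i j. of_int (A i j) :: 'a)"
    by (auto simp: finitary_upto_def)
  show "of_int ((A \<otimes>\<^bsub>finitary_monoid\<^esub> B) i j) =
    ((\<lambda>i j. of_int (A i j)) \<otimes>\<^bsub>finitary_monoid\<^esub> (\<lambda>i j. of_int (B i j) :: 'a)) i j"
    using finitary_mult_eq[OF n, of i "Suc (max n i)" B j]
      finitary_mult_eq[OF n', of i "Suc (max n i)" "\<lambda>i j. of_int (B i j)" j]
    by simp
qed

lemma of_int_finitary: "finitary A \<Longrightarrow> finitary (\<lambda>i j. of_int (A i j) :: 'a::ring_1)"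
  unfolding finitary_def by (metis of_int_0 of_int_1)

lemma of_int_GL:
  assumes "A \<in> carrier GL"
  shows "(\<lambda>i j. of_int (A i j) :: 'a::ring_1) \<in> carrier GL"
proof -
  interpret G: group "GL :: int imat monoid" by (rule group_GL)
  have i: "inv\<^bsub>GL\<^esub> A \<in> carrier GL" using assms by simp
  have "A \<otimes>\<^bsub>finitary_monoid\<^esub> (inv\<^bsub>GL\<^esub> A) = (\<lambda>i j. if i = j then 1 else 0)"
    "(inv\<^bsub>GL\<^esub> A) \<otimes>\<^bsub>finitary_monoid\<^esub> A = (\<lambda>i j. if i = j then 1 else 0)"
    using G.r_inv[OF assms] G.l_inv[OF assms] by (simp_all add: GL_mult GL_one)
  then show ?thesis
    by (intro GL_I[of _ "\<lambda>i j. of_int ((inv\<^bsub>GL\<^esub> A) i j)"] of_int_finitary finitary_GL[OF assms] finitary_GL[OF i])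
      (auto simp: of_int_mult[symmetric] finitary_GL[OF assms] finitary_GL[OF i] fun_eq_iff)
qed

lemma group_hom_of_int:
  "group_hom GL GL (\<lambda>A i j. of_int (A i j) :: 'a::ring_1)"
  by (intro group_hom.intro group_hom_axioms.intro group_GL homI)
    (auto simp: of_int_GL GL_mult of_int_mult finitary_GL)

lemma comm_group_K1: "comm_group (K1 :: 'a::ring_1 imat set monoid)"
  unfolding K1_def by (rule group.derived_quot_is_comm_group[OF group_GL])

lemma K1_class_hom: "K1_class \<in> hom GL K1"
proof -
  interpret normal "derived GL (carrier GL)" "GL :: 'a imat monoid"
    by (rule group.derived_self_is_normal[OF group_GL])
  show ?thesis unfolding K1_def K1_class_def by (rule r_coset_hom_Mod)
qed

text \<open>\<open>K1_of_int\<close> takes a union over all representatives. It is a single class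
  because the map induced by \<open>of_int\<close> sends the derived subgroup into the derived
  subgroup.\<close>

lemma K1_of_int_class:
  assumes B: "B \<in> carrier GL"
  shows "K1_of_int (K1_class B) = K1_class (\<lambda>i j. of_int (B i j) :: 'a::ring_1)"
proof -
  interpret G: group "GL :: int imat monoid" by (rule group_GL)
  interpret G': group "GL :: 'a imat monoid" by (rule group_GL)
  interpret D: subgroup "derived GL (carrier GL)" "GL :: int imat monoid"
    by (rule G.derived_is_subgroup) simp
  interpret D': subgroup "derived GL (carrier GL)" "GL :: 'a imat monoid"
    by (rule G'.derived_is_subgroup) simp
  interpret h: group_hom GL GL "\<lambda>A i j. of_int (A i j) :: 'a" by (rule group_hom_of_int)
  have eq: "K1_class (\<lambda>i j. of_int (A i j) :: 'a) = K1_class (\<lambda>i j. of_int (B i j))"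
    if A: "A \<in> K1_class B" for A
  proof -
    obtain d where d: "d \<in> derived GL (carrier GL)" "A = d \<otimes>\<^bsub>GL\<^esub> B"
      using A by (auto simp: K1_class_def r_coset_def)
    let ?h = "\<lambda>A i j. of_int (A i j) :: 'a"
    have dc: "d \<in> carrier GL" using d D.mem_carrier by blast
    have "?h d \<in> ?h ` derived GL (carrier GL)" using d by blast
    also have "\<dots> = derived GL (?h ` carrier GL)" by (rule h.derived_img[symmetric]) simp
    also have "\<dots> \<subseteq> derived GL (carrier GL)"
      by (rule G'.mono_derived) (auto simp: of_int_GL)
    finally have hd: "?h d \<in> derived GL (carrier GL)" .
    have "?h A = ?h d \<otimes>\<^bsub>GL\<^esub> ?h B" using h.hom_mult[OF dc B] d by simp
    then have "?h A \<in> derived GL (carrier GL) #>\<^bsub>GL\<^esub> ?h B"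
      using hd by (auto simp: r_coset_def)
    then show ?thesis unfolding K1_class_def
      by (intro G'.repr_independence[symmetric] of_int_GL B D'.is_subgroup)
  qed
  have "B \<in> K1_class B" unfolding K1_class_def
    by (rule G.rcos_self[OF B D.is_subgroup])
  then show ?thesis unfolding K1_of_int_def using eq by blast
qed

text \<open>The set is rewritten as the image of the composite homomorphism from the integral
  \<open>GL\<close> to \<open>K1\<close>, for which being a subgroup is immediate.\<close>

lemma subgroup_K1_of_int: "subgroup (K1_of_int ` carrier K1) (K1 :: 'a::ring_1 imat set monoid)"
proof -
  interpret G: comm_group "K1 :: 'a imat set monoid" by (rule comm_group_K1)
  interpret h: group_hom GL GL "\<lambda>A i j. of_int (A i j) :: 'a" by (rule group_hom_of_int)
  have "(\<lambda>A. K1_class (\<lambda>i j. of_int (A i j) :: 'a)) \<in> hom GL K1"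
    using hom_compose[OF h.homh K1_class_hom] by (simp add: o_def)
  then interpret c: group_hom GL K1 "\<lambda>A. K1_class (\<lambda>i j. of_int (A i j) :: 'a)"
    by (intro group_hom.intro group_hom_axioms.intro group_GL G.is_group)
  have "carrier K1 = K1_class ` carrier (GL :: int imat monoid)"
    by (simp add: K1_def K1_class_def carrier_FactGroup)
  then have "K1_of_int ` carrier K1 = (\<lambda>A. K1_class (\<lambda>i j. of_int (A i j) :: 'a)) ` carrier GL"
    by (simp only: image_image) (rule image_cong[OF refl K1_of_int_class])
  then show ?thesis using c.img_is_subgroup by simp
qed

lemma group_K1_red: "comm_group (K1_red :: 'a::ring_1 imat set set monoid)"
  unfolding K1_red_def
  by (rule comm_group.abelian_FactGroup[OF comm_group_K1 subgroup_K1_of_int])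

lemma K1_red_class_hom: "K1_red_class \<in> hom GL K1_red"
proof -
  interpret G: comm_group "K1 :: 'a imat set monoid" by (rule comm_group_K1)
  interpret normal "K1_of_int ` carrier K1" "K1 :: 'a imat set monoid"
    by (rule G.subgroup_imp_normal[OF subgroup_K1_of_int])
  show ?thesis
    using hom_compose[OF K1_class_hom r_coset_hom_Mod] 
    unfolding K1_red_def K1_red_class_def by (simp add: o_def)
qed

text \<open>The origin of every sign and permutation that may be ignored later: their matrices are
  integral, hence trivial in the reduced group.\<close>

lemma K1_red_class_of_int:
  assumes "B \<in> carrier GL"
  shows "K1_red_class (\<lambda>i j. of_int (B i j) :: 'a::ring_1) = \<one>\<^bsub>K1_red\<^esub>"
proof -
  interpret G: comm_group "K1 :: 'a imat set monoid" by (rule comm_group_K1)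
  have "K1_class B \<in> carrier K1" using K1_class_hom assms by (auto simp: hom_def)
  then have "K1_class (\<lambda>i j. of_int (B i j) :: 'a) \<in> K1_of_int ` carrier K1"
    using K1_of_int_class[OF assms, where 'a='a] by (metis imageI)
  then show ?thesis unfolding K1_red_class_def K1_red_def
    by (simp add: G.coset_join2 subgroup_K1_of_int subgroup.mem_carrier[OF subgroup_K1_of_int])
qed

section \<open>Torsion modulo \<open>Z\<close> and the involution\<close>

locale l_setting = l_theory bar q Z
  for bar :: "'a::ring_1 \<Rightarrow> 'a" and q :: nat and Z :: "'a imat set set set" +
  assumes bar_inv: "ring_involution bar"
    and weakly_finite: "weakly_finite TYPE('a)"
    and subgroup_Z: "subgroup Z K1_red"
    and star_Z: "star_invariant bar Z"
begin

lemma K1_red_group_hom: "group_hom GL K1_red (K1_red_class :: 'a imat \<Rightarrow> _)"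
  by (intro group_hom.intro group_hom_axioms.intro group_GL K1_red_class_hom
      comm_group.axioms(2)[OF group_K1_red])

lemma represents_Z_mult:
  assumes "represents_Z A" "represents_Z B" shows "represents_Z (A \<otimes>\<^bsub>GL\<^esub> B)"
proof -
  interpret h: group_hom GL K1_red "K1_red_class :: 'a imat \<Rightarrow> _" by (rule K1_red_group_hom)
  show ?thesis using assms unfolding represents_Z_def
    using subgroup.m_closed[OF subgroup_Z] by simp
qed

lemma represents_Z_inv:
  assumes "represents_Z A" shows "represents_Z (inv\<^bsub>GL\<^esub> A)"
proof -
  interpret h: group_hom GL K1_red "K1_red_class :: 'a imat \<Rightarrow> _" by (rule K1_red_group_hom)
  show ?thesis using assms unfolding represents_Z_def
    using subgroup.m_inv_closed[OF subgroup_Z] by simp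
qed

lemma represents_Z_of_int:
  assumes "B \<in> carrier GL" shows "represents_Z (\<lambda>i j. of_int (B i j))"
  unfolding represents_Z_def K1_red_class_of_int[OF assms]
  using of_int_GL[OF assms] subgroup.one_closed[OF subgroup_Z] by simp

text \<open>Conjugate elements have equal classes in an abelian group. The relation is written as an
  intertwining, so that no inverse of \<open>H\<close> has to be named.\<close>

lemma represents_Z_conj:
  assumes "represents_Z A" "B \<in> carrier GL" "H \<in> carrier GL" "H \<otimes>\<^bsub>GL\<^esub> B = A \<otimes>\<^bsub>GL\<^esub> H"
  shows "represents_Z B"
proof -
  interpret h: group_hom GL K1_red "K1_red_class :: 'a imat \<Rightarrow> _" by (rule K1_red_group_hom)
  interpret K: comm_group "K1_red :: 'a imat set set monoid" by (rule group_K1_red)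
  have A: "A \<in> carrier GL" using assms by (simp add: represents_Z_def)
  have "K1_red_class H \<otimes>\<^bsub>K1_red\<^esub> K1_red_class B = K1_red_class H \<otimes>\<^bsub>K1_red\<^esub> K1_red_class A"
    using arg_cong[OF assms(4), of K1_red_class] assms(2,3) A by (simp add: K.m_comm)
  then have "K1_red_class B = K1_red_class A"
    using assms(2,3) A by simp
  then show ?thesis using assms by (simp add: represents_Z_def)
qed

text \<open>The last equation says that \<open>C\<close> is a commutator of \<open>A\<close> and
  \<open>B\<close>, without inverses. It is the source of the vanishing torsion of shears.\<close>

lemma represents_Z_commutator:
  assumes "A \<in> carrier GL" "B \<in> carrier GL" "C \<in> carrier GL"
    "A \<otimes>\<^bsub>GL\<^esub> B \<otimes>\<^bsub>GL\<^esub> C = B \<otimes>\<^bsub>GL\<^esub> A"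
  shows "represents_Z C"
proof -
  interpret h: group_hom GL K1_red "K1_red_class :: 'a imat \<Rightarrow> _" by (rule K1_red_group_hom)
  interpret K: comm_group "K1_red :: 'a imat set set monoid" by (rule group_K1_red)
  let ?r = "K1_red_class :: 'a imat \<Rightarrow> _"
  have "(?r A \<otimes>\<^bsub>K1_red\<^esub> ?r B) \<otimes>\<^bsub>K1_red\<^esub> ?r C = ?r B \<otimes>\<^bsub>K1_red\<^esub> ?r A"
    using arg_cong[OF assms(4), of ?r] assms(1-3) by simp
  also have "\<dots> = ?r A \<otimes>\<^bsub>K1_red\<^esub> ?r B"
    using assms(1-3) by (intro K.m_comm) auto
  finally have "?r C = \<one>\<^bsub>K1_red\<^esub>"
    using assms(1-3) by (simp only: h.H.l_cancel_one h.hom_closed h.H.m_closed)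
  then show ?thesis using assms subgroup.one_closed[OF subgroup_Z] by (simp add: represents_Z_def)
qed

lemma represents_Z_star:
  assumes "represents_Z A" "(\<lambda>i j. bar (A j i)) \<in> carrier GL"
  shows "represents_Z (\<lambda>i j. bar (A j i))"
  using assms star_Z unfolding represents_Z_def star_invariant_def by blast

lemma bar_add [simp]: "bar (x + y) = bar x + bar y"
  and bar_mult [simp]: "bar (x * y) = bar y * bar x"
  and bar_bar [simp]: "bar (bar x) = x"
  using bar_inv unfolding ring_involution_def by auto

lemma bar_0 [simp]: "bar 0 = 0"
  using bar_add[of 0 0] by simp

lemma bar_1 [simp]: "bar 1 = 1"
  using bar_mult[of "bar 1" 1] by (metis bar_bar bar_mult mult_1_right)

lemma bar_minus [simp]: "bar (- x) = - bar x"
  using bar_add[of "- x" x] by (simp add: eq_neg_iff_add_eq_0)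

lemma bar_diff [simp]: "bar (x - y) = bar x - bar y"
  using bar_add[of x "- y"] by simp

lemma bar_sum: "bar (\<Sum>i\<in>I. f i) = (\<Sum>i\<in>I. bar (f i))"
  by (induction I rule: infinite_finite_induct) auto

end

subsection \<open>Linear maps\<close>

text \<open>In contrast to \<open>mhom\<close> there is no extensionality, so that composites and
  explicit terms can be used without \<open>restrict\<close>; \<open>restrict_mhom\<close> and
  \<open>mhom_lin\<close> translate between the two.\<close>

definition lin :: "('a::ring_1, 'm, 'y) module_scheme \<Rightarrow> ('a, 'n, 'z) module_scheme \<Rightarrow> ('m \<Rightarrow> 'n) \<Rightarrow> bool" where
  "lin M N f \<longleftrightarrow> (\<forall>x\<in>carrier M. f x \<in> carrier N) \<and>
     (\<forall>x\<in>carrier M. \<forall>y\<in>carrier M. f (x \<oplus>\<^bsub>M\<^esub> y) = f x \<oplus>\<^bsub>N\<^esub> f y) \<and>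
     (\<forall>a. \<forall>x\<in>carrier M. f (a \<odot>\<^bsub>M\<^esub> x) = a \<odot>\<^bsub>N\<^esub> f x)"

definition liso :: "('a::ring_1, 'm, 'y) module_scheme \<Rightarrow> ('a, 'n, 'z) module_scheme \<Rightarrow> ('m \<Rightarrow> 'n) \<Rightarrow> bool" where
  "liso M N f \<longleftrightarrow> lin M N f \<and> bij_betw f (carrier M) (carrier N)"

lemma linI:
  assumes "\<And>x. x \<in> carrier M \<Longrightarrow> f x \<in> carrier N"
    "\<And>x y. x \<in> carrier M \<Longrightarrow> y \<in> carrier M \<Longrightarrow> f (x \<oplus>\<^bsub>M\<^esub> y) = f x \<oplus>\<^bsub>N\<^esub> f y"
    "\<And>a x. x \<in> carrier M \<Longrightarrow> f (a \<odot>\<^bsub>M\<^esub> x) = a \<odot>\<^bsub>N\<^esub> f x"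
  shows "lin M N f"
  using assms unfolding lin_def by blast

lemma lin_closed: "lin M N f \<Longrightarrow> x \<in> carrier M \<Longrightarrow> f x \<in> carrier N"
  and lin_add: "lin M N f \<Longrightarrow> x \<in> carrier M \<Longrightarrow> y \<in> carrier M \<Longrightarrow> f (x \<oplus>\<^bsub>M\<^esub> y) = f x \<oplus>\<^bsub>N\<^esub> f y"
  and lin_smult: "lin M N f \<Longrightarrow> x \<in> carrier M \<Longrightarrow> f (a \<odot>\<^bsub>M\<^esub> x) = a \<odot>\<^bsub>N\<^esub> f x"
  unfolding lin_def by blast+

lemma lin_comp: "lin M N f \<Longrightarrow> lin N P g \<Longrightarrow> lin M P (\<lambda>x. g (f x))"
  by (simp add: lin_def)

lemma lin_id: "lin M M (\<lambda>x. x)"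
  by (simp add: lin_def)

lemma liso_lin: "liso M N f \<Longrightarrow> lin M N f"
  and liso_bij: "liso M N f \<Longrightarrow> bij_betw f (carrier M) (carrier N)"
  and liso_closed: "liso M N f \<Longrightarrow> x \<in> carrier M \<Longrightarrow> f x \<in> carrier N"
  by (auto simp: liso_def lin_def)

lemma liso_inj: "liso M N f \<Longrightarrow> x \<in> carrier M \<Longrightarrow> y \<in> carrier M \<Longrightarrow> f x = f y \<Longrightarrow> x = y"
  by (metis liso_bij bij_betw_imp_inj_on inj_onD)

lemma liso_id: "liso M M (\<lambda>x. x)"
  using bij_betw_id[of "carrier M"] by (simp add: liso_def lin_id id_def)

lemma liso_comp: "liso M N f \<Longrightarrow> liso N P g \<Longrightarrow> liso M P (\<lambda>x. g (f x))"
  unfolding liso_def using lin_comp[of M N f P g] bij_betw_trans[of f "carrier M" "carrier N" g "carrier P"]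
  by (simp add: o_def)

lemma lisoI:
  assumes "lin M N f" "\<And>x. x \<in> carrier M \<Longrightarrow> g (f x) = x"
    "\<And>y. y \<in> carrier N \<Longrightarrow> g y \<in> carrier M" "\<And>y. y \<in> carrier N \<Longrightarrow> f (g y) = y"
  shows "liso M N f"
  unfolding liso_def using assms
  by (auto intro!: bij_betw_byWitness[where f' = g] dest: lin_closed)

text \<open>Additive inverses are given as \<open>(- 1) \<odot> x\<close>, which linear maps
  preserve by definition; this form is kept in all later computations.\<close>

lemma left_moduleI:
  fixes M (structure)
  assumes "\<And>x y. x \<in> carrier M \<Longrightarrow> y \<in> carrier M \<Longrightarrow> x \<oplus> y \<in> carrier M"
    and "\<zero> \<in> carrier M"
    and "\<And>a x. x \<in> carrier M \<Longrightarrow> a \<odot> x \<in> carrier M"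
    and "\<And>x y z. x \<in> carrier M \<Longrightarrow> y \<in> carrier M \<Longrightarrow> z \<in> carrier M \<Longrightarrow> (x \<oplus> y) \<oplus> z = x \<oplus> (y \<oplus> z)"
    and "\<And>x y. x \<in> carrier M \<Longrightarrow> y \<in> carrier M \<Longrightarrow> x \<oplus> y = y \<oplus> x"
    and "\<And>x. x \<in> carrier M \<Longrightarrow> \<zero> \<oplus> x = x"
    and "\<And>x. x \<in> carrier M \<Longrightarrow> (- 1) \<odot> x \<oplus> x = \<zero>"
    and "\<And>a b x. x \<in> carrier M \<Longrightarrow> (a + b) \<odot> x = a \<odot> x \<oplus> b \<odot> x"
    and "\<And>a x y. x \<in> carrier M \<Longrightarrow> y \<in> carrier M \<Longrightarrow> a \<odot> (x \<oplus> y) = a \<odot> x \<oplus> a \<odot> y"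
    and "\<And>a b x. x \<in> carrier M \<Longrightarrow> (a * b) \<odot> x = a \<odot> (b \<odot> x)"
    and "\<And>x. x \<in> carrier M \<Longrightarrow> 1 \<odot> x = x"
  shows "left_module (M :: ('a::ring_1, 'm, 'z) module_scheme)"
  unfolding left_module_def
  using assms by (intro conjI abelian_groupI allI ballI) (assumption | blast)+

context
  fixes M :: "('a::ring_1, 'm, 'z) module_scheme" (structure)
  assumes lm: "left_module M"
begin

interpretation abelian_group M using lm by (simp add: left_module_def)

lemma lm_add [simp]: "x \<in> carrier M \<Longrightarrow> y \<in> carrier M \<Longrightarrow> x \<oplus> y \<in> carrier M"
  and lm_zero [simp]: "\<zero> \<in> carrier M"
  and lm_assoc: "x \<in> carrier M \<Longrightarrow> y \<in> carrier M \<Longrightarrow> z \<in> carrier M \<Longrightarrow> (x \<oplus> y) \<oplus> z = x \<oplus> (y \<oplus> z)"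
  and lm_comm: "x \<in> carrier M \<Longrightarrow> y \<in> carrier M \<Longrightarrow> x \<oplus> y = y \<oplus> x"
  and lm_lcomm: "x \<in> carrier M \<Longrightarrow> y \<in> carrier M \<Longrightarrow> z \<in> carrier M \<Longrightarrow> x \<oplus> (y \<oplus> z) = y \<oplus> (x \<oplus> z)"
  and lm_l_zero [simp]: "x \<in> carrier M \<Longrightarrow> \<zero> \<oplus> x = x"
  and lm_r_zero [simp]: "x \<in> carrier M \<Longrightarrow> x \<oplus> \<zero> = x"
  and lm_cancel: "x \<in> carrier M \<Longrightarrow> y \<in> carrier M \<Longrightarrow> z \<in> carrier M \<Longrightarrow> x \<oplus> y = x \<oplus> z \<longleftrightarrow> y = z"
  by (auto simp: a_assoc a_comm a_lcomm)

lemma lm_smult [simp]: "x \<in> carrier M \<Longrightarrow> a \<odot> x \<in> carrier M"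
  and lm_smult_add: "x \<in> carrier M \<Longrightarrow> y \<in> carrier M \<Longrightarrow> a \<odot> (x \<oplus> y) = a \<odot> x \<oplus> a \<odot> y"
  and lm_add_smult: "x \<in> carrier M \<Longrightarrow> (a + b) \<odot> x = a \<odot> x \<oplus> b \<odot> x"
  and lm_mult_smult: "x \<in> carrier M \<Longrightarrow> (a * b) \<odot> x = a \<odot> (b \<odot> x)"
  and lm_one_smult [simp]: "x \<in> carrier M \<Longrightarrow> 1 \<odot> x = x"
  using lm by (auto simp: left_module_def)

lemma lm_zero_smult [simp]: "x \<in> carrier M \<Longrightarrow> 0 \<odot> x = \<zero>"
  using lm_add_smult[of x 0 0] lm_cancel[of "0 \<odot> x" "0 \<odot> x" \<zero>] by simp

lemma lm_smult_zero [simp]: "a \<odot> \<zero> = \<zero>"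
  using lm_smult_add[of \<zero> \<zero> a] lm_cancel[of "a \<odot> \<zero>" "a \<odot> \<zero>" \<zero>] by simp

lemma lm_neg: "x \<in> carrier M \<Longrightarrow> x \<oplus> (- 1) \<odot> x = \<zero>"
  using lm_add_smult[of x 1 "- 1"] by simp

lemma lm_neg2: "x \<in> carrier M \<Longrightarrow> y \<in> carrier M \<Longrightarrow> x \<oplus> ((- 1) \<odot> x \<oplus> y) = y"
  by (simp add: lm_assoc[symmetric] lm_neg)

lemma lm_neg3: "x \<in> carrier M \<Longrightarrow> y \<in> carrier M \<Longrightarrow> (- 1) \<odot> x \<oplus> (x \<oplus> y) = y"
  by (simp add: lm_assoc[symmetric] lm_neg lm_comm[of _ x])

lemma lm_neg4: "x \<in> carrier M \<Longrightarrow> (- 1) \<odot> x \<oplus> x = \<zero>"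
  using lm_neg[of x] lm_comm[of x] by simp

lemma lin_cong:
  assumes "lin M N f" "\<And>x. x \<in> carrier M \<Longrightarrow> f x = g x" shows "lin M N g"
  using assms unfolding lin_def by simp

lemma liso_cong:
  assumes "liso M N f" "\<And>x. x \<in> carrier M \<Longrightarrow> f x = g x" shows "liso M N g"
  using assms lin_cong[of N f g] bij_betw_cong[of "carrier M" f g "carrier N"] unfolding liso_def by simp

lemma lin_zero: "left_module N \<Longrightarrow> lin M N f \<Longrightarrow> f \<zero> = \<zero>\<^bsub>N\<^esub>"
  using lin_smult[of M N f \<zero> 0] lin_closed[of M N f \<zero>]
  by (metis lm_zero lm_zero_smult Submission.lm_zero_smult)

lemma liso_inv:
  assumes "liso M N f" shows "liso N M (inv_into (carrier M) f)"
proof -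
  let ?g = "inv_into (carrier M) f"
  have bij: "bij_betw f (carrier M) (carrier N)" by (rule liso_bij[OF assms])
  have g: "?g y \<in> carrier M" "f (?g y) = y" if "y \<in> carrier N" for y
    using bij that by (auto simp: bij_betw_def inv_into_into f_inv_into_f)
  have gf: "?g (f x) = x" if "x \<in> carrier M" for x
    using bij that by (simp add: bij_betw_def)
  have l: "lin M N f" by (rule liso_lin[OF assms])
  have "lin N M ?g"
  proof (rule linI)
    fix x y assume "x \<in> carrier N" "y \<in> carrier N"
    then show "?g (x \<oplus>\<^bsub>N\<^esub> y) = ?g x \<oplus> ?g y"
      using gf[of "?g x \<oplus> ?g y"] lin_add[OF l, of "?g x" "?g y"] g by simp
  next
    fix a x assume "x \<in> carrier N"
    then show "?g (a \<odot>\<^bsub>N\<^esub> x) = a \<odot> ?g x"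
      using gf[of "a \<odot> ?g x"] lin_smult[OF l, of "?g x"] g by simp
  qed (rule g)
  then show ?thesis using bij_betw_inv_into[OF bij] by (simp add: liso_def)
qed

lemma restrict_mhom: "restrict f (carrier M) \<in> mhom M N \<longleftrightarrow> lin M N f"
  unfolding mhom_def lin_def by (auto simp: Pi_iff)

lemma restrict_miso: "restrict f (carrier M) \<in> miso M N \<longleftrightarrow> liso M N f"
  unfolding miso_def liso_def using restrict_mhom[of f N] bij_betw_cong[of "carrier M" "restrict f (carrier M)" f]
  by auto

end

lemma mhom_lin: "f \<in> mhom M N \<Longrightarrow> lin M N f"
  unfolding mhom_def lin_def by (auto simp: PiE_iff)

lemma liso_inv_into:
  assumes "liso M N f"
  shows "y \<in> carrier N \<Longrightarrow> inv_into (carrier M) f y \<in> carrier M"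
    "y \<in> carrier N \<Longrightarrow> f (inv_into (carrier M) f y) = y"
    "x \<in> carrier M \<Longrightarrow> inv_into (carrier M) f (f x) = x"
  using liso_bij[OF assms] by (auto simp: bij_betw_def inv_into_into f_inv_into_f)

section \<open>Direct sums, free modules and the ring as a module\<close>

lemma msum_simps [simp]:
  "carrier (msum M N) = carrier M \<times> carrier N"
  "\<zero>\<^bsub>msum M N\<^esub> = (\<zero>\<^bsub>M\<^esub>, \<zero>\<^bsub>N\<^esub>)"
  "u \<oplus>\<^bsub>msum M N\<^esub> v = (fst u \<oplus>\<^bsub>M\<^esub> fst v, snd u \<oplus>\<^bsub>N\<^esub> snd v)"
  "a \<odot>\<^bsub>msum M N\<^esub> u = (a \<odot>\<^bsub>M\<^esub> fst u, a \<odot>\<^bsub>N\<^esub> snd u)"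
  by (auto simp: msum_def split: prod.splits)

lemma free_simps [simp]:
  "carrier (free_module n) = {v. \<forall>i\<ge>n. v i = 0}"
  "\<zero>\<^bsub>free_module n\<^esub> = (\<lambda>i. 0)"
  "v \<oplus>\<^bsub>free_module n\<^esub> w = (\<lambda>i. v i + w i)"
  "a \<odot>\<^bsub>free_module n\<^esub> v = (\<lambda>i. a * v i)"
  by (auto simp: free_module_def)

lemma ring_module_simps [simp]:
  "carrier ring_module = UNIV" "\<zero>\<^bsub>ring_module\<^esub> = 0"
  "x \<oplus>\<^bsub>ring_module\<^esub> y = x + y" "a \<odot>\<^bsub>ring_module\<^esub> x = a * x"
  by (auto simp: ring_module_def)

lemma left_module_msum [simp]: "left_module M \<Longrightarrow> left_module N \<Longrightarrow> left_module (msum M N)"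
  by (rule left_moduleI) (auto simp: lm_assoc lm_neg4 lm_add_smult lm_smult_add lm_mult_smult intro: lm_comm)

lemma left_module_free [simp]: "left_module (free_module n)"
  by (rule left_moduleI) (auto simp: algebra_simps)

lemma left_module_ring [simp]: "left_module ring_module"
  by (rule left_moduleI) (auto simp: algebra_simps)

lemma lin_map_prod: "lin M M' f \<Longrightarrow> lin N N' g \<Longrightarrow> lin (msum M N) (msum M' N') (map_prod f g)"
  by (auto simp: lin_def)

lemma liso_map_prod: "liso M M' f \<Longrightarrow> liso N N' g \<Longrightarrow> liso (msum M N) (msum M' N') (map_prod f g)"
  unfolding liso_def using lin_map_prod[of M M' f N N' g] by (auto intro: bij_betw_map_prod)

abbreviation Fm :: "nat \<Rightarrow> ('a::ring_1, nat \<Rightarrow> 'a) module" where "Fm \<equiv> free_module"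

lemma unit_vec_simps [simp]: "unit_vec i i = 1" "i \<noteq> j \<Longrightarrow> unit_vec i j = 0"
  by (auto simp: unit_vec_def)

lemma unit_vec_F: "i < n \<Longrightarrow> unit_vec i \<in> carrier (Fm n)"
  by (auto simp: unit_vec_def)

text \<open>Induction over the number \<open>m\<close> of coordinates that may be nonzero, with
  \<open>n\<close> fixed so that \<open>f\<close> and \<open>g\<close> keep their domain.\<close>

lemma lin_F_eqI:
  assumes N: "left_module N" and f: "lin (Fm n) N f" and g: "lin (Fm n) N g"
    and eq: "\<And>i. i < n \<Longrightarrow> f (unit_vec i) = g (unit_vec i)" and v: "v \<in> carrier (Fm n)"
  shows "f v = g v"
proof -
  have "v \<in> carrier (Fm m) \<Longrightarrow> f v = g v" if "m \<le> n" for m v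
    using that
  proof (induction m arbitrary: v)
    case 0
    then have "v = \<zero>\<^bsub>Fm n\<^esub>" by auto
    then show ?case using lin_zero[OF left_module_free N] f g by metis
  next
    case (Suc m)
    define w where "w = v(m := 0)"
    have w: "w \<in> carrier (Fm m)" using Suc.prems by (auto simp: w_def)
    have wn: "w \<in> carrier (Fm n)" "unit_vec m \<in> carrier (Fm n)" "v m \<odot>\<^bsub>Fm n\<^esub> unit_vec m \<in> carrier (Fm n)"
      using w Suc.prems by (auto simp: unit_vec_def)
    have v: "v = w \<oplus>\<^bsub>Fm n\<^esub> v m \<odot>\<^bsub>Fm n\<^esub> unit_vec m"
      by (auto simp: w_def unit_vec_def)
    have "f v = f w \<oplus>\<^bsub>N\<^esub> v m \<odot>\<^bsub>N\<^esub> f (unit_vec m)"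
      by (subst v) (simp only: lin_add[OF f wn(1,3)] lin_smult[OF f wn(2)])
    also have "\<dots> = g w \<oplus>\<^bsub>N\<^esub> v m \<odot>\<^bsub>N\<^esub> g (unit_vec m)"
      using Suc.IH[OF w] Suc.prems eq[of m] by simp
    also have "\<dots> = g (w \<oplus>\<^bsub>Fm n\<^esub> v m \<odot>\<^bsub>Fm n\<^esub> unit_vec m)"
      by (simp only: lin_add[OF g wn(1,3)] lin_smult[OF g wn(2)])
    also have "\<dots> = g v" by (simp only: v[symmetric])
    finally show ?case .
  qed
  then show ?thesis using v by blast
qed

lemma lin_F_ring:
  assumes f: "lin (Fm n) ring_module f" and v: "v \<in> carrier (Fm n)"
  shows "f v = (\<Sum>k<n. v k * f (unit_vec k))"
proof (rule lin_F_eqI[OF left_module_ring f _ _ v])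
  show "lin (Fm n) ring_module (\<lambda>v. \<Sum>k<n. v k * f (unit_vec k))"
    by (rule linI) (auto simp: sum.distrib sum_distrib_left algebra_simps)
  show "f (unit_vec i) = (\<Sum>k<n. unit_vec i k * f (unit_vec k))" if "i < n" for i
    using that by (simp add: unit_vec_def if_distrib[of "\<lambda>x. x * _"] cong: if_cong)
qed

lemma lin_F_F:
  assumes f: "lin (Fm n) (Fm m) f" and v: "v \<in> carrier (Fm n)"
  shows "f v j = (\<Sum>k<n. v k * f (unit_vec k) j)"
proof -
  have "lin (Fm n) ring_module (\<lambda>v. f v j)"
    using f by (auto simp: lin_def)
  from lin_F_ring[OF this v] show ?thesis .
qed

text \<open>Rows are the images of the unit vectors, as in \<open>trans_mat\<close>. Coordinate
  vectors are therefore rows multiplied from the left, and \<open>mat_comp\<close> reverses the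
  order of composition.\<close>

definition mat :: "nat \<Rightarrow> ((nat \<Rightarrow> 'a::ring_1) \<Rightarrow> nat \<Rightarrow> 'a) \<Rightarrow> 'a imat" where
  "mat n \<alpha> = (\<lambda>i. if i < n then \<alpha> (unit_vec i) else unit_vec i)"

lemma mat_upto: "lin (Fm n) (Fm n) \<alpha> \<Longrightarrow> finitary_upto n (mat n \<alpha>)"
  unfolding finitary_upto_def mat_def using lin_closed[of "Fm n" "Fm n" \<alpha>] unit_vec_F[of _ n]
  by (auto simp: unit_vec_def)

lemma mat_comp:
  assumes a: "lin (Fm n) (Fm n) \<alpha>" and b: "lin (Fm n) (Fm n) \<beta>"
  shows "mat n \<beta> \<otimes>\<^bsub>GL\<^esub> mat n \<alpha> = mat n (\<lambda>v. \<alpha> (\<beta> v))"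
proof (intro ext)
  fix i j
  show "(mat n \<beta> \<otimes>\<^bsub>GL\<^esub> mat n \<alpha>) i j = mat n (\<lambda>v. \<alpha> (\<beta> v)) i j"
  proof (cases "i < n")
    case True
    have "(mat n \<beta> \<otimes>\<^bsub>GL\<^esub> mat n \<alpha>) i j = (\<Sum>k<n. mat n \<beta> i k * mat n \<alpha> k j)"
      unfolding GL_mult by (rule finitary_mult_eq[OF mat_upto[OF b] True order_refl])
    also have "\<dots> = \<alpha> (\<beta> (unit_vec i)) j"
      using True lin_F_F[OF a lin_closed[OF b unit_vec_F[OF True]], of j] by (simp add: mat_def)
    finally show ?thesis using True by (simp add: mat_def)
  next
    case False
    have "(mat n \<beta> \<otimes>\<^bsub>GL\<^esub> mat n \<alpha>) i j = (\<Sum>k<Suc i. mat n \<beta> i k * mat n \<alpha> k j)"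
      unfolding GL_mult by (rule finitary_mult_eq[OF mat_upto[OF b]]) (use False in auto)
    also have "\<dots> = mat n \<alpha> i j"
      using False by (simp add: mat_def unit_vec_def if_distrib[of "\<lambda>x. x * _"] cong: if_cong)
    finally show ?thesis using False by (simp add: mat_def)
  qed
qed

lemma mat_id: "(\<And>v. v \<in> carrier (Fm n) \<Longrightarrow> \<alpha> v = v) \<Longrightarrow> mat n \<alpha> = (\<lambda>i j. if i = j then 1 else 0)"
  unfolding mat_def using unit_vec_F[of _ n] by (intro ext) (auto simp: unit_vec_def)

lemma mat_GL:
  assumes "liso (Fm n) (Fm n) \<alpha>" shows "mat n \<alpha> \<in> carrier GL"
proof (rule GL_I)
  let ?b = "inv_into (carrier (Fm n)) \<alpha>"
  have a: "lin (Fm n) (Fm n) \<alpha>" by (rule liso_lin[OF assms])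
  have b: "lin (Fm n) (Fm n) ?b" by (rule liso_lin[OF liso_inv[OF left_module_free assms]])
  show "finitary (mat n \<alpha>)" "finitary (mat n ?b)"
    using mat_upto[OF a] mat_upto[OF b] finitary_iff_upto by blast+
  show "mat n \<alpha> \<otimes>\<^bsub>finitary_monoid\<^esub> mat n ?b = (\<lambda>i j. if i = j then 1 else 0)"
    unfolding GL_mult[symmetric] mat_comp[OF b a] by (rule mat_id) (rule liso_inv_into[OF assms])
  show "mat n ?b \<otimes>\<^bsub>finitary_monoid\<^esub> mat n \<alpha> = (\<lambda>i j. if i = j then 1 else 0)"
    unfolding GL_mult[symmetric] mat_comp[OF a b] by (rule mat_id) (rule liso_inv_into[OF assms])
qed

lemma mat_cong: "(\<And>v. v \<in> carrier (Fm n) \<Longrightarrow> \<alpha> v = \<beta> v) \<Longrightarrow> mat n \<alpha> = mat n \<beta>"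
  unfolding mat_def using unit_vec_F[of _ n] by (intro ext) auto

section \<open>Block decompositions of free modules\<close>

definition tr :: "nat \<Rightarrow> (nat \<Rightarrow> 'a::ring_1) \<Rightarrow> nat \<Rightarrow> 'a" where
  "tr n v = (\<lambda>i. if i < n then v i else 0)"
definition sh :: "nat \<Rightarrow> (nat \<Rightarrow> 'a::ring_1) \<Rightarrow> nat \<Rightarrow> 'a" where
  "sh n v = (\<lambda>i. v (i + n))"
definition jn :: "nat \<Rightarrow> (nat \<Rightarrow> 'a::ring_1) \<Rightarrow> (nat \<Rightarrow> 'a) \<Rightarrow> nat \<Rightarrow> 'a" where
  "jn n v w = (\<lambda>i. if i < n then v i else w (i - n))"

lemmas tsj = tr_def sh_def jn_def

lemma tr_F: "tr n v \<in> carrier (Fm n)" by (simp add: tr_def)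
lemma sh_F: "v \<in> carrier (Fm (n + m)) \<Longrightarrow> sh n v \<in> carrier (Fm m)" by (simp add: sh_def)
lemma jn_F: "w \<in> carrier (Fm m) \<Longrightarrow> jn n v w \<in> carrier (Fm (n + m))" by (auto simp: jn_def)
lemma tr_jn [simp]: "v \<in> carrier (Fm n) \<Longrightarrow> tr n (jn n v w) = v" by (auto simp: tsj)
lemma sh_jn [simp]: "sh n (jn n v w) = w" by (auto simp: tsj)
lemma jn_tr_sh [simp]: "jn n (tr n v) (sh n v) = v" by (auto simp: tsj)
lemma tr_lin [simp]: "tr n (\<lambda>i. v i + w i) = (\<lambda>i. tr n v i + tr n w i)" "tr n (\<lambda>i. a * v i) = (\<lambda>i. a * tr n v i)"
  by (auto simp: tsj)
lemma sh_lin [simp]: "sh n (\<lambda>i. v i + w i) = (\<lambda>i. sh n v i + sh n w i)" "sh n (\<lambda>i. a * v i) = (\<lambda>i. a * sh n v i)"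
  by (auto simp: tsj)
lemma tr_unit: "tr n (unit_vec i) = (if i < n then unit_vec i else (\<lambda>_. 0))"
  by (auto simp: tsj unit_vec_def)
lemma sh_unit: "sh n (unit_vec i) = (if i < n then (\<lambda>_. 0) else unit_vec (i - n))"
  by (auto simp: tsj unit_vec_def fun_eq_iff)
lemma jn_unit: "i < n \<Longrightarrow> jn n (unit_vec i) (\<lambda>_. 0) = unit_vec i" "jn n (\<lambda>_. 0) (unit_vec i) = unit_vec (i + n)"
  by (auto simp: tsj unit_vec_def fun_eq_iff)
lemma tr_jn_tr [simp]: "tr n (jn n (tr n v) w) = tr n v" by (auto simp: tsj)

lemma lin_tr: "lin (Fm m) (Fm n) (tr n)"
  by (rule linI) (auto simp: tr_def)

lemma liso_split: "liso (Fm (n + m)) (msum (Fm n) (Fm m)) (\<lambda>v. (tr n v, sh n v))"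
  by (rule lisoI[of _ _ _ "\<lambda>(v, w). jn n v w"]) (auto intro!: linI simp: tsj fun_eq_iff)

lemma liso_join: "liso (msum (Fm n) (Fm m)) (Fm (n + m)) (\<lambda>u. jn n (fst u) (snd u))"
  by (rule lisoI[of _ _ _ "\<lambda>v. (tr n v, sh n v)"]) (auto intro!: linI simp: tsj fun_eq_iff)

definition bl :: "nat \<Rightarrow> ((nat \<Rightarrow> 'a::ring_1) \<Rightarrow> nat \<Rightarrow> 'a) \<Rightarrow> ((nat \<Rightarrow> 'a) \<Rightarrow> nat \<Rightarrow> 'a) \<Rightarrow> (nat \<Rightarrow> 'a) \<Rightarrow> nat \<Rightarrow> 'a" where
  "bl n \<alpha> \<beta> v = jn n (\<alpha> (tr n v)) (\<beta> (sh n v))"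

lemma liso_bl:
  assumes "liso (Fm n) (Fm n') \<alpha>" "liso (Fm m) (Fm m') \<beta>"
  shows "liso (Fm (n + m)) (Fm (n' + m')) (\<lambda>v. jn n' (\<alpha> (tr n v)) (\<beta> (sh n v)))"
  using liso_comp[OF liso_comp[OF liso_split liso_map_prod[OF assms]] liso_join] by simp

text \<open>An added identity block leaves no trace in the infinite matrix, since \<open>mat\<close>
  continues by unit vectors anyway.\<close>

lemma mat_bl: "liso (Fm n) (Fm n) \<alpha> \<Longrightarrow> mat (n + m) (bl n \<alpha> (\<lambda>v. v)) = mat n \<alpha>"
  using lin_zero[OF left_module_free left_module_free liso_lin[of "Fm n" "Fm n" \<alpha>]]
    lin_closed[OF liso_lin[of "Fm n" "Fm n" \<alpha>] unit_vec_F]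
  by (intro ext) (auto simp: mat_def bl_def tr_unit sh_unit jn_unit, auto simp: jn_def)

definition bsw :: "nat \<Rightarrow> nat \<Rightarrow> (nat \<Rightarrow> 'a::ring_1) \<Rightarrow> nat \<Rightarrow> 'a" where
  "bsw n m v = jn m (sh n v) (tr n v)"

lemma liso_bsw: "liso (Fm (n + m)) (Fm (m + n)) (bsw n m)"
  by (rule lisoI[of _ _ _ "bsw m n"]) (auto intro!: linI simp: bsw_def tsj fun_eq_iff)

definition shear :: "nat \<Rightarrow> ((nat \<Rightarrow> 'a::ring_1) \<Rightarrow> nat \<Rightarrow> 'a) \<Rightarrow> (nat \<Rightarrow> 'a) \<Rightarrow> nat \<Rightarrow> 'a" where
  "shear n h v = jn n (tr n v) (\<lambda>i. sh n v i + h (tr n v) i)"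

lemma liso_shear:
  assumes h: "lin (Fm n) (Fm m) h" shows "liso (Fm (n + m)) (Fm (n + m)) (shear n h)"
proof (rule lisoI[of _ _ _ "shear n (\<lambda>v i. - h v i)"])
  note hF = lin_closed[OF h tr_F]
  have l: "h (\<lambda>i. tr n v i + tr n w i) = (\<lambda>i. h (tr n v) i + h (tr n w) i)"
    "h (\<lambda>i. a * tr n v i) = (\<lambda>i. a * h (tr n v) i)" for v w a
    using lin_add[OF h tr_F tr_F] lin_smult[OF h tr_F] by simp_all
  show "lin (Fm (n + m)) (Fm (n + m)) (shear n h)"
  proof (rule linI)
    fix v w :: "nat \<Rightarrow> 'a" and a assume v: "v \<in> carrier (Fm (n + m))"
    show "shear n h v \<in> carrier (Fm (n + m))"
      using hF[of v] v by (auto simp: shear_def jn_def sh_def)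
    show "shear n h (v \<oplus>\<^bsub>Fm (n + m)\<^esub> w) = shear n h v \<oplus>\<^bsub>Fm (n + m)\<^esub> shear n h w"
      by (simp add: shear_def l) (simp add: jn_def fun_eq_iff algebra_simps)
    show "shear n h (a \<odot>\<^bsub>Fm (n + m)\<^esub> v) = a \<odot>\<^bsub>Fm (n + m)\<^esub> shear n h v"
      by (simp add: shear_def l) (simp add: jn_def fun_eq_iff algebra_simps)
  qed
  fix v :: "nat \<Rightarrow> 'a" assume v: "v \<in> carrier (Fm (n + m))"
  show "shear n (\<lambda>v i. - h v i) (shear n h v) = v" "shear n h (shear n (\<lambda>v i. - h v i) v) = v"
    unfolding shear_def tr_jn[OF tr_F] sh_jn by simp_all
  show "shear n (\<lambda>v i. - h v i) v \<in> carrier (Fm (n + m))"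
    using hF[of v] v by (auto simp: shear_def jn_def sh_def)
qed

definition permf :: "nat \<Rightarrow> (nat \<Rightarrow> nat) \<Rightarrow> (nat \<Rightarrow> 'a::ring_1) \<Rightarrow> nat \<Rightarrow> 'a" where
  "permf n \<sigma> v = (\<lambda>i. if i < n then v (\<sigma> i) else 0)"

lemma liso_permf:
  assumes "\<And>i. i < n \<Longrightarrow> \<sigma> i < n \<and> \<tau> (\<sigma> i) = i" "\<And>i. i < n \<Longrightarrow> \<tau> i < n \<and> \<sigma> (\<tau> i) = i"
  shows "liso (Fm n) (Fm n) (permf n \<sigma>)"
  by (rule lisoI[of _ _ _ "permf n \<tau>"]) (use assms in \<open>auto intro!: linI simp: permf_def fun_eq_iff\<close>)

lemma liso_neg: "liso (Fm n) (Fm n) (\<lambda>v i. - v i)"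
  by (rule lisoI[of _ _ _ "\<lambda>v i. - v i"]) (auto intro!: linI)

section \<open>Automorphisms of free modules with torsion in \<open>Z\<close>\<close>

context l_setting
begin

definition zs :: "nat \<Rightarrow> ((nat \<Rightarrow> 'a) \<Rightarrow> nat \<Rightarrow> 'a) \<Rightarrow> bool" where
  "zs n \<alpha> \<longleftrightarrow> liso (Fm n) (Fm n) \<alpha> \<and> represents_Z (mat n \<alpha>)"

lemma zs_liso: "zs n \<alpha> \<Longrightarrow> liso (Fm n) (Fm n) \<alpha>" by (simp add: zs_def)

lemma zs_closed: "zs n \<alpha> \<Longrightarrow> v \<in> carrier (Fm n) \<Longrightarrow> \<alpha> v \<in> carrier (Fm n)"
  by (rule liso_closed[OF zs_liso])

lemma zs_cong: "zs n \<alpha> \<Longrightarrow> (\<And>v. v \<in> carrier (Fm n) \<Longrightarrow> \<alpha> v = \<beta> v) \<Longrightarrow> zs n \<beta>"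
  unfolding zs_def using mat_cong[of n \<alpha> \<beta>] liso_cong[OF left_module_free, of n "Fm n" \<alpha> \<beta>] by simp

lemma zs_comp: "zs n \<alpha> \<Longrightarrow> zs n \<beta> \<Longrightarrow> zs n (\<lambda>v. \<alpha> (\<beta> v))"
  unfolding zs_def using liso_comp[of "Fm n" "Fm n" \<beta> "Fm n" \<alpha>] represents_Z_mult[of "mat n \<beta>" "mat n \<alpha>"]
  by (simp add: mat_comp liso_lin)

lemma zs_inv:
  assumes a: "zs n \<alpha>" and b: "\<And>v. v \<in> carrier (Fm n) \<Longrightarrow> \<beta> v \<in> carrier (Fm n) \<and> \<alpha> (\<beta> v) = v"
  shows "zs n \<beta>"
proof -
  let ?c = "inv_into (carrier (Fm n)) \<alpha>"
  have l: "liso (Fm n) (Fm n) \<alpha>" by (rule zs_liso[OF a])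
  have c: "liso (Fm n) (Fm n) ?c" by (rule liso_inv[OF left_module_free l])
  interpret G: group "GL :: 'a imat monoid" by (rule group_GL)
  have "mat n \<alpha> \<otimes>\<^bsub>GL\<^esub> mat n ?c = \<one>\<^bsub>GL\<^esub>"
    unfolding mat_comp[OF liso_lin[OF c] liso_lin[OF l]] GL_one by (rule mat_id) (rule liso_inv_into[OF l])
  then have "mat n ?c = inv\<^bsub>GL\<^esub> (mat n \<alpha>)"
    using G.inv_unique' mat_GL[OF l] mat_GL[OF c] G.inv_equality G.l_inv G.inv_comm by metis
  then have "zs n ?c" using a c represents_Z_inv by (simp add: zs_def)
  then show ?thesis
    by (rule zs_cong) (metis b l liso_inv_into(3))
qed

lemma zs_conj:
  assumes a: "zs n \<alpha>" and b: "liso (Fm n) (Fm n) \<beta>" and h: "liso (Fm n) (Fm n) h"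
    and eq: "\<And>v. v \<in> carrier (Fm n) \<Longrightarrow> \<beta> (h v) = h (\<alpha> v)"
  shows "zs n \<beta>"
proof -
  have "mat n h \<otimes>\<^bsub>GL\<^esub> mat n \<beta> = mat n \<alpha> \<otimes>\<^bsub>GL\<^esub> mat n h"
    unfolding mat_comp[OF liso_lin[OF b] liso_lin[OF h]] mat_comp[OF liso_lin[OF h] liso_lin[OF zs_liso[OF a]]]
    by (rule mat_cong) (rule eq)
  then show ?thesis
    using represents_Z_conj[OF _ mat_GL[OF b] mat_GL[OF h]] a b by (auto simp: zs_def)
qed

lemma zs_commutator:
  assumes a: "liso (Fm n) (Fm n) \<alpha>" and b: "liso (Fm n) (Fm n) \<beta>" and c: "liso (Fm n) (Fm n) \<gamma>"
    and eq: "\<And>v. v \<in> carrier (Fm n) \<Longrightarrow> \<gamma> (\<beta> (\<alpha> v)) = \<alpha> (\<beta> v)"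
  shows "zs n \<gamma>"
proof -
  note l = liso_lin[OF a] liso_lin[OF b] liso_lin[OF c]
  have "mat n \<alpha> \<otimes>\<^bsub>GL\<^esub> mat n \<beta> \<otimes>\<^bsub>GL\<^esub> mat n \<gamma> = mat n \<beta> \<otimes>\<^bsub>GL\<^esub> mat n \<alpha>"
    unfolding mat_comp[OF l(2,1)] mat_comp[OF l(1,2)] mat_comp[OF l(3) lin_comp[OF l(1,2)]]
    by (rule mat_cong) (rule eq)
  then show ?thesis
    using represents_Z_commutator mat_GL[OF a] mat_GL[OF b] mat_GL[OF c] c by (auto simp: zs_def)
qed

text \<open>The two matrices coincide. The direction that removes the identity block is what makes
  cancellation of free summands possible.\<close>

lemma zs_bl_left: "liso (Fm n) (Fm n) \<alpha> \<Longrightarrow> zs (n + m) (bl n \<alpha> (\<lambda>v. v)) \<longleftrightarrow> zs n \<alpha>"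
  unfolding zs_def using mat_bl[of n \<alpha> m] liso_bl[of n n \<alpha> m m "\<lambda>v. v", OF _ liso_id]
  by (simp add: bl_def[abs_def])

text \<open>Conjugation by the block swap reduces this to \<open>zs_bl_left\<close>; torsion does
  not see conjugation.\<close>

lemma zs_bl_right:
  assumes "zs m \<beta>" shows "zs (n + m) (bl n (\<lambda>v. v) \<beta>)"
proof (rule zs_conj)
  note l = zs_liso[OF assms]
  show "zs (n + m) (bl m \<beta> (\<lambda>v. v))"
    using zs_bl_left[OF l, of n] assms by (simp add: add.commute)
  show "liso (Fm (n + m)) (Fm (n + m)) (bl n (\<lambda>v. v) \<beta>)"
    using liso_bl[OF liso_id l] by (simp add: bl_def[abs_def])
  show "liso (Fm (n + m)) (Fm (n + m)) (bsw m n :: (nat \<Rightarrow> 'a) \<Rightarrow> _)"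
    using liso_bsw[of m n] by (simp add: add.commute)
  fix v :: "nat \<Rightarrow> 'a" assume "v \<in> carrier (Fm (n + m))"
  then have v: "sh m v \<in> carrier (Fm n)" using sh_F[of v m n] by (simp add: add.commute)
  have "\<beta> (tr m v) \<in> carrier (Fm m)" by (rule liso_closed[OF l tr_F])
  then show "bl n (\<lambda>v. v) \<beta> (bsw m n v) = bsw m n (bl m \<beta> (\<lambda>v. v) v)"
    using v by (simp only: bl_def bsw_def tr_jn sh_jn)
qed

lemma zs_bl: "zs n \<alpha> \<Longrightarrow> zs m \<beta> \<Longrightarrow> zs (n + m) (bl n \<alpha> \<beta>)"
  using zs_comp[of "n + m" "bl n \<alpha> (\<lambda>v. v)" "bl n (\<lambda>v. v) \<beta>"] zs_bl_left[OF zs_liso, of n \<alpha> m] zs_bl_right[of m \<beta> n]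
  by (simp add: bl_def[abs_def])

lemma zs_of_int:
  assumes "liso (Fm n) (Fm n) \<alpha>" "liso (Fm n) (Fm n) (\<beta> :: (nat \<Rightarrow> int) \<Rightarrow> _)"
    "\<And>i j. i < n \<Longrightarrow> \<alpha> (unit_vec i) j = of_int (\<beta> (unit_vec i) j)"
  shows "zs n \<alpha>"
proof -
  have "mat n \<alpha> = (\<lambda>i j. of_int (mat n \<beta> i j))"
    using assms(3) by (intro ext) (simp add: mat_def unit_vec_def)
  then show ?thesis
    using represents_Z_of_int[OF mat_GL[OF assms(2)]] assms(1) by (simp add: zs_def)
qed

lemma zs_permf:
  assumes "\<And>i. i < n \<Longrightarrow> \<sigma> i < n \<and> \<tau> (\<sigma> i) = i" "\<And>i. i < n \<Longrightarrow> \<tau> i < n \<and> \<sigma> (\<tau> i) = i"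
  shows "zs n (permf n \<sigma>)"
  by (rule zs_of_int[OF liso_permf[of n \<sigma> \<tau>, OF assms] liso_permf[of n \<sigma> \<tau>, OF assms]]) (auto simp: permf_def unit_vec_def)

lemma zs_bsw: "zs (n + m) (bsw n m)"
proof (rule zs_cong)
  show "zs (n + m) (permf (n + m) (\<lambda>i. if i < m then i + n else i - m))"
    by (rule zs_permf[of _ _ "\<lambda>i. if i < n then i + m else i - n"]) auto
qed (auto simp: permf_def bsw_def tsj fun_eq_iff)

lemma zs_id: "zs n (\<lambda>v. v)"
  by (rule zs_of_int[OF liso_id liso_id]) (auto simp: unit_vec_def)

lemma zs_neg: "zs n (\<lambda>v i. - v i)"
  by (rule zs_of_int[OF liso_neg liso_neg]) (auto simp: unit_vec_def)

text \<open>On three blocks, \<open>(x, y) \<mapsto> (x, y + h x)\<close> is the commutator of \<open>(x, z) \<mapsto> (x, z + h x)\<close> and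
  \<open>(y, z) \<mapsto> (y + z, z)\<close>.\<close>

lemma zs_shear:
  assumes h: "lin (Fm n) (Fm m) h" shows "zs (n + m) (shear n h)"
proof -
  define A where "A v = jn (n + m) (tr (n + m) v) (\<lambda>i. sh (n + m) v i + h (tr n v) i)" for v
  define B where "B v = jn n (tr n v) (jn m (\<lambda>i. sh n v i + sh (n + m) v i) (sh (n + m) v))" for v :: "nat \<Rightarrow> 'a"
  let ?C = "bl (n + m) (shear n h) (\<lambda>v. v)"
  note hF = lin_closed[OF h tr_F]
  have hk: "h v i = 0" if "i \<ge> m" "v \<in> carrier (Fm n)" for v i
    using lin_closed[OF h that(2)] that(1) by simp
  have tt: "tr n (tr (n + m) v) = tr n v" for v :: "nat \<Rightarrow> 'a" by (auto simp: tsj)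
  have A: "liso (Fm (n + m + m)) (Fm (n + m + m)) A"
    using liso_shear[OF lin_comp[OF lin_tr h], of "n + m"] by (simp add: shear_def[abs_def] A_def[abs_def] tt)
  have B: "liso (Fm (n + m + m)) (Fm (n + m + m)) B"
    by (rule lisoI[of _ _ _ "\<lambda>v. jn n (tr n v) (jn m (\<lambda>i. sh n v i - sh (n + m) v i) (sh (n + m) v))"])
      (auto intro!: linI simp: B_def tsj fun_eq_iff algebra_simps)
  have "zs (n + m + m) ?C"
  proof (rule zs_commutator[OF B A])
    show "liso (Fm (n + m + m)) (Fm (n + m + m)) ?C"
      using liso_bl[OF liso_shear[OF h] liso_id] by (simp add: bl_def[abs_def])
    fix v :: "nat \<Rightarrow> 'a" assume v: "v \<in> carrier (Fm (n + m + m))"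
    have t: "tr n (B w) = tr n w" "tr n (A w) = tr n w" for w
      by (auto simp: B_def A_def tsj)
    have u: "tr n (tr (n + m) w) = tr n w" for w :: "nat \<Rightarrow> 'a" by (auto simp: tsj)
    have trA: "tr (n + m) (A (B v)) = tr (n + m) (B v)"
      by (auto simp: A_def tsj fun_eq_iff)
    have trB: "tr n (tr (n + m) (B v)) = tr n v" by (simp only: u t)
    have AB: "sh (n + m) (A (B v)) = (\<lambda>i. sh (n + m) v i + h (tr n v) i)"
      unfolding A_def[of "B v"] t by (auto simp: B_def tsj fun_eq_iff)
    have BA: "B (A v) = jn n (tr n v) (jn m (\<lambda>i. sh n v i + (sh (n + m) v i + h (tr n v) i)) (\<lambda>i. sh (n + m) v i + h (tr n v) i))"
      unfolding B_def[of "A v"] t by (auto simp: A_def tsj fun_eq_iff)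
    show "?C (A (B v)) = B (A v)"
      unfolding bl_def shear_def trA trB AB BA sh_jn
      by (auto simp: fun_eq_iff B_def tsj algebra_simps)
  qed
  then show ?thesis using zs_bl_left[OF liso_shear[OF h]] by blast
qed

end

subsection \<open>Linear combinations\<close>

text \<open>Lists are extended at the end because the indices of the earlier entries, and hence
  their coefficients, then stay the same.\<close>

lemma lincomb_snoc:
  assumes N: "left_module N" and bs: "set bs \<subseteq> carrier N" and b: "b \<in> carrier N"
  shows "lincomb N (bs @ [b]) c = lincomb N bs c \<oplus>\<^bsub>N\<^esub> c (length bs) \<odot>\<^bsub>N\<^esub> b"
    and "lincomb N bs c \<in> carrier N"
proof -
  interpret abelian_group N using N unfolding left_module_def by blast
  have mem: "bs ! i \<in> carrier N" if "i < length bs" for i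
    using subsetD[OF bs nth_mem[OF that]] .
  have cl: "(\<lambda>i. c i \<odot>\<^bsub>N\<^esub> bs ! i) \<in> {..<length bs} \<rightarrow> carrier N"
    using mem N by auto
  show "lincomb N bs c \<in> carrier N"
    unfolding lincomb_def by (rule finsum_closed[OF cl])
  have "lincomb N (bs @ [b]) c = (\<Oplus>\<^bsub>N\<^esub>i\<in>insert (length bs) {..<length bs}. c i \<odot>\<^bsub>N\<^esub> (bs @ [b]) ! i)"
    by (simp add: lincomb_def lessThan_Suc)
  also have "\<dots> = c (length bs) \<odot>\<^bsub>N\<^esub> b \<oplus>\<^bsub>N\<^esub> (\<Oplus>\<^bsub>N\<^esub>i\<in>{..<length bs}. c i \<odot>\<^bsub>N\<^esub> (bs @ [b]) ! i)"
    by (subst finsum_insert) (use mem b N in \<open>auto simp: nth_append\<close>)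
  also have "(\<Oplus>\<^bsub>N\<^esub>i\<in>{..<length bs}. c i \<odot>\<^bsub>N\<^esub> (bs @ [b]) ! i) = lincomb N bs c"
    unfolding lincomb_def by (rule finsum_cong') (use mem N in \<open>auto simp: nth_append\<close>)
  finally show "lincomb N (bs @ [b]) c = lincomb N bs c \<oplus>\<^bsub>N\<^esub> c (length bs) \<odot>\<^bsub>N\<^esub> b"
    using \<open>lincomb N bs c \<in> carrier N\<close> b N by (simp add: lm_comm)
qed

lemma lincomb_Nil: "left_module N \<Longrightarrow> lincomb N [] c = \<zero>\<^bsub>N\<^esub>"
  unfolding lincomb_def left_module_def by (simp add: abelian_monoid.finsum_empty abelian_group_def)

lemma lincomb_zero:
  assumes N: "left_module N" and "set bs \<subseteq> carrier N" "\<And>i. i < length bs \<Longrightarrow> c i = 0"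
  shows "lincomb N bs c = \<zero>\<^bsub>N\<^esub>"
  using assms(2,3)
  by (induction bs rule: rev_induct) (auto simp: lincomb_Nil[OF N] lincomb_snoc(1)[OF N] N)

lemma lincomb_add:
  assumes N: "left_module N" and "set bs \<subseteq> carrier N"
  shows "lincomb N bs (\<lambda>i. c i + d i) = lincomb N bs c \<oplus>\<^bsub>N\<^esub> lincomb N bs d"
  using assms(2)
proof (induction bs rule: rev_induct)
  case (snoc b bs)
  have [simp]: "lincomb N bs c \<in> carrier N" for c
    using snoc.prems by (intro lincomb_snoc(2)[OF N]) auto
  show ?case using snoc
    by (simp add: lincomb_snoc(1)[OF N] N lm_add_smult[OF N] lm_assoc[OF N] lm_lcomm[OF N])
qed (simp add: lincomb_Nil[OF N] N)

lemma lincomb_smult: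
  assumes N: "left_module N" and "set bs \<subseteq> carrier N"
  shows "lincomb N bs (\<lambda>i. a * c i) = a \<odot>\<^bsub>N\<^esub> lincomb N bs c"
  using assms(2)
proof (induction bs rule: rev_induct)
  case (snoc b bs)
  have [simp]: "lincomb N bs c \<in> carrier N" for c
    using snoc.prems by (intro lincomb_snoc(2)[OF N]) auto
  show ?case using snoc
    by (simp add: lincomb_snoc(1)[OF N] N lm_mult_smult[OF N] lm_smult_add[OF N])
qed (simp add: lincomb_Nil[OF N] N)

lemma lincomb_unit:
  assumes N: "left_module N" and "set bs \<subseteq> carrier N" "i < length bs"
  shows "lincomb N bs (unit_vec i) = bs ! i"
  using assms(2,3)
proof (induction bs rule: rev_induct)
  case (snoc b bs)
  show ?case
  proof (cases "i = length bs")
    case True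
    then show ?thesis using snoc.prems lincomb_zero[OF N, of bs "unit_vec i"]
      by (simp add: lincomb_snoc(1)[OF N] N)
  next
    case False
    then have i: "i < length bs" using snoc.prems by simp
    then have "bs ! i \<in> carrier N" using snoc.prems subsetD[OF _ nth_mem[OF i]] by simp
    then show ?thesis using snoc i by (simp add: lincomb_snoc(1)[OF N] N nth_append)
  qed
qed simp

lemma lin_lincomb:
  assumes "left_module N" "set bs \<subseteq> carrier N"
  shows "lin (Fm n) N (lincomb N bs)"
  by (rule linI) (simp_all add: lincomb_add[OF assms] lincomb_smult[OF assms] lincomb_snoc(2)[OF assms(1,2)
    lm_zero[OF assms(1)]])

lemma bij_betw_iff_ex1:
  assumes "\<And>c. c \<in> A \<Longrightarrow> f c \<in> B"
  shows "bij_betw f A B \<longleftrightarrow> (\<forall>x\<in>B. \<exists>!c. c \<in> A \<and> f c = x)"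
proof
  assume b: "bij_betw f A B"
  show "\<forall>x\<in>B. \<exists>!c. c \<in> A \<and> f c = x"
  proof
    fix x assume "x \<in> B"
    then obtain c where "c \<in> A" "f c = x" using b by (auto simp: bij_betw_def)
    then show "\<exists>!c. c \<in> A \<and> f c = x"
      using b by (intro ex1I[of _ c]) (auto simp: bij_betw_def inj_on_def)
  qed
next
  assume u: "\<forall>x\<in>B. \<exists>!c. c \<in> A \<and> f c = x"
  have "inj_on f A"
  proof (rule inj_onI)
    fix c d assume "c \<in> A" "d \<in> A" "f c = f d"
    with bspec[OF u assms[of d]] show "c = d" by blast
  qed
  moreover have "f ` A = B" using assms u by blast
  ultimately show "bij_betw f A B" by (simp add: bij_betw_def)
qed

text \<open>The passage from lists to frames: a basis is an isomorphism from a free module. Torsion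
  is compared on frames from here on, and \<open>frame_list\<close> leads back to lists.\<close>

lemma is_basis_iff:
  assumes N: "left_module N"
  shows "is_basis N bs \<longleftrightarrow> set bs \<subseteq> carrier N \<and> liso (Fm (length bs)) N (lincomb N bs)"
proof -
  have "liso (Fm (length bs)) N (lincomb N bs) \<longleftrightarrow>
      (\<forall>x\<in>carrier N. \<exists>!c. c \<in> carrier (Fm (length bs)) \<and> lincomb N bs c = x)"
    if s: "set bs \<subseteq> carrier N"
    unfolding liso_def
      bij_betw_iff_ex1[of "carrier (Fm (length bs))" "lincomb N bs", OF lincomb_snoc(2)[OF N s lm_zero[OF N]]]
    using lin_lincomb[OF N s] by (simp only: simp_thms)
  then show ?thesis unfolding is_basis_def by (simp only: cong: conj_cong)
qed

lemma coords_eq: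
  assumes N: "left_module N" and b: "is_basis N bs" and x: "x \<in> carrier N"
  shows "coords N bs x = inv_into (carrier (Fm (length bs))) (lincomb N bs) x"
proof -
  have l: "liso (Fm (length bs)) N (lincomb N bs)" using is_basis_iff[OF N] b by blast
  show ?thesis unfolding coords_def
    by (rule the_equality) (use liso_inv_into[OF l] x in auto)
qed

definition frame_list :: "nat \<Rightarrow> ((nat \<Rightarrow> 'a::ring_1) \<Rightarrow> 'n) \<Rightarrow> 'n list" where
  "frame_list n \<kappa> = map (\<lambda>i. \<kappa> (unit_vec i)) [0..<n]"

lemma frame_list:
  assumes N: "left_module N" and k: "liso (Fm n) N \<kappa>"
  shows "length (frame_list n \<kappa>) = n" "is_basis N (frame_list n \<kappa>)"
    "v \<in> carrier (Fm n) \<Longrightarrow> lincomb N (frame_list n \<kappa>) v = \<kappa> v"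
proof -
  show l: "length (frame_list n \<kappa>) = n" by (simp add: frame_list_def)
  have s: "set (frame_list n \<kappa>) \<subseteq> carrier N"
    using liso_closed[OF k unit_vec_F] by (auto simp: frame_list_def)
  have eq: "lincomb N (frame_list n \<kappa>) v = \<kappa> v" if "v \<in> carrier (Fm n)" for v
    using lin_F_eqI[OF N lin_lincomb[OF N s] liso_lin[OF k] _ that] lincomb_unit[OF N s] l
    by (simp add: frame_list_def)
  then show "v \<in> carrier (Fm n) \<Longrightarrow> lincomb N (frame_list n \<kappa>) v = \<kappa> v" .
  have "liso (Fm n) N (lincomb N (frame_list n \<kappa>))"
    by (rule liso_cong[OF left_module_free k]) (simp only: eq)
  then show "is_basis N (frame_list n \<kappa>)" using is_basis_iff[OF N] s l by simp
qed

lemma frame_list_lincomb: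
  assumes "left_module N" "set bs \<subseteq> carrier N"
  shows "frame_list (length bs) (lincomb N bs) = bs"
  by (rule nth_equalityI) (simp_all add: frame_list_def lincomb_unit[OF assms])

lemma frame_list_cong:
  "(\<And>v. v \<in> carrier (Fm n) \<Longrightarrow> \<kappa> v = \<kappa>' v) \<Longrightarrow> frame_list n \<kappa> = frame_list n \<kappa>'"
  unfolding frame_list_def using unit_vec_F by (intro map_cong) auto

context l_setting
begin

subsection \<open>Frames up to \<open>Z\<close>\<close>

lemma ibn: "liso (Fm n :: ('a, _) module) (Fm m) f \<Longrightarrow> n = m"
proof -
  assume "liso (Fm n :: ('a, _) module) (Fm m) f"
  then have "restrict f (carrier (Fm n)) \<in> miso (Fm n) (Fm m)"
    by (simp only: restrict_miso[OF left_module_free])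
  then show ?thesis using weakly_finite unfolding weakly_finite_def by blast
qed

text \<open>The module version of two bases being equivalent, at a fixed rank and before
  stabilisation. That \<kappa>' is an isomorphism as well follows, see \<open>feqE\<close>.\<close>

definition feq :: "('a, 'n, 'z) module_scheme \<Rightarrow> nat \<Rightarrow> ((nat \<Rightarrow> 'a) \<Rightarrow> 'n) \<Rightarrow> ((nat \<Rightarrow> 'a) \<Rightarrow> 'n) \<Rightarrow> bool" where
  "feq N n \<kappa> \<kappa>' \<longleftrightarrow> liso (Fm n) N \<kappa> \<and> (\<exists>\<alpha>. zs n \<alpha> \<and> (\<forall>v\<in>carrier (Fm n). \<kappa>' v = \<kappa> (\<alpha> v)))"

lemma feqI: "liso (Fm n) N \<kappa> \<Longrightarrow> zs n \<alpha> \<Longrightarrow> (\<And>v. v \<in> carrier (Fm n) \<Longrightarrow> \<kappa>' v = \<kappa> (\<alpha> v)) \<Longrightarrow> feq N n \<kappa> \<kappa>'"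
  unfolding feq_def by blast

lemma feqE:
  assumes "feq N n \<kappa> \<kappa>'"
  obtains \<alpha> where "liso (Fm n) N \<kappa>" "liso (Fm n) N \<kappa>'" "zs n \<alpha>"
    "\<And>v. v \<in> carrier (Fm n) \<Longrightarrow> \<kappa>' v = \<kappa> (\<alpha> v)"
proof -
  obtain \<alpha> where a: "liso (Fm n) N \<kappa>" "zs n \<alpha>" "\<And>v. v \<in> carrier (Fm n) \<Longrightarrow> \<kappa>' v = \<kappa> (\<alpha> v)"
    using assms unfolding feq_def by blast
  have "liso (Fm n) N \<kappa>'"
    by (rule liso_cong[OF left_module_free liso_comp[OF zs_liso[OF a(2)] a(1)]]) (simp only: a(3))
  then show ?thesis using that a by blast
qed

lemma feq_iff:
  assumes k: "liso (Fm n) N \<kappa>" and k': "liso (Fm n) N \<kappa>'"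
  shows "feq N n \<kappa> \<kappa>' \<longleftrightarrow> zs n (\<lambda>v. inv_into (carrier (Fm n)) \<kappa> (\<kappa>' v))"
proof
  assume f: "feq N n \<kappa> \<kappa>'"
  obtain \<alpha> where a: "zs n \<alpha>" "\<And>v. v \<in> carrier (Fm n) \<Longrightarrow> \<kappa>' v = \<kappa> (\<alpha> v)"
    by (rule feqE[OF f]) (iprover intro: that)
  show "zs n (\<lambda>v. inv_into (carrier (Fm n)) \<kappa> (\<kappa>' v))"
    by (rule zs_cong[OF a(1)]) (simp only: a(2) liso_inv_into(3)[OF k zs_closed[OF a(1)]])
next
  assume z: "zs n (\<lambda>v. inv_into (carrier (Fm n)) \<kappa> (\<kappa>' v))"
  show "feq N n \<kappa> \<kappa>'"
    by (rule feqI[OF k z]) (simp only: liso_inv_into(2)[OF k liso_closed[OF k']])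
qed

lemma feq_refl: "liso (Fm n) N \<kappa> \<Longrightarrow> feq N n \<kappa> \<kappa>"
  by (rule feqI[OF _ zs_id]) simp_all

lemma feq_sym: assumes "feq N n \<kappa> \<kappa>'" shows "feq N n \<kappa>' \<kappa>"
  using assms
proof (rule feqE)
  fix \<alpha> assume a: "liso (Fm n) N \<kappa>" "liso (Fm n) N \<kappa>'" "zs n \<alpha>"
    "\<And>v. v \<in> carrier (Fm n) \<Longrightarrow> \<kappa>' v = \<kappa> (\<alpha> v)"
  note i = liso_inv_into[OF zs_liso[OF a(3)]]
  have "zs n (inv_into (carrier (Fm n)) \<alpha>)"
    by (rule zs_inv[OF a(3)]) (simp only: i simp_thms)
  then show ?thesis by (rule feqI[OF a(2)]) (simp only: a(4) i)
qed

lemma feq_trans: assumes "feq N n \<kappa> \<kappa>'" "feq N n \<kappa>' \<kappa>''" shows "feq N n \<kappa> \<kappa>''"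
  using assms(1)
proof (rule feqE)
  fix \<alpha> assume a: "liso (Fm n) N \<kappa>" "liso (Fm n) N \<kappa>'" "zs n \<alpha>"
    "\<And>v. v \<in> carrier (Fm n) \<Longrightarrow> \<kappa>' v = \<kappa> (\<alpha> v)"
  from assms(2) show ?thesis
  proof (rule feqE)
    fix \<beta> assume b: "zs n \<beta>" "\<And>v. v \<in> carrier (Fm n) \<Longrightarrow> \<kappa>'' v = \<kappa>' (\<beta> v)"
    show ?thesis
      by (rule feqI[OF a(1) zs_comp[OF a(3) b(1)]]) (simp only: b(2) a(4) zs_closed[OF b(1)])
  qed
qed

lemma feq_cong:
  assumes "feq N n \<kappa> \<kappa>'" "\<And>v. v \<in> carrier (Fm n) \<Longrightarrow> \<kappa> v = \<mu> v" "\<And>v. v \<in> carrier (Fm n) \<Longrightarrow> \<kappa>' v = \<mu>' v"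
  shows "feq N n \<mu> \<mu>'"
  using assms(1)
proof (rule feqE)
  fix \<alpha> assume a: "liso (Fm n) N \<kappa>" "zs n \<alpha>" "\<And>v. v \<in> carrier (Fm n) \<Longrightarrow> \<kappa>' v = \<kappa> (\<alpha> v)"
  show ?thesis
    by (rule feqI[OF liso_cong[OF left_module_free a(1) assms(2)] a(2)])
      (simp_all only: a(3) assms(3)[symmetric] assms(2)[symmetric] zs_closed[OF a(2)])
qed

lemma feq_transport:
  assumes "feq N n \<kappa> \<kappa>'" "liso N N' F" shows "feq N' n (\<lambda>v. F (\<kappa> v)) (\<lambda>v. F (\<kappa>' v))"
  using assms(1) by (rule feqE) (rule feqI[OF liso_comp[OF _ assms(2)]], auto)

definition fsum :: "nat \<Rightarrow> ((nat \<Rightarrow> 'a) \<Rightarrow> 'm) \<Rightarrow> ((nat \<Rightarrow> 'a) \<Rightarrow> 'n) \<Rightarrow> (nat \<Rightarrow> 'a) \<Rightarrow> 'm \<times> 'n" where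
  "fsum n \<kappa> \<kappa>' v = (\<kappa> (tr n v), \<kappa>' (sh n v))"

lemma liso_fsum: "liso (Fm n) M \<kappa> \<Longrightarrow> liso (Fm m) N \<kappa>' \<Longrightarrow> liso (Fm (n + m)) (msum M N) (fsum n \<kappa> \<kappa>')"
  using liso_comp[OF liso_split liso_map_prod] by (simp add: fsum_def[abs_def])

lemma bl_tr_sh:
  assumes "zs n \<alpha>" shows "tr n (bl n \<alpha> \<beta> v) = \<alpha> (tr n v)" "sh n (bl n \<alpha> \<beta> v) = \<beta> (sh n v)"
  using tr_jn[OF zs_closed[OF assms tr_F]] by (simp_all add: bl_def)

lemma feq_fsum:
  assumes "feq M n \<kappa> \<kappa>'" "feq N m \<mu> \<mu>'"
  shows "feq (msum M N) (n + m) (fsum n \<kappa> \<mu>) (fsum n \<kappa>' \<mu>')"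
proof -
  obtain \<alpha> where a: "liso (Fm n) M \<kappa>" "zs n \<alpha>" "\<And>v. v \<in> carrier (Fm n) \<Longrightarrow> \<kappa>' v = \<kappa> (\<alpha> v)"
    by (rule feqE[OF assms(1)]) (iprover intro: that)
  obtain \<beta> where b: "liso (Fm m) N \<mu>" "zs m \<beta>" "\<And>v. v \<in> carrier (Fm m) \<Longrightarrow> \<mu>' v = \<mu> (\<beta> v)"
    by (rule feqE[OF assms(2)]) (iprover intro: that)
  show ?thesis
    by (rule feqI[OF liso_fsum[OF a(1) b(1)] zs_bl[OF a(2) b(2)]])
      (simp only: fsum_def bl_tr_sh[OF a(2)] a(3)[OF tr_F] b(3)[OF sh_F])
qed

text \<open>With the same frame \<mu> on the second summand the change of frame is the block sum
  with an identity, which \<open>zs_bl_left\<close> removes.\<close>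

lemma feq_fsum_cancel:
  assumes k: "liso (Fm n) M \<kappa>" "liso (Fm n) M \<kappa>'" and m: "liso (Fm m) N \<mu>"
    and f: "feq (msum M N) (n + m) (fsum n \<kappa> \<mu>) (fsum n \<kappa>' \<mu>)"
  shows "feq M n \<kappa> \<kappa>'"
proof -
  let ?a = "\<lambda>v. inv_into (carrier (Fm n)) \<kappa> (\<kappa>' v)"
  have la: "liso (Fm n) (Fm n) ?a" by (rule liso_comp[OF k(2) liso_inv[OF left_module_free k(1)]])
  have ca: "?a v \<in> carrier (Fm n)" "\<kappa> (?a v) = \<kappa>' v" if "v \<in> carrier (Fm n)" for v
    using liso_inv_into(1,2)[OF k(1) liso_closed[OF k(2) that]] by simp_all
  have lf: "liso (Fm (n + m)) (msum M N) (fsum n \<kappa> \<mu>)" by (rule liso_fsum[OF k(1) m])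
  obtain \<beta> where b: "zs (n + m) \<beta>" "\<And>v. v \<in> carrier (Fm (n + m)) \<Longrightarrow> fsum n \<kappa>' \<mu> v = fsum n \<kappa> \<mu> (\<beta> v)"
    by (rule feqE[OF f]) (iprover intro: that)
  have "zs (n + m) (bl n ?a (\<lambda>v. v))"
  proof (rule zs_cong[OF b(1)])
    fix v :: "nat \<Rightarrow> 'a" assume v: "v \<in> carrier (Fm (n + m))"
    have blc: "bl n ?a (\<lambda>v. v) v \<in> carrier (Fm (n + m))"
      unfolding bl_def by (rule jn_F[OF sh_F[OF v]])
    have "fsum n \<kappa> \<mu> (\<beta> v) = fsum n \<kappa> \<mu> (bl n ?a (\<lambda>v. v) v)"
      unfolding b(2)[OF v, symmetric]
      by (simp only: fsum_def bl_def tr_jn[OF ca(1)[OF tr_F]] sh_jn ca(2)[OF tr_F])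
    then show "\<beta> v = bl n ?a (\<lambda>v. v) v"
      by (rule liso_inj[OF lf zs_closed[OF b(1) v] blc])
  qed
  then show ?thesis using zs_bl_left[OF la] feq_iff[OF k] by blast
qed

text \<open>The torsion of an automorphism of \<open>N\<close> is invariant under conjugation by any
  automorphism \<open>h\<close>, whatever the torsion of \<open>h\<close>: in the frame \<kappa>
  this is \<open>zs_conj\<close>.\<close>

lemma feq_conj:
  assumes f: "feq N n \<kappa> (\<lambda>v. \<gamma> (\<kappa> v))" and h: "liso N N h" and d: "liso N N \<delta>"
    and eq: "\<And>x. x \<in> carrier N \<Longrightarrow> \<delta> (h x) = h (\<gamma> x)"
  shows "feq N n \<kappa> (\<lambda>v. \<delta> (\<kappa> v))"
proof -
  let ?i = "inv_into (carrier (Fm n)) \<kappa>"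
  obtain \<alpha> where a: "liso (Fm n) N \<kappa>" "zs n \<alpha>" "\<And>v. v \<in> carrier (Fm n) \<Longrightarrow> \<gamma> (\<kappa> v) = \<kappa> (\<alpha> v)"
    by (rule feqE[OF f]) (iprover intro: that)
  note i = liso_inv_into[OF a(1)] and kc = liso_closed[OF a(1)] and hc = liso_closed[OF h] and dc = liso_closed[OF d]
  have l: "liso (Fm n) (Fm n) (\<lambda>v. ?i (g (\<kappa> v)))" if "liso N N g" for g
    by (rule liso_comp[OF liso_comp[OF a(1) that] liso_inv[OF left_module_free a(1)]])
  have "zs n (\<lambda>v. ?i (\<delta> (\<kappa> v)))"
  proof (rule zs_conj[OF a(2) l[OF d] l[OF h]])
    fix v :: "nat \<Rightarrow> 'a" assume v: "v \<in> carrier (Fm n)"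
    show "?i (\<delta> (\<kappa> (?i (h (\<kappa> v))))) = ?i (h (\<kappa> (\<alpha> v)))"
      by (simp only: i(2)[OF hc[OF kc[OF v]]] eq[OF kc[OF v]] a(3)[OF v])
  qed
  then show ?thesis using feq_iff[OF a(1) liso_comp[OF a(1) d]] by simp
qed

subsection \<open>Stable frames\<close>

definition sframe :: "('a, 'm, 'z) module_scheme \<Rightarrow> nat \<Rightarrow> nat \<Rightarrow> ((nat \<Rightarrow> 'a) \<Rightarrow> 'm \<times> (nat \<Rightarrow> 'a)) \<Rightarrow> bool" where
  "sframe M m n \<kappa> \<longleftrightarrow> liso (Fm n) (msum M (Fm m)) \<kappa>"

text \<open>The number of new coordinates is not an argument: the same function serves as a frame of
  every stabilisation, because vectors are sequences of unbounded length. This gives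
  \<open>st_st\<close> without casts.\<close>

definition st :: "nat \<Rightarrow> nat \<Rightarrow> ((nat \<Rightarrow> 'a) \<Rightarrow> 'm \<times> (nat \<Rightarrow> 'a)) \<Rightarrow> (nat \<Rightarrow> 'a) \<Rightarrow> 'm \<times> (nat \<Rightarrow> 'a)" where
  "st m n \<kappa> v = (fst (\<kappa> (tr n v)), jn m (snd (\<kappa> (tr n v))) (sh n v))"

lemma sframe_closed: "sframe M m n \<kappa> \<Longrightarrow> v \<in> carrier (Fm n) \<Longrightarrow> fst (\<kappa> v) \<in> carrier M \<and> snd (\<kappa> v) \<in> carrier (Fm m)"
  unfolding sframe_def by (drule (1) liso_closed) (auto simp: mem_Times_iff)

lemma liso_assoc: "liso (msum (msum M N) P) (msum M (msum N P)) (\<lambda>u. (fst (fst u), (snd (fst u), snd u)))"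
  by (rule lisoI[of _ _ _ "\<lambda>u. ((fst u, fst (snd u)), snd (snd u))"]) (auto simp: lin_def)

lemma sframe_st:
  assumes "sframe M m n \<kappa>" shows "sframe M (m + j) (n + j) (st m n \<kappa>)"
proof -
  have "liso (Fm (n + j)) (msum (msum M (Fm m)) (Fm j)) (fsum n \<kappa> (\<lambda>v. v))"
    by (rule liso_fsum[OF assms[unfolded sframe_def] liso_id])
  from liso_comp[OF liso_comp[OF this liso_assoc] liso_map_prod[OF liso_id liso_join]]
  show ?thesis unfolding sframe_def by (simp add: fsum_def st_def[abs_def])
qed

lemma feq_st:
  assumes "feq (msum M (Fm m)) n \<kappa> \<kappa>'"
  shows "feq (msum M (Fm (m + j))) (n + j) (st m n \<kappa>) (st m n \<kappa>')"
proof -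
  have "feq (msum (msum M (Fm m)) (Fm j)) (n + j) (fsum n \<kappa> (\<lambda>v. v)) (fsum n \<kappa>' (\<lambda>v. v))"
    by (rule feq_fsum[OF assms feq_refl[OF liso_id]])
  from feq_transport[OF feq_transport[OF this liso_assoc] liso_map_prod[OF liso_id liso_join]]
  show ?thesis by (simp add: fsum_def st_def[abs_def])
qed

lemma st_st: "st (m + j) (n + j) (st m n \<kappa>) v = st m n \<kappa> v"
proof -
  have "tr n (tr (n + j) v) = tr n v" "jn (m + j) (jn m w (sh n (tr (n + j) v))) (sh (n + j) v) = jn m w (sh n v)" for w
    by (auto simp: tsj fun_eq_iff algebra_simps)
  then show ?thesis by (simp add: st_def)
qed

text \<open>The second size equation follows from the first by \<open>sframe_rank\<close>, that is,
  by weak finiteness. Including it keeps this invariant out of the theory of stable frames.\<close>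

definition seq :: "('a, 'm, 'z) module_scheme \<Rightarrow> nat \<Rightarrow> nat \<Rightarrow> ((nat \<Rightarrow> 'a) \<Rightarrow> 'm \<times> (nat \<Rightarrow> 'a)) \<Rightarrow>
    nat \<Rightarrow> nat \<Rightarrow> ((nat \<Rightarrow> 'a) \<Rightarrow> 'm \<times> (nat \<Rightarrow> 'a)) \<Rightarrow> bool" where
  "seq M m n \<kappa> m' n' \<kappa>' \<longleftrightarrow> sframe M m n \<kappa> \<and> sframe M m' n' \<kappa>' \<and>
     (\<exists>j j'. m + j = m' + j' \<and> n + j = n' + j' \<and>
        feq (msum M (Fm (m + j))) (n + j) (st m n \<kappa>) (st m' n' \<kappa>'))"

lemma seqI:
  assumes "sframe M m n \<kappa>" "sframe M m' n' \<kappa>'" "m + j = m' + j'" "n + j = n' + j'"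
    "feq (msum M (Fm (m + j))) (n + j) (st m n \<kappa>) (st m' n' \<kappa>')"
  shows "seq M m n \<kappa> m' n' \<kappa>'"
  using assms unfolding seq_def by blast

lemma seq_up:
  assumes "feq (msum M (Fm (m + j))) (n + j) (st m n \<kappa>) (st m' n' \<kappa>')" "m + j = m' + j'" "n + j = n' + j'"
  shows "feq (msum M (Fm (m + j + i))) (n + j + i) (st m n \<kappa>) (st m' n' \<kappa>')"
  by (rule feq_cong[OF feq_st[OF assms(1), of i]]) (simp only: st_st, simp only: assms(2,3) st_st)

lemma seq_sym: "seq M m n \<kappa> m' n' \<kappa>' \<Longrightarrow> seq M m' n' \<kappa>' m n \<kappa>"
  unfolding seq_def using feq_sym by metis

text \<open>The two comparisons take place at different sizes. Stabilising the first by
  \<open>j\<close> and the second by \<open>i'\<close> brings them to a common one.\<close>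

lemma seq_trans:
  assumes 1: "seq M m1 n1 \<kappa>1 m2 n2 \<kappa>2" and 2: "seq M m2 n2 \<kappa>2 m3 n3 \<kappa>3"
  shows "seq M m1 n1 \<kappa>1 m3 n3 \<kappa>3"
proof -
  from 1 obtain i i' where i: "sframe M m1 n1 \<kappa>1" "m1 + i = m2 + i'" "n1 + i = n2 + i'"
    "feq (msum M (Fm (m1 + i))) (n1 + i) (st m1 n1 \<kappa>1) (st m2 n2 \<kappa>2)"
    unfolding seq_def by blast
  from 2 obtain j j' where j: "sframe M m3 n3 \<kappa>3" "m2 + j = m3 + j'" "n2 + j = n3 + j'"
    "feq (msum M (Fm (m2 + j))) (n2 + j) (st m2 n2 \<kappa>2) (st m3 n3 \<kappa>3)"
    unfolding seq_def by blast
  have e: "m1 + (i + j) = m2 + i' + j" "n1 + (i + j) = n2 + i' + j" "m2 + j + i' = m2 + i' + j" "n2 + j + i' = n2 + i' + j"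
    using i j by auto
  have "feq (msum M (Fm (m1 + (i + j)))) (n1 + (i + j)) (st m1 n1 \<kappa>1) (st m2 n2 \<kappa>2)"
    using seq_up[OF i(4,2,3), of j] by (simp only: add.assoc)
  moreover have "feq (msum M (Fm (m1 + (i + j)))) (n1 + (i + j)) (st m2 n2 \<kappa>2) (st m3 n3 \<kappa>3)"
    using seq_up[OF j(4,2,3), of i'] unfolding e .
  ultimately have "feq (msum M (Fm (m1 + (i + j)))) (n1 + (i + j)) (st m1 n1 \<kappa>1) (st m3 n3 \<kappa>3)"
    by (rule feq_trans)
  then show ?thesis
    by (rule seqI[OF i(1) j(1), rotated -1, of _ "j' + i'"]) (use i j in auto)
qed

text \<open>For frames of equal size stabilisation loses nothing: \<open>st\<close> is, up to
  reordering, the sum with a standard frame, and \<open>feq_fsum_cancel\<close> removes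
  that.\<close>

lemma seq_same:
  assumes k: "sframe M m n \<kappa>" "sframe M m n \<kappa>'"
  shows "seq M m n \<kappa> m n \<kappa>' \<longleftrightarrow> feq (msum M (Fm m)) n \<kappa> \<kappa>'"
proof
  assume "feq (msum M (Fm m)) n \<kappa> \<kappa>'"
  then show "seq M m n \<kappa> m n \<kappa>'"
    by (intro seqI[OF k, of 0 0] refl feq_st)
next
  assume "seq M m n \<kappa> m n \<kappa>'"
  then obtain j where f: "feq (msum M (Fm (m + j))) (n + j) (st m n \<kappa>) (st m n \<kappa>')"
    unfolding seq_def by auto
  let ?h = "\<lambda>u :: 'b \<times> (nat \<Rightarrow> 'a). ((fst u, tr m (snd u)), sh m (snd u))"
  have h: "liso (msum M (Fm (m + j))) (msum (msum M (Fm m)) (Fm j)) ?h"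
    by (rule lisoI[of _ _ _ "\<lambda>u. (fst (fst u), jn m (snd (fst u)) (snd u))"])
      (auto simp: lin_def tsj fun_eq_iff)
  have e: "?h (st m n \<mu> v) = fsum n \<mu> (\<lambda>v. v) v" if "sframe M m n \<mu>" for \<mu> :: "(nat \<Rightarrow> 'a) \<Rightarrow> 'b \<times> (nat \<Rightarrow> 'a)" and v
    using tr_jn[of "snd (\<mu> (tr n v))" m] sframe_closed[OF that tr_F, of v] by (simp add: st_def fsum_def)
  have "feq (msum (msum M (Fm m)) (Fm j)) (n + j) (fsum n \<kappa> (\<lambda>v. v)) (fsum n \<kappa>' (\<lambda>v. v))"
    by (rule feq_cong[OF feq_transport[OF f h]]) (simp_all only: e k)
  then show "feq (msum M (Fm m)) n \<kappa> \<kappa>'"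
    by (rule feq_fsum_cancel[OF k[unfolded sframe_def] liso_id])
qed

lemma seq_refl: "sframe M m n \<kappa> \<Longrightarrow> seq M m n \<kappa> m n \<kappa>"
  using seq_same feq_refl unfolding sframe_def by metis

lemma seq_cong: "sframe M m n \<kappa> \<Longrightarrow> (\<And>v. v \<in> carrier (Fm n) \<Longrightarrow> \<kappa> v = \<kappa>' v) \<Longrightarrow> seq M m n \<kappa> m n \<kappa>'"
  unfolding sframe_def
  by (subst seq_same) (auto simp: sframe_def intro: liso_cong[OF left_module_free] feqI[OF _ zs_id])

lemma seq_st: assumes "sframe M m n \<kappa>" shows "seq M m n \<kappa> (m + j) (n + j) (st m n \<kappa>)"
proof (rule seqI[where j = j and j' = 0])
  have e: "st (m + j) (n + j) (st m n \<kappa>) = st m n \<kappa>" by (rule ext) (rule st_st)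
  show "feq (msum M (Fm (m + j))) (n + j) (st m n \<kappa>) (st (m + j) (n + j) (st m n \<kappa>))"
    unfolding e by (rule feq_refl[OF sframe_st[OF assms, unfolded sframe_def]])
qed (simp_all add: assms sframe_st)

lemma seq_transport:
  assumes "seq M m n \<kappa> m' n' \<kappa>'" "liso M N f"
  shows "seq N m n (\<lambda>v. map_prod f (\<lambda>x. x) (\<kappa> v)) m' n' (\<lambda>v. map_prod f (\<lambda>x. x) (\<kappa>' v))"
proof -
  have s: "st m n (\<lambda>v. map_prod f (\<lambda>x. x) (\<mu> v)) v = map_prod f (\<lambda>x. x) (st m n \<mu> v)" for \<mu> v m n
    by (simp add: st_def)
  show ?thesis
    using assms(1) feq_transport[OF _ liso_map_prod[OF assms(2) liso_id]] liso_comp[OF _ liso_map_prod[OF assms(2) liso_id]]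
    unfolding seq_def sframe_def s[abs_def] by blast
qed

text \<open>An automorphism \<open>\<gamma>\<close> of the free summand of \<open>M \<oplus> \<Lambda>\<^sup>m\<close> is, after adding another \<open>\<Lambda>\<^sup>m\<close>,
  conjugate to the block sum of \<open>1\<close> and \<open>\<gamma>\<close>.\<close>

lemma feq_twist:
  assumes k: "liso (Fm n) (msum M (Fm m)) \<kappa>" and g: "zs m \<gamma>"
  shows "feq (msum M (Fm m)) n \<kappa> (\<lambda>v. map_prod (\<lambda>x. x) \<gamma> (\<kappa> v))"
proof -
  let ?N = "msum (msum M (Fm m)) (Fm m)"
  let ?h = "\<lambda>u :: ('b \<times> (nat \<Rightarrow> 'a)) \<times> (nat \<Rightarrow> 'a). ((fst (fst u), snd u), snd (fst u))"
  note lg = zs_liso[OF g]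
  have f: "feq (Fm m) m (\<lambda>v. v) \<gamma>" by (rule feqI[OF liso_id g]) simp
  have "feq ?N (n + m) (fsum n \<kappa> (\<lambda>v. v)) (\<lambda>v. map_prod (\<lambda>x. x) \<gamma> (fsum n \<kappa> (\<lambda>v. v) v))"
    using feq_fsum[OF feq_refl[OF k] f] by (simp add: fsum_def[abs_def])
  then have "feq ?N (n + m) (fsum n \<kappa> (\<lambda>v. v)) (\<lambda>v. map_prod (map_prod (\<lambda>x. x) \<gamma>) (\<lambda>x. x) (fsum n \<kappa> (\<lambda>v. v) v))"
  proof (rule feq_conj)
    show "liso ?N ?N ?h" by (rule lisoI[of _ _ _ ?h]) (auto simp: lin_def)
    show "liso ?N ?N (map_prod (map_prod (\<lambda>x. x) \<gamma>) (\<lambda>x. x))"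
      by (intro liso_map_prod liso_id lg)
  qed auto
  then have "feq ?N (n + m) (fsum n \<kappa> (\<lambda>v. v)) (fsum n (\<lambda>v. map_prod (\<lambda>x. x) \<gamma> (\<kappa> v)) (\<lambda>v. v))"
    by (simp add: fsum_def[abs_def])
  then show ?thesis
    by (rule feq_fsum_cancel[OF k liso_comp[OF k liso_map_prod[OF liso_id lg]] liso_id])
qed

text \<open>A frame may be changed at its source by definition and on its free summand by
  \<open>feq_twist\<close>. All reorderings of blocks in sums and swaps go through this
  lemma.\<close>

lemma seq_twist:
  assumes k: "sframe M m n \<kappa>" and s: "zs n \<sigma>" and g: "zs m \<gamma>"
  shows "seq M m n \<kappa> m n (\<lambda>v. map_prod (\<lambda>x. x) \<gamma> (\<kappa> (\<sigma> v)))"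
proof -
  have k': "sframe M m n (\<lambda>v. \<kappa> (\<sigma> v))"
    using liso_comp[OF zs_liso[OF s]] k by (simp add: sframe_def)
  have "feq (msum M (Fm m)) n \<kappa> (\<lambda>v. \<kappa> (\<sigma> v))"
    using k s by (intro feqI[of _ _ _ \<sigma>]) (auto simp: sframe_def)
  from feq_trans[OF this feq_twist[OF k'[unfolded sframe_def] g]]
  have f: "feq (msum M (Fm m)) n \<kappa> (\<lambda>v. map_prod (\<lambda>x. x) \<gamma> (\<kappa> (\<sigma> v)))" .
  then have "sframe M m n (\<lambda>v. map_prod (\<lambda>x. x) \<gamma> (\<kappa> (\<sigma> v)))"
    unfolding sframe_def by (rule feqE)
  then show ?thesis using seq_same[OF k] f by blast
qed

section \<open>Sums of stable frames\<close>

definition ssum :: "nat \<Rightarrow> nat \<Rightarrow> ((nat \<Rightarrow> 'a) \<Rightarrow> 'm \<times> (nat \<Rightarrow> 'a)) \<Rightarrow> ((nat \<Rightarrow> 'a) \<Rightarrow> 'n \<times> (nat \<Rightarrow> 'a)) \<Rightarrow>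
    (nat \<Rightarrow> 'a) \<Rightarrow> ('m \<times> 'n) \<times> (nat \<Rightarrow> 'a)" where
  "ssum m n \<kappa> \<mu> v = ((fst (\<kappa> (tr n v)), fst (\<mu> (sh n v))), jn m (snd (\<kappa> (tr n v))) (snd (\<mu> (sh n v))))"

lemma liso_rearrange:
  "liso (msum (msum M (Fm m)) (msum N (Fm p))) (msum (msum M N) (Fm (m + p)))
     (\<lambda>u. ((fst (fst u), fst (snd u)), jn m (snd (fst u)) (snd (snd u))))"
  by (rule lisoI[of _ _ _ "\<lambda>u. ((fst (fst u), tr m (snd u)), (snd (fst u), sh m (snd u)))"])
    (auto simp: lin_def tsj fun_eq_iff)

lemma ssum_alt: "ssum m n \<kappa> \<mu> v = (\<lambda>u. ((fst (fst u), fst (snd u)), jn m (snd (fst u)) (snd (snd u)))) (fsum n \<kappa> \<mu> v)"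
  by (simp add: ssum_def fsum_def)

lemma sframe_ssum: "sframe M m n \<kappa> \<Longrightarrow> sframe N p r \<mu> \<Longrightarrow> sframe (msum M N) (m + p) (n + r) (ssum m n \<kappa> \<mu>)"
  unfolding sframe_def ssum_alt[abs_def] by (rule liso_comp[OF liso_fsum liso_rearrange])

lemma feq_ssum:
  "feq (msum M (Fm m)) n \<kappa> \<kappa>' \<Longrightarrow> feq (msum N (Fm p)) r \<mu> \<mu>' \<Longrightarrow>
   feq (msum (msum M N) (Fm (m + p))) (n + r) (ssum m n \<kappa> \<mu>) (ssum m n \<kappa>' \<mu>')"
  unfolding ssum_alt[abs_def] by (rule feq_transport[OF feq_fsum liso_rearrange])

text \<open>The new coordinates of the second summand come last on both sides, so the frame is
  literally a stabilisation of the sum.\<close>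

lemma seq_ssum_st_right:
  assumes k: "sframe M m n \<kappa>" "sframe N p r \<mu>"
  shows "seq (msum M N) (m + p) (n + r) (ssum m n \<kappa> \<mu>) (m + (p + j)) (n + (r + j)) (ssum m n \<kappa> (st p r \<mu>))"
proof -
  have "ssum m n \<kappa> (st p r \<mu>) = st (m + p) (n + r) (ssum m n \<kappa> \<mu>)"
  proof (rule ext)
    fix v :: "nat \<Rightarrow> 'a"
    have "tr n (tr (n + r) v) = tr n v" "sh n (tr (n + r) v) = tr r (sh n v)" "sh (n + r) v = sh r (sh n v)"
      "jn m a (jn p b c) = jn (m + p) (jn m a b) c" for a b c :: "nat \<Rightarrow> 'a"
      by (auto simp: tsj fun_eq_iff algebra_simps)
    then show "ssum m n \<kappa> (st p r \<mu>) v = st (m + p) (n + r) (ssum m n \<kappa> \<mu>) v"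
      by (simp add: ssum_def st_def)
  qed
  then show ?thesis using seq_st[OF sframe_ssum[OF k], of j] by (simp add: add.assoc[symmetric])
qed

text \<open>Here the new coordinates land in the middle. The block swap \<sigma> on the source and
  \<gamma> on the free summand move them to the end, and neither has torsion.\<close>

lemma seq_ssum_st_left:
  assumes k: "sframe M m n \<kappa>" "sframe N p r \<mu>"
  shows "seq (msum M N) (m + p) (n + r) (ssum m n \<kappa> \<mu>) (m + j + p) (n + j + r) (ssum (m + j) (n + j) (st m n \<kappa>) \<mu>)"
proof -
  define \<sigma> where "\<sigma> = bl n (\<lambda>v. v) (bsw j r :: (nat \<Rightarrow> 'a) \<Rightarrow> _)"
  define \<gamma> where "\<gamma> = bl m (\<lambda>v. v) (bsw p j :: (nat \<Rightarrow> 'a) \<Rightarrow> _)"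
  have s: "zs (n + r + j) \<sigma>"
    using zs_bl[OF zs_id zs_bsw, of n j r] by (simp add: \<sigma>_def add_ac)
  have g: "zs (m + p + j) \<gamma>"
    using zs_bl[OF zs_id zs_bsw, of m p j] by (simp add: \<gamma>_def add_ac)
  have eq: "map_prod (\<lambda>x. x) \<gamma> (st (m + p) (n + r) (ssum m n \<kappa> \<mu>) (\<sigma> v)) = ssum (m + j) (n + j) (st m n \<kappa>) \<mu> v"
    if v: "v \<in> carrier (Fm (n + r + j))" for v
  proof -
    have a: "tr n (tr (n + r) (\<sigma> v)) = tr n v" "tr n (tr (n + j) v) = tr n v"
      "sh n (tr (n + r) (\<sigma> v)) = sh (n + j) v" "sh (n + r) (\<sigma> v) = tr j (sh n v)" "sh n (tr (n + j) v) = tr j (sh n v)"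
      using v by (auto simp: \<sigma>_def bl_def bsw_def tsj fun_eq_iff algebra_simps)
    have b: "\<gamma> (jn (m + p) (jn m x y) z) = jn (m + j) (jn m x z) y"
      if "y \<in> carrier (Fm p)" "z \<in> carrier (Fm j)" "x \<in> carrier (Fm m)" for x y z
      using that by (auto simp: \<gamma>_def bl_def bsw_def tsj fun_eq_iff algebra_simps)
    have "sh (n + j) v \<in> carrier (Fm r)" using v by (auto simp: sh_def)
    then have "\<gamma> (jn (m + p) (jn m (snd (\<kappa> (tr n v))) (snd (\<mu> (sh (n + j) v)))) (tr j (sh n v)))
       = jn (m + j) (jn m (snd (\<kappa> (tr n v))) (tr j (sh n v))) (snd (\<mu> (sh (n + j) v)))"
      using sframe_closed[OF k(1) tr_F] sframe_closed[OF k(2)] tr_F by (intro b) blast+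
    then show ?thesis by (simp add: ssum_def st_def a)
  qed
  have f: "sframe (msum M N) (m + p + j) (n + r + j) (st (m + p) (n + r) (ssum m n \<kappa> \<mu>))"
    by (rule sframe_st[OF sframe_ssum[OF k]])
  note t = seq_twist[OF f s g]
  have "sframe (msum M N) (m + p + j) (n + r + j) (\<lambda>v. map_prod (\<lambda>x. x) \<gamma> (st (m + p) (n + r) (ssum m n \<kappa> \<mu>) (\<sigma> v)))"
    using t unfolding seq_def by blast
  from seq_trans[OF seq_trans[OF seq_st[OF sframe_ssum[OF k]] t] seq_cong[OF this eq]]
  show ?thesis by (simp add: add_ac)
qed

lemma seq_ssum:
  assumes 1: "seq M m n \<kappa> m' n' \<kappa>'" and 2: "seq N p r \<mu> p' r' \<mu>'"
  shows "seq (msum M N) (m + p) (n + r) (ssum m n \<kappa> \<mu>) (m' + p') (n' + r') (ssum m' n' \<kappa>' \<mu>')"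
proof -
  from 1 obtain i i' where i: "sframe M m n \<kappa>" "sframe M m' n' \<kappa>'" "m' + i' = m + i" "n' + i' = n + i"
    "feq (msum M (Fm (m + i))) (n + i) (st m n \<kappa>) (st m' n' \<kappa>')"
    unfolding seq_def by metis
  from 2 obtain j j' where j: "sframe N p r \<mu>" "sframe N p' r' \<mu>'" "p' + j' = p + j" "r' + j' = r + j"
    "feq (msum N (Fm (p + j))) (r + j) (st p r \<mu>) (st p' r' \<mu>')"
    unfolding seq_def by metis
  have up: "seq (msum M N) (m + p) (n + r) (ssum m n \<kappa> \<mu>) (m + i + (p + j)) (n + i + (r + j)) (ssum (m + i) (n + i) (st m n \<kappa>) (st p r \<mu>))"
    if "sframe M m n \<kappa>" "sframe N p r \<mu>" for m n \<kappa> p r \<mu> i j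
    by (rule seq_trans[OF seq_ssum_st_left[OF that] seq_ssum_st_right[OF sframe_st[OF that(1)] that(2)]])
  have mid: "seq (msum M N) (m + i + (p + j)) (n + i + (r + j)) (ssum (m + i) (n + i) (st m n \<kappa>) (st p r \<mu>))
     (m + i + (p + j)) (n + i + (r + j)) (ssum (m + i) (n + i) (st m' n' \<kappa>') (st p' r' \<mu>'))"
  proof (subst seq_same)
    show "sframe (msum M N) (m + i + (p + j)) (n + i + (r + j)) (ssum (m + i) (n + i) (st m n \<kappa>) (st p r \<mu>))"
      by (intro sframe_ssum sframe_st i j)
    show "sframe (msum M N) (m + i + (p + j)) (n + i + (r + j)) (ssum (m + i) (n + i) (st m' n' \<kappa>') (st p' r' \<mu>'))"
      using sframe_ssum[OF sframe_st[OF i(2), of i'] sframe_st[OF j(2), of j']] by (simp only: i(3,4) j(3,4))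
    show "feq (msum (msum M N) (Fm (m + i + (p + j)))) (n + i + (r + j))
       (ssum (m + i) (n + i) (st m n \<kappa>) (st p r \<mu>)) (ssum (m + i) (n + i) (st m' n' \<kappa>') (st p' r' \<mu>'))"
      by (rule feq_ssum[OF i(5) j(5)])
  qed
  have "seq (msum M N) (m' + p') (n' + r') (ssum m' n' \<kappa>' \<mu>') (m + i + (p + j)) (n + i + (r + j)) (ssum (m + i) (n + i) (st m' n' \<kappa>') (st p' r' \<mu>'))"
    using up[OF i(2) j(2), of i' j'] by (simp only: i(3,4) j(3,4))
  then show ?thesis
    using seq_trans[OF up[OF i(1) j(1)] seq_trans[OF mid seq_sym]] by blast
qed

subsection \<open>Based modules\<close>

definition sb :: "nat \<Rightarrow> nat \<Rightarrow> ((nat \<Rightarrow> 'a) \<Rightarrow> 'm \<times> (nat \<Rightarrow> 'a)) \<Rightarrow> ('a, 'm) sbasis" where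
  "sb m n \<kappa> = (m, frame_list n \<kappa>)"

lemma sb_cong: "(\<And>v. v \<in> carrier (Fm n) \<Longrightarrow> \<kappa> v = \<kappa>' v) \<Longrightarrow> sb m n \<kappa> = sb m n \<kappa>'"
  unfolding sb_def using frame_list_cong[of n \<kappa> \<kappa>'] by simp

lemma sframe_cong: "sframe M m n \<kappa> \<Longrightarrow> (\<And>v. v \<in> carrier (Fm n) \<Longrightarrow> \<kappa> v = \<kappa>' v) \<Longrightarrow> sframe M m n \<kappa>'"
  unfolding sframe_def by (rule liso_cong[OF left_module_free])

lemma is_sbasis_sb:
  assumes "left_module M" "sframe M m n \<kappa>" shows "is_sbasis M (sb m n \<kappa>)"
  using frame_list(2)[OF left_module_msum[OF assms(1) left_module_free] assms(2)[unfolded sframe_def]]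
  by (simp add: is_sbasis_def sb_def)

lemma is_sbasisE:
  assumes "left_module M" "is_sbasis M b"
  obtains m n \<kappa> where "sframe M m n \<kappa>" "b = sb m n \<kappa>"
proof -
  let ?N = "msum M (Fm (fst b) :: ('a, _) module)"
  have N: "left_module ?N" by (rule left_module_msum[OF assms(1) left_module_free])
  have "set (snd b) \<subseteq> carrier ?N \<and> liso (Fm (length (snd b))) ?N (lincomb ?N (snd b))"
    using assms(2) is_basis_iff[OF N] by (simp only: is_sbasis_def)
  then show ?thesis
    using that[of "fst b" "length (snd b)" "lincomb ?N (snd b)"] frame_list_lincomb[OF N, of "snd b"]
    by (simp add: sb_def sframe_def)
qed

lemma sframe_zero: "left_module M \<Longrightarrow> sframe M m n \<kappa> \<Longrightarrow> \<kappa> (\<lambda>_. 0) = (\<zero>\<^bsub>M\<^esub>, \<lambda>_. 0)"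
  using lin_zero[of "Fm n" "msum M (Fm m)" \<kappa>]
  by (simp add: sframe_def liso_lin)

lemma stabilise_sb:
  assumes M: "left_module M" and k: "sframe M m n \<kappa>" and "m \<le> p"
  shows "stabilise M p (sb m n \<kappa>) = frame_list (n + (p - m)) (st m n \<kappa>)"
proof (rule nth_equalityI)
  show "length (stabilise M p (sb m n \<kappa>)) = length (frame_list (n + (p - m)) (st m n \<kappa>))"
    by (simp add: stabilise_def sb_def frame_list_def)
  fix i assume "i < length (stabilise M p (sb m n \<kappa>))"
  then have i: "i < n + (p - m)" by (simp add: stabilise_def sb_def frame_list_def)
  show "stabilise M p (sb m n \<kappa>) ! i = frame_list (n + (p - m)) (st m n \<kappa>) ! i"
  proof (cases "i < n")
    case True
    have "jn m (snd (\<kappa> (unit_vec i))) (\<lambda>_. 0) = snd (\<kappa> (unit_vec i))"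
      using sframe_closed[OF k unit_vec_F[OF True]] by (auto simp: jn_def)
    then show ?thesis using True i
      by (simp add: stabilise_def sb_def frame_list_def nth_append st_def tr_unit sh_unit)
  next
    case False
    have e: "[m..<p] ! (i - n) = i - n + m"
      by (subst nth_upt) (use i False assms(3) in arith)+
    have "stabilise M p (sb m n \<kappa>) ! i = (\<zero>\<^bsub>M\<^esub>, unit_vec ([m..<p] ! (i - n)))"
      using i False by (simp add: stabilise_def sb_def frame_list_def nth_append del: nth_upt)
    moreover have "frame_list (n + (p - m)) (st m n \<kappa>) ! i = st m n \<kappa> (unit_vec i)"
      using i by (simp add: frame_list_def)
    moreover have "st m n \<kappa> (unit_vec i) = (\<zero>\<^bsub>M\<^esub>, unit_vec (i - n + m))"
      using False by (simp add: st_def tr_unit sh_unit jn_unit(2) sframe_zero[OF M k])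
    ultimately show ?thesis by (simp only: e)
  qed
qed

lemma coords_frame_list:
  assumes N: "left_module N" and k: "liso (Fm n) N \<kappa>" and x: "x \<in> carrier N"
  shows "coords N (frame_list n \<kappa>) x = inv_into (carrier (Fm n)) \<kappa> x"
proof -
  note f = frame_list[OF N k]
  have l: "liso (Fm n) N (lincomb N (frame_list n \<kappa>))" using f(1,2) is_basis_iff[OF N] by metis
  have "coords N (frame_list n \<kappa>) x = inv_into (carrier (Fm n)) (lincomb N (frame_list n \<kappa>)) x"
    using coords_eq[OF N f(2) x] f(1) by simp
  also have "\<dots> = inv_into (carrier (Fm n)) \<kappa> x"
    using liso_inv_into(1,2)[OF l x] liso_inv_into(1,2)[OF k x] f(3) liso_inj[OF k] by metis
  finally show ?thesis .
qed

lemma trans_mat_frames: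
  assumes N: "left_module N" and k: "liso (Fm n) N \<kappa>" "liso (Fm n) N \<kappa>'"
  shows "trans_mat N (frame_list n \<kappa>) (frame_list n \<kappa>') = mat n (\<lambda>v. inv_into (carrier (Fm n)) \<kappa> (\<kappa>' v))"
  using coords_frame_list[OF N k(1) liso_closed[OF k(2) unit_vec_F]]
  by (intro ext) (simp add: trans_mat_def mat_def frame_list_def)

lemma represents_Z_trans_mat:
  assumes N: "left_module N" and k: "liso (Fm n) N \<kappa>" "liso (Fm n) N \<kappa>'"
  shows "represents_Z (trans_mat N (frame_list n \<kappa>) (frame_list n \<kappa>')) \<longleftrightarrow> feq N n \<kappa> \<kappa>'"
  unfolding trans_mat_frames[OF assms] feq_iff[OF k] zs_def
  using liso_comp[OF k(2) liso_inv[OF left_module_free k(1)]] by simp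

lemma liso_eq_rank:
  fixes N :: "('a, 'n, 'z) module_scheme"
  assumes k: "liso (Fm n) N \<kappa>" and k': "liso (Fm n') N \<kappa>'" shows "n = n'"
  by (rule ibn[OF liso_comp[OF k liso_inv[OF left_module_free k']]])

lemma sframe_rank:
  assumes "sframe M m n \<kappa>" "sframe M m' n' \<kappa>'" shows "n + m' = n' + m"
  using liso_eq_rank[of "n + m'" "msum M (Fm (m + m'))" "st m n \<kappa>" "n' + m" "st m' n' \<kappa>'"]
    sframe_st[OF assms(1), of m'] sframe_st[OF assms(2), of m]
  by (simp add: sframe_def add.commute)

text \<open>The bridge from transformation matrices to frames. From matrices to frames, weak
  finiteness is used through \<open>sframe_rank\<close>: it shows that the two stabilised frames
  have the same source.\<close>

lemma s_equiv_iff: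
  assumes M: "left_module M" and k: "sframe M m n \<kappa>" "sframe M m' n' \<kappa>'"
  shows "s_equiv M (sb m n \<kappa>) (sb m' n' \<kappa>') \<longleftrightarrow> seq M m n \<kappa> m' n' \<kappa>'"
proof
  assume "s_equiv M (sb m n \<kappa>) (sb m' n' \<kappa>')"
  then obtain p where p: "m \<le> p" "m' \<le> p"
    "represents_Z (trans_mat (msum M (Fm p)) (stabilise M p (sb m n \<kappa>)) (stabilise M p (sb m' n' \<kappa>')))"
    unfolding s_equiv_def by (auto simp: sb_def)
  have e: "m + (p - m) = p" "m' + (p - m') = p" "n' + (p - m') = n + (p - m)"
    using p sframe_rank[OF k] by auto
  have "feq (msum M (Fm p)) (n + (p - m)) (st m n \<kappa>) (st m' n' \<kappa>')"
    using p(3) unfolding stabilise_sb[OF M k(1) p(1)] stabilise_sb[OF M k(2) p(2)] e(3)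
    by (subst (asm) represents_Z_trans_mat)
      (use sframe_st[OF k(1), of "p - m"] sframe_st[OF k(2), of "p - m'"] M e in \<open>simp_all add: sframe_def\<close>)
  then show "seq M m n \<kappa> m' n' \<kappa>'"
    by (intro seqI[OF k, of "p - m" "p - m'"]) (simp_all add: e)
next
  assume "seq M m n \<kappa> m' n' \<kappa>'"
  then obtain j j' where j: "m + j = m' + j'" "n + j = n' + j'"
    "feq (msum M (Fm (m + j))) (n + j) (st m n \<kappa>) (st m' n' \<kappa>')"
    unfolding seq_def by blast
  have e: "m' \<le> m + j" "n' + (m + j - m') = n + j" using j by auto
  have "represents_Z (trans_mat (msum M (Fm (m + j))) (stabilise M (m + j) (sb m n \<kappa>)) (stabilise M (m + j) (sb m' n' \<kappa>')))"
    unfolding stabilise_sb[OF M k(1) le_add1] stabilise_sb[OF M k(2) e(1)] e(2) add_diff_cancel_left'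
    by (subst represents_Z_trans_mat)
      (use sframe_st[OF k(1), of j] sframe_st[OF k(2), of j'] M j in \<open>simp_all add: sframe_def\<close>)
  then show "s_equiv M (sb m n \<kappa>) (sb m' n' \<kappa>')"
    unfolding s_equiv_def using e(1) by (intro exI[of _ "m + j"]) (simp add: sb_def)
qed

lemma sb_in_s_class:
  assumes "left_module M" "sframe M m n \<kappa>" "sframe M m' n' \<kappa>'"
  shows "sb m' n' \<kappa>' \<in> s_class M (sb m n \<kappa>) \<longleftrightarrow> seq M m n \<kappa> m' n' \<kappa>'"
  using s_equiv_iff[OF assms] is_sbasis_sb[OF assms(1,3)] by (simp add: s_class_def)

lemma s_classE:
  assumes "left_module M" "c \<in> s_class M b"
  obtains m n \<kappa> where "sframe M m n \<kappa>" "c = sb m n \<kappa>"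
proof -
  have "is_sbasis M c" using assms(2) by (simp add: s_class_def)
  then show ?thesis using that by (rule is_sbasisE[OF assms(1)])
qed

lemma s_class_subset:
  assumes M: "left_module M" and s: "seq M m n \<kappa> m' n' \<kappa>'"
  shows "s_class M (sb m' n' \<kappa>') \<subseteq> s_class M (sb m n \<kappa>)"
proof
  fix c assume c: "c \<in> s_class M (sb m' n' \<kappa>')"
  obtain m'' n'' \<kappa>'' where k: "sframe M m'' n'' \<kappa>''" "c = sb m'' n'' \<kappa>''"
    using s_classE[OF M c] by metis
  have f: "sframe M m n \<kappa>" "sframe M m' n' \<kappa>'" using s by (auto simp: seq_def)
  show "c \<in> s_class M (sb m n \<kappa>)"
    using c seq_trans[OF s] unfolding k(2) sb_in_s_class[OF M f(1) k(1)] sb_in_s_class[OF M f(2) k(1)] by blast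
qed

lemma s_class_eq: "left_module M \<Longrightarrow> seq M m n \<kappa> m' n' \<kappa>' \<Longrightarrow> s_class M (sb m' n' \<kappa>') = s_class M (sb m n \<kappa>)"
  by (rule equalityI[OF s_class_subset s_class_subset[OF _ seq_sym]])

section \<open>Frames belonging to a based module\<close>

definition HB :: "('a, 'm) based_module \<Rightarrow> nat \<Rightarrow> nat \<Rightarrow> ((nat \<Rightarrow> 'a) \<Rightarrow> 'm \<times> (nat \<Rightarrow> 'a)) \<Rightarrow> bool" where
  "HB M m n \<kappa> \<longleftrightarrow> sframe M m n \<kappa> \<and> sb m n \<kappa> \<in> sbases M"

lemma HB_sframe: "HB M m n \<kappa> \<Longrightarrow> sframe M m n \<kappa>" by (simp add: HB_def)

lemma is_based_left_module [simp]: "is_based M \<Longrightarrow> left_module M"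
  by (simp add: is_based_def)

lemma is_based_HB_E:
  assumes "is_based M" obtains m n \<kappa> where "HB M m n \<kappa>"
proof -
  obtain b where b: "is_sbasis M b" "sbases M = s_class M b" "left_module M"
    using assms by (auto simp: is_based_def)
  obtain m n \<kappa> where k: "sframe M m n \<kappa>" "b = sb m n \<kappa>" using is_sbasisE[OF b(3,1)] by metis
  have "HB M m n \<kappa>" using b(2) k sb_in_s_class[OF b(3) k(1) k(1)] seq_refl[OF k(1)] by (simp add: HB_def)
  then show ?thesis by (rule that)
qed

lemma is_basedI: "left_module M \<Longrightarrow> sframe M m n \<kappa> \<Longrightarrow> sbases M = s_class M (sb m n \<kappa>) \<Longrightarrow> is_based M"
  using is_sbasis_sb unfolding is_based_def by blast

lemma HB_sbases:
  assumes M: "is_based M" and k: "HB M m n \<kappa>" shows "sbases M = s_class M (sb m n \<kappa>)"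
proof -
  obtain b where b: "is_sbasis M b" "sbases M = s_class M b" "left_module M"
    using M by (auto simp: is_based_def)
  obtain m' n' \<kappa>' where k': "sframe M m' n' \<kappa>'" "b = sb m' n' \<kappa>'" using is_sbasisE[OF b(3,1)] by metis
  have "seq M m' n' \<kappa>' m n \<kappa>"
    using k b(2) sb_in_s_class[OF b(3) k'(1) HB_sframe[OF k]] by (simp add: HB_def k'(2))
  show ?thesis unfolding b(2) k'(2) by (rule s_class_eq[OF b(3) seq_sym[OF \<open>seq M m' n' \<kappa>' m n \<kappa>\<close>]])
qed

lemma HB_iff:
  assumes "is_based M" "HB M m n \<kappa>" shows "HB M m' n' \<kappa>' \<longleftrightarrow> seq M m n \<kappa> m' n' \<kappa>'"
proof -
  have "HB M m' n' \<kappa>' \<longleftrightarrow> sframe M m' n' \<kappa>' \<and> sb m' n' \<kappa>' \<in> s_class M (sb m n \<kappa>)"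
    unfolding HB_def HB_sbases[OF assms] ..
  also have "\<dots> \<longleftrightarrow> seq M m n \<kappa> m' n' \<kappa>'"
    using sb_in_s_class[OF is_based_left_module[OF assms(1)] HB_sframe[OF assms(2)], of m' n' \<kappa>']
    unfolding seq_def by blast
  finally show ?thesis .
qed

lemma HB_feq:
  assumes M: "is_based M" and k: "HB M m n \<kappa>" and f: "feq (msum M (Fm m)) n \<kappa> \<kappa>'"
  shows "HB M m n \<kappa>'"
proof -
  have "sframe M m n \<kappa>'" using f unfolding sframe_def by (rule feqE)
  then show ?thesis using seq_same[OF HB_sframe[OF k]] HB_iff[OF M k] f by simp
qed

lemma HB_classI:
  "left_module M \<Longrightarrow> sframe M m n \<kappa> \<Longrightarrow> sbases M = s_class M (sb m n \<kappa>) \<Longrightarrow> HB M m n \<kappa>"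
  using sb_in_s_class[of M m n \<kappa> m n \<kappa>] seq_refl[of M m n \<kappa>] by (simp add: HB_def)

lemma HB_st: "is_based M \<Longrightarrow> HB M m n \<kappa> \<Longrightarrow> HB M (m + j) (n + j) (st m n \<kappa>)"
  using HB_iff seq_st HB_sframe by metis

lemma HB_cong: "HB M m n \<kappa> \<Longrightarrow> (\<And>v. v \<in> carrier (Fm n) \<Longrightarrow> \<kappa> v = \<kappa>' v) \<Longrightarrow> HB M m n \<kappa>'"
  unfolding HB_def using sframe_cong[of M m n \<kappa> \<kappa>'] sb_cong[of n \<kappa> \<kappa>'] by metis

lemma sbases_E:
  assumes "is_based M" "b \<in> sbases M" obtains m n \<kappa> where "HB M m n \<kappa>" "b = sb m n \<kappa>"
proof -
  obtain c where c: "sbases M = s_class M c" using assms(1) by (auto simp: is_based_def)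
  obtain m n \<kappa> where "sframe M m n \<kappa>" "b = sb m n \<kappa>"
    using s_classE[of M b c] assms c by auto
  then show ?thesis using that assms(2) by (simp add: HB_def)
qed

lemma with_sbases_simps [simp]:
  "carrier (with_sbases M B) = carrier M" "\<zero>\<^bsub>with_sbases M B\<^esub> = \<zero>\<^bsub>M\<^esub>"
  "add (with_sbases M B) = add M" "smult (with_sbases M B) = smult M" "sbases (with_sbases M B) = B"
  "msum (with_sbases M B) N = msum M N" "msum N (with_sbases M B) = msum N M"
  by (simp_all add: with_sbases_def msum_def)

lemma s_class_with_sbases [simp]: "s_class (with_sbases M B) = s_class M"
  by (intro ext) (simp add: s_class_def is_sbasis_def s_equiv_def stabilise_def)

lemma lin_with_sbases [simp]: "lin (with_sbases M B) N = lin M N" "lin N (with_sbases M B) = lin N M"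
  by (intro ext, simp add: lin_def)+

lemma liso_with_sbases [simp]: "liso (with_sbases M B) N = liso M N" "liso N (with_sbases M B) = liso N M"
  by (intro ext, simp add: liso_def)+

lemma sframe_with_sbases [simp]: "sframe (with_sbases M B) = sframe M"
  by (intro ext) (simp add: sframe_def)

lemma left_module_with_sbases [simp]: "left_module M \<Longrightarrow> left_module (with_sbases M B)"
  by (rule left_moduleI) (auto simp: lm_assoc lm_neg4 lm_add_smult lm_smult_add lm_mult_smult intro: lm_comm)

lemma bsum_simps [simp]:
  "carrier (bsum M N) = carrier M \<times> carrier N"
  "\<zero>\<^bsub>bsum M N\<^esub> = (\<zero>\<^bsub>M\<^esub>, \<zero>\<^bsub>N\<^esub>)"
  "u \<oplus>\<^bsub>bsum M N\<^esub> v = (fst u \<oplus>\<^bsub>M\<^esub> fst v, snd u \<oplus>\<^bsub>N\<^esub> snd v)"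
  "a \<odot>\<^bsub>bsum M N\<^esub> u = (a \<odot>\<^bsub>M\<^esub> fst u, a \<odot>\<^bsub>N\<^esub> snd u)"
  by (simp_all add: bsum_def)

lemma lin_bsum: "lin (bsum M N) P = lin (msum M N) P" "lin P (bsum M N) = lin P (msum M N)"
  by (simp_all add: bsum_def)

lemma liso_bsum: "liso (bsum M N) P = liso (msum M N) P" "liso P (bsum M N) = liso P (msum M N)"
  by (simp_all add: bsum_def)

lemma sum_sbasis_sb:
  assumes M: "left_module M" "left_module N" and k: "sframe M m n \<kappa>" "sframe N p r \<mu>"
  shows "sum_sbasis M N (sb m n \<kappa>) (sb p r \<mu>) = sb (m + p) (n + r) (ssum m n \<kappa> \<mu>)"
proof -
  have "map (\<lambda>(x, v). ((x, \<zero>\<^bsub>N\<^esub>), v)) (frame_list n \<kappa>) @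
     map (\<lambda>(y, w). ((\<zero>\<^bsub>M\<^esub>, y), \<lambda>j. if j < m then 0 else w (j - m))) (frame_list r \<mu>) = frame_list (n + r) (ssum m n \<kappa> \<mu>)"
    (is "?l = ?r")
  proof (rule nth_equalityI)
    show "length ?l = length ?r" by (simp add: frame_list_def)
    fix i assume "i < length ?l"
    then have i: "i < n + r" by (simp add: frame_list_def)
    show "?l ! i = ?r ! i"
    proof (cases "i < n")
      case True
      have "jn m (snd (\<kappa> (unit_vec i))) (\<lambda>_. 0) = snd (\<kappa> (unit_vec i))"
        using sframe_closed[OF k(1) unit_vec_F[OF True]] by (auto simp: jn_def)
      then show ?thesis using True i sframe_zero[OF M(2) k(2)]
        by (simp add: frame_list_def nth_append ssum_def tr_unit sh_unit case_prod_beta)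
    next
      case False
      then show ?thesis using i sframe_zero[OF M(1) k(1)]
        by (simp add: frame_list_def nth_append ssum_def tr_unit sh_unit case_prod_beta)
          (simp add: jn_def)
    qed
  qed
  then show ?thesis unfolding sum_sbasis_def sb_def fst_conv snd_conv by simp
qed

text \<open>\<open>bsum\<close> takes the union over all pairs of s-bases. It is one class because
  \<open>seq\<close> is compatible with \<open>ssum\<close>.\<close>

lemma bsum_sbases:
  assumes M: "is_based M" "is_based N" and k: "HB M m n \<kappa>" "HB N p r \<mu>"
  shows "sbases (bsum M N) = s_class (msum M N) (sb (m + p) (n + r) (ssum m n \<kappa> \<mu>))"
proof -
  have lm: "left_module M" "left_module N" "left_module (msum M N)" using M by simp_all
  have "s_class (msum M N) (sum_sbasis M N b c) = s_class (msum M N) (sb (m + p) (n + r) (ssum m n \<kappa> \<mu>))"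
    if b: "b \<in> sbases M" and c: "c \<in> sbases N" for b c
  proof -
    obtain m' n' \<kappa>' where k': "HB M m' n' \<kappa>'" "b = sb m' n' \<kappa>'" using sbases_E[OF M(1) b] by metis
    obtain p' r' \<mu>' where mu': "HB N p' r' \<mu>'" "c = sb p' r' \<mu>'" using sbases_E[OF M(2) c] by metis
    have "seq (msum M N) (m + p) (n + r) (ssum m n \<kappa> \<mu>) (m' + p') (n' + r') (ssum m' n' \<kappa>' \<mu>')"
      using HB_iff[OF M(1) k(1)] k'(1) HB_iff[OF M(2) k(2)] mu'(1) by (intro seq_ssum) simp_all
    from s_class_eq[OF lm(3) this] show ?thesis
      unfolding k'(2) mu'(2) sum_sbasis_sb[OF lm(1,2) HB_sframe[OF k'(1)] HB_sframe[OF mu'(1)]] .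
  qed
  moreover have "sbases M \<noteq> {}" "sbases N \<noteq> {}" using k by (auto simp: HB_def)
  ultimately show ?thesis unfolding bsum_def by fastforce
qed

lemma left_module_bsum [simp]: "left_module M \<Longrightarrow> left_module N \<Longrightarrow> left_module (bsum M N)"
  by (simp add: bsum_def)

lemma sframe_bsum: "sframe (bsum M N) = sframe (msum M N)"
  by (simp add: bsum_def)

lemma s_class_bsum: "s_class (bsum M N) = s_class (msum M N)"
  by (simp add: bsum_def)

lemma HB_bsum:
  assumes M: "is_based M" "is_based N" and k: "HB M m n \<kappa>" "HB N p r \<mu>"
  shows "HB (bsum M N) (m + p) (n + r) (ssum m n \<kappa> \<mu>)"
  by (rule HB_classI) (use assms bsum_sbases[OF assms] in \<open>simp_all add: sframe_bsum s_class_bsum sframe_ssum HB_sframe\<close>)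

lemma is_based_bsum [simp]:
  assumes M: "is_based M" "is_based N" shows "is_based (bsum M N)"
proof -
  obtain m n \<kappa> where k: "HB M m n \<kappa>" using is_based_HB_E[OF M(1)] by metis
  obtain p r \<mu> where mu: "HB N p r \<mu>" using is_based_HB_E[OF M(2)] by metis
  show ?thesis
    by (rule is_basedI[of _ "m + p" "n + r" "ssum m n \<kappa> \<mu>"])
      (use assms k mu bsum_sbases[OF assms k mu] in \<open>simp_all add: sframe_bsum s_class_bsum sframe_ssum HB_sframe\<close>)
qed

subsection \<open>Simple isomorphisms\<close>

text \<open>A simple isomorphism as a function that is arbitrary outside the carrier, unlike in \<open>simple_iso\<close>.\<close>

definition smp :: "('a, 'm) based_module \<Rightarrow> ('a, 'n) based_module \<Rightarrow> ('m \<Rightarrow> 'n) \<Rightarrow> bool" where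
  "smp M N f \<longleftrightarrow> is_based M \<and> is_based N \<and> simple_iso M N (restrict f (carrier M))"

lemma map_sbasis_sb: "map_sbasis f (sb m n \<kappa>) = sb m n (\<lambda>v. map_prod f (\<lambda>x. x) (\<kappa> v))"
  by (simp add: map_sbasis_def sb_def frame_list_def id_def)

lemma map_sbasis_restrict: "sframe M m n \<kappa> \<Longrightarrow> map_sbasis (restrict f (carrier M)) (sb m n \<kappa>) = sb m n (\<lambda>v. map_prod f (\<lambda>x. x) (\<kappa> v))"
  unfolding map_sbasis_sb using sframe_closed[of M m n \<kappa>] by (intro sb_cong) (simp add: map_prod_def case_prod_beta)

lemma sframe_transport: "sframe M m n \<kappa> \<Longrightarrow> liso M N f \<Longrightarrow> sframe N m n (\<lambda>v. map_prod f (\<lambda>x. x) (\<kappa> v))"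
  unfolding sframe_def by (rule liso_comp[OF _ liso_map_prod[OF _ liso_id]])

text \<open>\<open>simple_iso\<close> tests one pair of s-bases. By \<open>seq_transport\<close> the
  choice is immaterial, so it suffices to follow any single distinguished frame of
  \<open>M\<close>.\<close>

lemma smp_iff:
  assumes M: "is_based M" "is_based N" and k: "HB M m n \<kappa>"
  shows "smp M N f \<longleftrightarrow> liso M N f \<and> HB N m n (\<lambda>v. map_prod f (\<lambda>x. x) (\<kappa> v))"
proof (intro iffI conjI)
  assume "smp M N f"
  then obtain b c where bc: "liso M N f" "b \<in> sbases M" "c \<in> sbases N" "s_equiv N c (map_sbasis (restrict f (carrier M)) b)"
    unfolding smp_def simple_iso_def using restrict_miso[of M f N] M by auto
  then show "liso M N f" by simp
  obtain m' n' \<kappa>' where k': "HB M m' n' \<kappa>'" "b = sb m' n' \<kappa>'" using sbases_E[OF M(1) bc(2)] by metis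
  obtain p r \<mu> where mu: "HB N p r \<mu>" "c = sb p r \<mu>" using sbases_E[OF M(2) bc(3)] by metis
  have "seq N p r \<mu> m' n' (\<lambda>v. map_prod f (\<lambda>x. x) (\<kappa>' v))"
    using bc(4) unfolding k'(2) mu(2) map_sbasis_restrict[OF HB_sframe[OF k'(1)]]
    by (subst (asm) s_equiv_iff) (use M mu HB_sframe sframe_transport[OF HB_sframe[OF k'(1)] bc(1)] in auto)
  moreover have "seq M m' n' \<kappa>' m n \<kappa>" using HB_iff[OF M(1) k'(1)] k by blast
  ultimately have "seq N p r \<mu> m n (\<lambda>v. map_prod f (\<lambda>x. x) (\<kappa> v))"
    using seq_trans seq_transport bc(1) by metis
  then show "HB N m n (\<lambda>v. map_prod f (\<lambda>x. x) (\<kappa> v))" using HB_iff[OF M(2) mu(1)] by blast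
next
  assume a: "liso M N f \<and> HB N m n (\<lambda>v. map_prod f (\<lambda>x. x) (\<kappa> v))"
  note s = HB_sframe[OF conjunct2[OF a]]
  have "s_equiv N (sb m n (\<lambda>v. map_prod f (\<lambda>x. x) (\<kappa> v))) (map_sbasis (restrict f (carrier M)) (sb m n \<kappa>))"
    unfolding map_sbasis_restrict[OF HB_sframe[OF k]]
    by (subst s_equiv_iff) (use M s seq_refl in auto)
  then show "smp M N f"
    unfolding smp_def simple_iso_def using a k restrict_miso[of M f N] M by (auto simp: HB_def)
qed

lemma smp_liso: "smp M N f \<Longrightarrow> liso M N f"
  unfolding smp_def simple_iso_def using restrict_miso[of M f N] by auto

lemmas smp_lin = liso_lin[OF smp_liso]
lemmas smp_closed = liso_closed[OF smp_liso]

lemma smp_based: "smp M N f \<Longrightarrow> is_based M" "smp M N f \<Longrightarrow> is_based N"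
  by (auto simp: smp_def)

lemma smpI:
  assumes "is_based M" "is_based N" "HB M m n \<kappa>" "liso M N f" "HB N m n \<mu>"
    "\<And>v. v \<in> carrier (Fm n) \<Longrightarrow> f (fst (\<kappa> v)) = fst (\<mu> v) \<and> snd (\<kappa> v) = snd (\<mu> v)"
  shows "smp M N f"
proof -
  have "HB N m n (\<lambda>v. map_prod f (\<lambda>x. x) (\<kappa> v))"
    by (rule HB_cong[OF assms(5)]) (use assms(6) in \<open>auto simp: prod_eq_iff\<close>)
  then show ?thesis using smp_iff[OF assms(1-3)] assms(4) by blast
qed

lemma smp_HB: "smp M N f \<Longrightarrow> HB M m n \<kappa> \<Longrightarrow> HB N m n (\<lambda>v. map_prod f (\<lambda>x. x) (\<kappa> v))"
  using smp_iff smp_based by metis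

lemma smp_id: assumes "is_based M" shows "smp M M (\<lambda>x. x)"
proof -
  obtain m n \<kappa> where "HB M m n \<kappa>" using is_based_HB_E[OF assms] by metis
  then show ?thesis using assms liso_id by (intro smpI) auto
qed

lemma smp_comp: assumes "smp M N f" "smp N P g" shows "smp M P (\<lambda>x. g (f x))"
proof -
  obtain m n \<kappa> where k: "HB M m n \<kappa>" using is_based_HB_E[OF smp_based(1)[OF assms(1)]] by metis
  from smp_HB[OF assms(2) smp_HB[OF assms(1) k]] k show ?thesis
    using smp_based[OF assms(1)] smp_based[OF assms(2)] liso_comp[OF smp_liso[OF assms(1)] smp_liso[OF assms(2)]]
    by (intro smpI) auto
qed

lemma smp_cong: assumes "smp M N f" "\<And>x. x \<in> carrier M \<Longrightarrow> f x = g x" shows "smp M N g"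
proof -
  have "restrict f (carrier M) = restrict g (carrier M)" using assms(2) by (rule restrict_ext)
  then show ?thesis using assms(1) by (simp add: smp_def)
qed

text \<open>A right inverse of a bijection is the inverse. This allows \<open>g\<close> to be an
  explicit formula, such as a projection, instead of \<open>inv_into\<close>.\<close>

lemma smp_inverse:
  assumes f: "smp M N f" and g: "\<And>y. y \<in> carrier N \<Longrightarrow> g y \<in> carrier M \<and> f (g y) = y"
  shows "smp N M g"
proof -
  obtain m n \<kappa> where k: "HB M m n \<kappa>" using is_based_HB_E[OF smp_based(1)[OF f]] by metis
  have gf: "g (f x) = x" if "x \<in> carrier M" for x
    using liso_inj[OF smp_liso[OF f]] g smp_closed[OF f that] that by blast
  have "liso N M (inv_into (carrier M) f)"
    using smp_based[OF f] by (intro liso_inv[OF _ smp_liso[OF f]]) simp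
  then have "liso N M g"
    by (rule liso_cong[rotated]) (use smp_based[OF f] g gf liso_inv_into[OF smp_liso[OF f]] in \<open>auto, metis\<close>)
  then show ?thesis
    using smp_based[OF f] smp_HB[OF f k] k gf sframe_closed[OF HB_sframe[OF k]]
    by (intro smpI) auto
qed

lemma smp_inv: assumes f: "smp M N f" shows "smp N M (inv_into (carrier M) f)"
  by (rule smp_inverse[OF f]) (simp add: liso_inv_into[OF smp_liso[OF f]])

lemma smp_bsum:
  assumes "smp M M' f" "smp N N' g" shows "smp (bsum M N) (bsum M' N') (map_prod f g)"
proof -
  obtain m n \<kappa> where k: "HB M m n \<kappa>" using is_based_HB_E[OF smp_based(1)[OF assms(1)]] by metis
  obtain p r \<mu> where mu: "HB N p r \<mu>" using is_based_HB_E[OF smp_based(1)[OF assms(2)]] by metis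
  note b = smp_based[OF assms(1)] smp_based[OF assms(2)]
  show ?thesis
    by (rule smpI[OF is_based_bsum[OF b(1,3)] is_based_bsum[OF b(2,4)] HB_bsum[OF b(1,3) k mu] _
          HB_bsum[OF b(2,4) smp_HB[OF assms(1) k] smp_HB[OF assms(2) mu]]])
      (auto simp: liso_bsum ssum_def intro: liso_map_prod smp_liso assms)
qed

lemma smp_assoc:
  assumes b: "is_based M" "is_based N" "is_based P"
  shows "smp (bsum (bsum M N) P) (bsum M (bsum N P)) (\<lambda>u. (fst (fst u), (snd (fst u), snd u)))"
proof -
  obtain m n \<kappa> where k: "HB M m n \<kappa>" using is_based_HB_E[OF b(1)] by metis
  obtain p r \<mu> where mu: "HB N p r \<mu>" using is_based_HB_E[OF b(2)] by metis
  obtain s t \<nu> where nu: "HB P s t \<nu>" using is_based_HB_E[OF b(3)] by metis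
  note nb = is_based_bsum[OF b(1,2)] is_based_bsum[OF b(2,3)]
  have h: "HB (bsum M (bsum N P)) (m + p + s) (n + r + t) (ssum m n \<kappa> (ssum p r \<mu> \<nu>))"
    using HB_bsum[OF b(1) nb(2) k HB_bsum[OF b(2,3) mu nu]] by (simp add: add.assoc)
  show ?thesis
  proof (rule smpI[OF is_based_bsum[OF nb(1) b(3)] is_based_bsum[OF b(1) nb(2)] HB_bsum[OF nb(1) b(3) HB_bsum[OF b(1,2) k mu] nu] _ h])
    show "liso (bsum (bsum M N) P) (bsum M (bsum N P)) (\<lambda>u. (fst (fst u), (snd (fst u), snd u)))"
      using liso_assoc[of M N P] by (simp add: bsum_def)
    fix v :: "nat \<Rightarrow> 'a"
    have "tr n (tr (n + r) v) = tr n v" "sh n (tr (n + r) v) = tr r (sh n v)" "sh (n + r) v = sh r (sh n v)"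
      "jn m a (jn p b c) = jn (m + p) (jn m a b) c" for a b c :: "nat \<Rightarrow> 'a"
      by (auto simp: tsj fun_eq_iff algebra_simps)
    then show "(fst (fst (fst (ssum (m + p) (n + r) (ssum m n \<kappa> \<mu>) \<nu> v))),
          snd (fst (fst (ssum (m + p) (n + r) (ssum m n \<kappa> \<mu>) \<nu> v))), snd (fst (ssum (m + p) (n + r) (ssum m n \<kappa> \<mu>) \<nu> v))) =
         fst (ssum m n \<kappa> (ssum p r \<mu> \<nu>) v) \<and>
         snd (ssum (m + p) (n + r) (ssum m n \<kappa> \<mu>) \<nu> v) = snd (ssum m n \<kappa> (ssum p r \<mu> \<nu>) v)"
      by (simp add: ssum_def)
  qed
qed

text \<open>The frames of the two sums differ by block swaps of the source and of the free summand.
  These are permutation matrices, and the reduced group has no room for their signs.\<close>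

lemma smp_swap:
  assumes b: "is_based M" "is_based N"
  shows "smp (bsum M N) (bsum N M) (\<lambda>u. (snd u, fst u))"
proof -
  obtain m n \<kappa> where k: "HB M m n \<kappa>" using is_based_HB_E[OF b(1)] by metis
  obtain p r \<mu> where mu: "HB N p r \<mu>" using is_based_HB_E[OF b(2)] by metis
  note nb = is_based_bsum[OF b] is_based_bsum[OF b(2,1)]
  note h = HB_bsum[OF b(2,1) mu k]
  have z: "zs (r + n) (bsw n r)" "zs (p + m) (bsw p m)"
    using zs_bsw[of n r] zs_bsw[of p m] by (simp_all add: add.commute)
  have "HB (bsum N M) (p + m) (r + n) (\<lambda>v. map_prod (\<lambda>x. x) (bsw p m) (ssum p r \<mu> \<kappa> (bsw n r v)))"
    using HB_iff[OF nb(2) h] seq_twist[OF HB_sframe[OF h] z] by blast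
  then have h': "HB (bsum N M) (m + p) (n + r) (\<lambda>v. map_prod (\<lambda>x. x) (bsw p m) (ssum p r \<mu> \<kappa> (bsw n r v)))"
    by (simp add: add.commute)
  show ?thesis
  proof (rule smpI[OF nb HB_bsum[OF b k mu] _ h'])
    show "liso (bsum M N) (bsum N M) (\<lambda>u. (snd u, fst u))"
      unfolding liso_bsum by (rule lisoI[of _ _ _ "\<lambda>u. (snd u, fst u)"]) (auto simp: lin_def)
    fix v :: "nat \<Rightarrow> 'a" assume v: "v \<in> carrier (Fm (n + r))"
    have e: "tr r (bsw n r v) = sh n v" "sh r (bsw n r v) = tr n v"
      using v by (auto simp: bsw_def tsj fun_eq_iff)
    have "bsw p m (jn p a c) = jn m c a" if "a \<in> carrier (Fm p)" for a c :: "nat \<Rightarrow> 'a"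
      using that by (simp only: bsw_def tr_jn sh_jn)
    then show "(snd (fst (ssum m n \<kappa> \<mu> v)), fst (fst (ssum m n \<kappa> \<mu> v))) = fst (map_prod (\<lambda>x. x) (bsw p m) (ssum p r \<mu> \<kappa> (bsw n r v))) \<and>
      snd (ssum m n \<kappa> \<mu> v) = snd (map_prod (\<lambda>x. x) (bsw p m) (ssum p r \<mu> \<kappa> (bsw n r v)))"
      using sframe_closed[OF HB_sframe[OF mu] sh_F[OF v]] by (simp add: ssum_def e)
  qed
qed

lemma smp_shear:
  assumes b: "is_based M" "is_based N" and h: "lin M N h"
  shows "smp (bsum M N) (bsum M N) (\<lambda>u. (fst u, snd u \<oplus>\<^bsub>N\<^esub> h (fst u)))"
proof -
  obtain m n \<kappa> where k: "HB M m n \<kappa>" using is_based_HB_E[OF b(1)] by metis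
  obtain p r \<mu> where mu: "HB N p r \<mu>" using is_based_HB_E[OF b(2)] by metis
  have lm: "left_module M" "left_module N" using b by simp_all
  note nb = is_based_bsum[OF b] and kl = HB_sframe[OF k, unfolded sframe_def] and ml = HB_sframe[OF mu, unfolded sframe_def]
  \<comment> \<open>Extended by zero on the free summand, \<open>h\<close> becomes a map between the
    free sources of the two frames; in these coordinates the shear of the modules is
    \<open>zs_shear\<close>.\<close>
  let ?H = "\<lambda>u. (h (fst u), \<lambda>_. 0 :: 'a)"
  let ?h = "\<lambda>v. inv_into (carrier (Fm r)) \<mu> (?H (\<kappa> v))"
  have H: "lin (msum M (Fm m)) (msum N (Fm p)) ?H" using h by (auto simp: lin_def)
  have hl: "lin (Fm n) (Fm r) ?h"
    by (rule lin_comp[OF lin_comp[OF liso_lin[OF kl] H] liso_lin[OF liso_inv[OF left_module_free ml]]])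
  have mh: "\<mu> (?h v) = ?H (\<kappa> v)" if "v \<in> carrier (Fm n)" for v
    by (rule liso_inv_into(2)[OF ml lin_closed[OF H liso_closed[OF kl that]]])
  note hb = HB_bsum[OF b k mu]
  have "feq (msum (bsum M N) (Fm (m + p))) (n + r) (ssum m n \<kappa> \<mu>) (\<lambda>v. ssum m n \<kappa> \<mu> (shear n ?h v))"
    by (rule feqI[OF HB_sframe[OF hb, unfolded sframe_def] zs_shear[OF hl]]) simp
  then have h': "HB (bsum M N) (m + p) (n + r) (\<lambda>v. ssum m n \<kappa> \<mu> (shear n ?h v))"
    by (rule HB_feq[OF nb hb])
  show ?thesis
  proof (rule smpI[OF nb nb hb _ h'])
    let ?g = "\<lambda>u. (fst u, snd u \<oplus>\<^bsub>N\<^esub> (- 1) \<odot>\<^bsub>N\<^esub> h (fst u))"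
    show "liso (bsum M N) (bsum M N) (\<lambda>u. (fst u, snd u \<oplus>\<^bsub>N\<^esub> h (fst u)))"
      unfolding liso_bsum
    proof (rule lisoI[of _ _ _ ?g])
      show "lin (msum M N) (msum M N) (\<lambda>u. (fst u, snd u \<oplus>\<^bsub>N\<^esub> h (fst u)))"
        by (rule linI) (use lm lin_closed[OF h] in \<open>auto simp: lin_add[OF h] lin_smult[OF h] lm_smult_add lm_assoc lm_lcomm\<close>)
    qed (use lm lin_closed[OF h] in \<open>auto simp: lm_assoc lm_neg lm_neg4\<close>)
    fix v :: "nat \<Rightarrow> 'a" assume v: "v \<in> carrier (Fm (n + r))"
    have e: "tr n (shear n ?h v) = tr n v" "sh n (shear n ?h v) = sh n v \<oplus>\<^bsub>Fm r\<^esub> ?h (tr n v)"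
      by (simp_all add: shear_def)
    have "\<mu> (sh n v \<oplus>\<^bsub>Fm r\<^esub> ?h (tr n v)) = \<mu> (sh n v) \<oplus>\<^bsub>msum N (Fm p)\<^esub> ?H (\<kappa> (tr n v))"
      by (subst lin_add[OF liso_lin[OF ml] sh_F[OF v] lin_closed[OF hl tr_F]]) (simp only: mh[OF tr_F])
    then show "(fst (fst (ssum m n \<kappa> \<mu> v)), snd (fst (ssum m n \<kappa> \<mu> v)) \<oplus>\<^bsub>N\<^esub> h (fst (fst (ssum m n \<kappa> \<mu> v)))) = fst (ssum m n \<kappa> \<mu> (shear n ?h v)) \<and>
      snd (ssum m n \<kappa> \<mu> v) = snd (ssum m n \<kappa> \<mu> (shear n ?h v))"
      unfolding ssum_def e by simp
  qed
qed

lemma smp_neg: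
  assumes b: "is_based M" shows "smp M M (\<lambda>x. (- 1) \<odot>\<^bsub>M\<^esub> x)"
proof -
  obtain m n \<kappa> where k: "HB M m n \<kappa>" using is_based_HB_E[OF b] by metis
  have lm: "left_module M" using b by simp
  note kl = HB_sframe[OF k, unfolded sframe_def]
  \<comment> \<open>The negation at the source also negates the free component; the second negation
    restores it, so that only the component in \<open>M\<close> changes sign.\<close>
  have h': "HB M m n (\<lambda>v. map_prod (\<lambda>x. x) (\<lambda>v i. - v i) (\<kappa> (\<lambda>i. - v i)))"
    using HB_iff[OF b k] seq_twist[OF HB_sframe[OF k] zs_neg zs_neg] by blast
  show ?thesis
  proof (rule smpI[OF b b k _ h'])
    show "liso M M (\<lambda>x. (- 1) \<odot>\<^bsub>M\<^esub> x)"
      by (rule lisoI[of _ _ _ "\<lambda>x. (- 1) \<odot>\<^bsub>M\<^esub> x"])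
        (use lm in \<open>auto intro!: linI simp: lm_smult_add lm_mult_smult[symmetric]\<close>)
    fix v :: "nat \<Rightarrow> 'a" assume v: "v \<in> carrier (Fm n)"
    have "(\<lambda>i. - v i) = (- 1) \<odot>\<^bsub>Fm n\<^esub> v" by simp
    then have "\<kappa> (\<lambda>i. - v i) = (- 1) \<odot>\<^bsub>msum M (Fm m)\<^esub> \<kappa> v"
      using lin_smult[OF liso_lin[OF kl] v] by metis
    then show "(- 1) \<odot>\<^bsub>M\<^esub> fst (\<kappa> v) = fst (map_prod (\<lambda>x. x) (\<lambda>v i. - v i) (\<kappa> (\<lambda>i. - v i))) \<and>
      snd (\<kappa> v) = snd (map_prod (\<lambda>x. x) (\<lambda>v i. - v i) (\<kappa> (\<lambda>i. - v i)))"
      by simp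
  qed
qed

section \<open>Transport along injections, the universe type, and ranks\<close>

lemma push_simps [simp]:
  fixes P :: "('a, 'm) based_module"
  shows
  "carrier (push_based f P N) = f ` carrier P" "\<zero>\<^bsub>push_based f P N\<^esub> = \<zero>\<^bsub>N\<^esub>"
  "add (push_based f P N) = add N" "smult (push_based f P N) = smult N"
  "sbases (push_based f P N) = map_sbasis f ` sbases P"
  by (simp_all add: push_based_def)

text \<open>The pushed s-bases form a full equivalence class on the image, since \<open>seq\<close>
  is transported both by \<open>f\<close> and by its inverse.\<close>

lemma push_based:
  assumes P: "is_based P" and N: "left_module N" and f: "lin P N f" and inj: "inj_on f (carrier P)"
  shows "is_based (push_based f P N)" "smp P (push_based f P N) f" "lin (push_based f P N) N (\<lambda>x. x)"
proof -
  let ?Q = "push_based f P N"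
  have lm: "left_module P" using P by simp
  have c: "f x \<in> carrier N" if "x \<in> carrier P" for x using lin_closed[OF f that] .
  have fz: "f \<zero>\<^bsub>P\<^esub> = \<zero>\<^bsub>N\<^esub>" by (rule lin_zero[OF lm N f])
  have lQ: "left_module ?Q"
  proof (rule left_moduleI)
    show "\<zero>\<^bsub>?Q\<^esub> \<in> carrier ?Q" using fz lm_zero[OF lm] by (auto simp: image_iff) metis
  qed (use lm N c in \<open>auto simp: lin_add[OF f, symmetric] lin_smult[OF f, symmetric] lm_assoc lm_neg4 fz
      lm_add_smult lm_smult_add lm_mult_smult intro: lm_comm\<close>)
  have li: "liso P ?Q f"
    unfolding liso_def lin_def using f inj by (auto simp: lin_def inj_on_imp_bij_betw)
  obtain m n \<kappa> where k: "HB P m n \<kappa>" using is_based_HB_E[OF P] by metis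
  let ?k = "\<lambda>v. map_prod f (\<lambda>x. x) (\<kappa> v)"
  have fr: "sframe ?Q m n ?k" by (rule sframe_transport[OF HB_sframe[OF k] li])
  have "map_sbasis f ` sbases P = s_class ?Q (sb m n ?k)"
  proof (intro equalityI subsetI)
    fix b assume "b \<in> map_sbasis f ` sbases P"
    then obtain c where c: "c \<in> sbases P" "b = map_sbasis f c" by blast
    obtain m' n' \<kappa>' where k': "HB P m' n' \<kappa>'" "c = sb m' n' \<kappa>'" using sbases_E[OF P c(1)] by metis
    have "seq ?Q m n ?k m' n' (\<lambda>v. map_prod f (\<lambda>x. x) (\<kappa>' v))"
      using HB_iff[OF P k] k'(1) by (intro seq_transport[OF _ li]) blast
    then show "b \<in> s_class ?Q (sb m n ?k)"
      unfolding c(2) k'(2) map_sbasis_sb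
      using sb_in_s_class[OF lQ fr sframe_transport[OF HB_sframe[OF k'(1)] li]] by blast
  next
    fix b assume b: "b \<in> s_class ?Q (sb m n ?k)"
    obtain m' n' \<kappa>' where k': "sframe ?Q m' n' \<kappa>'" "b = sb m' n' \<kappa>'" using s_classE[OF lQ b] by metis
    note i = liso_inv_into[OF li] and g = liso_inv[OF lm li]
    let ?g = "inv_into (carrier P) f"
    have s: "seq ?Q m n ?k m' n' \<kappa>'" using b unfolding k'(2) sb_in_s_class[OF lQ fr k'(1)] .
    have "seq P m n (\<lambda>v. map_prod ?g (\<lambda>x. x) (?k v)) m' n' (\<lambda>v. map_prod ?g (\<lambda>x. x) (\<kappa>' v))"
      by (rule seq_transport[OF s g])
    moreover have "seq P m n \<kappa> m n (\<lambda>v. map_prod ?g (\<lambda>x. x) (?k v))"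
      by (rule seq_cong[OF HB_sframe[OF k]]) (use i(3) sframe_closed[OF HB_sframe[OF k]] in \<open>auto simp: prod_eq_iff\<close>)
    ultimately have h: "HB P m' n' (\<lambda>v. map_prod ?g (\<lambda>x. x) (\<kappa>' v))"
      using HB_iff[OF P k] seq_trans by blast
    have "b = map_sbasis f (sb m' n' (\<lambda>v. map_prod ?g (\<lambda>x. x) (\<kappa>' v)))"
      unfolding map_sbasis_sb k'(2)
      by (rule sb_cong) (use i(2) sframe_closed[OF k'(1)] in \<open>auto simp: prod_eq_iff\<close>)
    then show "b \<in> map_sbasis f ` sbases P" using h by (auto simp: HB_def)
  qed
  then have cl: "sbases ?Q = s_class ?Q (sb m n ?k)" by simp
  show b: "is_based ?Q" by (rule is_basedI[OF lQ fr cl])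
  show "smp P ?Q f"
    using smp_iff[OF P b k] li HB_classI[OF lQ fr cl] by blast
  show "lin ?Q N (\<lambda>x. x)" using c by (auto simp: lin_def)
qed

text \<open>The coordinates of \<open>(x, 0)\<close> in a frame embed a stably free module into a
  finitely generated free one; its image, with transported s-bases, lies in the universe.\<close>

lemma univ_based:
  assumes "is_based M"
  obtains f and M' :: "('a, 'a univ) based_module" where "is_based M'" "smp M M' f"
proof -
  obtain m n \<kappa> where k: "HB M m n \<kappa>" using is_based_HB_E[OF assms] by metis
  have lm: "left_module M" using assms by simp
  note kl = HB_sframe[OF k, unfolded sframe_def]
  let ?i = "inv_into (carrier (Fm n)) \<kappa>"
  let ?f = "\<lambda>x. ?i (x, \<lambda>_. 0)"
  have i: "liso (msum M (Fm m)) (Fm n) ?i" by (rule liso_inv[OF left_module_free kl])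
  have "lin M (msum M (Fm m)) (\<lambda>x. (x, \<lambda>_. 0))" by (auto simp: lin_def)
  from lin_comp[OF this liso_lin[OF i]] have f: "lin M (Fm n) ?f" .
  have inj: "inj_on ?f (carrier M)"
    by (rule inj_onI) (use liso_inj[OF i, of "(_, \<lambda>_. 0)" "(_, \<lambda>_. 0)"] in auto)
  from push_based[OF assms left_module_free f inj] that show ?thesis by blast
qed

definition std :: "nat \<Rightarrow> ('a, 'a univ) based_module" where
  "std k = with_sbases (Fm k) (s_class (Fm k) (sb 0 k (\<lambda>v. (v, \<lambda>_. 0))))"

lemma std_frame: "sframe (Fm k) 0 k (\<lambda>v. (v, \<lambda>_. 0))"
  unfolding sframe_def by (rule lisoI[of _ _ _ fst]) (auto simp: lin_def fun_eq_iff)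

lemma is_based_std [simp]: "is_based (std k)" and HB_std: "HB (std k) 0 k (\<lambda>v. (v, \<lambda>_. 0))"
  using is_basedI[of "std k" 0 k "\<lambda>v. (v, \<lambda>_. 0)"] HB_classI[of "std k" 0 k "\<lambda>v. (v, \<lambda>_. 0)"] std_frame
  by (simp_all add: std_def)

lemma rank_HB:
  assumes M: "is_based M" and k: "HB M m n \<kappa>" shows "rank M = int n - int m"
proof -
  have "(SOME b. b \<in> sbases M) \<in> sbases M" by (rule someI[of _ "sb m n \<kappa>"]) (use k in \<open>simp add: HB_def\<close>)
  from sbases_E[OF M this] obtain m' n' \<kappa>' where k': "HB M m' n' \<kappa>'" "(SOME b. b \<in> sbases M) = sb m' n' \<kappa>'" by metis
  have "n + m' = n' + m" by (rule sframe_rank[OF HB_sframe[OF k] HB_sframe[OF k'(1)]])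
  then show ?thesis unfolding rank_def k'(2) by (simp add: sb_def frame_list_def)
qed

lemma rank_smp: assumes "smp M N f" shows "rank M = rank N"
proof -
  obtain m n \<kappa> where k: "HB M m n \<kappa>" using is_based_HB_E[OF smp_based(1)[OF assms]] by metis
  show ?thesis using rank_HB[OF smp_based(1)[OF assms] k] rank_HB[OF smp_based(2)[OF assms] smp_HB[OF assms k]] by simp
qed

lemma rank_bsum: assumes b: "is_based M" "is_based N" shows "rank (bsum M N) = rank M + rank N"
proof -
  obtain m n \<kappa> where k: "HB M m n \<kappa>" using is_based_HB_E[OF b(1)] by metis
  obtain p r \<mu> where mu: "HB N p r \<mu>" using is_based_HB_E[OF b(2)] by metis
  show ?thesis
    using rank_HB[OF b(1) k] rank_HB[OF b(2) mu] rank_HB[OF is_based_bsum[OF b] HB_bsum[OF b k mu]] by simp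
qed

text \<open>The free part of \<kappa> is absorbed into the module \<open>std m\<close>. Compared
  with the frame given by \<open>HB_bsum\<close> the two copies of Lambda^m have exchanged roles,
  and their swap has no torsion.\<close>

lemma HB_bsum_std:
  assumes b: "is_based V" and k: "HB V m n \<kappa>"
  shows "HB (bsum V (std m)) m (n + m) (fsum n \<kappa> (\<lambda>v. v))"
proof -
  let ?j = "\<lambda>u :: 'b \<times> (nat \<Rightarrow> 'a). ((fst u, sh m (snd u)), tr m (snd u))"
  have kc: "snd (\<kappa> (tr n v)) \<in> carrier (Fm m)" for v using sframe_closed[OF HB_sframe[OF k] tr_F] by blast
  have j: "liso (msum V (Fm (m + m))) (msum (bsum V (std m)) (Fm m)) ?j"
    by (rule lisoI[of _ _ _ "\<lambda>u. (fst (fst u), jn m (snd u) (snd (fst u)))"])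
      (auto simp: lin_def tsj fun_eq_iff bsum_def std_def)
  have f: "feq (msum V (Fm (m + m))) (n + m) (st m n \<kappa>) (\<lambda>v. map_prod (\<lambda>x. x) (bsw m m) (st m n \<kappa> v))"
    using sframe_st[OF HB_sframe[OF k]] zs_bsw by (intro feq_twist) (auto simp: sframe_def)
  note h = HB_bsum[OF b is_based_std k HB_std, of m]
  have "feq (msum (bsum V (std m)) (Fm m)) (n + m) (ssum m n \<kappa> (\<lambda>v. (v, \<lambda>_. 0))) (fsum n \<kappa> (\<lambda>v. v))"
  proof (rule feq_cong[OF feq_transport[OF f j]])
    fix v
    have e: "tr m (jn m (snd (\<kappa> (tr n v))) w) = snd (\<kappa> (tr n v))" for w by (rule tr_jn[OF kc])
    have e': "jn m (snd (\<kappa> (tr n v))) (\<lambda>_. 0) = snd (\<kappa> (tr n v))" using kc[of v] by (auto simp: jn_def)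
    show "?j (st m n \<kappa> v) = ssum m n \<kappa> (\<lambda>v. (v, \<lambda>_. 0)) v" by (simp add: st_def ssum_def e e')
    assume "v \<in> carrier (Fm (n + m))"
    then have "tr m (sh n v) = sh n v" by (auto simp: tsj)
    then have "tr m (jn m (sh n v) w) = sh n v" for w by (metis tr_jn_tr)
    then show "?j (map_prod (\<lambda>x. x) (bsw m m) (st m n \<kappa> v)) = fsum n \<kappa> (\<lambda>v. v) v"
      by (simp add: st_def fsum_def bsw_def e)
  qed
  then show ?thesis
    using HB_feq[OF is_based_bsum[OF b is_based_std] h] by simp
qed

text \<open>Equal ranks allow frames \<kappa> and \<mu> of the same size \<open>m\<close>,
  \<open>n\<close>. Then \<mu> after the inverse of \<kappa> is an isomorphism once the free summand
  is part of the module, and it matches distinguished frames.\<close>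

lemma rank_eq_stably_simple:
  assumes b: "is_based V" "is_based W" and r: "rank V = rank W"
  obtains k g where "smp (bsum V (std k)) (bsum W (std k)) g"
proof -
  obtain m1 n1 \<kappa>1 where k1: "HB V m1 n1 \<kappa>1" using is_based_HB_E[OF b(1)] by metis
  obtain m2 n2 \<kappa>2 where k2: "HB W m2 n2 \<kappa>2" using is_based_HB_E[OF b(2)] by metis
  define m n where "m = m1 + m2" and "n = n1 + m2"
  have e: "n = n2 + m1" using r rank_HB[OF b(1) k1] rank_HB[OF b(2) k2] by (simp add: n_def)
  obtain \<kappa> \<mu> where k: "HB V m n \<kappa>" and mu: "HB W m n \<mu>"
    using HB_st[OF b(1) k1, of m2] HB_st[OF b(2) k2, of m1] e by (auto simp: m_def n_def add.commute)
  note kl = HB_sframe[OF k, unfolded sframe_def] and ml = HB_sframe[OF mu, unfolded sframe_def]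
  let ?g = "\<lambda>u. \<mu> (inv_into (carrier (Fm n)) \<kappa> u)"
  have "smp (bsum V (std m)) (bsum W (std m)) ?g"
  proof (rule smpI[OF _ _ HB_bsum_std[OF b(1) k] _ HB_bsum_std[OF b(2) mu]])
    show "liso (bsum V (std m)) (bsum W (std m)) ?g"
      using liso_comp[OF liso_inv[OF left_module_free kl] ml] by (simp add: bsum_def std_def)
  qed (use b liso_inv_into(3)[OF kl tr_F] in \<open>auto simp: fsum_def\<close>)
  then show ?thesis by (rule that)
qed

subsection \<open>Duals and perfect pairings\<close>

text \<open>Sesquilinear pairings, conjugate linear in the first argument.\<close>

definition pr :: "('a, 'm, 'y) module_scheme \<Rightarrow> ('a, 'n, 'z) module_scheme \<Rightarrow> ('m \<Rightarrow> 'n \<Rightarrow> 'a) \<Rightarrow> bool" where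
  "pr D K \<beta> \<longleftrightarrow> (\<forall>x\<in>carrier D. \<forall>x'\<in>carrier D. \<forall>y\<in>carrier K. \<beta> (x \<oplus>\<^bsub>D\<^esub> x') y = \<beta> x y + \<beta> x' y) \<and>
     (\<forall>x\<in>carrier D. \<forall>y\<in>carrier K. \<forall>y'\<in>carrier K. \<beta> x (y \<oplus>\<^bsub>K\<^esub> y') = \<beta> x y + \<beta> x y') \<and>
     (\<forall>a. \<forall>x\<in>carrier D. \<forall>y\<in>carrier K. \<beta> (a \<odot>\<^bsub>D\<^esub> x) y = \<beta> x y * bar a) \<and>
     (\<forall>a. \<forall>x\<in>carrier D. \<forall>y\<in>carrier K. \<beta> x (a \<odot>\<^bsub>K\<^esub> y) = a * \<beta> x y)"

lemma prI:
  assumes "\<And>x x' y. x \<in> carrier D \<Longrightarrow> x' \<in> carrier D \<Longrightarrow> y \<in> carrier K \<Longrightarrow> \<beta> (x \<oplus>\<^bsub>D\<^esub> x') y = \<beta> x y + \<beta> x' y"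
    "\<And>x y y'. x \<in> carrier D \<Longrightarrow> y \<in> carrier K \<Longrightarrow> y' \<in> carrier K \<Longrightarrow> \<beta> x (y \<oplus>\<^bsub>K\<^esub> y') = \<beta> x y + \<beta> x y'"
    "\<And>a x y. x \<in> carrier D \<Longrightarrow> y \<in> carrier K \<Longrightarrow> \<beta> (a \<odot>\<^bsub>D\<^esub> x) y = \<beta> x y * bar a"
    "\<And>a x y. x \<in> carrier D \<Longrightarrow> y \<in> carrier K \<Longrightarrow> \<beta> x (a \<odot>\<^bsub>K\<^esub> y) = a * \<beta> x y"
  shows "pr D K \<beta>"
  unfolding pr_def using assms by blast

lemma pr_add1: "pr D K \<beta> \<Longrightarrow> x \<in> carrier D \<Longrightarrow> x' \<in> carrier D \<Longrightarrow> y \<in> carrier K \<Longrightarrow> \<beta> (x \<oplus>\<^bsub>D\<^esub> x') y = \<beta> x y + \<beta> x' y"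
  and pr_add2: "pr D K \<beta> \<Longrightarrow> x \<in> carrier D \<Longrightarrow> y \<in> carrier K \<Longrightarrow> y' \<in> carrier K \<Longrightarrow> \<beta> x (y \<oplus>\<^bsub>K\<^esub> y') = \<beta> x y + \<beta> x y'"
  and pr_smult1: "pr D K \<beta> \<Longrightarrow> x \<in> carrier D \<Longrightarrow> y \<in> carrier K \<Longrightarrow> \<beta> (a \<odot>\<^bsub>D\<^esub> x) y = \<beta> x y * bar a"
  and pr_smult2: "pr D K \<beta> \<Longrightarrow> x \<in> carrier D \<Longrightarrow> y \<in> carrier K \<Longrightarrow> \<beta> x (a \<odot>\<^bsub>K\<^esub> y) = a * \<beta> x y"
  by (simp_all add: pr_def)

lemmas pr_rules = pr_add1 pr_add2 pr_smult1 pr_smult2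

lemma pr_comp: "pr D K \<beta> \<Longrightarrow> lin D' D f \<Longrightarrow> lin K' K g \<Longrightarrow> pr D' K' (\<lambda>x y. \<beta> (f x) (g y))"
  by (simp add: pr_def lin_def)

lemma pr_flip: "pr D K \<beta> \<Longrightarrow> pr K D (\<lambda>x y. bar (\<beta> y x))"
  by (simp add: pr_def)

lemma pr_zero:
  assumes "left_module D" "left_module K" "pr D K \<beta>"
  shows "x \<in> carrier D \<Longrightarrow> \<beta> x \<zero>\<^bsub>K\<^esub> = 0" "y \<in> carrier K \<Longrightarrow> \<beta> \<zero>\<^bsub>D\<^esub> y = 0"
  using pr_smult2[OF assms(3), of x "\<zero>\<^bsub>K\<^esub>" 0] pr_smult1[OF assms(3), of "\<zero>\<^bsub>D\<^esub>" y 0] assms(1,2) by simp_all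

lemma dual_module_simps [simp]:
  "carrier (dual_module M) = mhom M ring_module"
  "\<zero>\<^bsub>dual_module M\<^esub> = (\<lambda>x\<in>carrier M. 0)"
  "f \<oplus>\<^bsub>dual_module M\<^esub> g = (\<lambda>x\<in>carrier M. f x + g x)"
  "a \<odot>\<^bsub>dual_module M\<^esub> f = (\<lambda>x\<in>carrier M. f x * bar a)"
  by (simp_all add: dual_module_def)

lemma dual_simps [simp]:
  "carrier (dual M) = mhom M ring_module"
  "\<zero>\<^bsub>dual M\<^esub> = (\<lambda>x\<in>carrier M. 0)"
  "f \<oplus>\<^bsub>dual M\<^esub> g = (\<lambda>x\<in>carrier M. f x + g x)"
  "a \<odot>\<^bsub>dual M\<^esub> f = (\<lambda>x\<in>carrier M. f x * bar a)"
  by (simp_all add: dual_def)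

lemma dual_like: "sframe (dual M) = sframe (dual_module M)" "s_class (dual M) = s_class (dual_module M)"
  "lin (dual M) N = lin (dual_module M) N" "lin N (dual M) = lin N (dual_module M)"
  "liso (dual M) N = liso (dual_module M) N" "liso N (dual M) = liso N (dual_module M)"
  by (simp_all add: dual_def)

lemma mhom_ring_lin: "f \<in> mhom M ring_module \<Longrightarrow> lin M ring_module f"
  by (rule mhom_lin)

lemma mhom_ext: "f \<in> mhom M N \<Longrightarrow> g \<in> mhom M N \<Longrightarrow> (\<And>x. x \<in> carrier M \<Longrightarrow> f x = g x) \<Longrightarrow> f = g"
  unfolding mhom_def by (auto intro: PiE_ext)

lemma mhom_restrict: "f \<in> mhom M N \<Longrightarrow> restrict f (carrier M) = f"
  unfolding mhom_def by (auto intro: PiE_restrict)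

lemma left_module_dual_module [simp]: "left_module M \<Longrightarrow> left_module (dual_module M)"
proof (rule left_moduleI)
  assume M: "left_module M"
  note r = restrict_mhom[OF M, of _ ring_module]
  fix f g assume f: "f \<in> carrier (dual_module M)" and g: "g \<in> carrier (dual_module M)"
  show "f \<oplus>\<^bsub>dual_module M\<^esub> g \<in> carrier (dual_module M)"
    using mhom_lin[OF f[simplified]] mhom_lin[OF g[simplified]] by (simp add: r lin_def algebra_simps)
  show "a \<odot>\<^bsub>dual_module M\<^esub> f \<in> carrier (dual_module M)" for a
    using mhom_lin[OF f[simplified]] by (simp add: r lin_def algebra_simps)
next
  assume M: "left_module M"
  show "\<zero>\<^bsub>dual_module M\<^esub> \<in> carrier (dual_module M)"
    using restrict_mhom[OF M, of "\<lambda>_. 0" ring_module] by (simp add: lin_def)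
qed (auto simp: fun_eq_iff restrict_def mhom_def PiE_def extensional_def algebra_simps)

lemma lin_dual_map:
  assumes M: "left_module D" "left_module K" and b: "pr D K \<beta>"
  shows "lin D (dual_module K) (\<lambda>d. \<lambda>k\<in>carrier K. \<beta> d k)"
proof (rule linI)
  show "(\<lambda>k\<in>carrier K. \<beta> d k) \<in> carrier (dual_module K)" if "d \<in> carrier D" for d
    using that by (simp add: restrict_mhom[OF M(2)] lin_def pr_rules[OF b])
qed (auto simp: pr_rules[OF b] restrict_def)

lemma pr_eval: "pr (dual_module K) K (\<lambda>f x. f x)"
  by (rule prI) (simp_all add: lin_add[OF mhom_ring_lin, simplified] lin_smult[OF mhom_ring_lin, simplified])

section \<open>The standard pairing and dual frames\<close>

definition ip :: "nat \<Rightarrow> (nat \<Rightarrow> 'a) \<Rightarrow> (nat \<Rightarrow> 'a) \<Rightarrow> 'a" where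
  "ip n v c = (\<Sum>i<n. c i * bar (v i))"

lemma pr_ip: "pr (Fm n) (Fm n) (ip n)"
  by (rule prI) (simp_all add: ip_def algebra_simps sum.distrib sum_distrib_left sum_distrib_right)

lemma bar_ip: "bar (ip n v c) = ip n c v"
  by (simp add: ip_def bar_sum)

lemma ip_unit: "i < n \<Longrightarrow> ip n (unit_vec i) c = c i" "i < n \<Longrightarrow> ip n v (unit_vec i) = bar (v i)"
  by (simp_all add: ip_def unit_vec_def if_distrib[of bar] if_distrib[of "\<lambda>x. x * _"] if_distrib[of "\<lambda>x. _ * x"] cong: if_cong)

lemma ip_nondeg:
  assumes v: "v \<in> carrier (Fm n)" "w \<in> carrier (Fm n)" and e: "\<And>c. c \<in> carrier (Fm n) \<Longrightarrow> ip n v c = ip n w c"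
  shows "v = w"
proof
  fix i show "v i = w i"
  proof (cases "i < n")
    case True
    then have "bar (v i) = bar (w i)" using e[OF unit_vec_F[OF True]] ip_unit(2)[of i n] by simp
    then show ?thesis by (metis bar_bar)
  qed (use v in simp)
qed

lemma sum_split: "(\<Sum>i<n + m. f i) = (\<Sum>i<n. f i) + (\<Sum>i<m. f (i + n))" for f :: "nat \<Rightarrow> 'b::comm_monoid_add"
  by (induction m) (simp_all add: algebra_simps)

lemma ip_split: "ip (n + m) v c = ip n (tr n v) (tr n c) + ip m (sh n v) (sh n c)"
  by (simp add: ip_def sum_split tr_def sh_def)

lemma ip_jn: "ip (n + m) (jn n v w) (jn n v' w') = ip n v v' + ip m w w'"
  by (simp add: ip_def sum_split jn_def)

text \<open>The standard pairing is added on the free summand, so that duality of frames can be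
  stated for stabilised modules.\<close>

definition xp :: "nat \<Rightarrow> ('m \<Rightarrow> 'n \<Rightarrow> 'a) \<Rightarrow> 'm \<times> (nat \<Rightarrow> 'a) \<Rightarrow> 'n \<times> (nat \<Rightarrow> 'a) \<Rightarrow> 'a" where
  "xp m \<beta> u w = \<beta> (fst u) (fst w) + ip m (snd u) (snd w)"

lemma pr_xp: "pr D K \<beta> \<Longrightarrow> pr (msum D (Fm m)) (msum K (Fm m)) (xp m \<beta>)"
  using pr_ip[of m] by (simp add: pr_def xp_def algebra_simps)

text \<open>Dual bases: in the coordinates given by the two frames the pairing is the standard
  one.\<close>

definition dframes :: "('m \<Rightarrow> 'n \<Rightarrow> 'a) \<Rightarrow> nat \<Rightarrow> nat \<Rightarrow> ((nat \<Rightarrow> 'a) \<Rightarrow> 'm \<times> (nat \<Rightarrow> 'a)) \<Rightarrow> ((nat \<Rightarrow> 'a) \<Rightarrow> 'n \<times> (nat \<Rightarrow> 'a)) \<Rightarrow> bool" where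
  "dframes \<beta> m n \<kappa> \<mu> \<longleftrightarrow> (\<forall>v\<in>carrier (Fm n). \<forall>c\<in>carrier (Fm n). xp m \<beta> (\<kappa> v) (\<mu> c) = ip n v c)"

lemma dframesD: "dframes \<beta> m n \<kappa> \<mu> \<Longrightarrow> v \<in> carrier (Fm n) \<Longrightarrow> c \<in> carrier (Fm n) \<Longrightarrow> xp m \<beta> (\<kappa> v) (\<mu> c) = ip n v c"
  by (simp only: dframes_def)

lemma dframesI: "(\<And>v c. v \<in> carrier (Fm n) \<Longrightarrow> c \<in> carrier (Fm n) \<Longrightarrow> xp m \<beta> (\<kappa> v) (\<mu> c) = ip n v c) \<Longrightarrow> dframes \<beta> m n \<kappa> \<mu>"
  unfolding dframes_def by blast

lemma dframes_st: "dframes \<beta> m n \<kappa> \<mu> \<Longrightarrow> dframes \<beta> (m + j) (n + j) (st m n \<kappa>) (st m n \<mu>)"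
proof (rule dframesI)
  fix v c :: "nat \<Rightarrow> 'a" assume d: "dframes \<beta> m n \<kappa> \<mu>"
  show "xp (m + j) \<beta> (st m n \<kappa> v) (st m n \<mu> c) = ip (n + j) v c"
    using dframesD[OF d tr_F tr_F, of v c] unfolding xp_def st_def fst_conv snd_conv ip_jn unfolding ip_split
    by (simp add: add.assoc[symmetric])
qed

text \<open>The dual frame: \<open>v\<close> becomes the functional that pairs coordinates with
  \<open>v\<close>. The \<open>bar\<close> in the free part comes from the identification of a free
  module with its dual made in \<open>dual_sbasis\<close>.\<close>

definition dfr :: "('a, 'm, 'z) module_scheme \<Rightarrow> nat \<Rightarrow> nat \<Rightarrow> ((nat \<Rightarrow> 'a) \<Rightarrow> 'm \<times> (nat \<Rightarrow> 'a)) \<Rightarrow> (nat \<Rightarrow> 'a) \<Rightarrow> ('m \<Rightarrow> 'a) \<times> (nat \<Rightarrow> 'a)" where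
  "dfr K m n \<mu> v = (\<lambda>x\<in>carrier K. ip n v (inv_into (carrier (Fm n)) \<mu> (x, \<lambda>_. 0)),
     \<lambda>j. if j < m then bar (ip n v (inv_into (carrier (Fm n)) \<mu> (\<zero>\<^bsub>K\<^esub>, unit_vec j))) else 0)"

lemma dfr_dframes:
  assumes K: "left_module K" and k: "sframe K m n \<mu>"
  shows "dframes (\<lambda>f x. f x) m n (dfr K m n \<mu>) \<mu>"
proof (rule dframesI)
  fix v c :: "nat \<Rightarrow> 'a" assume v: "v \<in> carrier (Fm n)" and c: "c \<in> carrier (Fm n)"
  note kl = k[unfolded sframe_def]
  let ?i = "inv_into (carrier (Fm n)) \<mu>"
  have i: "lin (msum K (Fm m)) (Fm n) ?i" by (rule liso_lin[OF liso_inv[OF left_module_free kl]])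
  have F: "lin (msum K (Fm m)) ring_module (\<lambda>u. ip n v (?i u))"
    by (rule lin_comp[OF i]) (use v in \<open>simp add: lin_def pr_rules[OF pr_ip, simplified]\<close>)
  have F2: "lin (Fm m) ring_module (\<lambda>w. ip n v (?i (\<zero>\<^bsub>K\<^esub>, w)))"
    by (rule lin_comp[OF _ F, of "Fm m" "\<lambda>w. (\<zero>\<^bsub>K\<^esub>, w)"]) (use K in \<open>simp add: lin_def\<close>)
  obtain x w where xw: "\<mu> c = (x, w)" by fastforce
  have x: "x \<in> carrier K" and w: "w \<in> carrier (Fm m)" using sframe_closed[OF k c] xw by simp_all
  have "ip n v c = ip n v (?i (\<mu> c))" by (simp only: liso_inv_into(3)[OF kl c])
  also have "\<mu> c = (x, \<lambda>_. 0) \<oplus>\<^bsub>msum K (Fm m)\<^esub> (\<zero>\<^bsub>K\<^esub>, w)" using x K by (simp add: xw)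
  also have "ip n v (?i \<dots>) = ip n v (?i (x, \<lambda>_. 0)) + ip n v (?i (\<zero>\<^bsub>K\<^esub>, w))"
    by (subst lin_add[OF F]) (use x w K in auto)
  also have "ip n v (?i (\<zero>\<^bsub>K\<^esub>, w)) = (\<Sum>j<m. w j * ip n v (?i (\<zero>\<^bsub>K\<^esub>, unit_vec j)))"
    by (rule lin_F_ring[OF F2 w])
  finally show "xp m (\<lambda>f x. f x) (dfr K m n \<mu> v) (\<mu> c) = ip n v c"
    using x by (simp add: xw xp_def dfr_def ip_def[of m])
qed

text \<open>Identities between dual frames are proved by pairing both sides with a frame of
  \<open>K\<close>, which avoids unfolding \<open>dfr\<close>.\<close>

lemma eval_nondeg:
  assumes K: "left_module K" and k: "sframe K m n \<mu>"
    and u: "u \<in> carrier (msum (dual_module K) (Fm m))" "u' \<in> carrier (msum (dual_module K) (Fm m))"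
    and e: "\<And>c. c \<in> carrier (Fm n) \<Longrightarrow> xp m (\<lambda>f x. f x) u (\<mu> c) = xp m (\<lambda>f x. f x) u' (\<mu> c)"
  shows "u = u'"
proof -
  note kl = k[unfolded sframe_def]
  have e': "xp m (\<lambda>f x. f x) u w = xp m (\<lambda>f x. f x) u' w" if "w \<in> carrier (msum K (Fm m))" for w
    using e[OF liso_inv_into(1)[OF kl that]] liso_inv_into(2)[OF kl that] by simp
  have c: "fst u \<in> mhom K ring_module" "snd u \<in> carrier (Fm m)" "fst u' \<in> mhom K ring_module" "snd u' \<in> carrier (Fm m)"
    using u by (auto simp: mem_Times_iff)
  have "fst u = fst u'"
  proof (rule mhom_ext[OF c(1,3)])
    fix x assume "x \<in> carrier K"
    then show "fst u x = fst u' x" using e'[of "(x, \<lambda>_. 0)"] by (simp add: xp_def ip_def)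
  qed
  moreover have "snd u = snd u'"
  proof (rule ip_nondeg[OF c(2,4)])
    fix w :: "nat \<Rightarrow> 'a" assume "w \<in> carrier (Fm m)"
    then show "ip m (snd u) w = ip m (snd u') w"
      using e'[of "(\<zero>\<^bsub>K\<^esub>, w)"] K calculation by (simp add: xp_def)
  qed
  ultimately show ?thesis by (simp add: prod_eq_iff)
qed

lemma sframe_dfr:
  assumes K: "left_module K" and k: "sframe K m n \<mu>"
  shows "sframe (dual_module K) m n (dfr K m n \<mu>)"
proof -
  note kl = k[unfolded sframe_def] and d = dframesD[OF dfr_dframes[OF K k]]
  let ?i = "inv_into (carrier (Fm n)) \<mu>"
  have i: "lin (msum K (Fm m)) (Fm n) ?i" by (rule liso_lin[OF liso_inv[OF left_module_free kl]])
  have ic: "?i (x, \<lambda>_. 0) \<in> carrier (Fm n)" if "x \<in> carrier K" for x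
    using that by (intro lin_closed[OF i]) simp
  let ?h = "\<lambda>u w. xp m (\<lambda>f x. f x) u (\<mu> w)"
  \<comment> \<open>The coordinates of a functional are its values on the frame vectors, conjugated
    because the pairing is conjugate linear on the left.\<close>
  let ?g = "\<lambda>u i. if i < n then bar (?h u (unit_vec i)) else 0"
  have gF: "?g u \<in> carrier (Fm n)" for u by simp
  have hl: "lin (Fm n) ring_module (?h u)" if "u \<in> carrier (msum (dual_module K) (Fm m))" for u
    by (rule lin_comp[OF liso_lin[OF kl]]) (use that in \<open>simp add: lin_def pr_rules[OF pr_xp[OF pr_eval], simplified]\<close>)
  have gh: "ip n (?g u) c = ?h u c" if "u \<in> carrier (msum (dual_module K) (Fm m))" "c \<in> carrier (Fm n)" for u c
    by (subst lin_F_ring[OF hl[OF that(1)] that(2)]) (simp add: ip_def)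
  have cl: "dfr K m n \<mu> v \<in> carrier (msum (dual_module K) (Fm m))" if v: "v \<in> carrier (Fm n)" for v
  proof -
    have "lin K ring_module (\<lambda>x. ip n v (?i (x, \<lambda>_. 0)))"
    proof (rule lin_comp[OF lin_comp[OF _ i]])
      show "lin K (msum K (Fm m)) (\<lambda>x. (x, \<lambda>_. 0))" by (simp add: lin_def)
      show "lin (Fm n) ring_module (ip n v)" using v by (simp add: lin_def pr_rules[OF pr_ip, simplified])
    qed
    then show ?thesis by (simp add: dfr_def restrict_mhom[OF K])
  qed
  show ?thesis unfolding sframe_def
  proof (rule lisoI[of _ _ _ ?g])
    show "lin (Fm n) (msum (dual_module K) (Fm m)) (dfr K m n \<mu>)"
      by (rule linI[OF cl], assumption) (auto simp: dfr_def fun_eq_iff restrict_def ip_def bar_sum algebra_simps sum.distrib sum_distrib_left sum_distrib_right)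
    show "?g u \<in> carrier (Fm n)" for u by (rule gF)
    fix v :: "nat \<Rightarrow> 'a" assume v: "v \<in> carrier (Fm n)"
    show "?g (dfr K m n \<mu> v) = v"
      by (rule ip_nondeg[OF gF v]) (simp only: gh[OF cl[OF v]] d[OF v])
  next
    fix u assume u: "u \<in> carrier (msum (dual_module K) (Fm m))"
    show "dfr K m n \<mu> (?g u) = u"
      by (rule eval_nondeg[OF K k cl[OF gF] u]) (simp only: d[OF gF] gh[OF u])
  qed
qed

lemma dual_sbasis_sb:
  assumes K: "left_module K" and k: "sframe K m n \<mu>"
  shows "dual_sbasis K (sb m n \<mu>) = sb m n (dfr K m n \<mu>)"
proof -
  note kl = k[unfolded sframe_def]
  note c = coords_frame_list[OF left_module_msum[OF K left_module_free] kl]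
  have c1: "coords (msum K (Fm m)) (frame_list n \<mu>) (x, \<lambda>j. 0) = inv_into (carrier (Fm n)) \<mu> (x, \<lambda>j. 0)" if "x \<in> carrier K" for x
    by (rule c) (use that in simp)
  have c2: "coords (msum K (Fm m)) (frame_list n \<mu>) (\<zero>\<^bsub>K\<^esub>, unit_vec j) = inv_into (carrier (Fm n)) \<mu> (\<zero>\<^bsub>K\<^esub>, unit_vec j)" if "j < m" for j
    by (rule c) (use that K unit_vec_F[of j m] in simp)
  have "(\<lambda>x\<in>carrier K. coords (msum K (Fm m)) (frame_list n \<mu>) (x, \<lambda>j. 0) i,
         \<lambda>j. if j < m then bar (coords (msum K (Fm m)) (frame_list n \<mu>) (\<zero>\<^bsub>K\<^esub>, unit_vec j) i) else 0)
       = dfr K m n \<mu> (unit_vec i)" if "i < n" for i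
    using that by (auto simp: dfr_def ip_unit c1 c2 fun_eq_iff restrict_def)
  moreover have "frame_list n (dfr K m n \<mu>) = map (\<lambda>i. dfr K m n \<mu> (unit_vec i)) [0..<n]" "length (frame_list n \<mu>) = n"
    by (simp_all add: frame_list_def)
  ultimately show ?thesis
    unfolding dual_sbasis_def sb_def Let_def fst_conv snd_conv by simp
qed

text \<open>The adjoint with respect to \<open>ip\<close>; its matrix is the conjugate
  transpose.\<close>

definition adj :: "nat \<Rightarrow> ((nat \<Rightarrow> 'a) \<Rightarrow> nat \<Rightarrow> 'a) \<Rightarrow> (nat \<Rightarrow> 'a) \<Rightarrow> nat \<Rightarrow> 'a" where
  "adj n \<alpha> v = (\<lambda>i. if i < n then bar (ip n v (\<alpha> (unit_vec i))) else 0)"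

lemma adj_F: "adj n \<alpha> v \<in> carrier (Fm n)" by (simp add: adj_def)

lemma ip_adj:
  assumes a: "lin (Fm n) (Fm n) \<alpha>" and c: "c \<in> carrier (Fm n)" and v: "v \<in> carrier (Fm n)"
  shows "ip n (adj n \<alpha> v) c = ip n v (\<alpha> c)"
proof -
  have l: "lin (Fm n) ring_module (\<lambda>c. ip n v (\<alpha> c))"
    by (rule lin_comp[OF a]) (use v in \<open>simp add: lin_def pr_rules[OF pr_ip, simplified]\<close>)
  show ?thesis by (subst lin_F_ring[OF l c], unfold ip_def[of n "adj n \<alpha> v"]) (simp add: adj_def)
qed

text \<open>The invariance of \<open>Z\<close> under the involution enters here. Invertibility comes
  from nondegeneracy of \<open>ip\<close>: the adjoint of the inverse is inverse to the
  adjoint.\<close>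

lemma zs_adj: assumes z: "zs n \<alpha>" shows "zs n (adj n \<alpha>)"
proof -
  note l = zs_liso[OF z]
  let ?b = "inv_into (carrier (Fm n)) \<alpha>"
  note i = liso_inv_into[OF l]
  have b: "lin (Fm n) (Fm n) ?b" by (rule liso_lin[OF liso_inv[OF left_module_free l]])
  have la: "liso (Fm n) (Fm n) (adj n \<alpha>)"
  proof (rule lisoI[of _ _ _ "adj n ?b"])
    show "lin (Fm n) (Fm n) (adj n \<alpha>)"
      by (rule linI) (auto simp: adj_def ip_def fun_eq_iff sum.distrib algebra_simps sum_distrib_left sum_distrib_right bar_sum)
    show "adj n ?b v \<in> carrier (Fm n)" for v by (rule adj_F)
    fix v :: "nat \<Rightarrow> 'a" assume v: "v \<in> carrier (Fm n)"
    show "adj n ?b (adj n \<alpha> v) = v"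
    proof (rule ip_nondeg[OF adj_F v])
      fix c :: "nat \<Rightarrow> 'a" assume c: "c \<in> carrier (Fm n)"
      show "ip n (adj n ?b (adj n \<alpha> v)) c = ip n v c"
        by (simp only: ip_adj[OF b c adj_F] ip_adj[OF liso_lin[OF l] i(1)[OF c] v] i(2)[OF c])
    qed
    show "adj n \<alpha> (adj n ?b v) = v"
    proof (rule ip_nondeg[OF adj_F v])
      fix c :: "nat \<Rightarrow> 'a" assume c: "c \<in> carrier (Fm n)"
      show "ip n (adj n \<alpha> (adj n ?b v)) c = ip n v c"
        by (simp only: ip_adj[OF liso_lin[OF l] c adj_F] ip_adj[OF b liso_closed[OF l c] v] i(3)[OF c])
    qed
  qed
  have "mat n (adj n \<alpha>) = (\<lambda>i j. bar (mat n \<alpha> j i))"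
  proof (intro ext)
    fix i j
    have "\<alpha> (unit_vec j) i = 0" if "j < n" "\<not> i < n"
      using liso_closed[OF l unit_vec_F[OF that(1)]] that(2) by simp
    then show "mat n (adj n \<alpha>) i j = bar (mat n \<alpha> j i)"
      by (simp add: mat_def adj_def ip_unit) (auto simp: unit_vec_def)
  qed
  moreover have "represents_Z (\<lambda>i j. bar (mat n \<alpha> j i))"
    using z mat_GL[OF la] unfolding zs_def calculation by (intro represents_Z_star) simp_all
  ultimately show ?thesis using la by (simp add: zs_def)
qed

text \<open>Dualisation is contravariant: if \<mu>' is \<mu> after \<alpha>, the dual frame of \<mu>
  is that of \<mu>' after the adjoint of \<alpha>. Hence the reversed order in the
  conclusion.\<close>

lemma feq_dfr:
  assumes K: "left_module K" and f: "feq (msum K (Fm m)) n \<mu> \<mu>'"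
  shows "feq (msum (dual_module K) (Fm m)) n (dfr K m n \<mu>') (dfr K m n \<mu>)"
proof -
  obtain \<alpha> where a: "liso (Fm n) (msum K (Fm m)) \<mu>" "liso (Fm n) (msum K (Fm m)) \<mu>'" "zs n \<alpha>"
    "\<And>v. v \<in> carrier (Fm n) \<Longrightarrow> \<mu>' v = \<mu> (\<alpha> v)"
    by (rule feqE[OF f]) (iprover intro: that)
  note s = sframe_def[of K m n, symmetric]
  have k: "sframe K m n \<mu>" "sframe K m n \<mu>'" using a(1,2) by (simp_all add: s)
  note d = dframesD[OF dfr_dframes[OF K k(1)]] and d' = dframesD[OF dfr_dframes[OF K k(2)]]
  note l = sframe_dfr[OF K k(1), unfolded sframe_def] and l' = sframe_dfr[OF K k(2), unfolded sframe_def]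
  show ?thesis
  proof (rule feqI[OF l' zs_adj[OF a(3)]])
    fix v :: "nat \<Rightarrow> 'a" assume v: "v \<in> carrier (Fm n)"
    show "dfr K m n \<mu> v = dfr K m n \<mu>' (adj n \<alpha> v)"
    proof (rule eval_nondeg[OF K k(2) liso_closed[OF l v] liso_closed[OF l' adj_F]])
      fix c :: "nat \<Rightarrow> 'a" assume c: "c \<in> carrier (Fm n)"
      show "xp m (\<lambda>f x. f x) (dfr K m n \<mu> v) (\<mu>' c) = xp m (\<lambda>f x. f x) (dfr K m n \<mu>' (adj n \<alpha> v)) (\<mu>' c)"
        unfolding d'[OF adj_F c] ip_adj[OF liso_lin[OF zs_liso[OF a(3)]] c v]
        by (simp only: a(4)[OF c] d[OF v zs_closed[OF a(3) c]])
    qed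
  qed
qed

lemma dfr_st:
  assumes K: "left_module K" and k: "sframe K m n \<mu>" and v: "v \<in> carrier (Fm (n + j))"
  shows "dfr K (m + j) (n + j) (st m n \<mu>) v = st m n (dfr K m n \<mu>) v"
proof (rule eval_nondeg[OF K sframe_st[OF k, of j]])
  note ks = sframe_st[OF k, of j] and ds = sframe_st[OF sframe_dfr[OF K k], of j]
  show "dfr K (m + j) (n + j) (st m n \<mu>) v \<in> carrier (msum (dual_module K) (Fm (m + j)))"
    by (rule liso_closed[OF sframe_dfr[OF K ks, unfolded sframe_def] v])
  show "st m n (dfr K m n \<mu>) v \<in> carrier (msum (dual_module K) (Fm (m + j)))"
    by (rule liso_closed[OF ds[unfolded sframe_def] v])
  fix c :: "nat \<Rightarrow> 'a" assume c: "c \<in> carrier (Fm (n + j))"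
  show "xp (m + j) (\<lambda>f x. f x) (dfr K (m + j) (n + j) (st m n \<mu>) v) (st m n \<mu> c) =
    xp (m + j) (\<lambda>f x. f x) (st m n (dfr K m n \<mu>) v) (st m n \<mu> c)"
    by (simp only: dframesD[OF dfr_dframes[OF K ks] v c] dframesD[OF dframes_st[OF dfr_dframes[OF K k]] v c])
qed

lemma seq_dfr:
  assumes K: "left_module K" and s: "seq K m n \<mu> m' n' \<mu>'"
  shows "seq (dual_module K) m n (dfr K m n \<mu>) m' n' (dfr K m' n' \<mu>')"
proof -
  from s obtain j j' where j: "sframe K m n \<mu>" "sframe K m' n' \<mu>'" "m + j = m' + j'" "n + j = n' + j'"
    "feq (msum K (Fm (m + j))) (n + j) (st m n \<mu>) (st m' n' \<mu>')"
    unfolding seq_def by blast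
  have "feq (msum (dual_module K) (Fm (m + j))) (n + j) (dfr K (m + j) (n + j) (st m n \<mu>)) (dfr K (m + j) (n + j) (st m' n' \<mu>'))"
    by (rule feq_sym[OF feq_dfr[OF K j(5)]])
  then have "feq (msum (dual_module K) (Fm (m + j))) (n + j) (st m n (dfr K m n \<mu>)) (st m' n' (dfr K m' n' \<mu>'))"
    by (rule feq_cong) (rule dfr_st[OF K j(1)], assumption, unfold j(3,4), rule dfr_st[OF K j(2)])
  then show ?thesis by (rule seqI[OF sframe_dfr[OF K j(1)] sframe_dfr[OF K j(2)] j(3,4)])
qed

lemma dual_sbases:
  assumes K: "is_based K" and k: "HB K m n \<mu>"
  shows "sbases (dual K) = s_class (dual_module K) (sb m n (dfr K m n \<mu>))"
proof -
  have lm: "left_module K" using K by simp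
  have "s_class (dual_module K) (dual_sbasis K b) = s_class (dual_module K) (sb m n (dfr K m n \<mu>))"
    if b: "b \<in> sbases K" for b
  proof -
    obtain m' n' \<mu>' where k': "HB K m' n' \<mu>'" "b = sb m' n' \<mu>'" using sbases_E[OF K b] by metis
    have "seq K m n \<mu> m' n' \<mu>'" using HB_iff[OF K k] k'(1) by blast
    from s_class_eq[OF left_module_dual_module[OF lm] seq_dfr[OF lm this]] show ?thesis
      unfolding k'(2) dual_sbasis_sb[OF lm HB_sframe[OF k'(1)]] .
  qed
  moreover have "sbases K \<noteq> {}" using k by (auto simp: HB_def)
  ultimately show ?thesis by (auto simp: dual_def)
qed

lemma is_based_dual [simp]: assumes K: "is_based K" shows "is_based (dual K)"
proof -
  obtain m n \<mu> where k: "HB K m n \<mu>" using is_based_HB_E[OF K] by metis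
  show ?thesis
    by (rule is_basedI[of _ m n "dfr K m n \<mu>"])
      (use K sframe_dfr[OF _ HB_sframe[OF k]] dual_sbases[OF K k] in \<open>simp_all add: dual_like\<close>, simp add: dual_def)
qed

lemma HB_dual: assumes K: "is_based K" and k: "HB K m n \<mu>" shows "HB (dual K) m n (dfr K m n \<mu>)"
  by (rule HB_classI) (use K sframe_dfr[OF _ HB_sframe[OF k]] dual_sbases[OF K k] in \<open>simp_all add: dual_like\<close>)

lemma rank_dual: assumes K: "is_based K" shows "rank (dual K) = rank K"
proof -
  obtain m n \<mu> where k: "HB K m n \<mu>" using is_based_HB_E[OF K] by metis
  show ?thesis using rank_HB[OF K k] rank_HB[OF is_based_dual[OF K] HB_dual[OF K k]] by simp
qed

text \<open>Lets a based module \<open>D\<close> play the part of \<open>dual K\<close> while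
  staying in its own type; complementary Lagrangians are paired in this way.\<close>

definition perfect :: "('a, 'm) based_module \<Rightarrow> ('a, 'n) based_module \<Rightarrow> ('m \<Rightarrow> 'n \<Rightarrow> 'a) \<Rightarrow> bool" where
  "perfect D K \<beta> \<longleftrightarrow> is_based D \<and> is_based K \<and> pr D K \<beta> \<and> smp D (dual K) (\<lambda>d. \<lambda>k\<in>carrier K. \<beta> d k)"

lemma perfectD: "perfect D K \<beta> \<Longrightarrow> is_based D" "perfect D K \<beta> \<Longrightarrow> is_based K" "perfect D K \<beta> \<Longrightarrow> pr D K \<beta>"
  "perfect D K \<beta> \<Longrightarrow> smp D (dual K) (\<lambda>d. \<lambda>k\<in>carrier K. \<beta> d k)"
  by (auto simp: perfect_def)

lemma xp_dual_map:
  assumes "snd u \<in> carrier (Fm m)" "fst w \<in> carrier K"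
  shows "xp m (\<lambda>f x. f x) (map_prod (\<lambda>d. \<lambda>k\<in>carrier K. \<beta> d k) (\<lambda>x. x) u) w = xp m \<beta> u w"
  using assms by (simp add: xp_def)

lemma perfect_dframes:
  assumes p: "perfect D K \<beta>" and k: "HB K m n \<mu>"
  obtains \<kappa> where "HB D m n \<kappa>" "dframes \<beta> m n \<kappa> \<mu>"
proof -
  note b = perfectD[OF p]
  let ?f = "\<lambda>d. \<lambda>k\<in>carrier K. \<beta> d k"
  let ?g = "inv_into (carrier D) ?f"
  let ?k = "\<lambda>v. map_prod ?g (\<lambda>x. x) (dfr K m n \<mu> v)"
  have lm: "left_module K" using b by simp
  have h: "HB (dual K) m n (dfr K m n \<mu>)" by (rule HB_dual[OF b(2) k])
  have h': "HB D m n ?k" by (rule smp_HB[OF smp_inv[OF b(4)] h])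
  have "dframes \<beta> m n ?k \<mu>"
  proof (rule dframesI)
    fix v c :: "nat \<Rightarrow> 'a" assume v: "v \<in> carrier (Fm n)" and c: "c \<in> carrier (Fm n)"
    have "fst (dfr K m n \<mu> v) \<in> carrier (dual K)" using sframe_closed[OF HB_sframe[OF h] v] by blast
    from liso_inv_into(2)[OF smp_liso[OF b(4)] this]
    have "map_prod ?f (\<lambda>x. x) (?k v) = dfr K m n \<mu> v" by (simp add: prod_eq_iff)
    with xp_dual_map[of "?k v" m "\<mu> c" K \<beta>] sframe_closed[OF HB_sframe[OF k] c] sframe_closed[OF HB_sframe[OF h'] v]
    show "xp m \<beta> (?k v) (\<mu> c) = ip n v c"
      using dframesD[OF dfr_dframes[OF lm HB_sframe[OF k]] v c] by simp
  qed
  with h' show ?thesis by (rule that)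
qed

lemma liso_map_prod_cancel:
  assumes M: "left_module P" and f: "lin M N f" and l: "liso (msum M P) (msum N P) (map_prod f (\<lambda>x. x))"
  shows "liso M N f"
proof -
  have "inj_on f (carrier M)"
  proof (rule inj_onI)
    fix x y assume "x \<in> carrier M" "y \<in> carrier M" "f x = f y"
    then show "x = y" using liso_inj[OF l, of "(x, \<zero>\<^bsub>P\<^esub>)" "(y, \<zero>\<^bsub>P\<^esub>)"] M by simp
  qed
  moreover have "f ` carrier M = carrier N"
  proof (intro equalityI subsetI)
    fix y assume "y \<in> carrier N"
    then have "(y, \<zero>\<^bsub>P\<^esub>) \<in> map_prod f (\<lambda>x. x) ` carrier (msum M P)"
      using liso_bij[OF l] M by (simp add: bij_betw_def)
    then show "y \<in> f ` carrier M" by auto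
  qed (use lin_closed[OF f] in auto)
  ultimately show ?thesis using f by (simp add: liso_def bij_betw_def)
qed

text \<open>With \<open>perfect_dframes\<close> this describes perfect pairings by a pair of
  distinguished dual frames. That condition is symmetric up to \<open>bar\<close> and additive, so
  flips and sums follow without comparing double duals or duals of sums.\<close>

lemma perfectI_dframes:
  assumes D: "is_based D" and K: "is_based K" and b: "pr D K \<beta>"
    and k: "HB D m n \<kappa>" "HB K m n \<mu>" and d: "dframes \<beta> m n \<kappa> \<mu>"
  shows "perfect D K \<beta>"
proof -
  have lm: "left_module D" "left_module K" using D K by simp_all
  let ?f = "\<lambda>d. \<lambda>k\<in>carrier K. \<beta> d k"
  note h = HB_dual[OF K k(2)] and kl = HB_sframe[OF k(1), unfolded sframe_def]
  note dl = sframe_dfr[OF lm(2) HB_sframe[OF k(2)], unfolded sframe_def]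
  have fl: "lin D (dual_module K) ?f" by (rule lin_dual_map[OF lm b])
  have fml: "lin (msum D (Fm m)) (msum (dual_module K) (Fm m)) (map_prod ?f (\<lambda>x. x))"
    by (rule lin_map_prod[OF fl lin_id])
  have e: "map_prod ?f (\<lambda>x. x) (\<kappa> v) = dfr K m n \<mu> v" if v: "v \<in> carrier (Fm n)" for v
  proof (rule eval_nondeg[OF lm(2) HB_sframe[OF k(2)] lin_closed[OF fml liso_closed[OF kl v]] liso_closed[OF dl v]])
    fix c :: "nat \<Rightarrow> 'a" assume c: "c \<in> carrier (Fm n)"
    show "xp m (\<lambda>f x. f x) (map_prod ?f (\<lambda>x. x) (\<kappa> v)) (\<mu> c) = xp m (\<lambda>f x. f x) (dfr K m n \<mu> v) (\<mu> c)"
      unfolding dframesD[OF dfr_dframes[OF lm(2) HB_sframe[OF k(2)]] v c]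
      using sframe_closed[OF HB_sframe[OF k(1)] v] sframe_closed[OF HB_sframe[OF k(2)] c]
      by (subst xp_dual_map) (simp_all only: dframesD[OF d v c] simp_thms)
  qed
  let ?i = "inv_into (carrier (Fm n)) \<kappa>"
  have "liso (msum D (Fm m)) (msum (dual_module K) (Fm m)) (\<lambda>u. dfr K m n \<mu> (?i u))"
    by (rule liso_comp[OF liso_inv[OF left_module_free kl] dl])
  then have "liso (msum D (Fm m)) (msum (dual_module K) (Fm m)) (map_prod ?f (\<lambda>x. x))"
    by (rule liso_cong[OF left_module_msum[OF lm(1) left_module_free]])
      (simp only: e[OF liso_inv_into(1)[OF kl], symmetric] liso_inv_into(2)[OF kl])
  then have l: "liso D (dual K) ?f"
    unfolding dual_like by (rule liso_map_prod_cancel[OF left_module_free fl])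
  have "smp D (dual K) ?f"
    by (rule smpI[OF D is_based_dual[OF K] k(1) l h]) (use e in \<open>auto simp: prod_eq_iff\<close>)
  then show ?thesis using D K b by (simp add: perfect_def)
qed

lemma perfect_flip: assumes p: "perfect D K \<beta>" shows "perfect K D (\<lambda>x y. bar (\<beta> y x))"
proof -
  note b = perfectD[OF p]
  obtain m n \<mu> where k: "HB K m n \<mu>" using is_based_HB_E[OF b(2)] by metis
  obtain \<kappa> where d: "HB D m n \<kappa>" "dframes \<beta> m n \<kappa> \<mu>" by (rule perfect_dframes[OF p k])
  have "dframes (\<lambda>x y. bar (\<beta> y x)) m n \<mu> \<kappa>"
  proof (rule dframesI)
    fix v c :: "nat \<Rightarrow> 'a" assume v: "v \<in> carrier (Fm n)" and c: "c \<in> carrier (Fm n)"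
    have "xp m (\<lambda>x y. bar (\<beta> y x)) (\<mu> v) (\<kappa> c) = bar (xp m \<beta> (\<kappa> c) (\<mu> v))"
      by (simp add: xp_def bar_ip)
    then show "xp m (\<lambda>x y. bar (\<beta> y x)) (\<mu> v) (\<kappa> c) = ip n v c"
      by (simp only: dframesD[OF d(2) c v] bar_ip)
  qed
  then show ?thesis by (rule perfectI_dframes[OF b(2,1) pr_flip[OF b(3)] k d(1)])
qed

lemma pr_sum:
  "pr D K \<beta> \<Longrightarrow> pr D' K' \<beta>' \<Longrightarrow> pr (msum D D') (msum K K') (\<lambda>u w. \<beta> (fst u) (fst w) + \<beta>' (snd u) (snd w))"
  by (simp add: pr_def algebra_simps)

lemma pr_like: "pr (bsum D D') K = pr (msum D D') K" "pr K (bsum D D') = pr K (msum D D')"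
  "pr (dual D) K = pr (dual_module D) K" "pr K (dual D) = pr K (dual_module D)"
  by (simp_all add: pr_def fun_eq_iff)

lemma perfect_sum:
  assumes p: "perfect D K \<beta>" "perfect D' K' \<beta>'"
  shows "perfect (bsum D D') (bsum K K') (\<lambda>u w. \<beta> (fst u) (fst w) + \<beta>' (snd u) (snd w))"
proof -
  note b = perfectD[OF p(1)] and b' = perfectD[OF p(2)]
  obtain m n \<mu> where k: "HB K m n \<mu>" using is_based_HB_E[OF b(2)] by metis
  obtain \<kappa> where d: "HB D m n \<kappa>" "dframes \<beta> m n \<kappa> \<mu>" by (rule perfect_dframes[OF p(1) k])
  obtain m' n' \<mu>' where k': "HB K' m' n' \<mu>'" using is_based_HB_E[OF b'(2)] by metis
  obtain \<kappa>' where d': "HB D' m' n' \<kappa>'" "dframes \<beta>' m' n' \<kappa>' \<mu>'" by (rule perfect_dframes[OF p(2) k'])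
  show ?thesis
  proof (rule perfectI_dframes)
    show "HB (bsum D D') (m + m') (n + n') (ssum m n \<kappa> \<kappa>')" by (rule HB_bsum[OF b(1) b'(1) d(1) d'(1)])
    show "HB (bsum K K') (m + m') (n + n') (ssum m n \<mu> \<mu>')" by (rule HB_bsum[OF b(2) b'(2) k k'])
    show "dframes (\<lambda>u w. \<beta> (fst u) (fst w) + \<beta>' (snd u) (snd w)) (m + m') (n + n') (ssum m n \<kappa> \<kappa>') (ssum m n \<mu> \<mu>')"
    proof (rule dframesI)
      fix v c :: "nat \<Rightarrow> 'a" assume v: "v \<in> carrier (Fm (n + n'))" and c: "c \<in> carrier (Fm (n + n'))"
      note 1 = dframesD[OF d(2) tr_F tr_F, of v c, unfolded xp_def]
        and 2 = dframesD[OF d'(2) sh_F[OF v] sh_F[OF c], unfolded xp_def]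
      show "xp (m + m') (\<lambda>u w. \<beta> (fst u) (fst w) + \<beta>' (snd u) (snd w)) (ssum m n \<kappa> \<kappa>' v) (ssum m n \<mu> \<mu>' c) = ip (n + n') v c"
        unfolding xp_def ssum_def fst_conv snd_conv ip_jn unfolding ip_split 1[symmetric] 2[symmetric]
        by (simp only: add_ac)
    qed
  qed (use b b' pr_sum in \<open>auto simp: pr_like\<close>)
qed

lemma perfect_left:
  assumes p: "perfect D K \<beta>" and f: "smp D' D f"
  shows "perfect D' K (\<lambda>x y. \<beta> (f x) y)"
  unfolding perfect_def using smp_comp[OF f perfectD(4)[OF p]] smp_based[OF f] perfectD[OF p]
    pr_comp[OF perfectD(3)[OF p] smp_lin[OF f] lin_id] by simp

lemma perfect_right:
  assumes p: "perfect D K \<beta>" and f: "smp K' K f"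
  shows "perfect D K' (\<lambda>x y. \<beta> x (f y))"
  using perfect_flip[OF perfect_left[OF perfect_flip[OF p] f]] by simp

lemma perfect_cong:
  assumes p: "perfect D K \<beta>" and e: "\<And>x y. x \<in> carrier D \<Longrightarrow> y \<in> carrier K \<Longrightarrow> \<beta> x y = \<beta>' x y"
  shows "perfect D K \<beta>'"
proof -
  note b = perfectD[OF p]
  have lm: "left_module D" "left_module K" using b by simp_all
  have "pr D K \<beta>'" by (rule prI) (simp_all add: lm e[symmetric] pr_rules[OF b(3)])
  moreover have "smp D (dual K) (\<lambda>d. \<lambda>k\<in>carrier K. \<beta>' d k)"
    by (rule smp_cong[OF b(4)]) (use e in \<open>auto simp: restrict_def\<close>)
  ultimately show ?thesis using b by (simp add: perfect_def)
qed

lemma perfect_eval: assumes K: "is_based K" shows "perfect (dual K) K (\<lambda>f x. f x)"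
proof -
  have "smp (dual K) (dual K) (\<lambda>f. \<lambda>k\<in>carrier K. f k)"
    by (rule smp_cong[OF smp_id]) (use K in \<open>auto simp: mhom_restrict\<close>)
  then show ?thesis using K by (simp add: perfect_def pr_like pr_eval)
qed

lemma perfect_std: "perfect (std k) (std k) (ip k)"
proof (rule perfectI_dframes[OF _ _ _ HB_std HB_std])
  show "pr (std k) (std k) (ip k)" using pr_ip[of k] by (simp add: pr_def std_def)
qed (auto intro!: dframesI simp: xp_def ip_def[of 0])

subsection \<open>Quadratic forms in terms of representatives\<close>

lemma eps_cases: "eps = 1 \<or> eps = - 1"
  unfolding eps_def by (induction q) auto

lemma eps_eps [simp]: "eps * eps = 1" "eps * (eps * x) = x"
  using eps_cases by auto

lemma bar_eps [simp]: "bar eps = eps"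
  using eps_cases by auto

lemma eps_comm: "x * eps = eps * x"
  using eps_cases by auto

definition lam :: "('m \<Rightarrow> 'm \<Rightarrow> 'a) \<Rightarrow> 'm \<Rightarrow> 'm \<Rightarrow> 'a" where
  "lam \<phi> x y = \<phi> x y + eps * bar (\<phi> y x)"

definition asym :: "('m \<Rightarrow> 'm \<Rightarrow> 'a) \<Rightarrow> 'm \<Rightarrow> 'm \<Rightarrow> 'a" where
  "asym \<chi> x y = \<chi> x y - eps * bar (\<chi> y x)"

text \<open>Equality of classes in \<open>Q_eps M\<close>, expressed for representatives with
  arbitrary values outside the carrier.\<close>

definition qeq :: "('a, 'm, 'z) module_scheme \<Rightarrow> ('m \<Rightarrow> 'm \<Rightarrow> 'a) \<Rightarrow> ('m \<Rightarrow> 'm \<Rightarrow> 'a) \<Rightarrow> bool" where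
  "qeq M \<phi> \<psi> \<longleftrightarrow> (\<exists>\<chi>. pr M M \<chi> \<and> (\<forall>x\<in>carrier M. \<forall>y\<in>carrier M. \<phi> x y = asym \<chi> x y + \<psi> x y))"

definition ext2 :: "('a, 'm, 'z) module_scheme \<Rightarrow> ('m \<Rightarrow> 'm \<Rightarrow> 'a) \<Rightarrow> 'm \<Rightarrow> 'm \<Rightarrow> 'a" where
  "ext2 M \<phi> = (\<lambda>x\<in>carrier M. \<lambda>y\<in>carrier M. \<phi> x y)"

lemma ext2_apply [simp]: "x \<in> carrier M \<Longrightarrow> y \<in> carrier M \<Longrightarrow> ext2 M \<phi> x y = \<phi> x y"
  by (simp add: ext2_def)

lemma ext2_eq_iff: "ext2 M \<phi> = ext2 M \<psi> \<longleftrightarrow> (\<forall>x\<in>carrier M. \<forall>y\<in>carrier M. \<phi> x y = \<psi> x y)"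
  unfolding ext2_def by (auto simp: fun_eq_iff restrict_def)

definition Qc :: "('a, 'm, 'z) module_scheme \<Rightarrow> ('m \<Rightarrow> 'm \<Rightarrow> 'a) \<Rightarrow> ('m \<Rightarrow> 'm \<Rightarrow> 'a) set" where
  "Qc M \<phi> = Q_class M (ext2 M \<phi>)"

lemma qeqI: "pr M M \<chi> \<Longrightarrow> (\<And>x y. x \<in> carrier M \<Longrightarrow> y \<in> carrier M \<Longrightarrow> \<phi> x y = asym \<chi> x y + \<psi> x y) \<Longrightarrow> qeq M \<phi> \<psi>"
  unfolding qeq_def by blast

lemma qeqE:
  assumes "qeq M \<phi> \<psi>"
  obtains \<chi> where "pr M M \<chi>" "\<And>x y. x \<in> carrier M \<Longrightarrow> y \<in> carrier M \<Longrightarrow> \<phi> x y = asym \<chi> x y + \<psi> x y"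
  using assms unfolding qeq_def by metis

lemma pr_0: "pr D K (\<lambda>_ _. 0)" by (simp add: pr_def)
lemma pr_add: "pr D K \<beta> \<Longrightarrow> pr D K \<gamma> \<Longrightarrow> pr D K (\<lambda>x y. \<beta> x y + \<gamma> x y)"
  by (simp add: pr_def algebra_simps)
lemma pr_diff: "pr D K \<beta> \<Longrightarrow> pr D K \<gamma> \<Longrightarrow> pr D K (\<lambda>x y. \<beta> x y - \<gamma> x y)"
  by (simp add: pr_def algebra_simps)
lemma pr_minus: "pr D K \<beta> \<Longrightarrow> pr D K (\<lambda>x y. - \<beta> x y)"
  by (simp add: pr_def algebra_simps)
lemma pr_eps: "pr D K \<beta> \<Longrightarrow> pr D K (\<lambda>x y. eps * \<beta> x y)"
  using eps_cases by (auto simp: pr_minus)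
lemma pr_lam: "pr M M \<phi> \<Longrightarrow> pr M M (lam \<phi>)"
  unfolding lam_def[abs_def] by (intro pr_add pr_eps pr_flip)
lemma pr_asym: "pr M M \<phi> \<Longrightarrow> pr M M (asym \<phi>)"
  unfolding asym_def[abs_def] by (intro pr_diff pr_eps pr_flip)

lemma qeq_refl: "(\<And>x y. x \<in> carrier M \<Longrightarrow> y \<in> carrier M \<Longrightarrow> \<phi> x y = \<psi> x y) \<Longrightarrow> qeq M \<phi> \<psi>"
  by (rule qeqI[OF pr_0]) (simp add: asym_def)

lemma qeq_sym: assumes "qeq M \<phi> \<psi>" shows "qeq M \<psi> \<phi>"
  using assms by (rule qeqE) (rule qeqI[OF pr_minus], assumption, simp add: asym_def)

lemma qeq_add: assumes "qeq M \<phi> \<psi>" "qeq M \<phi>' \<psi>'" shows "qeq M (\<lambda>x y. \<phi> x y + \<phi>' x y) (\<lambda>x y. \<psi> x y + \<psi>' x y)"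
  using assms(1)
proof (rule qeqE)
  fix \<chi> assume c: "pr M M \<chi>" "\<And>x y. x \<in> carrier M \<Longrightarrow> y \<in> carrier M \<Longrightarrow> \<phi> x y = asym \<chi> x y + \<psi> x y"
  from assms(2) show ?thesis
  proof (rule qeqE)
    fix \<chi>' assume c': "pr M M \<chi>'" "\<And>x y. x \<in> carrier M \<Longrightarrow> y \<in> carrier M \<Longrightarrow> \<phi>' x y = asym \<chi>' x y + \<psi>' x y"
    show ?thesis
      by (rule qeqI[OF pr_add[OF c(1) c'(1)]], simp only: c(2) c'(2)) (simp add: asym_def algebra_simps)
  qed
qed

lemma qeq_minus: assumes "qeq M \<phi> \<psi>" shows "qeq M (\<lambda>x y. - \<phi> x y) (\<lambda>x y. - \<psi> x y)"
  using assms by (rule qeqE) (rule qeqI[OF pr_minus], assumption, simp add: asym_def)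

lemma qeq_trans: assumes "qeq M \<phi> \<psi>" "qeq M \<psi> \<omega>" shows "qeq M \<phi> \<omega>"
proof -
  \<comment> \<open>Transitivity from additivity: the two relations are added and the common form
    \<psi> is subtracted.\<close>
  have "qeq M (\<lambda>x y. \<phi> x y + \<psi> x y + - \<psi> x y) (\<lambda>x y. \<psi> x y + \<omega> x y + - \<psi> x y)"
    by (intro qeq_add assms qeq_refl) simp
  then show ?thesis by (simp add: algebra_simps)
qed

lemma qeq_pull: assumes "qeq N \<phi> \<psi>" "lin M N f" shows "qeq M (\<lambda>x y. \<phi> (f x) (f y)) (\<lambda>x y. \<psi> (f x) (f y))"
  using assms(1)
proof (rule qeqE)
  fix \<chi> assume c: "pr N N \<chi>" "\<And>x y. x \<in> carrier N \<Longrightarrow> y \<in> carrier N \<Longrightarrow> \<phi> x y = asym \<chi> x y + \<psi> x y"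
  show ?thesis
    by (rule qeqI[OF pr_comp[OF c(1) assms(2,2)]]) (simp add: c(2) lin_closed[OF assms(2)] asym_def)
qed

lemma qeq_cong:
  assumes "qeq M \<phi> \<psi>" "\<And>x y. x \<in> carrier M \<Longrightarrow> y \<in> carrier M \<Longrightarrow> \<phi> x y = \<phi>' x y"
    "\<And>x y. x \<in> carrier M \<Longrightarrow> y \<in> carrier M \<Longrightarrow> \<psi> x y = \<psi>' x y"
  shows "qeq M \<phi>' \<psi>'"
  using assms unfolding qeq_def by simp

text \<open>Symmetrisation annihilates \<open>asym \<chi>\<close>, because
  \<open>eps * eps = 1\<close> and \<open>eps\<close> is central.\<close>

lemma qeq_lam:
  assumes "qeq M \<phi> \<psi>" "x \<in> carrier M" "y \<in> carrier M" shows "lam \<phi> x y = lam \<psi> x y"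
  using assms(1)
proof (rule qeqE)
  fix \<chi> assume c: "\<And>x y. x \<in> carrier M \<Longrightarrow> y \<in> carrier M \<Longrightarrow> \<phi> x y = asym \<chi> x y + \<psi> x y"
  show ?thesis unfolding lam_def c[OF assms(2,3)] c[OF assms(3,2)]
    by (simp add: asym_def algebra_simps eps_comm)
qed

lemma mhom_dual_iff:
  assumes M: "left_module M" shows "ext2 M \<phi> \<in> mhom M (dual_module M) \<longleftrightarrow> pr M M \<phi>"
proof
  assume "pr M M \<phi>"
  from lin_dual_map[OF M M this] show "ext2 M \<phi> \<in> mhom M (dual_module M)"
    unfolding ext2_def restrict_mhom[OF M] .
next
  assume "ext2 M \<phi> \<in> mhom M (dual_module M)"
  then have l: "lin M (dual_module M) (\<lambda>x. \<lambda>y\<in>carrier M. \<phi> x y)"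
    unfolding ext2_def restrict_mhom[OF M] .
  have l2: "lin M ring_module (\<phi> x)" if "x \<in> carrier M" for x
    using lin_closed[OF l that] by (simp add: restrict_mhom[OF M])
  show "pr M M \<phi>"
  proof (rule prI)
    fix a x x' y assume x: "x \<in> carrier M" and x': "x' \<in> carrier M" and y: "y \<in> carrier M"
    show "\<phi> (x \<oplus>\<^bsub>M\<^esub> x') y = \<phi> x y + \<phi> x' y"
      using fun_cong[OF lin_add[OF l x x'], of y] y by simp
  next
    fix a x y assume x: "x \<in> carrier M" and y: "y \<in> carrier M"
    show "\<phi> (a \<odot>\<^bsub>M\<^esub> x) y = \<phi> x y * bar a"
      using fun_cong[OF lin_smult[OF l x, of a], of y] y by simp
    show "\<phi> x (a \<odot>\<^bsub>M\<^esub> y) = a * \<phi> x y" using lin_smult[OF l2[OF x] y] by simp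
  next
    fix x y y' assume x: "x \<in> carrier M" and y: "y \<in> carrier M" "y' \<in> carrier M"
    show "\<phi> x (y \<oplus>\<^bsub>M\<^esub> y') = \<phi> x y + \<phi> x y'" using lin_add[OF l2[OF x] y] by simp
  qed
qed

lemma mhom_dual_ext2:
  assumes "F \<in> mhom M (dual_module M)" shows "ext2 M F = F"
proof -
  have "ext2 M F = restrict F (carrier M)"
    unfolding ext2_def
    by (rule restrict_ext, rule mhom_restrict) (use lin_closed[OF mhom_lin[OF assms]] in simp)
  then show ?thesis using mhom_restrict[OF assms] by simp
qed

lemma mhom_dual_pr: "left_module M \<Longrightarrow> F \<in> mhom M (dual_module M) \<Longrightarrow> pr M M F"
  using mhom_dual_iff[of M F] mhom_dual_ext2[of F M] by simp

lemma Qc_mem: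
  assumes M: "left_module M" and p: "pr M M \<phi>"
  shows "F \<in> Qc M \<phi> \<longleftrightarrow> F \<in> mhom M (dual_module M) \<and> qeq M F \<phi>"
proof -
  have z: "Q_zero M = (\<lambda>\<chi>. ext2 M (asym \<chi>)) ` mhom M (dual_module M)"
    unfolding Q_zero_def by (rule image_cong) (auto simp: ext2_def T_eps_def asym_def restrict_def fun_eq_iff)
  have m: "h \<otimes>\<^bsub>hom_group M (dual_module M)\<^esub> ext2 M \<phi> = ext2 M (\<lambda>x y. h x y + \<phi> x y)" for h
    by (auto simp: hom_group_def ext2_def restrict_def fun_eq_iff)
  have "F \<in> Qc M \<phi> \<longleftrightarrow> (\<exists>\<chi>\<in>mhom M (dual_module M). F = ext2 M (\<lambda>x y. asym \<chi> x y + \<phi> x y))"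
    unfolding Qc_def Q_class_def r_coset_def z by (auto simp: m ext2_eq_iff)
  also have "\<dots> \<longleftrightarrow> F \<in> mhom M (dual_module M) \<and> qeq M F \<phi>"
  proof
    assume "\<exists>\<chi>\<in>mhom M (dual_module M). F = ext2 M (\<lambda>x y. asym \<chi> x y + \<phi> x y)"
    then obtain \<chi> where c: "pr M M \<chi>" "F = ext2 M (\<lambda>x y. asym \<chi> x y + \<phi> x y)"
      using mhom_dual_pr[OF M] by blast
    then show "F \<in> mhom M (dual_module M) \<and> qeq M F \<phi>"
      using mhom_dual_iff[OF M] pr_add[OF pr_asym[OF c(1)] p] by (auto intro: qeqI[OF c(1)])
  next
    assume f: "F \<in> mhom M (dual_module M) \<and> qeq M F \<phi>"
    then obtain \<chi> where c: "pr M M \<chi>" "\<And>x y. x \<in> carrier M \<Longrightarrow> y \<in> carrier M \<Longrightarrow> F x y = asym \<chi> x y + \<phi> x y"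
      by (auto elim: qeqE)
    have "F = ext2 M F" using f mhom_dual_ext2 by metis
    also have "\<dots> = ext2 M (\<lambda>x y. asym (ext2 M \<chi>) x y + \<phi> x y)"
      unfolding ext2_eq_iff using c(2) by (simp add: asym_def)
    finally show "\<exists>\<chi>\<in>mhom M (dual_module M). F = ext2 M (\<lambda>x y. asym \<chi> x y + \<phi> x y)"
      using mhom_dual_iff[OF M] c(1) by blast
  qed
  finally show ?thesis .
qed

lemma ext2_mem_Qc: "left_module M \<Longrightarrow> pr M M \<phi> \<Longrightarrow> ext2 M \<phi> \<in> Qc M \<phi>"
  by (simp add: Qc_mem mhom_dual_iff qeq_refl)

lemma Qc_eq_iff:
  assumes M: "left_module M" and p: "pr M M \<phi>" "pr M M \<psi>"
  shows "Qc M \<phi> = Qc M \<psi> \<longleftrightarrow> qeq M \<phi> \<psi>"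
proof
  assume "Qc M \<phi> = Qc M \<psi>"
  then have "qeq M (ext2 M \<phi>) \<psi>" using ext2_mem_Qc[OF M p(1)] Qc_mem[OF M p(2)] by simp
  then show "qeq M \<phi> \<psi>" by (rule qeq_cong) simp_all
next
  assume q: "qeq M \<phi> \<psi>"
  then show "Qc M \<phi> = Qc M \<psi>"
    using qeq_trans[OF _ q] qeq_trans[OF _ qeq_sym[OF q]] by (auto simp: Qc_mem[OF M p(1)] Qc_mem[OF M p(2)])
qed

lemma Q_eps_carrier:
  assumes M: "left_module M" shows "carrier (Q_eps M) = {Qc M \<phi> | \<phi>. pr M M \<phi>}"
proof -
  have "carrier (Q_eps M) = Q_class M ` mhom M (dual_module M)"
    by (auto simp: Q_eps_def carrier_FactGroup Q_class_def hom_group_def)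
  also have "\<dots> = {Qc M \<phi> | \<phi>. pr M M \<phi>}"
  proof (intro equalityI subsetI)
    fix \<theta> assume "\<theta> \<in> Q_class M ` mhom M (dual_module M)"
    then obtain F where "F \<in> mhom M (dual_module M)" "\<theta> = Q_class M F" by blast
    then have "\<theta> = Qc M F \<and> pr M M F" using mhom_dual_ext2 mhom_dual_pr[OF M] by (metis Qc_def)
    then show "\<theta> \<in> {Qc M \<phi> | \<phi>. pr M M \<phi>}" by blast
  qed (use mhom_dual_iff[OF M] in \<open>auto simp: Qc_def\<close>)
  finally show ?thesis .
qed

lemma Q_eps_one: assumes M: "left_module M" shows "\<one>\<^bsub>Q_eps M\<^esub> = Qc M (\<lambda>_ _. 0)"
proof -
  have "F \<in> Q_zero M \<longleftrightarrow> F \<in> Qc M (\<lambda>_ _. 0)" for F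
  proof -
    have "h \<otimes>\<^bsub>hom_group M (dual_module M)\<^esub> ext2 M (\<lambda>_ _. 0) = ext2 M h" for h
      by (auto simp: hom_group_def ext2_def restrict_def fun_eq_iff)
    moreover have "ext2 M h = h" if "h \<in> Q_zero M" for h
      using that by (auto simp: Q_zero_def ext2_def restrict_def fun_eq_iff)
    ultimately show ?thesis by (auto simp: Qc_def Q_class_def r_coset_def)
  qed
  then show ?thesis by (auto simp: Q_eps_def)
qed

lemma Q_class_ext2: "Q_class M (\<lambda>x\<in>carrier M. \<lambda>y\<in>carrier M. \<phi> x y) = Qc M \<phi>"
  by (simp add: Qc_def ext2_def)

section \<open>Pullbacks, sums and symmetrisations of classes of forms\<close>

lemma Q_pull_Qc:
  assumes M: "left_module M" "left_module N" and p: "pr N N \<psi>" and f: "lin M N f"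
  shows "Q_pull M f (Qc N \<psi>) = Qc M (\<lambda>x y. \<psi> (f x) (f y))"
proof -
  have "Qc M (\<lambda>x y. F (f x) (f y)) = Qc M (\<lambda>x y. \<psi> (f x) (f y))" if F: "F \<in> Qc N \<psi>" for F
  proof -
    have "pr N N F" "qeq N F \<psi>" using F Qc_mem[OF M(2) p] mhom_dual_pr[OF M(2)] by auto
    then show ?thesis using Qc_eq_iff[OF M(1) pr_comp[OF _ f f] pr_comp[OF p f f]] qeq_pull[OF _ f] by blast
  qed
  then show ?thesis unfolding Q_pull_def Q_class_ext2 using ext2_mem_Qc[OF M(2) p] by blast
qed

lemma Q_pull_restrict:
  fixes f :: "'m \<Rightarrow> 'n"
  shows "Q_pull M (restrict f (carrier M)) \<theta> = Q_pull M f \<theta>"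
proof -
  have "(\<lambda>x\<in>carrier M. \<lambda>y\<in>carrier M. \<phi> (restrict f (carrier M) x) (restrict f (carrier M) y)) =
    (\<lambda>x\<in>carrier M. \<lambda>y\<in>carrier M. \<phi> (f x) (f y))" for \<phi> :: "'n \<Rightarrow> 'n \<Rightarrow> 'a"
    by (auto simp: restrict_def fun_eq_iff)
  then show ?thesis by (simp add: Q_pull_def)
qed

lemma qeq_sum:
  assumes "left_module M" "left_module N" "qeq M \<phi> \<phi>'" "qeq N \<psi> \<psi>'"
  shows "qeq (msum M N) (\<lambda>u v. \<phi> (fst u) (fst v) + \<psi> (snd u) (snd v)) (\<lambda>u v. \<phi>' (fst u) (fst v) + \<psi>' (snd u) (snd v))"
  by (intro qeq_add qeq_pull[OF assms(3)] qeq_pull[OF assms(4)]) (auto simp: lin_def)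

definition osum :: "('m \<Rightarrow> 'm \<Rightarrow> 'a) \<Rightarrow> ('n \<Rightarrow> 'n \<Rightarrow> 'a) \<Rightarrow> 'm \<times> 'n \<Rightarrow> 'm \<times> 'n \<Rightarrow> 'a" where
  "osum \<phi> \<psi> u v = \<phi> (fst u) (fst v) + \<psi> (snd u) (snd v)"

lemma pr_osum: "pr M M \<phi> \<Longrightarrow> pr N N \<psi> \<Longrightarrow> pr (msum M N) (msum M N) (osum \<phi> \<psi>)"
  unfolding osum_def[abs_def] by (rule pr_sum)

lemma qeq_osum: "left_module M \<Longrightarrow> left_module N \<Longrightarrow> qeq M \<phi> \<phi>' \<Longrightarrow> qeq N \<psi> \<psi>' \<Longrightarrow>
    qeq (msum M N) (osum \<phi> \<psi>) (osum \<phi>' \<psi>')"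
  unfolding osum_def[abs_def] by (rule qeq_sum)

lemma lam_osum: "lam (osum \<phi> \<psi>) = osum (lam \<phi>) (lam \<psi>)"
  by (intro ext) (simp add: lam_def osum_def algebra_simps)

lemma Q_sum_Qc:
  assumes M: "left_module M" "left_module N" and p: "pr M M \<phi>" "pr N N \<psi>"
  shows "Q_sum M N (Qc M \<phi>) (Qc N \<psi>) = Qc (msum M N) (osum \<phi> \<psi>)"
proof -
  have "Qc (msum M N) (osum F G) = Qc (msum M N) (osum \<phi> \<psi>)"
    if F: "F \<in> Qc M \<phi>" and G: "G \<in> Qc N \<psi>" for F G
  proof -
    have "pr M M F" "qeq M F \<phi>" "pr N N G" "qeq N G \<psi>"
      using F G Qc_mem[OF M(1) p(1)] Qc_mem[OF M(2) p(2)] mhom_dual_pr[OF M(1)] mhom_dual_pr[OF M(2)] by auto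
    then show ?thesis using Qc_eq_iff[OF left_module_msum[OF M] pr_osum pr_osum[OF p]] qeq_osum[OF M] by blast
  qed
  moreover have "ext2 M \<phi> \<in> Qc M \<phi>" "ext2 N \<psi> \<in> Qc N \<psi>" using ext2_mem_Qc M p by auto
  ultimately show ?thesis unfolding Q_sum_def Q_class_ext2 osum_def[abs_def] by blast
qed

lemma symm_Qc:
  assumes M: "left_module M" and p: "pr M M \<phi>" shows "symm M (Qc M \<phi>) = ext2 M (lam \<phi>)"
proof -
  have "(SOME \<psi>. \<psi> \<in> Qc M \<phi>) \<in> Qc M \<phi>" by (rule someI[of "\<lambda>\<psi>. \<psi> \<in> Qc M \<phi>", OF ext2_mem_Qc[OF M p]])
  then have "qeq M (SOME \<psi>. \<psi> \<in> Qc M \<phi>) \<phi>" by (simp add: Qc_mem[OF M p])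
  from qeq_lam[OF this] show ?thesis
    by (auto simp: symm_def Let_def T_eps_def lam_def ext2_def restrict_def fun_eq_iff)
qed

lemma Qc_with_sbases [simp]: "Qc (with_sbases M B) = Qc M"
proof -
  have d: "dual_module (with_sbases M B) = dual_module M" by (simp add: dual_module_def mhom_def)
  have h: "hom_group (with_sbases M B) N = hom_group M N" for N :: "('a, 'd) module" by (simp add: hom_group_def mhom_def)
  have "Q_zero (with_sbases M B) = Q_zero M" by (simp add: Q_zero_def d mhom_def T_eps_def)
  then show ?thesis by (intro ext) (simp add: Qc_def Q_class_def d h ext2_def)
qed

lemma Qc_bsum: "Qc (bsum M N) = Qc (msum M N)" by (simp add: bsum_def)

lemma qeq_bsum: "qeq (bsum M N) = qeq (msum M N)"
  by (intro ext) (simp add: qeq_def pr_like)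

subsection \<open>Complementary Lagrangians\<close>

definition nul :: "('a, 'm, 'z) module_scheme \<Rightarrow> ('m \<Rightarrow> 'm \<Rightarrow> 'a) \<Rightarrow> bool" where
  "nul K \<phi> \<longleftrightarrow> qeq K \<phi> (\<lambda>_ _. 0)"

text \<open>\<open>K\<close> and \<open>D\<close> are complementary simple Lagrangians of the simple form represented by \<open>\<phi>\<close>.\<close>

definition HP :: "('a, 'm) based_module \<Rightarrow> ('m \<Rightarrow> 'm \<Rightarrow> 'a) \<Rightarrow> ('a, 'm) based_module \<Rightarrow> ('a, 'm) based_module \<Rightarrow> bool" where
  "HP M \<phi> K D \<longleftrightarrow> pr M M \<phi> \<and> lin K M (\<lambda>x. x) \<and> lin D M (\<lambda>x. x) \<and>
     smp (bsum K D) M (\<lambda>u. fst u \<oplus>\<^bsub>M\<^esub> snd u) \<and> perfect D K (lam \<phi>) \<and> nul K \<phi> \<and> nul D \<phi>"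

lemma HPD:
  assumes "HP M \<phi> K D"
  shows "pr M M \<phi>" "lin K M (\<lambda>x. x)" "lin D M (\<lambda>x. x)" "smp (bsum K D) M (\<lambda>u. fst u \<oplus>\<^bsub>M\<^esub> snd u)"
    "perfect D K (lam \<phi>)" "nul K \<phi>" "nul D \<phi>" "is_based M" "is_based K" "is_based D"
  using assms smp_based perfectD unfolding HP_def by blast+

lemma nul_lam: "nul K \<phi> \<Longrightarrow> x \<in> carrier K \<Longrightarrow> y \<in> carrier K \<Longrightarrow> lam \<phi> x y = 0"
  unfolding nul_def by (drule (2) qeq_lam) (simp add: lam_def)

lemma perfect_minus: assumes "perfect D K \<beta>" shows "perfect D K (\<lambda>x y. - \<beta> x y)"
  by (rule perfect_cong[OF perfect_left[OF assms smp_neg[OF perfectD(1)[OF assms]]]])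
    (simp add: pr_smult1[OF perfectD(3)[OF assms]])

lemma perfect_eps: "perfect D K \<beta> \<Longrightarrow> perfect D K (\<lambda>x y. eps * \<beta> x y)"
  using eps_cases perfect_minus[of D K \<beta>] by auto

lemma bar_lam: "bar (lam \<phi> y x) = eps * lam \<phi> x y"
  by (simp add: lam_def algebra_simps eps_comm)

text \<open>Flipping \<open>lam \<phi>\<close> multiplies its values by \<open>eps\<close>. This is
  a sign, and signs preserve perfectness because negation is simple.\<close>

lemma HP_sym: assumes "HP M \<phi> K D" shows "HP M \<phi> D K"
proof -
  note h = HPD[OF assms]
  have "perfect K D (lam \<phi>)"
    by (rule perfect_cong[OF perfect_eps[OF perfect_flip[OF h(5)]]]) (simp add: bar_lam)
  moreover have "smp (bsum D K) M (\<lambda>u. fst u \<oplus>\<^bsub>M\<^esub> snd u)"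
    by (rule smp_cong[OF smp_comp[OF smp_swap[OF h(10,9)] h(4)]])
      (use h lin_closed[OF h(2)] lin_closed[OF h(3)] in \<open>auto intro: lm_comm\<close>)
  ultimately show ?thesis using h by (simp add: HP_def)
qed

lemma perfect_inj:
  assumes p: "perfect D K \<beta>" and d: "d \<in> carrier D" "\<And>k. k \<in> carrier K \<Longrightarrow> \<beta> d k = 0"
  shows "d = \<zero>\<^bsub>D\<^esub>"
proof -
  note b = perfectD[OF p]
  have lm: "left_module D" "left_module K" using b by simp_all
  show ?thesis
    by (rule liso_inj[OF smp_liso[OF b(4)] d(1)]) (use lm d pr_zero(2)[OF lm b(3)] in \<open>auto simp: restrict_def\<close>)
qed

lemma HP_decomp:
  assumes "HP M \<phi> K D" "x \<in> carrier M"
  obtains k d where "k \<in> carrier K" "d \<in> carrier D" "x = k \<oplus>\<^bsub>M\<^esub> d"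
  using liso_inv_into(1,2)[OF smp_liso[OF HPD(4)[OF assms(1)]] assms(2)] that
  by (auto simp: mem_Times_iff)

lemma HP_lam:
  assumes h: "HP M \<phi> K D" and c: "k \<in> carrier K" "k' \<in> carrier K" "d \<in> carrier D" "d' \<in> carrier D"
  shows "lam \<phi> (k \<oplus>\<^bsub>M\<^esub> d) (k' \<oplus>\<^bsub>M\<^esub> d') = lam \<phi> k d' + lam \<phi> d k'"
proof -
  note H = HPD[OF h]
  have m: "k \<in> carrier M" "k' \<in> carrier M" "d \<in> carrier M" "d' \<in> carrier M"
    using lin_closed[OF H(2)] lin_closed[OF H(3)] c by auto
  show ?thesis
    using m H(8) nul_lam[OF H(6) c(1,2)] nul_lam[OF H(7) c(3,4)]
    by (simp add: pr_add1[OF pr_lam[OF H(1)]] pr_add2[OF pr_lam[OF H(1)]])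
qed

text \<open>In the decomposition of \<open>M\<close> into \<open>K\<close> and \<open>D\<close> only
  the mixed terms of \<open>lam \<phi>\<close> survive. It is therefore the sum of the two perfect
  pairings, composed with the swap.\<close>

lemma HP_perfect: assumes h: "HP M \<phi> K D" shows "perfect M M (lam \<phi>)"
proof -
  note H = HPD[OF h] and H' = HPD[OF HP_sym[OF h]]
  let ?s = "\<lambda>u. fst u \<oplus>\<^bsub>M\<^esub> snd u"
  let ?i = "inv_into (carrier (bsum K D)) ?s"
  note i = smp_inv[OF H(4)] and ii = liso_inv_into[OF smp_liso[OF H(4)]]
  have "perfect (bsum K D) (bsum K D) (\<lambda>u w. lam \<phi> (fst u) (snd w) + lam \<phi> (snd u) (fst w))"
    using perfect_right[OF perfect_sum[OF H'(5) H(5)] smp_swap[OF H(9,10)]] by simp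
  from perfect_right[OF perfect_left[OF this i] i] show ?thesis
  proof (rule perfect_cong)
    fix x y assume x: "x \<in> carrier M" and y: "y \<in> carrier M"
    show "lam \<phi> (fst (?i x)) (snd (?i y)) + lam \<phi> (snd (?i x)) (fst (?i y)) = lam \<phi> x y"
      using HP_lam[OF h, of "fst (?i x)" "fst (?i y)" "snd (?i x)" "snd (?i y)"] ii(1,2)[OF x] ii(1,2)[OF y]
      by (simp add: mem_Times_iff)
  qed
qed

lemma is_submodule_iff: "is_submodule L M \<longleftrightarrow> left_module L \<and> lin L M (\<lambda>x. x)"
  unfolding is_submodule_def using restrict_mhom by auto

text \<open>Summands are handled by retractions, which compose and transport without naming a
  complement. The complement demanded by the definition is the kernel of the retraction.\<close>

lemma direct_summandI:
  assumes L: "left_module L" and M: "left_module M" and l: "lin L M (\<lambda>x. x)" and p: "lin M L p"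
    and pl: "\<And>x. x \<in> carrier L \<Longrightarrow> p x = x"
  shows "direct_summand (L :: ('a, 'm, 'y) module_scheme) (M :: ('a, 'm, 'z) module_scheme)"
proof -
  let ?W = "\<lparr>carrier = {x \<in> carrier M. p x = \<zero>\<^bsub>L\<^esub>}, mult = undefined, one = undefined, zero = \<zero>\<^bsub>M\<^esub>, add = add M, smult = smult M\<rparr> :: ('a, 'm) module"
  note lc = lin_closed[OF l] and pc = lin_closed[OF p]
  have W: "left_module ?W"
    by (rule left_moduleI) (use M L lin_zero[OF M L p] in
      \<open>auto simp: lin_add[OF p] lin_smult[OF p] lm_assoc lm_neg4 lm_add_smult lm_smult_add lm_mult_smult intro: lm_comm\<close>)
  have "liso (msum L ?W) M (\<lambda>u. fst u \<oplus>\<^bsub>M\<^esub> snd u)"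
  proof (rule lisoI[of _ _ _ "\<lambda>x. (p x, x \<oplus>\<^bsub>M\<^esub> (- 1) \<odot>\<^bsub>M\<^esub> p x)"])
    show "lin (msum L ?W) M (\<lambda>u. fst u \<oplus>\<^bsub>M\<^esub> snd u)"
      by (rule linI) (use M L lc in \<open>auto simp: lin_add[OF l] lin_smult[OF l] lm_assoc lm_lcomm lm_smult_add\<close>)
  next
    fix u assume "u \<in> carrier (msum L ?W)"
    then obtain x w where u: "u = (x, w)" "x \<in> carrier L" "w \<in> carrier M" "p w = \<zero>\<^bsub>L\<^esub>" by auto
    then have "p (x \<oplus>\<^bsub>M\<^esub> w) = x" using M L lc pl by (simp add: lin_add[OF p])
    then show "(p (fst u \<oplus>\<^bsub>M\<^esub> snd u), fst u \<oplus>\<^bsub>M\<^esub> snd u \<oplus>\<^bsub>M\<^esub> (- 1) \<odot>\<^bsub>M\<^esub> p (fst u \<oplus>\<^bsub>M\<^esub> snd u)) = u"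
      using u M lc by (simp add: lm_comm[of M x] lm_assoc lm_neg)
  next
    fix y assume y: "y \<in> carrier M"
    have ps: "p ((- 1) \<odot>\<^bsub>M\<^esub> p y) = (- 1) \<odot>\<^bsub>L\<^esub> p y" using lin_smult[OF p lc[OF pc[OF y]]] pl[OF pc[OF y]] by metis
    show "(p y, y \<oplus>\<^bsub>M\<^esub> (- 1) \<odot>\<^bsub>M\<^esub> p y) \<in> carrier (msum L ?W)"
      using y M L lc[OF pc[OF y]] pc[OF y] by (simp add: lin_add[OF p] ps lm_neg)
    show "fst (p y, y \<oplus>\<^bsub>M\<^esub> (- 1) \<odot>\<^bsub>M\<^esub> p y) \<oplus>\<^bsub>M\<^esub> snd (p y, y \<oplus>\<^bsub>M\<^esub> (- 1) \<odot>\<^bsub>M\<^esub> p y) = y"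
      using y M lc[OF pc[OF y]] by (simp add: lm_lcomm[of M _ y] lm_neg)
  qed
  then have "bij_betw (\<lambda>(x, w). x \<oplus>\<^bsub>M\<^esub> w) (carrier L \<times> carrier ?W) (carrier M)"
    unfolding liso_def by (simp add: case_prod_unfold)
  moreover have "is_submodule ?W M" using W by (simp add: is_submodule_iff lin_def)
  ultimately show ?thesis unfolding direct_summand_def using L l is_submodule_iff by blast
qed

lemma direct_summandE:
  assumes d: "direct_summand (L :: ('a, 'm, 'y) module_scheme) (M :: ('a, 'm, 'z) module_scheme)" and M: "left_module M"
  obtains p where "left_module L" "lin L M (\<lambda>x. x)" "lin M L p" "\<And>x. x \<in> carrier L \<Longrightarrow> p x = x"
proof -
  obtain W :: "('a, 'm) module" where s: "left_module L" "lin L M (\<lambda>x. x)" "left_module W" "lin W M (\<lambda>x. x)"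
    and b: "bij_betw (\<lambda>(x, w). x \<oplus>\<^bsub>M\<^esub> w) (carrier L \<times> carrier W) (carrier M)"
    using d unfolding direct_summand_def is_submodule_iff by blast
  let ?s = "\<lambda>u. fst u \<oplus>\<^bsub>M\<^esub> snd u"
  note lc = lin_closed[OF s(2)] lin_closed[OF s(4)]
  have "lin (msum L W) M ?s"
    by (rule linI) (use M s lc in \<open>auto simp: lin_add[OF s(2)] lin_smult[OF s(2)] lin_add[OF s(4)] lin_smult[OF s(4)] lm_assoc lm_lcomm lm_smult_add\<close>)
  then have l: "liso (msum L W) M ?s" using b by (simp add: liso_def case_prod_unfold)
  have li: "lin M (msum L W) (inv_into (carrier (msum L W)) ?s)"
    by (rule liso_lin[OF liso_inv[OF left_module_msum[OF s(1,3)] l]])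
  have "lin (msum L W) L fst" by (simp add: lin_def)
  from lin_comp[OF li this] have p: "lin M L (\<lambda>x. fst (inv_into (carrier (msum L W)) ?s x))" .
  have "fst (inv_into (carrier (msum L W)) ?s x) = x" if "x \<in> carrier L" for x
  proof -
    have "?s (x, \<zero>\<^bsub>W\<^esub>) = x" using lin_zero[OF s(3) M s(4)] M lc(1)[OF that] by simp
    then show ?thesis using liso_inv_into(3)[OF l, of "(x, \<zero>\<^bsub>W\<^esub>)"] that s(3) by simp
  qed
  with s p show ?thesis by (intro that)
qed

lemma HP_summand: assumes h: "HP M \<phi> K D" shows "direct_summand K M"
proof -
  note H = HPD[OF h]
  let ?s = "\<lambda>u. fst u \<oplus>\<^bsub>M\<^esub> snd u"
  have lm: "left_module K" "left_module M" "left_module D" using H by simp_all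
  have li: "lin M (bsum K D) (inv_into (carrier (bsum K D)) ?s)" by (rule smp_lin[OF smp_inv[OF H(4)]])
  have "lin (bsum K D) K fst" by (simp add: lin_def)
  show ?thesis
  proof (rule direct_summandI[OF lm(1,2) H(2) lin_comp[OF li \<open>lin (bsum K D) K fst\<close>]])
    fix x assume x: "x \<in> carrier K"
    have "?s (x, \<zero>\<^bsub>D\<^esub>) = x" using lin_zero[OF lm(3,2) H(3)] lm lin_closed[OF H(2) x] by simp
    then show "fst (inv_into (carrier (bsum K D)) ?s x) = x"
      using liso_inv_into(3)[OF smp_liso[OF H(4)], of "(x, \<zero>\<^bsub>D\<^esub>)"] x lm by simp
  qed
qed

lemma smp_shear':
  assumes b: "is_based M" "is_based N" and h: "lin N M h"
  shows "smp (bsum M N) (bsum M N) (\<lambda>u. (fst u \<oplus>\<^bsub>M\<^esub> h (snd u), snd u))"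
  using smp_comp[OF smp_comp[OF smp_swap[OF b] smp_shear[OF b(2,1) h]] smp_swap[OF b(2,1)]] by simp

text \<open>Perfectness of \<open>lam \<phi>\<close> between \<open>D\<close> and \<open>K\<close>
  supplies everything: it forces \<open>K\<close> to equal its orthogonal, and its inverse, a map
  from \<open>dual K\<close> to \<open>D\<close>, is the section of the based exact
  sequence.\<close>

lemma HP_simple:
  assumes h: "HP M \<phi> K D"
  shows "is_simple_form (M, Qc M \<phi>)" "is_simple_lagrangian K (M, Qc M \<phi>)"
proof -
  note H = HPD[OF h] and P = perfectD[OF HP_perfect[OF h]] and PD = perfectD[OF HPD(5)[OF h]]
  have lm: "left_module K" "left_module M" "left_module D" using H by simp_all
  note kc = lin_closed[OF H(2)] and dc = lin_closed[OF H(3)]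
  have sy: "symm M (Qc M \<phi>) = ext2 M (lam \<phi>)" by (rule symm_Qc[OF lm(2) H(1)])
  have "is_form (M, Qc M \<phi>)" using H Q_eps_carrier[OF lm(2)] by auto
  then show "is_simple_form (M, Qc M \<phi>)"
    using P(4) by (simp add: sy ext2_def smp_def)
  have perp: "carrier K = {x \<in> carrier M. \<forall>y\<in>carrier K. lam \<phi> x y = 0}"
  proof (intro equalityI subsetI)
    fix x assume "x \<in> carrier K"
    then show "x \<in> {x \<in> carrier M. \<forall>y\<in>carrier K. lam \<phi> x y = 0}" using kc nul_lam[OF H(6)] by simp
  next
    fix x assume x: "x \<in> {x \<in> carrier M. \<forall>y\<in>carrier K. lam \<phi> x y = 0}"
    then have "x \<in> carrier M" by simp
    then obtain k d where kd: "k \<in> carrier K" "d \<in> carrier D" "x = k \<oplus>\<^bsub>M\<^esub> d" by (rule HP_decomp[OF h])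
    have "lam \<phi> d y = 0" if "y \<in> carrier K" for y
    proof -
      have "lam \<phi> (k \<oplus>\<^bsub>M\<^esub> d) y = 0" using x kd(3) that by blast
      then show ?thesis
        unfolding pr_add1[OF pr_lam[OF H(1)] kc[OF kd(1)] dc[OF kd(2)] kc[OF that]] nul_lam[OF H(6) kd(1) that] by simp
    qed
    then have "d = \<zero>\<^bsub>D\<^esub>" by (rule perfect_inj[OF H(5) kd(2)])
    then show "x \<in> carrier K" using kd lin_zero[OF lm(3,2) H(3)] kc lm by simp
  qed
  have "Q_pull K (\<lambda>x. x) (Qc M \<phi>) = \<one>\<^bsub>Q_eps K\<^esub>"
    unfolding Q_pull_Qc[OF lm(1,2) H(1,2)] Q_eps_one[OF lm(1)]
    using Qc_eq_iff[OF lm(1) pr_comp[OF H(1,2,2)] pr_0] H(6) by (simp add: nul_def)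
  moreover have pq: "perp M (Qc M \<phi>) (carrier K) = {x \<in> carrier M. \<forall>y\<in>carrier K. lam \<phi> x y = 0}"
    using kc by (auto simp: perp_def sy)
  moreover have "carrier K = perp M (Qc M \<phi>) (carrier K)" unfolding pq by (rule perp)
  ultimately have lag: "is_lagrangian K (M, Qc M \<phi>)" using H HP_summand[OF h] by simp
  let ?p = "\<lambda>x\<in>carrier M. \<lambda>y\<in>carrier K. symm M (Qc M \<phi>) x y"
  have pe: "?p = (\<lambda>x\<in>carrier M. \<lambda>y\<in>carrier K. lam \<phi> x y)"
    using kc by (auto simp: sy restrict_def fun_eq_iff)
  let ?e = "\<lambda>d. \<lambda>k\<in>carrier K. lam \<phi> d k"
  let ?d = "inv_into (carrier D) ?e"
  note d = smp_inv[OF PD(4)] and di = liso_inv_into[OF smp_liso[OF PD(4)]]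
  let ?s = "restrict ?d (carrier (dual K))"
  have "based_exact K M (dual K) (\<lambda>x\<in>carrier K. x) ?p"
    unfolding based_exact_def
  proof (intro conjI)
    show "(\<lambda>x\<in>carrier K. x) \<in> mhom K M" using H(2) restrict_mhom[OF lm(1)] by blast
    have "pr M K (lam \<phi>)" using pr_comp[OF pr_lam[OF H(1)] lin_id H(2)] by simp
    from lin_dual_map[OF lm(2,1) this] have "lin M (dual K) ?e" by (simp add: dual_like)
    then show pm0: "?p \<in> mhom M (dual K)" unfolding pe restrict_mhom[OF lm(2)] .
    have pm: "?p x \<in> carrier (dual K)" if "x \<in> carrier M" for x
      by (rule lin_closed[OF mhom_lin[OF pm0] that])
    show "inj_on (\<lambda>x\<in>carrier K. x) (carrier K)" by (simp add: inj_on_def)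
    show "?p ` carrier M = carrier (dual K)"
    proof (intro equalityI subsetI)
      fix f assume f: "f \<in> carrier (dual K)"
      have e: "?p (?d f) = f" using di(1,2)[OF f] dc by (simp add: pe)
      show "f \<in> ?p ` carrier M" by (rule image_eqI) (rule e[symmetric], rule dc[OF di(1)[OF f]])
    qed (use pm in blast)
    show "(\<lambda>x\<in>carrier K. x) ` carrier K = {x \<in> carrier M. ?p x = \<zero>\<^bsub>dual K\<^esub>}"
    proof -
      have "?p x = \<zero>\<^bsub>dual K\<^esub> \<longleftrightarrow> (\<forall>y\<in>carrier K. lam \<phi> x y = 0)" if "x \<in> carrier M" for x
        using that kc by (auto simp: sy restrict_def fun_eq_iff)
      then show ?thesis using perp by auto
    qed
    show "\<exists>s\<in>mhom (dual K) M. (\<forall>y\<in>carrier (dual K). ?p (s y) = y) \<and>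
        simple_iso (bsum K (dual K)) M (\<lambda>u\<in>carrier K \<times> carrier (dual K). (\<lambda>x\<in>carrier K. x) (fst u) \<oplus>\<^bsub>M\<^esub> s (snd u))"
    proof (intro bexI conjI ballI)
      have ldk: "left_module (dual K)" using H by simp
      show "?s \<in> mhom (dual K) M"
        unfolding restrict_mhom[OF ldk] using lin_comp[OF smp_lin[OF d] H(3)] by simp
      show "?p (?s f) = f" if "f \<in> carrier (dual K)" for f
        using di(1,2)[OF that] dc that by (simp add: pe)
      have "smp (bsum K (dual K)) M (\<lambda>u. fst u \<oplus>\<^bsub>M\<^esub> ?d (snd u))"
        using smp_comp[OF smp_bsum[OF smp_id[OF H(9)] d] H(4)] by simp
      then have "simple_iso (bsum K (dual K)) M (restrict (\<lambda>u. fst u \<oplus>\<^bsub>M\<^esub> ?d (snd u)) (carrier (bsum K (dual K))))"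
        by (simp add: smp_def)
      moreover have "restrict (\<lambda>u. fst u \<oplus>\<^bsub>M\<^esub> ?d (snd u)) (carrier (bsum K (dual K))) =
        (\<lambda>u\<in>carrier K \<times> carrier (dual K). (\<lambda>x\<in>carrier K. x) (fst u) \<oplus>\<^bsub>M\<^esub> ?s (snd u))"
        by (auto simp: restrict_def fun_eq_iff)
      ultimately show "simple_iso (bsum K (dual K)) M (\<lambda>u\<in>carrier K \<times> carrier (dual K). (\<lambda>x\<in>carrier K. x) (fst u) \<oplus>\<^bsub>M\<^esub> ?s (snd u))"
        by simp
    qed
  qed
  then show "is_simple_lagrangian K (M, Qc M \<phi>)" using lag by simp
qed

text \<open>A section \<open>s\<close> of the based exact sequence splits off \<open>dual K\<close>,
  but the form may be nonzero on its image. It is corrected by a map \<open>a\<close> into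
  \<open>K\<close> with \<open>f (a g) = \<phi> (s f) (s g)\<close>. No division by 2 is required
  since only the class in \<open>Q_eps\<close> has to vanish, and the correction is a shear, so
  simplicity persists.\<close>

lemma lagrangian_complement:
  assumes f: "is_simple_form (M, Qc M \<phi>)" and p: "pr M M \<phi>" and l: "is_simple_lagrangian K (M, Qc M \<phi>)"
  obtains D where "HP M \<phi> K D"
proof -
  have M: "is_based M" and K: "is_based K" and ds: "direct_summand K M" using f l by auto
  have lm: "left_module M" "left_module K" "left_module (dual K)" using M K by simp_all
  have i: "lin K M (\<lambda>x. x)" using ds by (simp add: direct_summand_def is_submodule_iff)
  note ic = lin_closed[OF i]
  have nK: "nul K \<phi>"
    using l Q_pull_Qc[OF lm(2,1) p i] Q_eps_one[OF lm(2)] Qc_eq_iff[OF lm(2) pr_comp[OF p i i] pr_0]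
    by (simp add: nul_def)
  have sy: "symm M (Qc M \<phi>) = ext2 M (lam \<phi>)" by (rule symm_Qc[OF lm(1) p])
  from l obtain s where s: "s \<in> mhom (dual K) M"
    "\<forall>y\<in>carrier (dual K). (\<lambda>x\<in>carrier M. \<lambda>y\<in>carrier K. symm M (Qc M \<phi>) x y) (s y) = y"
    "simple_iso (bsum K (dual K)) M (\<lambda>u\<in>carrier K \<times> carrier (dual K). (\<lambda>x\<in>carrier K. x) (fst u) \<oplus>\<^bsub>M\<^esub> s (snd u))"
    by (auto simp: based_exact_def)
  have sl: "lin (dual K) M s" by (rule mhom_lin[OF s(1)])
  note sc = lin_closed[OF sl]
  have ls: "lam \<phi> (s f) k = f k" if "f \<in> carrier (dual K)" "k \<in> carrier K" for f k
    using fun_cong[OF bspec[OF s(2) that(1)], of k] sc[OF that(1)] that(2) ic by (simp add: sy)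
  have "restrict (\<lambda>u. fst u \<oplus>\<^bsub>M\<^esub> s (snd u)) (carrier (bsum K (dual K))) =
        (\<lambda>u\<in>carrier K \<times> carrier (dual K). (\<lambda>x\<in>carrier K. x) (fst u) \<oplus>\<^bsub>M\<^esub> s (snd u))"
    by (auto simp: restrict_def fun_eq_iff)
  then have ss: "smp (bsum K (dual K)) M (\<lambda>u. fst u \<oplus>\<^bsub>M\<^esub> s (snd u))"
    using s(3) M K by (simp add: smp_def)
  define \<psi> where "\<psi> f g = \<phi> (s f) (s g)" for f g
  have ps: "pr (dual K) (dual K) \<psi>" unfolding \<psi>_def[abs_def] by (rule pr_comp[OF p sl sl])
  let ?E = "\<lambda>x. \<lambda>f\<in>carrier (dual K). bar (f x)"
  note E = perfectD(4)[OF perfect_flip[OF perfect_eval[OF K]]]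
  let ?B = "\<lambda>g. \<lambda>f\<in>carrier (dual K). bar (\<psi> f g)"
  have B: "lin (dual K) (dual (dual K)) ?B"
    using lin_dual_map[OF lm(3,3) pr_flip[OF ps]] by (simp add: dual_like)
  \<comment> \<open>\<open>K\<close> is identified with its double dual by evaluation, so the
    functional \<psi>(-, g) on \<open>dual K\<close> is evaluation at an element of
    \<open>K\<close>.\<close>
  define a where "a g = inv_into (carrier K) ?E (?B g)" for g
  have al: "lin (dual K) K a" unfolding a_def[abs_def] by (rule lin_comp[OF B smp_lin[OF smp_inv[OF E]]])
  note ac = lin_closed[OF al]
  have fa: "f (a g) = \<psi> f g" if f: "f \<in> carrier (dual K)" and g: "g \<in> carrier (dual K)" for f g
  proof -
    have "?E (a g) = ?B g" unfolding a_def by (rule liso_inv_into(2)[OF smp_liso[OF E] lin_closed[OF B g]])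
    from fun_cong[OF this, of f] f have "bar (f (a g)) = bar (\<psi> f g)" by simp
    then show ?thesis by (metis bar_bar)
  qed
  define t where "t f = s f \<oplus>\<^bsub>M\<^esub> (- 1) \<odot>\<^bsub>M\<^esub> a f" for f
  have tl: "lin (dual K) M t"
    unfolding t_def[abs_def]
    by (rule linI) (use lm(1) in \<open>simp_all only: lin_add[OF sl] lin_add[OF al] lin_smult[OF sl] lin_smult[OF al]
        lin_add[OF i ac ac] lin_smult[OF i ac] lm_add lm_smult ic ac sc lm_smult_add lm_assoc lm_lcomm lm_mult_smult[symmetric] mult_minus1 mult_minus1_right\<close>)
  note tc = lin_closed[OF tl]
  have na: "lin (dual K) K (\<lambda>f. (- 1) \<odot>\<^bsub>K\<^esub> a f)"
    by (rule lin_comp[OF al smp_lin[OF smp_neg[OF K]]])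
  have neg: "(- 1) \<odot>\<^bsub>K\<^esub> x = (- 1) \<odot>\<^bsub>M\<^esub> x" if "x \<in> carrier K" for x using lin_smult[OF i that] by metis
  have padd: "x \<oplus>\<^bsub>K\<^esub> y = x \<oplus>\<^bsub>M\<^esub> y" if "x \<in> carrier K" "y \<in> carrier K" for x y using lin_add[OF i that] by metis
  have st: "smp (bsum K (dual K)) M (\<lambda>u. fst u \<oplus>\<^bsub>M\<^esub> t (snd u))"
  proof (rule smp_cong[OF smp_comp[OF smp_shear'[OF K is_based_dual[OF K] na] ss]])
    fix u assume "u \<in> carrier (bsum K (dual K))"
    then have u: "fst u \<in> carrier K" "snd u \<in> carrier (dual K)" by auto
    then have m: "fst u \<in> carrier M" "a (snd u) \<in> carrier M" "s (snd u) \<in> carrier M" "(- 1) \<odot>\<^bsub>M\<^esub> a (snd u) \<in> carrier M"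
      using ic ac sc lm by auto
    have "fst u \<oplus>\<^bsub>K\<^esub> (- 1) \<odot>\<^bsub>K\<^esub> a (snd u) = fst u \<oplus>\<^bsub>M\<^esub> (- 1) \<odot>\<^bsub>M\<^esub> a (snd u)"
      using padd[OF u(1) lin_closed[OF na u(2)]] neg[OF ac[OF u(2)]] by simp
    then show "fst (fst u \<oplus>\<^bsub>K\<^esub> (- 1) \<odot>\<^bsub>K\<^esub> a (snd u), snd u) \<oplus>\<^bsub>M\<^esub> s (snd (fst u \<oplus>\<^bsub>K\<^esub> (- 1) \<odot>\<^bsub>K\<^esub> a (snd u), snd u)) = fst u \<oplus>\<^bsub>M\<^esub> t (snd u)"
      using m lm(1) by (simp add: t_def lm_assoc lm_comm[of M "(- 1) \<odot>\<^bsub>M\<^esub> a (snd u)"])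
  qed
  have inj: "inj_on t (carrier (dual K))"
  proof (rule inj_onI)
    fix f g assume "f \<in> carrier (dual K)" "g \<in> carrier (dual K)" "t f = t g"
    then show "f = g" using liso_inj[OF smp_liso[OF st], of "(\<zero>\<^bsub>K\<^esub>, f)" "(\<zero>\<^bsub>K\<^esub>, g)"] lm by simp
  qed
  define D where "D = push_based t (dual K) M"
  note D = push_based[OF is_based_dual[OF K] lm(1) tl inj, folded D_def]
  let ?r = "inv_into (carrier (dual K)) t"
  note r = smp_inv[OF D(2)] and ri = liso_inv_into[OF smp_liso[OF D(2)]]
  have sD: "smp (bsum K D) M (\<lambda>u. fst u \<oplus>\<^bsub>M\<^esub> snd u)"
    by (rule smp_cong[OF smp_comp[OF smp_bsum[OF smp_id[OF K] r] st]]) (use ri(2) in auto)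
  have lt: "lam \<phi> (t f) k = f k" if f: "f \<in> carrier (dual K)" and k: "k \<in> carrier K" for f k
  proof -
    have "lam \<phi> (t f) k = lam \<phi> (s f) k + lam \<phi> (a f) k * bar (- 1)"
      unfolding t_def using lm(1) sc[OF f] ic[OF ac[OF f]] ic[OF k]
      by (simp only: pr_add1[OF pr_lam[OF p]] pr_smult1[OF pr_lam[OF p]] lm_smult)
    then show ?thesis using ls[OF f k] nul_lam[OF nK ac[OF f] k] by simp
  qed
  have pD: "perfect D K (lam \<phi>)"
    by (rule perfect_cong[OF perfect_left[OF perfect_eval[OF K] r]]) (use lt[OF ri(1)] ri(2) in auto)
  from nK obtain \<chi> where c: "pr K K \<chi>" "\<And>x y. x \<in> carrier K \<Longrightarrow> y \<in> carrier K \<Longrightarrow> \<phi> x y = asym \<chi> x y + 0"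
    unfolding nul_def by (rule qeqE) (iprover intro: that)
  \<comment> \<open>Since \<open>lam \<phi> (s f) (a g) = \<phi> (s f) (s g)\<close>, one mixed term
    of \<open>\<phi> (t f) (t g)\<close> cancels. The other terms are \<open>asym\<close> of
    \<open>- \<phi> (a f) (s g)\<close>, and \<chi> accounts for \<phi> on \<open>K\<close>.\<close>
  let ?w = "\<lambda>f g. \<chi> (a f) (a g) - \<phi> (a f) (s g)"
  have "qeq (dual K) (\<lambda>f g. \<phi> (t f) (t g)) (\<lambda>_ _. 0)"
  proof (rule qeqI)
    show "pr (dual K) (dual K) ?w"
      by (intro pr_diff pr_comp[OF c(1) al al] pr_comp[OF p lin_comp[OF al i] sl])
    fix f g assume f: "f \<in> carrier (dual K)" and g: "g \<in> carrier (dual K)"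
    note m = sc[OF f] sc[OF g] ic[OF ac[OF f]] ic[OF ac[OF g]]
    have "\<phi> (t f) (t g) = \<phi> (s f) (s g) - \<phi> (s f) (a g) - \<phi> (a f) (s g) + \<phi> (a f) (a g)"
      unfolding t_def using lm(1) m
      by (simp add: pr_add1[OF p] pr_add2[OF p] pr_smult1[OF p] pr_smult2[OF p])
    moreover have "\<phi> (s f) (s g) = \<phi> (s f) (a g) + eps * bar (\<phi> (a g) (s f))"
      using ls[OF f ac[OF g]] fa[OF f g] by (simp add: \<psi>_def lam_def)
    moreover have "\<phi> (a f) (a g) = asym \<chi> (a f) (a g)" using c(2)[OF ac[OF f] ac[OF g]] by simp
    ultimately show "\<phi> (t f) (t g) = asym ?w f g + 0"
      by (simp add: asym_def algebra_simps)
  qed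
  from qeq_pull[OF this smp_lin[OF r]] have "nul D \<phi>"
    unfolding nul_def by (rule qeq_cong) (use ri(2) in auto)
  then have "HP M \<phi> K D" using p i D(3) sD pD nK by (simp add: HP_def)
  then show ?thesis by (rule that)
qed

subsection \<open>Isometries\<close>

definition isom :: "('a, 'm) based_module \<Rightarrow> ('m \<Rightarrow> 'm \<Rightarrow> 'a) \<Rightarrow> ('a, 'n) based_module \<Rightarrow> ('n \<Rightarrow> 'n \<Rightarrow> 'a) \<Rightarrow> ('m \<Rightarrow> 'n) \<Rightarrow> bool" where
  "isom M \<phi> N \<psi> f \<longleftrightarrow> smp M N f \<and> qeq M (\<lambda>x y. \<psi> (f x) (f y)) \<phi>"

lemma isom_smp: "isom M \<phi> N \<psi> f \<Longrightarrow> smp M N f" by (simp add: isom_def)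
lemma isom_qeq: "isom M \<phi> N \<psi> f \<Longrightarrow> qeq M (\<lambda>x y. \<psi> (f x) (f y)) \<phi>" by (simp add: isom_def)

lemma isom_id: "is_based M \<Longrightarrow> qeq M \<psi> \<phi> \<Longrightarrow> isom M \<phi> M \<psi> (\<lambda>x. x)"
  by (simp add: isom_def smp_id)

lemma isom_inv:
  assumes f: "isom M \<phi> N \<psi> f" shows "isom N \<psi> M \<phi> (inv_into (carrier M) f)"
proof -
  note i = smp_inv[OF isom_smp[OF f]]
  have "qeq N (\<lambda>x y. \<phi> (inv_into (carrier M) f x) (inv_into (carrier M) f y)) \<psi>"
    by (rule qeq_cong[OF qeq_pull[OF qeq_sym[OF isom_qeq[OF f]] smp_lin[OF i]]])
      (simp_all add: liso_inv_into[OF smp_liso[OF isom_smp[OF f]]])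
  with i show ?thesis by (simp add: isom_def)
qed

lemma isom_comp:
  assumes f: "isom M \<phi> N \<psi> f" and g: "isom N \<psi> P \<omega> g" shows "isom M \<phi> P \<omega> (\<lambda>x. g (f x))"
  unfolding isom_def
  using smp_comp[OF isom_smp[OF f] isom_smp[OF g]] qeq_trans[OF qeq_pull[OF isom_qeq[OF g] smp_lin[OF isom_smp[OF f]]] isom_qeq[OF f]]
  by simp

lemma isom_osum:
  assumes f: "isom M \<phi> M' \<phi>' f" and g: "isom N \<psi> N' \<psi>' g"
  shows "isom (bsum M N) (osum \<phi> \<psi>) (bsum M' N') (osum \<phi>' \<psi>') (map_prod f g)"
proof -
  note b = smp_based(1)[OF isom_smp[OF f]] smp_based(1)[OF isom_smp[OF g]]
  have "qeq (msum M N) (osum (\<lambda>x y. \<phi>' (f x) (f y)) (\<lambda>x y. \<psi>' (g x) (g y))) (osum \<phi> \<psi>)"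
    using b by (intro qeq_osum isom_qeq[OF f] isom_qeq[OF g]) simp_all
  then show ?thesis
    using smp_bsum[OF isom_smp[OF f] isom_smp[OF g]] by (simp add: isom_def qeq_bsum osum_def[abs_def])
qed

lemma isom_swap: "is_based M \<Longrightarrow> is_based N \<Longrightarrow> isom (bsum M N) (osum \<phi> \<psi>) (bsum N M) (osum \<psi> \<phi>) (\<lambda>u. (snd u, fst u))"
  by (simp add: isom_def smp_swap osum_def qeq_refl add.commute)

lemma isom_assoc: "is_based M \<Longrightarrow> is_based N \<Longrightarrow> is_based P \<Longrightarrow>
    isom (bsum (bsum M N) P) (osum (osum \<phi> \<psi>) \<omega>) (bsum M (bsum N P)) (osum \<phi> (osum \<psi> \<omega>)) (\<lambda>u. (fst (fst u), (snd (fst u), snd u)))"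
  by (simp add: isom_def smp_assoc osum_def qeq_refl add.assoc)

lemma smp_iff_simple_iso:
  assumes "is_based M" "is_based N" "F \<in> extensional (carrier M)"
  shows "simple_iso M N F \<longleftrightarrow> smp M N F"
  using assms by (simp add: smp_def extensional_restrict)

lemma simple_iso_ext: "simple_iso M N F \<Longrightarrow> F \<in> extensional (carrier M)"
  by (auto simp: simple_iso_def miso_def mhom_def PiE_def)

lemma isometryD:
  assumes b: "is_based M" "is_based N" and p: "pr M M \<phi>" "pr N N \<psi>"
    and i: "is_isometry (M, Qc M \<phi>) (N, Qc N \<psi>) F"
  shows "isom M \<phi> N \<psi> F"
proof -
  have lm: "left_module M" "left_module N" using b by simp_all
  have s: "smp M N F" using i smp_iff_simple_iso[OF b simple_iso_ext] by auto
  have "Qc M (\<lambda>x y. \<psi> (F x) (F y)) = Qc M \<phi>" using i Q_pull_Qc[OF lm p(2) smp_lin[OF s]] by simp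
  then show ?thesis
    using s Qc_eq_iff[OF lm(1) pr_comp[OF p(2) smp_lin[OF s] smp_lin[OF s]] p(1)] by (simp add: isom_def)
qed

lemma isometryI:
  assumes p: "pr M M \<phi>" "pr N N \<psi>" and i: "isom M \<phi> N \<psi> f"
  shows "is_isometry (M, Qc M \<phi>) (N, Qc N \<psi>) (restrict f (carrier M))"
proof -
  note s = isom_smp[OF i]
  have lm: "left_module M" "left_module N" using smp_based[OF s] by simp_all
  show ?thesis
    using s isom_qeq[OF i] Qc_eq_iff[OF lm(1) pr_comp[OF p(2) smp_lin[OF s] smp_lin[OF s]] p(1)]
    by (simp add: Q_pull_restrict Q_pull_Qc[OF lm p(2) smp_lin[OF s]] smp_def)
qed

subsection \<open>Isomorphisms of quasi-formations\<close>

definition ret :: "('a, 'm) based_module \<Rightarrow> ('a, 'm) based_module \<Rightarrow> bool" where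
  "ret V M \<longleftrightarrow> is_based V \<and> lin V M (\<lambda>x. x) \<and> (\<exists>p. lin M V p \<and> (\<forall>x\<in>carrier V. p x = x))"

definition qfr :: "('a, 'm) based_module \<Rightarrow> ('m \<Rightarrow> 'm \<Rightarrow> 'a) \<Rightarrow> ('a, 'm) based_module \<Rightarrow> ('a, 'm) based_module \<Rightarrow> bool" where
  "qfr M \<phi> L V \<longleftrightarrow> (\<exists>D. HP M \<phi> L D) \<and> ret V M \<and> 2 * rank V = rank M"

lemma ret_iff: "is_based M \<Longrightarrow> ret V M \<longleftrightarrow> is_based V \<and> direct_summand V M"
proof
  assume M: "is_based M" and "ret V M"
  then obtain p where "is_based V" "lin V M (\<lambda>x. x)" "lin M V p" "\<forall>x\<in>carrier V. p x = x"
    unfolding ret_def by blast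
  with M show "is_based V \<and> direct_summand V M"
    using direct_summandI[of V M p] by simp
next
  assume M: "is_based M" and d: "is_based V \<and> direct_summand V M"
  obtain p where "left_module V" "lin V M (\<lambda>x. x)" "lin M V p" "\<And>x. x \<in> carrier V \<Longrightarrow> p x = x"
    by (rule direct_summandE[OF conjunct2[OF d] is_based_left_module[OF M]]) (iprover intro: that)
  with d show "ret V M" unfolding ret_def by blast
qed

text \<open>Translation to representatives: \<open>lagrangian_complement\<close> finds the
  complement of \<open>L\<close> hidden in the definition of a simple Lagrangian, and
  \<open>HP_simple\<close> recovers the definition.\<close>

lemma qformation_iff:
  "is_qformation (M, \<theta>, L, V) \<longleftrightarrow> (\<exists>\<phi>. \<theta> = Qc M \<phi> \<and> qfr M \<phi> L V)"
proof
  assume q: "is_qformation (M, \<theta>, L, V)"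
  then have M: "is_based M" by simp
  then obtain \<phi> where p: "\<theta> = Qc M \<phi>" "pr M M \<phi>" using q Q_eps_carrier[of M] by auto
  obtain D where "HP M \<phi> L D" by (rule lagrangian_complement[of M \<phi> L]) (use q p in auto)
  then show "\<exists>\<phi>. \<theta> = Qc M \<phi> \<and> qfr M \<phi> L V"
    using q p ret_iff[OF M] unfolding qfr_def by auto
next
  assume "\<exists>\<phi>. \<theta> = Qc M \<phi> \<and> qfr M \<phi> L V"
  then obtain \<phi> D where p: "\<theta> = Qc M \<phi>" "HP M \<phi> L D" "ret V M" "2 * rank V = rank M"
    unfolding qfr_def by blast
  then show "is_qformation (M, \<theta>, L, V)"
    using HP_simple[OF p(2)] ret_iff[OF HPD(8)[OF p(2)]] by simp
qed

text \<open>One function serves for all three modules; that it carries \<open>L\<close> onto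
  \<open>L'\<close> and \<open>V\<close> onto \<open>V'\<close> is contained in
  \<open>smp\<close>.\<close>

definition qisor where
  "qisor M \<phi> L V M' \<phi>' L' V' f \<longleftrightarrow> isom M \<phi> M' \<phi>' f \<and> smp L L' f \<and> smp V V' f"

lemma qfrD:
  assumes "qfr M \<phi> L V"
  shows "pr M M \<phi>" "is_based M" "is_based L" "is_based V" "lin L M (\<lambda>x. x)" "lin V M (\<lambda>x. x)"
proof -
  obtain D where h: "HP M \<phi> L D" and r: "ret V M" using assms unfolding qfr_def by blast
  show "pr M M \<phi>" "is_based M" "is_based L" "lin L M (\<lambda>x. x)" by (rule HPD[OF h])+
  show "is_based V" "lin V M (\<lambda>x. x)" using r by (simp_all add: ret_def)
qed

lemma lin_id_subset: "lin L M (\<lambda>x. x) \<Longrightarrow> x \<in> carrier L \<Longrightarrow> x \<in> carrier M"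
  by (drule lin_closed)

lemma smp_image: "smp M N f \<Longrightarrow> f ` carrier M = carrier N"
  using liso_bij[OF smp_liso[of M N f]] by (simp add: bij_betw_def)

lemma qf_isomorphic_iff:
  assumes q: "qfr M \<phi> L V" and q': "qfr M' \<phi>' L' V'"
  shows "qf_isomorphic (M, Qc M \<phi>, L, V) (M', Qc M' \<phi>', L', V') \<longleftrightarrow> (\<exists>f. qisor M \<phi> L V M' \<phi>' L' V' f)"
proof
  note d = qfrD[OF q] and d' = qfrD[OF q']
  assume "qf_isomorphic (M, Qc M \<phi>, L, V) (M', Qc M' \<phi>', L', V')"
  then obtain F where F: "is_isometry (M, Qc M \<phi>) (M', Qc M' \<phi>') F"
    "simple_iso L L' (restrict F (carrier L))" "simple_iso V V' (restrict F (carrier V))" by auto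
  then show "\<exists>f. qisor M \<phi> L V M' \<phi>' L' V' f"
    using isometryD[OF d(2) d'(2) d(1) d'(1) F(1)] d d' unfolding qisor_def smp_def by blast
next
  note d = qfrD[OF q] and d' = qfrD[OF q']
  assume "\<exists>f. qisor M \<phi> L V M' \<phi>' L' V' f"
  then obtain f where f: "isom M \<phi> M' \<phi>' f" "smp L L' f" "smp V V' f" by (auto simp: qisor_def)
  let ?F = "restrict f (carrier M)"
  have e: "restrict ?F (carrier L) = restrict f (carrier L)" "restrict ?F (carrier V) = restrict f (carrier V)"
    using lin_id_subset[OF d(5)] lin_id_subset[OF d(6)] by (auto simp: restrict_def fun_eq_iff)
  have im: "?F ` carrier L = f ` carrier L" "?F ` carrier V = f ` carrier V"
    by (rule image_cong[OF refl], simp add: lin_id_subset[OF d(5)] lin_id_subset[OF d(6)])+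
  show "qf_isomorphic (M, Qc M \<phi>, L, V) (M', Qc M' \<phi>', L', V')"
    unfolding qf_isomorphic.simps
    by (rule exI[of _ ?F])
      (use f(2,3) in \<open>simp only: isometryI[OF d(1) d'(1) f(1)] im e smp_image[OF f(2)] smp_image[OF f(3)] smp_def simp_thms\<close>)
qed

text \<open>The inverse is taken on all of \<open>M\<close>, so that a single map inverts the
  isometry together with its restrictions, as \<open>qisor\<close> demands.\<close>

lemma smp_inv_sub:
  assumes f: "smp M M' f" and g: "smp L L' f" and l: "lin L M (\<lambda>x. x)"
  shows "smp L' L (inv_into (carrier M) f)"
proof (rule smp_inverse[OF g])
  fix y assume "y \<in> carrier L'"
  then obtain x where "x \<in> carrier L" "y = f x" using smp_image[OF g] by blast
  then show "inv_into (carrier M) f y \<in> carrier L \<and> f (inv_into (carrier M) f y) = y"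
    using liso_inv_into(3)[OF smp_liso[OF f] lin_id_subset[OF l]] by simp
qed

lemma qisor_refl: "qfr M \<phi> L V \<Longrightarrow> qisor M \<phi> L V M \<phi> L V (\<lambda>x. x)"
  unfolding qisor_def using isom_id[OF _ qeq_refl] smp_id qfrD by metis

lemma qisor_inv:
  "qfr M \<phi> L V \<Longrightarrow> qisor M \<phi> L V M' \<phi>' L' V' f \<Longrightarrow> qisor M' \<phi>' L' V' M \<phi> L V (inv_into (carrier M) f)"
  unfolding qisor_def using isom_inv smp_inv_sub isom_smp qfrD by metis

lemma qisor_comp:
  "qisor M \<phi> L V M' \<phi>' L' V' f \<Longrightarrow> qisor M' \<phi>' L' V' M'' \<phi>'' L'' V'' g \<Longrightarrow> qisor M \<phi> L V M'' \<phi>'' L'' V'' (\<lambda>x. g (f x))"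
  unfolding qisor_def using isom_comp smp_comp by metis

lemma qisor_sum:
  "qisor M \<phi> L V M' \<phi>' L' V' f \<Longrightarrow> qisor N \<psi> K W N' \<psi>' K' W' g \<Longrightarrow>
   qisor (bsum M N) (osum \<phi> \<psi>) (bsum L K) (bsum V W) (bsum M' N') (osum \<phi>' \<psi>') (bsum L' K') (bsum V' W') (map_prod f g)"
  unfolding qisor_def using isom_osum smp_bsum by metis

lemma ret_bsum: assumes "ret V M" "ret W N" shows "ret (bsum V W) (bsum M N)"
proof -
  from assms obtain p r where p: "is_based V" "lin V M (\<lambda>x. x)" "lin M V p" "\<forall>x\<in>carrier V. p x = x"
    and r: "is_based W" "lin W N (\<lambda>x. x)" "lin N W r" "\<forall>x\<in>carrier W. r x = x"
    unfolding ret_def by blast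
  have "lin (bsum V W) (bsum M N) (\<lambda>x. x)" using p(2) r(2) by (auto simp: lin_def)
  moreover have "lin (bsum M N) (bsum V W) (map_prod p r)" unfolding lin_bsum by (rule lin_map_prod[OF p(3) r(3)])
  moreover have "\<forall>x\<in>carrier (bsum V W). map_prod p r x = x" using p(4) r(4) by auto
  ultimately show ?thesis using p(1) r(1) is_based_bsum unfolding ret_def by blast
qed

section \<open>Sums and transport of complementary Lagrangians\<close>

lemma smp_interchange:
  assumes b: "is_based A" "is_based B" "is_based C" "is_based E"
  shows "smp (bsum (bsum A B) (bsum C E)) (bsum (bsum A C) (bsum B E))
     (\<lambda>u. ((fst (fst u), fst (snd u)), (snd (fst u), snd (snd u))))"
proof -
  note nb = is_based_bsum
  let ?inv = "\<lambda>u. ((fst u, fst (snd u)), snd (snd u))"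
  have as: "smp (bsum X (bsum Y W)) (bsum (bsum X Y) W) (\<lambda>u. ((fst u, fst (snd u)), snd (snd u)))"
    if "is_based X" "is_based Y" "is_based W" for X :: "('a, 'x) based_module" and Y :: "('a, 'y) based_module" and W :: "('a, 'w) based_module"
    by (rule smp_inverse[OF smp_assoc[OF that]]) auto
  have m: "smp (bsum B (bsum C E)) (bsum C (bsum B E)) (\<lambda>u. (fst (snd u), (fst u, snd (snd u))))"
    using smp_comp[OF as[OF b(2,3,4)] smp_comp[OF smp_bsum[OF smp_swap[OF b(2,3)] smp_id[OF b(4)]] smp_assoc[OF b(3,2,4)]]]
    by simp
  show ?thesis
    using smp_comp[OF smp_assoc[OF b(1,2) nb[OF b(3,4)]] smp_comp[OF smp_bsum[OF smp_id[OF b(1)] m] as[OF b(1,3) nb[OF b(2,4)]]]]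
    by simp
qed

lemma nul_osum: "left_module K \<Longrightarrow> left_module K' \<Longrightarrow> nul K \<phi> \<Longrightarrow> nul K' \<phi>' \<Longrightarrow> nul (bsum K K') (osum \<phi> \<phi>')"
  unfolding nul_def qeq_bsum using qeq_osum[of K K' \<phi> "\<lambda>_ _. 0" \<phi>' "\<lambda>_ _. 0"] by (simp add: osum_def[abs_def])

lemma HP_sum:
  assumes h: "HP M \<phi> K D" and h': "HP M' \<phi>' K' D'"
  shows "HP (bsum M M') (osum \<phi> \<phi>') (bsum K K') (bsum D D')"
proof -
  note H = HPD[OF h] and H' = HPD[OF h']
  have "lin (bsum K K') (bsum M M') (\<lambda>x. x)" "lin (bsum D D') (bsum M M') (\<lambda>x. x)"
    using H(2,3) H'(2,3) by (auto simp: lin_def)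
  moreover have "smp (bsum (bsum K K') (bsum D D')) (bsum M M') (\<lambda>u. fst u \<oplus>\<^bsub>bsum M M'\<^esub> snd u)"
    by (rule smp_cong[OF smp_comp[OF smp_interchange[OF H(9) H'(9) H(10) H'(10)] smp_bsum[OF H(4) H'(4)]]]) simp
  moreover have "perfect (bsum D D') (bsum K K') (lam (osum \<phi> \<phi>'))"
    using perfect_sum[OF H(5) H'(5)] unfolding lam_osum by (simp add: osum_def[abs_def])
  moreover have "pr (bsum M M') (bsum M M') (osum \<phi> \<phi>')" using pr_osum[OF H(1) H'(1)] by (simp add: pr_like)
  ultimately show ?thesis using H H' unfolding HP_def by (simp add: nul_osum)
qed

lemma qfr_sum: "qfr M \<phi> L V \<Longrightarrow> qfr M' \<phi>' L' V' \<Longrightarrow> qfr (bsum M M') (osum \<phi> \<phi>') (bsum L L') (bsum V V')"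
proof -
  assume q: "qfr M \<phi> L V" and q': "qfr M' \<phi>' L' V'"
  obtain D where h: "HP M \<phi> L D" and r: "ret V M" "2 * rank V = rank M" using q unfolding qfr_def by blast
  obtain D' where h': "HP M' \<phi>' L' D'" and r': "ret V' M'" "2 * rank V' = rank M'" using q' unfolding qfr_def by blast
  show ?thesis
    unfolding qfr_def
    using HP_sum[OF h h'] ret_bsum[OF r(1) r'(1)] r(2) r'(2)
      rank_bsum[OF qfrD(2)[OF q] qfrD(2)[OF q']] rank_bsum[OF qfrD(4)[OF q] qfrD(4)[OF q']] by auto
qed

lemma qisor_swap:
  "qfr M \<phi> L V \<Longrightarrow> qfr N \<psi> K W \<Longrightarrow>
   qisor (bsum M N) (osum \<phi> \<psi>) (bsum L K) (bsum V W) (bsum N M) (osum \<psi> \<phi>) (bsum K L) (bsum W V) (\<lambda>u. (snd u, fst u))"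
  unfolding qisor_def by (simp add: isom_swap smp_swap qfrD)

lemma qisor_assoc:
  "qfr M \<phi> L V \<Longrightarrow> qfr N \<psi> K W \<Longrightarrow> qfr P \<omega> J X \<Longrightarrow>
   qisor (bsum (bsum M N) P) (osum (osum \<phi> \<psi>) \<omega>) (bsum (bsum L K) J) (bsum (bsum V W) X)
     (bsum M (bsum N P)) (osum \<phi> (osum \<psi> \<omega>)) (bsum L (bsum K J)) (bsum V (bsum W X)) (\<lambda>u. (fst (fst u), (snd (fst u), snd u)))"
  unfolding qisor_def by (simp add: isom_assoc smp_assoc qfrD)

lemma HP_isom:
  assumes h: "HP M \<phi> K D" and p: "pr N N \<psi>" and f: "isom M \<phi> N \<psi> f"
    and k: "smp K K' f" "lin K' N (\<lambda>x. x)" and d: "smp D D' f" "lin D' N (\<lambda>x. x)"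
  shows "HP N \<psi> K' D'"
proof -
  note H = HPD[OF h] and s = isom_smp[OF f]
  let ?k = "inv_into (carrier K) f" and ?d = "inv_into (carrier D) f"
  note ki = smp_inv[OF k(1)] liso_inv_into[OF smp_liso[OF k(1)]]
    and di = smp_inv[OF d(1)] liso_inv_into[OF smp_liso[OF d(1)]]
  have kM: "?k x \<in> carrier M" if "x \<in> carrier K'" for x using lin_closed[OF H(2) ki(2)[OF that]] .
  have dM: "?d x \<in> carrier M" if "x \<in> carrier D'" for x using lin_closed[OF H(3) di(2)[OF that]] .
  have "smp (bsum K' D') N (\<lambda>u. fst u \<oplus>\<^bsub>N\<^esub> snd u)"
    by (rule smp_cong[OF smp_comp[OF smp_comp[OF smp_bsum[OF ki(1) di(1)] H(4)] s]])
      (auto simp: lin_add[OF smp_lin[OF s]] kM dM ki di)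
  moreover have "perfect D' K' (lam \<psi>)"
  proof (rule perfect_cong[OF perfect_right[OF perfect_left[OF H(5) di(1)] ki(1)]])
    fix x y assume x: "x \<in> carrier D'" and y: "y \<in> carrier K'"
    show "lam \<phi> (?d x) (?k y) = lam \<psi> x y"
      using qeq_lam[OF isom_qeq[OF f] dM[OF x] kM[OF y]] di(3)[OF x] ki(3)[OF y] by (simp add: lam_def)
  qed
  moreover have "nul K' \<psi>"
  proof -
    have "qeq K (\<lambda>x y. \<psi> (f x) (f y)) (\<lambda>_ _. 0)"
      by (rule qeq_trans[OF qeq_pull[OF isom_qeq[OF f] H(2)] H(6)[unfolded nul_def]])
    from qeq_pull[OF this smp_lin[OF ki(1)]] show ?thesis
      unfolding nul_def by (rule qeq_cong) (simp_all add: ki)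
  qed
  moreover have "nul D' \<psi>"
  proof -
    have "qeq D (\<lambda>x y. \<psi> (f x) (f y)) (\<lambda>_ _. 0)"
      by (rule qeq_trans[OF qeq_pull[OF isom_qeq[OF f] H(3)] H(7)[unfolded nul_def]])
    from qeq_pull[OF this smp_lin[OF di(1)]] show ?thesis
      unfolding nul_def by (rule qeq_cong) (simp_all add: di)
  qed
  ultimately show ?thesis using p k d by (simp add: HP_def)
qed

lemma push_sub:
  assumes f: "smp M N f" and V: "is_based V" and i: "lin V M (\<lambda>x. x)"
  shows "smp V (push_based f V N) f" "lin (push_based f V N) N (\<lambda>x. x)"
proof -
  have inj: "inj_on f (carrier V)"
    using liso_inj[OF smp_liso[OF f] lin_id_subset[OF i] lin_id_subset[OF i]] by (rule inj_onI)
  note p = push_based[OF V is_based_left_module[OF smp_based(2)[OF f]] lin_comp[OF i smp_lin[OF f]] inj]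
  show "smp V (push_based f V N) f" "lin (push_based f V N) N (\<lambda>x. x)" by (rule p)+
qed

lemma ret_isom:
  assumes f: "smp M N f" and r: "ret V M" and g: "smp V V' f" and i: "lin V' N (\<lambda>x. x)"
  shows "ret V' N"
proof -
  obtain p where p: "lin V M (\<lambda>x. x)" "lin M V p" "\<forall>x\<in>carrier V. p x = x" using r unfolding ret_def by blast
  let ?g = "inv_into (carrier M) f"
  have "lin N V' (\<lambda>y. f (p (?g y)))"
    by (rule lin_comp[OF lin_comp[OF smp_lin[OF smp_inv[OF f]] p(2)] smp_lin[OF g]])
  moreover have "\<forall>x\<in>carrier V'. f (p (?g x)) = x"
  proof
    fix y assume "y \<in> carrier V'"
    then obtain x where x: "x \<in> carrier V" "y = f x" using smp_image[OF g] by blast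
    then show "f (p (?g y)) = y"
      using liso_inv_into(3)[OF smp_liso[OF f] lin_id_subset[OF p(1)]] p(3) by simp
  qed
  ultimately show ?thesis using smp_based(2)[OF g] i unfolding ret_def by blast
qed

text \<open>Transport of structure along \<open>f\<close>; with \<open>univ_based\<close> it gives
  every quasi-formation an isomorphic copy in the universe.\<close>

lemma qfr_push:
  assumes q: "qfr M \<phi> L V" and f: "smp M N f"
  defines "\<psi> \<equiv> \<lambda>x y. \<phi> (inv_into (carrier M) f x) (inv_into (carrier M) f y)"
  shows "qfr N \<psi> (push_based f L N) (push_based f V N)"
    "qisor M \<phi> L V N \<psi> (push_based f L N) (push_based f V N) f"
proof -
  note d = qfrD[OF q]
  let ?g = "inv_into (carrier M) f"
  let ?\<psi> = "\<psi>"
  have p: "pr N N ?\<psi>" unfolding \<psi>_def by (rule pr_comp[OF d(1) smp_lin[OF smp_inv[OF f]] smp_lin[OF smp_inv[OF f]]])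
  have i: "isom M \<phi> N ?\<psi> f"
    unfolding isom_def \<psi>_def using f by (simp add: qeq_refl liso_inv_into(3)[OF smp_liso[OF f]])
  obtain D where h: "HP M \<phi> L D" and r: "ret V M" "2 * rank V = rank M" using q unfolding qfr_def by blast
  note H = HPD[OF h]
  note L = push_sub[OF f d(3) d(5)] and V = push_sub[OF f d(4) d(6)] and D = push_sub[OF f H(10,3)]
  show "qfr N ?\<psi> (push_based f L N) (push_based f V N)"
    unfolding qfr_def using HP_isom[OF h p i L D] ret_isom[OF f r(1) V] r(2) rank_smp[OF V(1)] rank_smp[OF f] by auto
  show "qisor M \<phi> L V N ?\<psi> (push_based f L N) (push_based f V N) f"
    using i L V by (simp add: qisor_def)
qed

subsection \<open>Hyperbolic forms\<close>

definition hyp :: "'m \<times> ('m \<Rightarrow> 'a) \<Rightarrow> 'm \<times> ('m \<Rightarrow> 'a) \<Rightarrow> 'a" where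
  "hyp u v = snd u (fst v)"

definition Hm :: "('a, 'm) based_module \<Rightarrow> ('a, 'm \<times> ('m \<Rightarrow> 'a)) based_module" where
  "Hm P = bsum P (dual P)"
definition iL :: "('a, 'm) based_module \<Rightarrow> ('a, 'm \<times> ('m \<Rightarrow> 'a)) based_module" where
  "iL P = push_based (\<lambda>x. (x, \<zero>\<^bsub>dual P\<^esub>)) P (Hm P)"
definition iD :: "('a, 'm) based_module \<Rightarrow> ('a, 'm \<times> ('m \<Rightarrow> 'a)) based_module" where
  "iD P = push_based (\<lambda>g. (\<zero>\<^bsub>P\<^esub>, g)) (dual P) (Hm P)"
definition iG :: "('a, 'm) based_module \<Rightarrow> ('m \<Rightarrow> 'm \<Rightarrow> 'a) \<Rightarrow> ('a, 'm \<times> ('m \<Rightarrow> 'a)) based_module" where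
  "iG P \<rho> = push_based (\<lambda>x. (x, \<rho> x)) P (Hm P)"

lemma hyperbolic_eq: "hyperbolic P = (Hm P, Qc (Hm P) hyp)"
  by (simp add: hyperbolic_def Let_def Hm_def Qc_def ext2_def hyp_def)

lemma trivial_formation_eq: "trivial_formation P = (Hm P, Qc (Hm P) hyp, iL P, iD P)"
  by (simp add: trivial_formation_def Let_def hyperbolic_eq iL_def iD_def)

lemma boundary_eq: "boundary P \<rho> = (Hm P, Qc (Hm P) hyp, iL P, iG P \<rho>)"
  by (simp add: boundary_def Let_def hyperbolic_eq iL_def iG_def)

lemma based_Hm: "is_based P \<Longrightarrow> is_based (Hm P)" by (simp add: Hm_def)

lemma left_module_dual [simp]: "is_based P \<Longrightarrow> left_module (dual P)" by simp

lemma iL: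
  assumes P: "is_based P"
  shows "smp P (iL P) (\<lambda>x. (x, \<zero>\<^bsub>dual P\<^esub>))" "lin (iL P) (Hm P) (\<lambda>x. x)"
proof -
  have l: "lin P (Hm P) (\<lambda>x. (x, \<zero>\<^bsub>dual P\<^esub>))"
    by (rule linI) (use P in \<open>auto simp: Hm_def simp del: dual_simps\<close>)
  have "left_module (Hm P)" using based_Hm[OF P] by simp
  from push_based[OF P this l] show "smp P (iL P) (\<lambda>x. (x, \<zero>\<^bsub>dual P\<^esub>))" "lin (iL P) (Hm P) (\<lambda>x. x)"
    unfolding iL_def by (simp_all add: inj_on_def)
qed

lemma iD:
  assumes P: "is_based P"
  shows "smp (dual P) (iD P) (\<lambda>g. (\<zero>\<^bsub>P\<^esub>, g))" "lin (iD P) (Hm P) (\<lambda>x. x)"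
proof -
  have l: "lin (dual P) (Hm P) (\<lambda>g. (\<zero>\<^bsub>P\<^esub>, g))"
    by (rule linI) (use P in \<open>auto simp: Hm_def simp del: dual_simps\<close>)
  have "left_module (Hm P)" using based_Hm[OF P] by simp
  from push_based[OF is_based_dual[OF P] this l] show "smp (dual P) (iD P) (\<lambda>g. (\<zero>\<^bsub>P\<^esub>, g))" "lin (iD P) (Hm P) (\<lambda>x. x)"
    unfolding iD_def by (simp_all add: inj_on_def)
qed

lemma iG:
  assumes P: "is_based P" and r: "\<rho> \<in> mhom P (dual_module P)"
  shows "smp P (iG P \<rho>) (\<lambda>x. (x, \<rho> x))" "lin (iG P \<rho>) (Hm P) (\<lambda>x. x)"
proof -
  have rl: "lin P (dual P) \<rho>" using mhom_lin[OF r] by (simp add: dual_like)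
  have l: "lin P (Hm P) (\<lambda>x. (x, \<rho> x))"
    by (rule linI) (use P lin_closed[OF rl] in \<open>auto simp: Hm_def lin_add[OF rl] lin_smult[OF rl] simp del: dual_simps\<close>)
  have "left_module (Hm P)" using based_Hm[OF P] by simp
  from push_based[OF P this l] show "smp P (iG P \<rho>) (\<lambda>x. (x, \<rho> x))" "lin (iG P \<rho>) (Hm P) (\<lambda>x. x)"
    unfolding iG_def by (simp_all add: inj_on_def)
qed

lemma pr_hyp: "pr (Hm P) (Hm P) hyp"
proof -
  have "lin (Hm P) (dual_module P) snd" "lin (Hm P) P fst" by (simp_all add: Hm_def lin_def)
  from pr_comp[OF pr_eval this] show ?thesis by (simp add: hyp_def[abs_def])
qed

lemma carrier_iL: "carrier (iL P) = (\<lambda>x. (x, \<zero>\<^bsub>dual P\<^esub>)) ` carrier P" and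
  carrier_iD: "carrier (iD P) = (\<lambda>g. (\<zero>\<^bsub>P\<^esub>, g)) ` carrier (dual P)" and
  carrier_iG: "carrier (iG P \<rho>) = (\<lambda>x. (x, \<rho> x)) ` carrier P" and
  carrier_Hm: "carrier (Hm P) = carrier P \<times> carrier (dual P)"
  by (simp_all add: iL_def iD_def iG_def Hm_def)

lemma iL_fst: assumes P: "is_based P" shows "smp (iL P) P fst"
  by (rule smp_inverse[OF iL(1)[OF P]]) (auto simp: carrier_iL)

lemma iD_snd: assumes P: "is_based P" shows "smp (iD P) (dual P) snd"
  by (rule smp_inverse[OF iD(1)[OF P]]) (auto simp: carrier_iD)

lemma dual_zero: "is_based P \<Longrightarrow> g \<in> carrier (dual P) \<Longrightarrow> g \<zero>\<^bsub>P\<^esub> = 0"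
  using lin_zero[OF _ left_module_ring, of P g] mhom_lin[of g P ring_module] by simp

lemma HP_hyperbolic: assumes P: "is_based P" shows "HP (Hm P) hyp (iL P) (iD P)"
proof -
  have lm: "left_module P" using P by simp
  have "smp (bsum (iL P) (iD P)) (Hm P) (\<lambda>u. fst u \<oplus>\<^bsub>Hm P\<^esub> snd u)"
  proof -
    have "smp (bsum (iL P) (iD P)) (Hm P) (map_prod fst snd)"
      unfolding Hm_def by (rule smp_bsum[OF iL_fst[OF P] iD_snd[OF P]])
    then show ?thesis
    proof (rule smp_cong)
      fix u assume "u \<in> carrier (bsum (iL P) (iD P))"
      then obtain x g where u: "u = ((x, \<zero>\<^bsub>dual P\<^esub>), (\<zero>\<^bsub>P\<^esub>, g))" "x \<in> carrier P" "g \<in> carrier (dual P)"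
        by (auto simp: carrier_iL carrier_iD)
      have "\<zero>\<^bsub>dual P\<^esub> \<oplus>\<^bsub>dual P\<^esub> g = g" by (rule lm_l_zero[OF left_module_dual[OF P] u(3)])
      then show "map_prod fst snd u = fst u \<oplus>\<^bsub>Hm P\<^esub> snd u"
        unfolding u(1) Hm_def bsum_simps using u lm by (simp del: dual_simps)
    qed
  qed
  moreover have "perfect (iD P) (iL P) (lam hyp)"
    by (rule perfect_cong[OF perfect_right[OF perfect_left[OF perfect_eval[OF P] iD_snd[OF P]] iL_fst[OF P]]])
      (use lm in \<open>auto simp: carrier_iL carrier_iD lam_def hyp_def\<close>)
  moreover have "nul (iL P) hyp"
    unfolding nul_def by (rule qeq_refl) (auto simp: carrier_iL hyp_def)
  moreover have "nul (iD P) hyp"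
    unfolding nul_def by (rule qeq_refl) (auto simp: carrier_iD hyp_def dual_zero[OF P])
  ultimately show ?thesis using iL(2)[OF P] iD(2)[OF P] pr_hyp by (simp add: HP_def)
qed

lemma rank_Hm: "is_based P \<Longrightarrow> rank (Hm P) = 2 * rank P"
  by (simp add: Hm_def rank_bsum rank_dual)

lemma HP_ret: assumes h: "HP M \<phi> K D" shows "ret K M" "ret D M"
  using ret_iff[OF HPD(8)[OF h]] HPD(9,10)[OF h] HP_summand[OF h] HP_summand[OF HP_sym[OF h]] by blast+

lemma HP_rank: assumes h: "HP M \<phi> K D" shows "rank D = rank K" "rank M = 2 * rank K"
  using rank_smp[OF perfectD(4)[OF HPD(5)[OF h]]] rank_dual[OF HPD(9)[OF h]]
    rank_smp[OF HPD(4)[OF h]] rank_bsum[OF HPD(9,10)[OF h]] by simp_all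

lemma qfr_triv: assumes P: "is_based P" shows "qfr (Hm P) hyp (iL P) (iD P)"
  unfolding qfr_def using HP_hyperbolic[OF P] HP_ret[OF HP_hyperbolic[OF P]] HP_rank[OF HP_hyperbolic[OF P]] by auto

lemma qfr_boundary:
  assumes P: "is_based P" and r: "\<rho> \<in> mhom P (dual_module P)" shows "qfr (Hm P) hyp (iL P) (iG P \<rho>)"
proof -
  note g = iG[OF P r]
  have "lin (Hm P) P fst" by (simp add: Hm_def lin_def)
  from lin_comp[OF this smp_lin[OF g(1)]] have "lin (Hm P) (iG P \<rho>) (\<lambda>u. (fst u, \<rho> (fst u)))" .
  then have "ret (iG P \<rho>) (Hm P)"
    unfolding ret_def using smp_based(2)[OF g(1)] g(2) by (auto simp: carrier_iG)
  then show ?thesis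
    unfolding qfr_def using HP_hyperbolic[OF P] rank_smp[OF g(1)] rank_Hm[OF P] by auto
qed

text \<open>Complementary Lagrangians are hyperbolic: \<open>R\<close> is sent to \<open>K\<close>
  by \<open>g\<close>, and \<open>dual R\<close> to \<open>D\<close> by inverting the pairing. The
  parameter \<open>g\<close> allows \<open>R\<close> to be chosen in another type than
  \<open>K\<close>.\<close>

lemma HP_model:
  assumes h: "HP M \<phi> K D" and g: "smp R K g"
  obtains f where "isom (Hm R) hyp M \<phi> f" "smp (iL R) K f" "smp (iD R) D f"
    "\<And>r d. r \<in> carrier R \<Longrightarrow> d \<in> carrier D \<Longrightarrow> f (r, \<lambda>x\<in>carrier R. lam \<phi> d (g x)) = g r \<oplus>\<^bsub>M\<^esub> d"
proof -
  note H = HPD[OF h]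
  have R: "is_based R" by (rule smp_based(1)[OF g])
  have lm: "left_module M" "left_module K" "left_module D" "left_module R" using H R by simp_all
  note kc = lin_closed[OF H(2)] and dc = lin_closed[OF H(3)] and gc = smp_closed[OF g]
  have pf: "perfect D R (\<lambda>d r. lam \<phi> d (g r))" by (rule perfect_right[OF H(5) g])
  let ?e = "\<lambda>d. \<lambda>r\<in>carrier R. lam \<phi> d (g r)"
  let ?d = "inv_into (carrier D) ?e"
  note e = perfectD(4)[OF pf]
  note d = smp_inv[OF e] and di = liso_inv_into[OF smp_liso[OF e]]
  define f where "f u = g (fst u) \<oplus>\<^bsub>M\<^esub> ?d (snd u)" for u
  have fs: "smp (Hm R) M f"
    using smp_comp[OF smp_bsum[OF g d] H(4)] by (simp add: Hm_def f_def[abs_def])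
  have "qeq (Hm R) (\<lambda>u v. \<phi> (f u) (f v)) hyp"
  proof -
    let ?K = "\<lambda>u. g (fst u)" and ?D = "\<lambda>u. ?d (snd u)"
    have f1: "lin (Hm R) R fst" and f2: "lin (Hm R) (dual R) snd" by (simp_all add: Hm_def lin_def)
    note K1 = lin_comp[OF f1 smp_lin[OF g]] and D1 = lin_comp[OF f2 smp_lin[OF d]]
    note KM = lin_comp[OF K1 H(2)] and DM = lin_comp[OF D1 H(3)]
    have "qeq (Hm R) (\<lambda>u v. \<phi> (?K u) (?K v) + \<phi> (?D u) (?D v)) (\<lambda>_ _. 0)"
      using qeq_add[OF qeq_pull[OF H(6)[unfolded nul_def] K1] qeq_pull[OF H(7)[unfolded nul_def] D1]] by simp
    \<comment> \<open>As \<open>hyp u v = lam \<phi> (?D u) (?K v)\<close>, the mixed terms differ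
      from \<open>hyp\<close> by \<open>asym\<close> of the first of them.\<close>
    moreover have "qeq (Hm R) (\<lambda>u v. \<phi> (?K u) (?D v) + \<phi> (?D u) (?K v)) hyp"
    proof (rule qeqI)
      show "pr (Hm R) (Hm R) (\<lambda>u v. \<phi> (?K u) (?D v))" by (rule pr_comp[OF H(1) KM DM])
      fix u v assume u: "u \<in> carrier (Hm R)" and v: "v \<in> carrier (Hm R)"
      have "snd u = ?e (?d (snd u))" by (rule di(2)[OF lin_closed[OF f2 u], symmetric])
      then have "hyp u v = ?e (?d (snd u)) (fst v)" unfolding hyp_def by simp
      also have "\<dots> = lam \<phi> (?D u) (?K v)" using lin_closed[OF f1 v] by simp
      finally have "hyp u v = lam \<phi> (?D u) (?K v)" .
      then show "\<phi> (?K u) (?D v) + \<phi> (?D u) (?K v) = asym (\<lambda>u v. \<phi> (?K u) (?D v)) u v + hyp u v"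
        by (simp add: asym_def lam_def)
    qed
    ultimately have "qeq (Hm R) (\<lambda>u v. (\<phi> (?K u) (?K v) + \<phi> (?D u) (?D v)) + (\<phi> (?K u) (?D v) + \<phi> (?D u) (?K v))) (\<lambda>u v. 0 + hyp u v)"
      by (rule qeq_add)
    then show ?thesis
    proof (rule qeq_cong)
      fix u v assume u: "u \<in> carrier (Hm R)" and v: "v \<in> carrier (Hm R)"
      show "(\<phi> (?K u) (?K v) + \<phi> (?D u) (?D v)) + (\<phi> (?K u) (?D v) + \<phi> (?D u) (?K v)) = \<phi> (f u) (f v)"
        unfolding f_def using lin_closed[OF KM u] lin_closed[OF KM v] lin_closed[OF DM u] lin_closed[OF DM v] lm(1)
        by (simp add: pr_add1[OF H(1)] pr_add2[OF H(1)] algebra_simps)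
    qed simp
  qed
  then have i: "isom (Hm R) hyp M \<phi> f" using fs by (simp add: isom_def)
  have e0: "?e \<zero>\<^bsub>D\<^esub> = \<zero>\<^bsub>dual R\<^esub>"
    by (rule lin_zero[OF lm(3) left_module_dual[OF R] smp_lin[OF e]])
  have d0: "?d \<zero>\<^bsub>dual R\<^esub> = \<zero>\<^bsub>D\<^esub>" unfolding e0[symmetric] by (rule di(3)[OF lm_zero[OF lm(3)]])
  have z: "\<zero>\<^bsub>D\<^esub> = \<zero>\<^bsub>M\<^esub>" "\<zero>\<^bsub>K\<^esub> = \<zero>\<^bsub>M\<^esub>" using lin_zero[OF lm(3,1) H(3)] lin_zero[OF lm(2,1) H(2)] by simp_all
  have "smp (iL R) K f"
  proof (rule smp_cong[OF smp_comp[OF iL_fst[OF R] g]])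
    fix u assume "u \<in> carrier (iL R)"
    then obtain r where "u = (r, \<zero>\<^bsub>dual R\<^esub>)" "r \<in> carrier R" by (auto simp: carrier_iL)
    then show "g (fst u) = f u" using d0 z lm kc gc by (simp add: f_def del: dual_simps)
  qed
  moreover have "smp (iD R) D f"
  proof (rule smp_cong[OF smp_comp[OF iD_snd[OF R] d]])
    fix u assume "u \<in> carrier (iD R)"
    then obtain x where x: "u = (\<zero>\<^bsub>R\<^esub>, x)" "x \<in> carrier (dual R)" by (auto simp: carrier_iD)
    have "g \<zero>\<^bsub>R\<^esub> = \<zero>\<^bsub>M\<^esub>" using lin_zero[OF lm(4,2) smp_lin[OF g]] z by simp
    then show "?d (snd u) = f u" using x lm dc[OF di(1)[OF x(2)]] by (simp add: f_def del: dual_simps)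
  qed
  moreover have "f (r, ?e x) = g r \<oplus>\<^bsub>M\<^esub> x" if "x \<in> carrier D" for r x
    using di(3)[OF that] by (simp add: f_def)
  ultimately show ?thesis using i by (intro that)
qed

lemma HP_trivial:
  assumes h: "HP M \<phi> K D" and g: "smp R K g"
  obtains f where "qisor (Hm R) hyp (iL R) (iD R) M \<phi> K D f"
  by (rule HP_model[OF h g]) (use that in \<open>auto simp: qisor_def\<close>)

text \<open>In the hyperbolic model an element \<open>d\<close> of \<open>D\<close> is the
  functional \<open>lam \<phi> d\<close>, so the graph of \<open>t\<close> becomes the graph of
  \<rho>.\<close>

lemma HP_boundary:
  assumes h: "HP M \<phi> K D" and g: "smp R K g" and t: "lin K D t"
    and S: "smp K S (\<lambda>k. k \<oplus>\<^bsub>M\<^esub> t k)"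
  defines "\<rho> \<equiv> ext2 R (\<lambda>x y. lam \<phi> (t (g x)) (g y))"
  obtains f where "\<rho> \<in> mhom R (dual_module R)" "qisor (Hm R) hyp (iL R) (iG R \<rho>) M \<phi> K S f"
proof -
  note H = HPD[OF h]
  have R: "is_based R" by (rule smp_based(1)[OF g])
  have lR: "left_module R" using R by simp
  obtain f where f: "isom (Hm R) hyp M \<phi> f" "smp (iL R) K f"
    "\<And>r d. r \<in> carrier R \<Longrightarrow> d \<in> carrier D \<Longrightarrow> f (r, \<lambda>x\<in>carrier R. lam \<phi> d (g x)) = g r \<oplus>\<^bsub>M\<^esub> d"
    by (rule HP_model[OF h g]) (iprover intro: that)
  have "pr R R (\<lambda>x y. lam \<phi> (t (g x)) (g y))"
    by (rule pr_comp[OF pr_lam[OF H(1)] lin_comp[OF lin_comp[OF smp_lin[OF g] t] H(3)] lin_comp[OF smp_lin[OF g] H(2)]])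
  then have r: "\<rho> \<in> mhom R (dual_module R)" unfolding \<rho>_def using mhom_dual_iff[OF lR] by blast
  note G = iG[OF R r]
  have fst: "smp (iG R \<rho>) R fst"
    by (rule smp_inverse[OF G(1)]) (auto simp: carrier_iG)
  have "smp (iG R \<rho>) S f"
  proof (rule smp_cong[OF smp_comp[OF fst smp_comp[OF g S]]])
    fix u assume "u \<in> carrier (iG R \<rho>)"
    then obtain x where x: "u = (x, \<rho> x)" "x \<in> carrier R" by (auto simp: carrier_iG)
    have "\<rho> x = (\<lambda>y\<in>carrier R. lam \<phi> (t (g x)) (g y))" using x(2) by (simp add: \<rho>_def ext2_def)
    then show "g (fst u) \<oplus>\<^bsub>M\<^esub> t (g (fst u)) = f u"
      using f(3)[OF x(2) lin_closed[OF t smp_closed[OF g x(2)]]] x by simp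
  qed
  with r f show ?thesis by (intro that) (auto simp: qisor_def)
qed

end

subsection \<open>Stable isomorphism classes\<close>

text \<open>Common frame for forms and quasi-formations: \<open>U\<close> are the objects,
  \<open>R\<close> is isomorphism, \<open>s\<close> a sum brought back into the universe (hence
  associative and commutative only up to \<open>R\<close>), and \<open>T\<close> are the objects to
  be made neutral.\<close>

locale stab_monoid =
  fixes U :: "'o set" and R :: "'o \<Rightarrow> 'o \<Rightarrow> bool" and s :: "'o \<Rightarrow> 'o \<Rightarrow> 'o" and T :: "'o set"
  assumes R_U: "R x y \<Longrightarrow> x \<in> U \<and> y \<in> U"
    and R_refl: "x \<in> U \<Longrightarrow> R x x"
    and R_sym: "R x y \<Longrightarrow> R y x"
    and R_trans [trans]: "R x y \<Longrightarrow> R y z \<Longrightarrow> R x z"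
    and s_cong: "R x x' \<Longrightarrow> R y y' \<Longrightarrow> R (s x y) (s x' y')"
    and s_comm: "x \<in> U \<Longrightarrow> y \<in> U \<Longrightarrow> R (s x y) (s y x)"
    and s_assoc: "x \<in> U \<Longrightarrow> y \<in> U \<Longrightarrow> z \<in> U \<Longrightarrow> R (s (s x y) z) (s x (s y z))"
    and T_U: "T \<subseteq> U" and T_ne: "T \<noteq> {}"
    and T_sum: "p \<in> T \<Longrightarrow> p' \<in> T \<Longrightarrow> s p p' \<in> T"
begin

lemma s_closed: "x \<in> U \<Longrightarrow> y \<in> U \<Longrightarrow> s x y \<in> U"
  using R_U[OF s_comm] by blast

lemma T_in: "p \<in> T \<Longrightarrow> p \<in> U" using T_U by blast

definition steq :: "'o \<Rightarrow> 'o \<Rightarrow> bool" where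
  "steq x y \<longleftrightarrow> x \<in> U \<and> y \<in> U \<and> (\<exists>p\<in>T. \<exists>p'\<in>T. R (s x p) (s y p'))"

lemma steqI: "x \<in> U \<Longrightarrow> y \<in> U \<Longrightarrow> p \<in> T \<Longrightarrow> p' \<in> T \<Longrightarrow> R (s x p) (s y p') \<Longrightarrow> steq x y"
  unfolding steq_def by blast

lemma steqE:
  assumes "steq x y" obtains p p' where "x \<in> U" "y \<in> U" "p \<in> T" "p' \<in> T" "R (s x p) (s y p')"
  using assms unfolding steq_def by blast

lemma steq_R: "R x y \<Longrightarrow> steq x y"
proof -
  assume r: "R x y"
  obtain t where t: "t \<in> T" using T_ne by blast
  show ?thesis
    by (rule steqI[OF _ _ t t s_cong[OF r R_refl[OF T_in[OF t]]]]) (use R_U[OF r] in auto)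
qed

lemma steq_sym: "steq x y \<Longrightarrow> steq y x"
  by (erule steqE) (rule steqI[rotated -1, OF R_sym])

lemma mid_swap: "x \<in> U \<Longrightarrow> y \<in> U \<Longrightarrow> z \<in> U \<Longrightarrow> R (s (s x y) z) (s (s x z) y)"
proof -
  assume U: "x \<in> U" "y \<in> U" "z \<in> U"
  have "R (s (s x y) z) (s x (s y z))" by (rule s_assoc[OF U])
  also have "R \<dots> (s x (s z y))" by (rule s_cong[OF R_refl[OF U(1)] s_comm[OF U(2,3)]])
  also have "R \<dots> (s (s x z) y)" by (rule R_sym[OF s_assoc[OF U(1,3,2)]])
  finally show ?thesis .
qed

lemma steq_trans: assumes "steq x y" "steq y z" shows "steq x z"
proof -
  obtain p p' where p: "x \<in> U" "y \<in> U" "p \<in> T" "p' \<in> T" "R (s x p) (s y p')" by (rule steqE[OF assms(1)])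
  obtain q q' where q: "z \<in> U" "q \<in> T" "q' \<in> T" "R (s y q) (s z q')" by (rule steqE[OF assms(2)])
  note u = p(1,2) q(1) T_in[OF p(3)] T_in[OF p(4)] T_in[OF q(2)] T_in[OF q(3)]
  have "R (s x (s p q)) (s (s x p) q)" by (rule R_sym[OF s_assoc[OF u(1,4,6)]])
  also have "R \<dots> (s (s y p') q)" by (rule s_cong[OF p(5) R_refl[OF u(6)]])
  also have "R \<dots> (s (s y q) p')" by (rule mid_swap[OF u(2,5,6)])
  also have "R \<dots> (s (s z q') p')" by (rule s_cong[OF q(4) R_refl[OF u(5)]])
  also have "R \<dots> (s z (s q' p'))" by (rule s_assoc[OF u(3,7,5)])
  finally show ?thesis by (rule steqI[OF u(1,3) T_sum[OF p(3) q(2)] T_sum[OF q(3) p(4)]])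
qed

lemma steq_cong1: assumes "steq x x'" "y \<in> U" shows "steq (s x y) (s x' y)"
proof -
  obtain p p' where p: "x \<in> U" "x' \<in> U" "p \<in> T" "p' \<in> T" "R (s x p) (s x' p')" by (rule steqE[OF assms(1)])
  note u = p(1,2) assms(2) T_in[OF p(3)] T_in[OF p(4)]
  have "R (s (s x y) p) (s (s x p) y)" by (rule mid_swap[OF u(1,3,4)])
  also have "R \<dots> (s (s x' p') y)" by (rule s_cong[OF p(5) R_refl[OF u(3)]])
  also have "R \<dots> (s (s x' y) p')" by (rule mid_swap[OF u(2,5,3)])
  finally show ?thesis by (rule steqI[OF s_closed[OF u(1,3)] s_closed[OF u(2,3)] p(3,4)])
qed

lemma steq_U: "steq x y \<Longrightarrow> x \<in> U \<and> y \<in> U" by (simp add: steq_def)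

lemma steq_cong: assumes "steq x x'" "steq y y'" shows "steq (s x y) (s x' y')"
proof -
  note u = steq_U[OF assms(1)] steq_U[OF assms(2)]
  have 1: "steq (s x y) (s x' y)" by (rule steq_cong1) (use assms u in auto)
  have 2: "steq (s y x') (s y' x')" by (rule steq_cong1) (use assms u in auto)
  show ?thesis
    using steq_trans[OF 1 steq_trans[OF steq_R[OF s_comm] steq_trans[OF 2 steq_R[OF s_comm]]]] u by blast
qed

lemma steq_unit: assumes "x \<in> U" "t \<in> T" shows "steq (s x t) x"
  by (rule steqI[OF s_closed[OF assms(1) T_in[OF assms(2)]] assms(1) assms(2) T_sum[OF assms(2,2)] s_assoc])
    (use assms T_in in auto)

lemma steq_T: "t \<in> T \<Longrightarrow> t' \<in> T \<Longrightarrow> steq t t'"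
  by (rule steqI[OF T_in T_in, of t t' t' t]) (auto intro: s_comm T_in)

end

text \<open>\<open>E\<close> is any congruence containing stable isomorphism: \<open>steq\<close>
  itself for forms, and \<open>l_equiv\<close> for quasi-formations.\<close>

locale stab_quot = stab_monoid U R s T
  for U :: "'o set" and R s T +
  fixes E :: "'o \<Rightarrow> 'o \<Rightarrow> bool"
  assumes E_U: "E x y \<Longrightarrow> x \<in> U \<and> y \<in> U"
    and E_sym: "E x y \<Longrightarrow> E y x"
    and E_trans: "E x y \<Longrightarrow> E y z \<Longrightarrow> E x z"
    and E_st: "steq x y \<Longrightarrow> E x y"
    and E_cong: "E x x' \<Longrightarrow> E y y' \<Longrightarrow> E (s x y) (s x' y')"
begin

definition cls :: "'o \<Rightarrow> 'o set" where "cls x = {z. E x z}"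

lemma cls_eq_iff: "x \<in> U \<Longrightarrow> y \<in> U \<Longrightarrow> cls x = cls y \<longleftrightarrow> E x y"
  unfolding cls_def using E_sym E_trans E_st[OF steq_R[OF R_refl]] by blast

lemma cls_self: "x \<in> U \<Longrightarrow> x \<in> cls x"
  unfolding cls_def using E_st[OF steq_R[OF R_refl]] by blast

text \<open>The multiplications of \<open>Fzs\<close> and \<open>l_monoid\<close> are unions over
  all representatives; by congruence all members of the union are the same class.\<close>

lemma UN_cls:
  assumes "x \<in> U" "y \<in> U" shows "(\<Union>v\<in>cls x. \<Union>w\<in>cls y. cls (s v w)) = cls (s x y)"
proof -
  have "cls (s v w) = cls (s x y)" if "v \<in> cls x" "w \<in> cls y" for v w
  proof -
    have e: "E x v" "E y w" using that by (auto simp: cls_def)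
    show ?thesis using cls_eq_iff[of "s v w" "s x y"] E_U[OF E_cong[OF e]] E_sym[OF E_cong[OF e]] by blast
  qed
  then show ?thesis using cls_self[OF assms(1)] cls_self[OF assms(2)] by blast
qed

lemma cls_comm_monoid:
  assumes c: "carrier G = cls ` U" and m: "\<And>x y. x \<in> U \<Longrightarrow> y \<in> U \<Longrightarrow> cls x \<otimes>\<^bsub>G\<^esub> cls y = cls (s x y)"
    and o: "\<And>t. t \<in> T \<Longrightarrow> \<one>\<^bsub>G\<^esub> = cls t"
  shows "comm_monoid G"
proof -
  obtain t where t: "t \<in> T" using T_ne by blast
  note tU = T_in[OF t]
  have eq: "cls x = cls y" if e: "E x y" for x y
    using cls_eq_iff[of x y] E_U[OF e] e by simp
  have assoc: "cls (s (s x y) z) = cls (s x (s y z))" if "x \<in> U" "y \<in> U" "z \<in> U" for x y z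
    by (rule eq[OF E_st[OF steq_R[OF s_assoc[OF that]]]])
  have comm: "cls (s x y) = cls (s y x)" if "x \<in> U" "y \<in> U" for x y
    by (rule eq[OF E_st[OF steq_R[OF s_comm[OF that]]]])
  have unit: "cls (s x t) = cls x" if "x \<in> U" for x
    by (rule eq[OF E_st[OF steq_unit[OF that t]]])
  show ?thesis
  proof (rule comm_monoidI)
    fix x y z assume "x \<in> carrier G" "y \<in> carrier G" "z \<in> carrier G"
    then show "x \<otimes>\<^bsub>G\<^esub> y \<otimes>\<^bsub>G\<^esub> z = x \<otimes>\<^bsub>G\<^esub> (y \<otimes>\<^bsub>G\<^esub> z)" by (auto simp: c m s_closed assoc)
  next
    fix x y assume "x \<in> carrier G" "y \<in> carrier G"
    then obtain a b where ab: "a \<in> U" "b \<in> U" "x = cls a" "y = cls b" by (auto simp: c)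
    show "x \<otimes>\<^bsub>G\<^esub> y = y \<otimes>\<^bsub>G\<^esub> x" unfolding ab(3,4) m[OF ab(1,2)] m[OF ab(2,1)] by (rule comm[OF ab(1,2)])
  next
    fix x assume "x \<in> carrier G"
    then obtain y where y: "y \<in> U" "x = cls y" by (auto simp: c)
    show "\<one>\<^bsub>G\<^esub> \<otimes>\<^bsub>G\<^esub> x = x" unfolding o[OF t] y(2) m[OF tU y(1)] comm[OF tU y(1)] by (rule unit[OF y(1)])
  qed (auto simp: c m s_closed o[OF t] tU)
qed

end

sublocale stab_monoid \<subseteq> self: stab_quot U R s T steq
  by unfold_locales (auto intro: steq_sym steq_trans steq_cong dest: steq_U)

subsection \<open>Grothendieck groups\<close>

context
  fixes A :: "('x, 'y) monoid_scheme" (structure)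
  assumes A: "comm_monoid A"
begin

interpretation comm_monoid A by (rule A)

lemma Gr_rel_iff: "((a, b), (c, d)) \<in> Gr_rel A \<longleftrightarrow> a \<in> carrier A \<and> b \<in> carrier A \<and> c \<in> carrier A \<and> d \<in> carrier A \<and>
    (\<exists>k\<in>carrier A. a \<otimes> d \<otimes> k = c \<otimes> b \<otimes> k)"
  by (simp add: Gr_rel_def)

lemma Gr_rel_equiv: "equiv (carrier A \<times> carrier A) (Gr_rel A)"
proof (rule equivI)
  show "Gr_rel A \<subseteq> (carrier A \<times> carrier A) \<times> (carrier A \<times> carrier A)" by (auto simp: Gr_rel_def)
  show "refl_on (carrier A \<times> carrier A) (Gr_rel A)" by (rule refl_onI) (auto simp: Gr_rel_def)
  show "sym_on UNIV (Gr_rel A)" by (rule symI) (auto simp: Gr_rel_def intro: HOL.sym)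
  show "trans_on UNIV (Gr_rel A)"
  proof (rule transI)
    fix x y z assume "(x, y) \<in> Gr_rel A" "(y, z) \<in> Gr_rel A"
    then obtain a b c d e f k l where xyz: "x = (a, b)" "y = (c, d)" "z = (e, f)"
      and m: "a \<in> carrier A" "b \<in> carrier A" "c \<in> carrier A" "d \<in> carrier A" "e \<in> carrier A" "f \<in> carrier A" "k \<in> carrier A" "l \<in> carrier A"
      and e: "a \<otimes> d \<otimes> k = c \<otimes> b \<otimes> k" "c \<otimes> f \<otimes> l = e \<otimes> d \<otimes> l"
      unfolding Gr_rel_def by blast
    have "a \<otimes> f \<otimes> (c \<otimes> d \<otimes> k \<otimes> l) = (a \<otimes> d \<otimes> k) \<otimes> (c \<otimes> f \<otimes> l)" using m by (simp add: m_ac)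
    also have "\<dots> = e \<otimes> b \<otimes> (c \<otimes> d \<otimes> k \<otimes> l)" unfolding e using m by (simp add: m_ac)
    finally show "(x, z) \<in> Gr_rel A" unfolding xyz Gr_rel_iff using m by blast
  qed
qed

lemma Gr_class_eq:
  assumes "a \<in> carrier A" "b \<in> carrier A" "c \<in> carrier A" "d \<in> carrier A"
  shows "Gr_rel A `` {(a, b)} = Gr_rel A `` {(c, d)} \<longleftrightarrow> (\<exists>k\<in>carrier A. a \<otimes> d \<otimes> k = c \<otimes> b \<otimes> k)"
  using eq_equiv_class_iff[OF Gr_rel_equiv, of "(a, b)" "(c, d)"] assms by (simp add: Gr_rel_iff)

lemma Gr_carrierE:
  assumes "X \<in> carrier (Gr A)"
  obtains a b where "a \<in> carrier A" "b \<in> carrier A" "X = Gr_rel A `` {(a, b)}"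
  using assms by (auto simp: Gr_def quotient_def)

lemma Gr_carrierI: "a \<in> carrier A \<Longrightarrow> b \<in> carrier A \<Longrightarrow> Gr_rel A `` {(a, b)} \<in> carrier (Gr A)"
  by (auto simp: Gr_def quotient_def)

lemma Gr_class_self: "a \<in> carrier A \<Longrightarrow> b \<in> carrier A \<Longrightarrow> (a, b) \<in> Gr_rel A `` {(a, b)}"
  by (auto simp: Gr_rel_iff)

lemma Gr_class_mem:
  "(c, d) \<in> Gr_rel A `` {(a, b)} \<Longrightarrow> a \<in> carrier A \<and> b \<in> carrier A \<and> c \<in> carrier A \<and> d \<in> carrier A \<and> (\<exists>k\<in>carrier A. a \<otimes> d \<otimes> k = c \<otimes> b \<otimes> k)"
  by (simp add: Gr_rel_iff)

lemma Gr_mult: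
  assumes m: "a \<in> carrier A" "b \<in> carrier A" "c \<in> carrier A" "d \<in> carrier A"
  shows "Gr_rel A `` {(a, b)} \<otimes>\<^bsub>Gr A\<^esub> Gr_rel A `` {(c, d)} = Gr_rel A `` {(a \<otimes> c, b \<otimes> d)}"
proof -
  have "Gr_rel A `` {(a' \<otimes> c', b' \<otimes> d')} = Gr_rel A `` {(a \<otimes> c, b \<otimes> d)}"
    if 1: "(a', b') \<in> Gr_rel A `` {(a, b)}" and 2: "(c', d') \<in> Gr_rel A `` {(c, d)}" for a' b' c' d'
  proof -
    obtain k l where k: "a' \<in> carrier A" "b' \<in> carrier A" "c' \<in> carrier A" "d' \<in> carrier A" "k \<in> carrier A" "l \<in> carrier A"
      "a \<otimes> b' \<otimes> k = a' \<otimes> b \<otimes> k" "c \<otimes> d' \<otimes> l = c' \<otimes> d \<otimes> l"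
      using Gr_class_mem[OF 1] Gr_class_mem[OF 2] by blast
    have "a' \<otimes> c' \<otimes> (b \<otimes> d) \<otimes> (k \<otimes> l) = (a' \<otimes> b \<otimes> k) \<otimes> (c' \<otimes> d \<otimes> l)" using m k(1-6) by (simp add: m_ac)
    also have "\<dots> = a \<otimes> c \<otimes> (b' \<otimes> d') \<otimes> (k \<otimes> l)" unfolding k(7,8)[symmetric] using m k(1-6) by (simp add: m_ac)
    finally show ?thesis using m k(1-6) by (subst Gr_class_eq) (auto intro!: bexI[of _ "k \<otimes> l"])
  qed
  then have "(\<Union>(a', b')\<in>Gr_rel A `` {(a, b)}. \<Union>(c', d')\<in>Gr_rel A `` {(c, d)}. Gr_rel A `` {(a' \<otimes> c', b' \<otimes> d')}) = Gr_rel A `` {(a \<otimes> c, b \<otimes> d)}"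
    using Gr_class_self[OF m(1,2)] Gr_class_self[OF m(3,4)] by fast
  then show ?thesis by (simp add: Gr_def)
qed

end

lemma Gr_map_class:
  assumes A: "comm_monoid A" and B: "comm_monoid B" and f: "f \<in> hom A B" and m: "a \<in> carrier A" "b \<in> carrier A"
  shows "Gr_map B f (Gr_rel A `` {(a, b)}) = Gr_rel B `` {(f a, f b)}"
proof -
  have fc: "f x \<in> carrier B" if "x \<in> carrier A" for x using f that by (auto simp: hom_def)
  have "Gr_rel B `` {(f a', f b')} = Gr_rel B `` {(f a, f b)}" if ab: "(a', b') \<in> Gr_rel A `` {(a, b)}" for a' b'
  proof -
    obtain k where k: "a' \<in> carrier A" "b' \<in> carrier A" "k \<in> carrier A" "a \<otimes>\<^bsub>A\<^esub> b' \<otimes>\<^bsub>A\<^esub> k = a' \<otimes>\<^bsub>A\<^esub> b \<otimes>\<^bsub>A\<^esub> k"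
      using Gr_class_mem[OF A ab] by blast
    have "f a \<otimes>\<^bsub>B\<^esub> f b' \<otimes>\<^bsub>B\<^esub> f k = f a' \<otimes>\<^bsub>B\<^esub> f b \<otimes>\<^bsub>B\<^esub> f k"
      using arg_cong[OF k(4), of f] f k(1-3) m
      by (simp add: hom_def comm_monoid.axioms(1)[OF A] monoid.m_closed)
    then show ?thesis using Gr_class_eq[OF B fc fc fc fc] m k(1-3) fc by metis
  qed
  then show ?thesis unfolding Gr_map_def using Gr_class_self[OF A m] by fast
qed

text \<open>The injectivity hypothesis matches equality in the Grothendieck group, which holds up to
  a common summand, here one of \<open>B\<close> traded for one of \<open>A\<close>. The
  surjectivity hypothesis says that every element of \<open>B\<close> is a difference of values of
  \<open>f\<close>.\<close>

lemma Gr_map_iso: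
  assumes A: "comm_monoid A" and B: "comm_monoid B" and f: "f \<in> hom A B"
    and inj: "\<And>a b k. a \<in> carrier A \<Longrightarrow> b \<in> carrier A \<Longrightarrow> k \<in> carrier B \<Longrightarrow> f a \<otimes>\<^bsub>B\<^esub> k = f b \<otimes>\<^bsub>B\<^esub> k \<Longrightarrow>
      \<exists>k'\<in>carrier A. a \<otimes>\<^bsub>A\<^esub> k' = b \<otimes>\<^bsub>A\<^esub> k'"
    and surj: "\<And>x. x \<in> carrier B \<Longrightarrow> \<exists>a\<in>carrier A. \<exists>a'\<in>carrier A. x \<otimes>\<^bsub>B\<^esub> f a = f a'"
  shows "Gr_map B f \<in> iso (Gr A) (Gr B)"
proof (rule isoI)
  interpret A: comm_monoid A by (rule A)
  interpret B: comm_monoid B by (rule B)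
  have fc: "f x \<in> carrier B" if "x \<in> carrier A" for x using f that by (auto simp: hom_def)
  have fm: "f (x \<otimes>\<^bsub>A\<^esub> y) = f x \<otimes>\<^bsub>B\<^esub> f y" if "x \<in> carrier A" "y \<in> carrier A" for x y using f that by (auto simp: hom_def)
  note gm = Gr_map_class[OF A B f]
  show "Gr_map B f \<in> hom (Gr A) (Gr B)"
  proof (rule homI)
    fix X assume "X \<in> carrier (Gr A)"
    then obtain a b where "a \<in> carrier A" "b \<in> carrier A" "X = Gr_rel A `` {(a, b)}" by (rule Gr_carrierE[OF A])
    then show "Gr_map B f X \<in> carrier (Gr B)" using gm Gr_carrierI[OF B] fc by metis
  next
    fix X Y assume X: "X \<in> carrier (Gr A)" and Y: "Y \<in> carrier (Gr A)"
    obtain a b where a: "a \<in> carrier A" "b \<in> carrier A" "X = Gr_rel A `` {(a, b)}" by (rule Gr_carrierE[OF A X])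
    obtain c d where c: "c \<in> carrier A" "d \<in> carrier A" "Y = Gr_rel A `` {(c, d)}" by (rule Gr_carrierE[OF A Y])
    show "Gr_map B f (X \<otimes>\<^bsub>Gr A\<^esub> Y) = Gr_map B f X \<otimes>\<^bsub>Gr B\<^esub> Gr_map B f Y"
      unfolding a(3) c(3) Gr_mult[OF A a(1,2) c(1,2)] gm[OF a(1,2)] gm[OF c(1,2)]
        gm[OF A.m_closed[OF a(1) c(1)] A.m_closed[OF a(2) c(2)]] Gr_mult[OF B fc[OF a(1)] fc[OF a(2)] fc[OF c(1)] fc[OF c(2)]]
      by (simp only: fm a c)
  qed
  show "bij_betw (Gr_map B f) (carrier (Gr A)) (carrier (Gr B))"
    unfolding bij_betw_def
  proof (rule conjI, rule inj_onI)
    fix X Y assume X: "X \<in> carrier (Gr A)" and Y: "Y \<in> carrier (Gr A)" and e: "Gr_map B f X = Gr_map B f Y"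
    obtain a b where a: "a \<in> carrier A" "b \<in> carrier A" "X = Gr_rel A `` {(a, b)}" by (rule Gr_carrierE[OF A X])
    obtain c d where c: "c \<in> carrier A" "d \<in> carrier A" "Y = Gr_rel A `` {(c, d)}" by (rule Gr_carrierE[OF A Y])
    have "Gr_rel B `` {(f a, f b)} = Gr_rel B `` {(f c, f d)}"
      using e unfolding a(3) c(3) gm[OF a(1,2)] gm[OF c(1,2)] .
    then obtain k where k: "k \<in> carrier B" "f a \<otimes>\<^bsub>B\<^esub> f d \<otimes>\<^bsub>B\<^esub> k = f c \<otimes>\<^bsub>B\<^esub> f b \<otimes>\<^bsub>B\<^esub> k"
      using Gr_class_eq[OF B fc[OF a(1)] fc[OF a(2)] fc[OF c(1)] fc[OF c(2)]] by blast
    have "\<exists>k'\<in>carrier A. a \<otimes>\<^bsub>A\<^esub> d \<otimes>\<^bsub>A\<^esub> k' = c \<otimes>\<^bsub>A\<^esub> b \<otimes>\<^bsub>A\<^esub> k'"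
      by (rule inj[OF A.m_closed[OF a(1) c(2)] A.m_closed[OF c(1) a(2)] k(1)]) (simp only: fm a c k(2))
    then show "X = Y" unfolding a(3) c(3) using Gr_class_eq[OF A a(1,2) c(1,2)] by blast
  next
    show "Gr_map B f ` carrier (Gr A) = carrier (Gr B)"
  proof (intro equalityI subsetI)
    fix Y assume "Y \<in> Gr_map B f ` carrier (Gr A)"
    then obtain X where X: "X \<in> carrier (Gr A)" "Y = Gr_map B f X" by blast
    obtain a b where a: "a \<in> carrier A" "b \<in> carrier A" "X = Gr_rel A `` {(a, b)}" by (rule Gr_carrierE[OF A X(1)])
    show "Y \<in> carrier (Gr B)" unfolding X(2) a(3) gm[OF a(1,2)] by (rule Gr_carrierI[OF B fc[OF a(1)] fc[OF a(2)]])
  next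
    fix Y assume "Y \<in> carrier (Gr B)"
    then obtain x y where x: "x \<in> carrier B" "y \<in> carrier B" "Y = Gr_rel B `` {(x, y)}" by (rule Gr_carrierE[OF B])
    obtain a a' where a: "a \<in> carrier A" "a' \<in> carrier A" "x \<otimes>\<^bsub>B\<^esub> f a = f a'" using surj[OF x(1)] by blast
    obtain b b' where b: "b \<in> carrier A" "b' \<in> carrier A" "y \<otimes>\<^bsub>B\<^esub> f b = f b'" using surj[OF x(2)] by blast
    \<comment> \<open>The difference of \<open>f a' - f a\<close> and \<open>f b' - f b\<close>
      represents \<open>x - y\<close>, so the pair \<open>(a' + b, a + b')\<close> is a
      preimage.\<close>
    note c = A.m_closed[OF a(2) b(1)] A.m_closed[OF a(1) b(2)]
    have "f (a' \<otimes>\<^bsub>A\<^esub> b) \<otimes>\<^bsub>B\<^esub> y = f a' \<otimes>\<^bsub>B\<^esub> f b'"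
      using a b x fc by (simp add: fm B.m_ac b(3)[symmetric])
    moreover have "x \<otimes>\<^bsub>B\<^esub> f (a \<otimes>\<^bsub>A\<^esub> b') = f a' \<otimes>\<^bsub>B\<^esub> f b'"
      using a b x fc by (simp add: fm B.m_assoc[symmetric])
    ultimately have "Gr_rel B `` {(f (a' \<otimes>\<^bsub>A\<^esub> b), f (a \<otimes>\<^bsub>A\<^esub> b'))} = Y"
      unfolding x(3) using Gr_class_eq[OF B fc[OF c(1)] fc[OF c(2)] x(1,2)] B.one_closed by auto
    then have "Gr_map B f (Gr_rel A `` {(a' \<otimes>\<^bsub>A\<^esub> b, a \<otimes>\<^bsub>A\<^esub> b')}) = Y" unfolding gm[OF c] .
    then show "Y \<in> Gr_map B f ` carrier (Gr A)" using Gr_carrierI[OF A c] by blast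
  qed
  qed
qed

context l_setting
begin

subsection \<open>The monoid of 0-stabilised forms\<close>

definition fiso :: "('a, 'm) qform \<Rightarrow> ('a, 'n) qform \<Rightarrow> bool" where
  "fiso v w \<longleftrightarrow> is_form v \<and> is_form w \<and> (\<exists>f. is_isometry v w f)"

lemma formI: "is_based M \<Longrightarrow> pr M M \<phi> \<Longrightarrow> is_form (M, Qc M \<phi>)"
  using Q_eps_carrier[of M] by (auto simp: is_form.simps)

lemma formE:
  assumes "is_form v" obtains M \<phi> where "v = (M, Qc M \<phi>)" "is_based M" "pr M M \<phi>"
proof -
  obtain M \<theta> where v: "v = (M, \<theta>)" by fastforce
  have "is_based M" "\<theta> \<in> carrier (Q_eps M)" using assms v by (auto simp: is_form.simps)
  then show ?thesis using that v Q_eps_carrier[of M] by auto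
qed

lemma fiso_iff:
  assumes "is_based M" "pr M M \<phi>" "is_based N" "pr N N \<psi>"
  shows "fiso (M, Qc M \<phi>) (N, Qc N \<psi>) \<longleftrightarrow> (\<exists>f. isom M \<phi> N \<psi> f)"
  unfolding fiso_def using isometryD[OF assms(1,3,2,4)] isometryI[OF assms(2,4)] formI[OF assms(1,2)] formI[OF assms(3,4)]
  by blast

lemma form_sum_Qc:
  "is_based M \<Longrightarrow> pr M M \<phi> \<Longrightarrow> is_based N \<Longrightarrow> pr N N \<psi> \<Longrightarrow>
   form_sum (M, Qc M \<phi>) (N, Qc N \<psi>) = (bsum M N, Qc (bsum M N) (osum \<phi> \<psi>))"
  by (simp add: Q_sum_Qc Qc_bsum)

declare is_form.simps [simp del] form_sum.simps [simp del]

lemma pr_osum': "pr M M \<phi> \<Longrightarrow> pr N N \<psi> \<Longrightarrow> pr (bsum M N) (bsum M N) (osum \<phi> \<psi>)"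
  by (simp add: pr_like pr_osum)

lemma is_form_sum: "is_form v \<Longrightarrow> is_form w \<Longrightarrow> is_form (form_sum v w)"
  by (elim formE) (simp add: form_sum_Qc formI pr_osum')

lemma fiso_form: "fiso v w \<Longrightarrow> is_form v" "fiso v w \<Longrightarrow> is_form w" by (auto simp: fiso_def)

lemma fiso_refl: "is_form v \<Longrightarrow> fiso v v"
proof (erule formE)
  fix M \<phi> assume a: "v = (M, Qc M \<phi>)" "is_based M" "pr M M \<phi>"
  show ?thesis unfolding a(1) using fiso_iff[OF a(2,3,2,3)] isom_id[OF a(2) qeq_refl] by blast
qed

lemma fisoE:
  assumes "fiso v w"
  obtains M \<phi> N \<psi> f where "v = (M, Qc M \<phi>)" "w = (N, Qc N \<psi>)" "is_based M" "pr M M \<phi>" "is_based N" "pr N N \<psi>" "isom M \<phi> N \<psi> f"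
proof -
  obtain M \<phi> where v: "v = (M, Qc M \<phi>)" "is_based M" "pr M M \<phi>" by (rule formE[OF fiso_form(1)[OF assms]])
  obtain N \<psi> where w: "w = (N, Qc N \<psi>)" "is_based N" "pr N N \<psi>" by (rule formE[OF fiso_form(2)[OF assms]])
  obtain f where "isom M \<phi> N \<psi> f" using assms fiso_iff[OF v(2,3) w(2,3)] unfolding v(1) w(1) by blast
  with v w show ?thesis by (rule_tac that)
qed

lemma fiso_sym: assumes "fiso v w" shows "fiso w v"
proof (rule fisoE[OF assms])
  fix M \<phi> N \<psi> f assume a: "v = (M, Qc M \<phi>)" "w = (N, Qc N \<psi>)" "is_based M" "pr M M \<phi>" "is_based N" "pr N N \<psi>" "isom M \<phi> N \<psi> f"
  show ?thesis unfolding a(1,2) using fiso_iff[OF a(5,6,3,4)] isom_inv[OF a(7)] by blast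
qed

lemma fiso_trans: assumes "fiso v w" "fiso w x" shows "fiso v x"
proof (rule formE[OF fiso_form(1)[OF assms(1)]], rule formE[OF fiso_form(1)[OF assms(2)]], rule formE[OF fiso_form(2)[OF assms(2)]])
  fix M \<phi> N \<psi> P \<omega>
  assume a: "v = (M, Qc M \<phi>)" "is_based M" "pr M M \<phi>" "w = (N, Qc N \<psi>)" "is_based N" "pr N N \<psi>" "x = (P, Qc P \<omega>)" "is_based P" "pr P P \<omega>"
  obtain f g where "isom M \<phi> N \<psi> f" "isom N \<psi> P \<omega> g"
    using assms unfolding a(1,4,7) fiso_iff[OF a(2,3,5,6)] fiso_iff[OF a(5,6,8,9)] by blast
  from isom_comp[OF this] show ?thesis unfolding a(1,7) fiso_iff[OF a(2,3,8,9)] by blast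
qed

lemma fiso_sum: assumes "fiso v v'" "fiso w w'" shows "fiso (form_sum v w) (form_sum v' w')"
proof (rule fisoE[OF assms(1)], rule fisoE[OF assms(2)])
  fix M \<phi> N \<psi> f M' \<phi>' N' \<psi>' f'
  assume a: "v = (M, Qc M \<phi>)" "v' = (N, Qc N \<psi>)" "is_based M" "pr M M \<phi>" "is_based N" "pr N N \<psi>" "isom M \<phi> N \<psi> f"
    and b: "w = (M', Qc M' \<phi>')" "w' = (N', Qc N' \<psi>')" "is_based M'" "pr M' M' \<phi>'" "is_based N'" "pr N' N' \<psi>'" "isom M' \<phi>' N' \<psi>' f'"
  have "fiso (bsum M M', Qc (bsum M M') (osum \<phi> \<phi>')) (bsum N N', Qc (bsum N N') (osum \<psi> \<psi>'))"
    using fiso_iff[OF is_based_bsum[OF a(3) b(3)] pr_osum'[OF a(4) b(4)] is_based_bsum[OF a(5) b(5)] pr_osum'[OF a(6) b(6)]]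
      isom_osum[OF a(7) b(7)] by blast
  then show ?thesis unfolding a(1,2) b(1,2) form_sum_Qc[OF a(3,4) b(3,4)] form_sum_Qc[OF a(5,6) b(5,6)] .
qed

lemma fiso_comm: assumes "is_form v" "is_form w" shows "fiso (form_sum v w) (form_sum w v)"
proof (rule formE[OF assms(1)], rule formE[OF assms(2)])
  fix M \<phi> N \<psi>
  assume a: "v = (M, Qc M \<phi>)" "is_based M" "pr M M \<phi>" and b: "w = (N, Qc N \<psi>)" "is_based N" "pr N N \<psi>"
  have "fiso (bsum M N, Qc (bsum M N) (osum \<phi> \<psi>)) (bsum N M, Qc (bsum N M) (osum \<psi> \<phi>))"
    using fiso_iff[OF is_based_bsum[OF a(2) b(2)] pr_osum'[OF a(3) b(3)] is_based_bsum[OF b(2) a(2)] pr_osum'[OF b(3) a(3)]]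
      isom_swap[OF a(2) b(2)] by blast
  then show ?thesis unfolding a(1) b(1) form_sum_Qc[OF a(2,3) b(2,3)] form_sum_Qc[OF b(2,3) a(2,3)] .
qed

lemma fiso_assoc:
  assumes "is_form v" "is_form w" "is_form x" shows "fiso (form_sum (form_sum v w) x) (form_sum v (form_sum w x))"
proof (rule formE[OF assms(1)], rule formE[OF assms(2)], rule formE[OF assms(3)])
  fix M \<phi> N \<psi> P \<omega>
  assume a: "v = (M, Qc M \<phi>)" "is_based M" "pr M M \<phi>" and b: "w = (N, Qc N \<psi>)" "is_based N" "pr N N \<psi>"
    and c: "x = (P, Qc P \<omega>)" "is_based P" "pr P P \<omega>"
  note ab = is_based_bsum[OF a(2) b(2)] pr_osum'[OF a(3) b(3)] and bc = is_based_bsum[OF b(2) c(2)] pr_osum'[OF b(3) c(3)]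
  have "fiso (bsum (bsum M N) P, Qc (bsum (bsum M N) P) (osum (osum \<phi> \<psi>) \<omega>)) (bsum M (bsum N P), Qc (bsum M (bsum N P)) (osum \<phi> (osum \<psi> \<omega>)))"
    using fiso_iff[OF is_based_bsum[OF ab(1) c(2)] pr_osum'[OF ab(2) c(3)] is_based_bsum[OF a(2) bc(1)] pr_osum'[OF a(3) bc(2)]]
      isom_assoc[OF a(2) b(2) c(2)] by blast
  then show ?thesis
    unfolding a(1) b(1) c(1) form_sum_Qc[OF a(2,3) b(2,3)] form_sum_Qc[OF b(2,3) c(2,3)] form_sum_Qc[OF ab c(2,3)] form_sum_Qc[OF a(2,3) bc] .
qed

lemma fiso_univ:
  assumes "is_form v" obtains u :: "('a, 'a univ) qform" where "is_form u" "fiso u v"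
proof (rule formE[OF assms])
  fix M \<phi> assume a: "v = (M, Qc M \<phi>)" "is_based M" "pr M M \<phi>"
  obtain f and M' :: "('a, 'a univ) based_module" where f: "is_based M'" "smp M M' f" by (rule univ_based[OF a(2)])
  let ?g = "inv_into (carrier M) f"
  note g = smp_inv[OF f(2)]
  have p: "pr M' M' (\<lambda>x y. \<phi> (?g x) (?g y))" by (rule pr_comp[OF a(3) smp_lin[OF g] smp_lin[OF g]])
  have "isom M' (\<lambda>x y. \<phi> (?g x) (?g y)) M \<phi> ?g" using g by (simp add: isom_def qeq_refl)
  then have "fiso (M', Qc M' (\<lambda>x y. \<phi> (?g x) (?g y))) v" unfolding a(1) using fiso_iff[OF f(1) p a(2,3)] by blast
  then show ?thesis using that fiso_form by blast
qed

lemma zero_form_eq: "is_based P \<Longrightarrow> zero_form P = (P, Qc P (\<lambda>_ _. 0))"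
  by (simp add: zero_form_def Q_eps_one)

lemma is_form_zero: "is_based P \<Longrightarrow> is_form (zero_form P)"
  using formI[OF _ pr_0] by (simp add: zero_form_eq)

lemma zero_form_sum: "is_based P \<Longrightarrow> is_based Q \<Longrightarrow> form_sum (zero_form P) (zero_form Q) = zero_form (bsum P Q)"
  by (simp add: zero_form_eq form_sum_Qc pr_0) (simp add: osum_def[abs_def])

lemma zero_form_iso: assumes "smp P Q f" shows "fiso (zero_form P) (zero_form Q)"
proof -
  note b = smp_based[OF assms]
  have "isom P (\<lambda>_ _. 0) Q (\<lambda>_ _. 0) f" using assms by (simp add: isom_def qeq_refl)
  then show ?thesis unfolding zero_form_eq[OF b(1)] zero_form_eq[OF b(2)] using fiso_iff[OF b(1) pr_0 b(2) pr_0] by blast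
qed

definition UF :: "('a, 'a univ) qform set" where "UF = {v. is_form v}"
text \<open>\<open>form_sum\<close> lands in a product type; a form of the universe isometric to it
  is chosen to obtain an operation on \<open>UF\<close>.\<close>

definition sF :: "('a, 'a univ) qform \<Rightarrow> ('a, 'a univ) qform \<Rightarrow> ('a, 'a univ) qform" where
  "sF v w = (SOME z. fiso z (form_sum v w))"
text \<open>Closed under isometry, because \<open>sF\<close> of two zero forms is only isometric to
  a zero form.\<close>

definition TF :: "('a, 'a univ) qform set" where
  "TF = {x. \<exists>P :: ('a, 'a univ) based_module. is_based P \<and> fiso x (zero_form P)}"

lemma TF_zero: "is_based P \<Longrightarrow> zero_form P \<in> TF"
  unfolding TF_def using fiso_refl[OF is_form_zero] by blast

lemma sF: assumes "is_form v" "is_form w" shows "fiso (sF v w) (form_sum v w)"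
proof -
  obtain u :: "('a, 'a univ) qform" where "fiso u (form_sum v w)" by (rule fiso_univ[OF is_form_sum[OF assms]])
  then show ?thesis unfolding sF_def by (rule someI)
qed

lemma sF_sum:
  assumes "fiso v v'" "fiso w w'" shows "fiso (sF v w) (form_sum v' w')"
  by (rule fiso_trans[OF sF[OF fiso_form(1)[OF assms(1)] fiso_form(1)[OF assms(2)]] fiso_sum[OF assms]])

interpretation F: stab_monoid UF fiso sF TF
proof
  show "fiso x y \<Longrightarrow> x \<in> UF \<and> y \<in> UF" for x y by (simp add: UF_def fiso_def)
  show "x \<in> UF \<Longrightarrow> fiso x x" for x by (simp add: UF_def fiso_refl)
  show "fiso x y \<Longrightarrow> fiso y x" for x y :: "('a, 'a univ) qform" by (rule fiso_sym)
  show "fiso x y \<Longrightarrow> fiso y z \<Longrightarrow> fiso x z" for x y z :: "('a, 'a univ) qform" by (rule fiso_trans)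
  show "fiso x x' \<Longrightarrow> fiso y y' \<Longrightarrow> fiso (sF x y) (sF x' y')" for x x' y y'
    by (rule fiso_trans[OF sF_sum fiso_sym[OF sF]]) (auto dest: fiso_form)
  show "x \<in> UF \<Longrightarrow> y \<in> UF \<Longrightarrow> fiso (sF x y) (sF y x)" for x y
    unfolding UF_def by (rule fiso_trans[OF sF fiso_trans[OF fiso_comm fiso_sym[OF sF]]]) auto
  show "fiso (sF (sF x y) z) (sF x (sF y z))" if "x \<in> UF" "y \<in> UF" "z \<in> UF" for x y z
  proof -
    have f: "is_form x" "is_form y" "is_form z" using that by (auto simp: UF_def)
    show ?thesis
      by (rule fiso_trans[OF sF_sum[OF sF[OF f(1,2)] fiso_refl[OF f(3)]] fiso_trans[OF fiso_assoc[OF f]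
        fiso_sym[OF sF_sum[OF fiso_refl[OF f(1)] sF[OF f(2,3)]]]]])
  qed
  show "TF \<subseteq> UF" by (auto simp: TF_def UF_def dest: fiso_form)
  show "TF \<noteq> {}" using TF_zero[OF is_based_std] by blast
  show "sF p p' \<in> TF" if pp: "p \<in> TF" "p' \<in> TF" for p p'
  proof -
    obtain P P' :: "('a, 'a univ) based_module" where P: "is_based P" "fiso p (zero_form P)" "is_based P'" "fiso p' (zero_form P')"
      using pp unfolding TF_def by blast
    obtain f and R :: "('a, 'a univ) based_module" where R: "is_based R" "smp (bsum P P') R f"
      by (rule univ_based[OF is_based_bsum[OF P(1,3)]])
    have "fiso (sF p p') (zero_form R)"
      by (rule fiso_trans[OF sF_sum[OF P(2,4)], unfolded zero_form_sum[OF P(1,3)], OF zero_form_iso[OF R(2)]])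
    then show ?thesis unfolding TF_def using R(1) by blast
  qed
qed

text \<open>A relation between forms over arbitrary types is read off from copies in the universe,
  where \<open>stab_monoid\<close> applies.\<close>

lemma zs_isometric_iff:
  fixes v :: "('a, 'm) qform" and w :: "('a, 'n) qform"
  assumes u: "fiso u v" "fiso u' w"
  shows "zs_isometric v w \<longleftrightarrow> F.steq u u'"
proof
  assume "zs_isometric v w"
  then obtain P P' :: "('a, 'a univ) based_module" and f where P: "is_based P" "is_based P'"
    "is_isometry (form_sum v (zero_form P)) (form_sum w (zero_form P')) f" unfolding zs_isometric_def by blast
  note z = is_form_zero[OF P(1)] is_form_zero[OF P(2)]
  have "fiso (form_sum v (zero_form P)) (form_sum w (zero_form P'))"
    unfolding fiso_def
    using P(3) is_form_sum[OF fiso_form(2)[OF u(1)] z(1)] is_form_sum[OF fiso_form(2)[OF u(2)] z(2)] by blast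
  then have "fiso (sF u (zero_form P)) (sF u' (zero_form P'))"
    by (rule fiso_trans[OF sF_sum[OF u(1) fiso_refl[OF z(1)]] fiso_trans[OF _ fiso_sym[OF sF_sum[OF u(2) fiso_refl[OF z(2)]]]]])
  moreover have "zero_form P \<in> TF" "zero_form P' \<in> TF" using TF_zero P by auto
  ultimately show "F.steq u u'" using u by (intro F.steqI) (auto simp: UF_def dest: fiso_form)
next
  assume "F.steq u u'"
  then obtain p p' where p: "p \<in> TF" "p' \<in> TF" "fiso (sF u p) (sF u' p')" by (rule F.steqE)
  then obtain P P' :: "('a, 'a univ) based_module" where P: "is_based P" "fiso p (zero_form P)" "is_based P'" "fiso p' (zero_form P')"
    unfolding TF_def by blast
  have "fiso (form_sum v (zero_form P)) (form_sum w (zero_form P'))"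
    by (rule fiso_trans[OF fiso_sym[OF sF_sum[OF u(1) P(2)]] fiso_trans[OF p(3) sF_sum[OF u(2) P(4)]]])
  then obtain f where "is_isometry (form_sum v (zero_form P)) (form_sum w (zero_form P')) f"
    unfolding fiso_def by blast
  then show "zs_isometric v w" unfolding zs_isometric_def using P(1,3) by blast
qed

lemma zs_class_eq: assumes "fiso u v" shows "zs_class v = F.self.cls u"
  unfolding zs_class_def F.self.cls_def
proof (intro Collect_cong iffI)
  fix w :: "('a, 'a univ) qform" assume w: "is_form w \<and> zs_isometric v w"
  show "F.steq u w" using zs_isometric_iff[OF assms fiso_refl[OF conjunct1[OF w]]] w by simp
next
  fix w :: "('a, 'a univ) qform" assume s: "F.steq u w"
  have w: "is_form w" using F.steq_U[OF s] by (simp add: UF_def)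
  show "is_form w \<and> zs_isometric v w" using zs_isometric_iff[OF assms fiso_refl[OF w]] s w by simp
qed

lemma zs_class_eq_iff:
  fixes v :: "('a, 'm) qform" and w :: "('a, 'n) qform"
  assumes "is_form v" "is_form w" shows "zs_class v = zs_class w \<longleftrightarrow> zs_isometric v w"
proof -
  obtain u u' :: "('a, 'a univ) qform" where u: "fiso u v" "fiso u' w"
    by (rule fiso_univ[OF assms(1)], rule fiso_univ[OF assms(2)]) (iprover intro: that)
  then have "u \<in> UF" "u' \<in> UF" by (auto simp: UF_def dest: fiso_form)
  then show ?thesis
    unfolding zs_class_eq[OF u(1)] zs_class_eq[OF u(2)] zs_isometric_iff[OF u] by (rule F.self.cls_eq_iff)
qed

lemma fiso_zs: assumes "fiso v w" shows "zs_class v = zs_class w"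
proof -
  obtain u :: "('a, 'a univ) qform" where u: "fiso u v" by (rule fiso_univ[OF fiso_form(1)[OF assms]])
  show ?thesis unfolding zs_class_eq[OF u] zs_class_eq[OF fiso_trans[OF u assms]] ..
qed

lemma Fzs_carrier: "carrier Fzs = F.self.cls ` UF"
proof -
  have "carrier Fzs = zs_class ` UF" by (simp add: Fzs_def UF_def)
  also have "\<dots> = F.self.cls ` UF" by (rule image_cong[OF refl zs_class_eq[OF fiso_refl]]) (simp add: UF_def)
  finally show ?thesis .
qed

lemma zs_class_carrier: assumes "is_form v" shows "zs_class v \<in> carrier Fzs"
proof -
  obtain u :: "('a, 'a univ) qform" where u: "is_form u" "fiso u v" by (rule fiso_univ[OF assms])
  then show ?thesis unfolding zs_class_eq[OF u(2)] Fzs_carrier by (simp add: UF_def)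
qed

lemma Fzs_mult:
  assumes "is_form v" "is_form w" shows "zs_class v \<otimes>\<^bsub>Fzs\<^esub> zs_class w = zs_class (form_sum v w)"
proof -
  obtain u u' :: "('a, 'a univ) qform" where u: "fiso u v" "fiso u' w"
    by (rule fiso_univ[OF assms(1)], rule fiso_univ[OF assms(2)]) (iprover intro: that)
  have U: "u \<in> UF" "u' \<in> UF" using u by (auto simp: UF_def dest: fiso_form)
  have "zs_class v \<otimes>\<^bsub>Fzs\<^esub> zs_class w = (\<Union>x\<in>F.self.cls u. \<Union>y\<in>F.self.cls u'. zs_class (form_sum x y))"
    unfolding zs_class_eq[OF u(1)] zs_class_eq[OF u(2)] by (simp add: Fzs_def)
  also have "\<dots> = (\<Union>x\<in>F.self.cls u. \<Union>y\<in>F.self.cls u'. F.self.cls (sF x y))"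
  proof (intro SUP_cong refl)
    fix x y assume "x \<in> F.self.cls u" "y \<in> F.self.cls u'"
    then have "F.steq u x" "F.steq u' y" by (simp_all add: F.self.cls_def)
    from F.steq_U[OF this(1)] F.steq_U[OF this(2)] have "is_form x" "is_form y" by (simp_all add: UF_def)
    then show "zs_class (form_sum x y) = F.self.cls (sF x y)" by (rule zs_class_eq[OF sF])
  qed
  also have "\<dots> = F.self.cls (sF u u')" by (rule F.self.UN_cls[OF U])
  also have "\<dots> = zs_class (form_sum v w)" by (rule zs_class_eq[OF sF_sum[OF u], symmetric])
  finally show ?thesis .
qed

lemma Fzs_one: assumes P: "is_based (P :: ('a, 'a univ) based_module)" shows "\<one>\<^bsub>Fzs\<^esub> = zs_class (zero_form P)"
proof -
  have eq: "zs_class (zero_form Q) = zs_class (zero_form P)" if Q: "is_based (Q :: ('a, 'a univ) based_module)" for Q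
  proof -
    have "zero_form P \<in> TF" "zero_form Q \<in> TF" using TF_zero P Q by auto
    then show ?thesis
      unfolding zs_class_eq_iff[OF is_form_zero[OF Q] is_form_zero[OF P]]
        zs_isometric_iff[OF fiso_refl[OF is_form_zero[OF Q]] fiso_refl[OF is_form_zero[OF P]]] by (intro F.steq_T)
  qed
  have "(\<Union>P\<in>{P :: ('a, 'a univ) based_module. is_based P}. zs_class (zero_form P)) = zs_class (zero_form P)"
  proof (rule SUP_eq_const)
    show "{P :: ('a, 'a univ) based_module. is_based P} \<noteq> {}" using P by blast
  qed (rule eq, simp)
  then show ?thesis by (simp add: Fzs_def)
qed

lemma comm_monoid_Fzs: "comm_monoid Fzs"
proof (rule F.self.cls_comm_monoid[OF Fzs_carrier])
  fix x y assume "x \<in> UF" "y \<in> UF"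
  then have f: "is_form x" "is_form y" by (auto simp: UF_def)
  show "F.self.cls x \<otimes>\<^bsub>Fzs\<^esub> F.self.cls y = F.self.cls (sF x y)"
    using Fzs_mult[OF f] zs_class_eq[OF fiso_refl[OF f(1)]] zs_class_eq[OF fiso_refl[OF f(2)]] zs_class_eq[OF sF[OF f]] by simp
next
  fix t assume "t \<in> TF"
  then obtain P :: "('a, 'a univ) based_module" where P: "is_based P" "fiso t (zero_form P)" unfolding TF_def by blast
  show "\<one>\<^bsub>Fzs\<^esub> = F.self.cls t" using Fzs_one[OF P(1)] zs_class_eq[OF P(2)] by simp
qed

end

context l_setting
begin

subsection \<open>The monoid of quasi-formations\<close>

declare is_qformation.simps [simp del] qf_sum.simps [simp del] qf_isomorphic.simps [simp del]

definition qiso :: "('a, 'm) qformation \<Rightarrow> ('a, 'n) qformation \<Rightarrow> bool" where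
  "qiso x y \<longleftrightarrow> is_qformation x \<and> is_qformation y \<and> qf_isomorphic x y"

lemma qfI: "qfr M \<phi> L V \<Longrightarrow> is_qformation (M, Qc M \<phi>, L, V)"
  using qformation_iff by blast

lemma qfE:
  assumes "is_qformation x" obtains M \<phi> L V where "x = (M, Qc M \<phi>, L, V)" "qfr M \<phi> L V"
proof -
  obtain M \<theta> L V where x: "x = (M, \<theta>, L, V)" by (cases x) blast
  then show ?thesis using that assms qformation_iff[of M \<theta> L V] by blast
qed

lemma qiso_iff:
  assumes q: "qfr M \<phi> L V" and q': "qfr M' \<phi>' L' V'"
  shows "qiso (M, Qc M \<phi>, L, V) (M', Qc M' \<phi>', L', V') \<longleftrightarrow> (\<exists>f. qisor M \<phi> L V M' \<phi>' L' V' f)"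
  unfolding qiso_def using qf_isomorphic_iff[OF q q'] qfI[OF q] qfI[OF q'] by simp

lemma qisoI: "qfr M \<phi> L V \<Longrightarrow> qfr M' \<phi>' L' V' \<Longrightarrow> qisor M \<phi> L V M' \<phi>' L' V' f \<Longrightarrow>
   qiso (M, Qc M \<phi>, L, V) (M', Qc M' \<phi>', L', V')"
  using qiso_iff by blast

lemma qf_sum_Qc:
  assumes q: "qfr M \<phi> L V" "qfr M' \<phi>' L' V'"
  shows "qf_sum (M, Qc M \<phi>, L, V) (M', Qc M' \<phi>', L', V') =
    (bsum M M', Qc (bsum M M') (osum \<phi> \<phi>'), bsum L L', bsum V V')"
  using qfrD[OF q(1)] qfrD[OF q(2)] by (simp add: qf_sum.simps Q_sum_Qc Qc_bsum)

lemma is_qf_sum: assumes "is_qformation x" "is_qformation y" shows "is_qformation (qf_sum x y)"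
proof (rule qfE[OF assms(1)], rule qfE[OF assms(2)])
  fix M \<phi> L V M' \<phi>' L' V'
  assume a: "x = (M, Qc M \<phi>, L, V)" "qfr M \<phi> L V" and b: "y = (M', Qc M' \<phi>', L', V')" "qfr M' \<phi>' L' V'"
  show ?thesis unfolding a(1) b(1) qf_sum_Qc[OF a(2) b(2)] by (rule qfI[OF qfr_sum[OF a(2) b(2)]])
qed

lemma qiso_qf: "qiso x y \<Longrightarrow> is_qformation x" "qiso x y \<Longrightarrow> is_qformation y" by (auto simp: qiso_def)

lemma qiso_refl: assumes "is_qformation x" shows "qiso x x"
proof (rule qfE[OF assms])
  fix M \<phi> L V assume a: "x = (M, Qc M \<phi>, L, V)" "qfr M \<phi> L V"
  show ?thesis unfolding a(1) by (rule qisoI[OF a(2,2) qisor_refl[OF a(2)]])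
qed

lemma qisoE:
  assumes "qiso x y"
  obtains M \<phi> L V M' \<phi>' L' V' f where "x = (M, Qc M \<phi>, L, V)" "qfr M \<phi> L V"
    "y = (M', Qc M' \<phi>', L', V')" "qfr M' \<phi>' L' V'" "qisor M \<phi> L V M' \<phi>' L' V' f"
proof (rule qfE[OF qiso_qf(1)[OF assms]], rule qfE[OF qiso_qf(2)[OF assms]])
  fix M \<phi> L V M' \<phi>' L' V'
  assume a: "x = (M, Qc M \<phi>, L, V)" "qfr M \<phi> L V" and b: "y = (M', Qc M' \<phi>', L', V')" "qfr M' \<phi>' L' V'"
  obtain f where "qisor M \<phi> L V M' \<phi>' L' V' f" using assms qiso_iff[OF a(2) b(2)] unfolding a(1) b(1) by blast
  then show ?thesis by (rule that[OF a b])
qed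

lemma qiso_sym: assumes "qiso x y" shows "qiso y x"
proof (rule qisoE[OF assms])
  fix M \<phi> L V M' \<phi>' L' V' f
  assume a: "x = (M, Qc M \<phi>, L, V)" "qfr M \<phi> L V" and b: "y = (M', Qc M' \<phi>', L', V')" "qfr M' \<phi>' L' V'"
    and f: "qisor M \<phi> L V M' \<phi>' L' V' f"
  show ?thesis unfolding a(1) b(1) by (rule qisoI[OF b(2) a(2) qisor_inv[OF a(2) f]])
qed

lemma qiso_trans: assumes "qiso x y" "qiso y z" shows "qiso x z"
proof (rule qfE[OF qiso_qf(1)[OF assms(1)]], rule qfE[OF qiso_qf(1)[OF assms(2)]], rule qfE[OF qiso_qf(2)[OF assms(2)]])
  fix M \<phi> L V M' \<phi>' L' V' M'' \<phi>'' L'' V''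
  assume a: "x = (M, Qc M \<phi>, L, V)" "qfr M \<phi> L V" and b: "y = (M', Qc M' \<phi>', L', V')" "qfr M' \<phi>' L' V'"
    and c: "z = (M'', Qc M'' \<phi>'', L'', V'')" "qfr M'' \<phi>'' L'' V''"
  obtain f g where "qisor M \<phi> L V M' \<phi>' L' V' f" "qisor M' \<phi>' L' V' M'' \<phi>'' L'' V'' g"
    using assms unfolding a(1) b(1) c(1) qiso_iff[OF a(2) b(2)] qiso_iff[OF b(2) c(2)] by blast
  from qisor_comp[OF this] show ?thesis unfolding a(1) c(1) by (rule qisoI[OF a(2) c(2)])
qed

lemma qiso_sum: assumes "qiso x x'" "qiso y y'" shows "qiso (qf_sum x y) (qf_sum x' y')"
proof (rule qisoE[OF assms(1)], rule qisoE[OF assms(2)])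
  fix M \<phi> L V M' \<phi>' L' V' f N \<psi> K W N' \<psi>' K' W' g
  assume a: "x = (M, Qc M \<phi>, L, V)" "qfr M \<phi> L V" and a': "x' = (M', Qc M' \<phi>', L', V')" "qfr M' \<phi>' L' V'"
    and f: "qisor M \<phi> L V M' \<phi>' L' V' f"
    and b: "y = (N, Qc N \<psi>, K, W)" "qfr N \<psi> K W" and b': "y' = (N', Qc N' \<psi>', K', W')" "qfr N' \<psi>' K' W'"
    and g: "qisor N \<psi> K W N' \<psi>' K' W' g"
  show ?thesis unfolding a(1) a'(1) b(1) b'(1) qf_sum_Qc[OF a(2) b(2)] qf_sum_Qc[OF a'(2) b'(2)]
    by (rule qisoI[OF qfr_sum[OF a(2) b(2)] qfr_sum[OF a'(2) b'(2)] qisor_sum[OF f g]])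
qed

lemma qiso_comm: assumes "is_qformation x" "is_qformation y" shows "qiso (qf_sum x y) (qf_sum y x)"
proof (rule qfE[OF assms(1)], rule qfE[OF assms(2)])
  fix M \<phi> L V M' \<phi>' L' V'
  assume a: "x = (M, Qc M \<phi>, L, V)" "qfr M \<phi> L V" and b: "y = (M', Qc M' \<phi>', L', V')" "qfr M' \<phi>' L' V'"
  show ?thesis unfolding a(1) b(1) qf_sum_Qc[OF a(2) b(2)] qf_sum_Qc[OF b(2) a(2)]
    by (rule qisoI[OF qfr_sum[OF a(2) b(2)] qfr_sum[OF b(2) a(2)] qisor_swap[OF a(2) b(2)]])
qed

lemma qiso_assoc:
  assumes "is_qformation x" "is_qformation y" "is_qformation z"
  shows "qiso (qf_sum (qf_sum x y) z) (qf_sum x (qf_sum y z))"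
proof (rule qfE[OF assms(1)], rule qfE[OF assms(2)], rule qfE[OF assms(3)])
  fix M \<phi> L V M' \<phi>' L' V' M'' \<phi>'' L'' V''
  assume a: "x = (M, Qc M \<phi>, L, V)" "qfr M \<phi> L V" and b: "y = (M', Qc M' \<phi>', L', V')" "qfr M' \<phi>' L' V'"
    and c: "z = (M'', Qc M'' \<phi>'', L'', V'')" "qfr M'' \<phi>'' L'' V''"
  note ab = qfr_sum[OF a(2) b(2)] and bc = qfr_sum[OF b(2) c(2)]
  show ?thesis unfolding a(1) b(1) c(1) qf_sum_Qc[OF a(2) b(2)] qf_sum_Qc[OF b(2) c(2)] qf_sum_Qc[OF ab c(2)] qf_sum_Qc[OF a(2) bc]
    by (rule qisoI[OF qfr_sum[OF ab c(2)] qfr_sum[OF a(2) bc] qisor_assoc[OF a(2) b(2) c(2)]])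
qed

lemma qiso_univ:
  assumes "is_qformation x" obtains u :: "('a, 'a univ) qformation" where "qiso u x"
proof (rule qfE[OF assms])
  fix M \<phi> L V assume a: "x = (M, Qc M \<phi>, L, V)" "qfr M \<phi> L V"
  obtain f and M' :: "('a, 'a univ) based_module" where f: "smp M M' f" by (rule univ_based[OF qfrD(2)[OF a(2)]])
  note p = qfr_push[OF a(2) f]
  show ?thesis by (rule that) (rule qiso_sym, unfold a(1), rule qisoI[OF a(2) p])
qed

lemma is_qf_triv: "is_based P \<Longrightarrow> is_qformation (trivial_formation P)"
  unfolding trivial_formation_eq by (rule qfI[OF qfr_triv])

lemma HP_qfr: assumes h: "HP M \<phi> K D" shows "qfr M \<phi> K D"
  unfolding qfr_def using h HP_ret[OF h] HP_rank[OF h] by auto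

lemma HP_qiso_triv:
  assumes h: "HP M \<phi> K D" and g: "smp R K g" shows "qiso (trivial_formation R) (M, Qc M \<phi>, K, D)"
proof -
  obtain f where "qisor (Hm R) hyp (iL R) (iD R) M \<phi> K D f" by (rule HP_trivial[OF h g])
  then show ?thesis unfolding trivial_formation_eq by (rule qisoI[OF qfr_triv[OF smp_based(1)[OF g]] HP_qfr[OF h]])
qed

text \<open>The sum of two trivial formations is not literally trivial, as the dual of a sum differs
  from the sum of the duals. It is a sum of complementary Lagrangians, so
  \<open>HP_qiso_triv\<close> applies.\<close>

lemma triv_sum:
  assumes P: "is_based P" "is_based Q" and g: "smp (bsum P Q) R g"
  shows "qiso (trivial_formation R) (qf_sum (trivial_formation P) (trivial_formation Q))"
  unfolding trivial_formation_eq[of P] trivial_formation_eq[of Q] qf_sum_Qc[OF qfr_triv[OF P(1)] qfr_triv[OF P(2)]]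
  by (rule HP_qiso_triv[OF HP_sum[OF HP_hyperbolic[OF P(1)] HP_hyperbolic[OF P(2)]]
        smp_comp[OF smp_inv[OF g] smp_bsum[OF iL(1)[OF P(1)] iL(1)[OF P(2)]]]])

definition UQ :: "('a, 'a univ) qformation set" where "UQ = {v. is_qformation v}"
definition sQ :: "('a, 'a univ) qformation \<Rightarrow> ('a, 'a univ) qformation \<Rightarrow> ('a, 'a univ) qformation" where
  "sQ v w = (SOME z. qiso z (qf_sum v w))"
definition TQ :: "('a, 'a univ) qformation set" where
  "TQ = {x. \<exists>P :: ('a, 'a univ) based_module. is_based P \<and> qiso x (trivial_formation P)}"

lemma sQ: assumes "is_qformation v" "is_qformation w" shows "qiso (sQ v w) (qf_sum v w)"
proof -
  obtain u :: "('a, 'a univ) qformation" where "qiso u (qf_sum v w)" by (rule qiso_univ[OF is_qf_sum[OF assms]])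
  then show ?thesis unfolding sQ_def by (rule someI)
qed

lemma sQ_sum: assumes "qiso v v'" "qiso w w'" shows "qiso (sQ v w) (qf_sum v' w')"
  by (rule qiso_trans[OF sQ[OF qiso_qf(1)[OF assms(1)] qiso_qf(1)[OF assms(2)]] qiso_sum[OF assms]])

interpretation Q: stab_monoid UQ qiso sQ TQ
proof
  show "qiso x y \<Longrightarrow> x \<in> UQ \<and> y \<in> UQ" for x y by (simp add: UQ_def qiso_def)
  show "x \<in> UQ \<Longrightarrow> qiso x x" for x by (simp add: UQ_def qiso_refl)
  show "qiso x y \<Longrightarrow> qiso y x" for x y :: "('a, 'a univ) qformation" by (rule qiso_sym)
  show "qiso x y \<Longrightarrow> qiso y z \<Longrightarrow> qiso x z" for x y z :: "('a, 'a univ) qformation" by (rule qiso_trans)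
  show "qiso (sQ x y) (sQ x' y')" if "qiso x x'" "qiso y y'" for x x' y y'
    by (rule qiso_trans[OF sQ_sum[OF that] qiso_sym[OF sQ[OF qiso_qf(2)[OF that(1)] qiso_qf(2)[OF that(2)]]]])
  show "qiso (sQ x y) (sQ y x)" if "x \<in> UQ" "y \<in> UQ" for x y
  proof -
    have f: "is_qformation x" "is_qformation y" using that by (auto simp: UQ_def)
    show ?thesis by (rule qiso_trans[OF sQ[OF f] qiso_trans[OF qiso_comm[OF f] qiso_sym[OF sQ[OF f(2,1)]]]])
  qed
  show "qiso (sQ (sQ x y) z) (sQ x (sQ y z))" if "x \<in> UQ" "y \<in> UQ" "z \<in> UQ" for x y z
  proof -
    have f: "is_qformation x" "is_qformation y" "is_qformation z" using that by (auto simp: UQ_def)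
    show ?thesis
      by (rule qiso_trans[OF sQ_sum[OF sQ[OF f(1,2)] qiso_refl[OF f(3)]] qiso_trans[OF qiso_assoc[OF f]
        qiso_sym[OF sQ_sum[OF qiso_refl[OF f(1)] sQ[OF f(2,3)]]]]])
  qed
  show "TQ \<subseteq> UQ" by (auto simp: TQ_def UQ_def dest: qiso_qf)
  obtain u :: "('a, 'a univ) qformation" where u: "qiso u (trivial_formation (std 0))"
    by (rule qiso_univ[OF is_qf_triv[OF is_based_std]])
  have "u \<in> TQ" unfolding TQ_def using u is_based_std by blast
  then show "TQ \<noteq> {}" by blast
  show "sQ p p' \<in> TQ" if pp: "p \<in> TQ" "p' \<in> TQ" for p p'
  proof -
    obtain P P' :: "('a, 'a univ) based_module" where P: "is_based P" "qiso p (trivial_formation P)" "is_based P'" "qiso p' (trivial_formation P')"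
      using pp unfolding TQ_def by blast
    obtain f and R :: "('a, 'a univ) based_module" where R: "is_based R" "smp (bsum P P') R f"
      by (rule univ_based[OF is_based_bsum[OF P(1,3)]])
    have "qiso (sQ p p') (trivial_formation R)"
      by (rule qiso_trans[OF sQ_sum[OF P(2,4)] qiso_sym[OF triv_sum[OF P(1,3) R(2)]]])
    then show ?thesis unfolding TQ_def using R(1) by blast
  qed
qed

lemma stably_isomorphic_iff:
  fixes v :: "('a, 'm) qformation" and w :: "('a, 'n) qformation"
  assumes u: "qiso u v" "qiso u' w"
  shows "stably_isomorphic v w \<longleftrightarrow> Q.steq u u'"
proof
  have U: "u \<in> UQ" "u' \<in> UQ" using u by (auto simp: UQ_def dest: qiso_qf)
  assume "stably_isomorphic v w"
  then obtain P P' :: "('a, 'a univ) based_module" where P: "is_based P" "is_based P'"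
    "qf_isomorphic (qf_sum v (trivial_formation P)) (qf_sum w (trivial_formation P'))" unfolding stably_isomorphic_def by blast
  note z = is_qf_triv[OF P(1)] is_qf_triv[OF P(2)]
  obtain p where p: "qiso p (trivial_formation P)" "p \<in> TQ"
    by (rule qiso_univ[OF z(1)]) (use P TQ_def in blast)
  obtain p' where p': "qiso p' (trivial_formation P')" "p' \<in> TQ"
    by (rule qiso_univ[OF z(2)]) (use P TQ_def in blast)
  have "qiso (qf_sum v (trivial_formation P)) (qf_sum w (trivial_formation P'))"
    unfolding qiso_def using P(3) is_qf_sum[OF qiso_qf(2)[OF u(1)] z(1)] is_qf_sum[OF qiso_qf(2)[OF u(2)] z(2)] by blast
  then have "qiso (sQ u p) (sQ u' p')"
    by (rule qiso_trans[OF sQ_sum[OF u(1) p(1)] qiso_trans[OF _ qiso_sym[OF sQ_sum[OF u(2) p'(1)]]]])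
  then show "Q.steq u u'" by (rule Q.steqI[OF U p(2) p'(2)])
next
  assume "Q.steq u u'"
  then obtain p p' where p: "p \<in> TQ" "p' \<in> TQ" "qiso (sQ u p) (sQ u' p')" by (rule Q.steqE)
  then obtain P P' :: "('a, 'a univ) based_module" where P: "is_based P" "qiso p (trivial_formation P)" "is_based P'" "qiso p' (trivial_formation P')"
    unfolding TQ_def by blast
  have "qiso (qf_sum v (trivial_formation P)) (qf_sum w (trivial_formation P'))"
    by (rule qiso_trans[OF qiso_sym[OF sQ_sum[OF u(1) P(2)]] qiso_trans[OF p(3) sQ_sum[OF u(2) P(4)]]])
  then have "qf_isomorphic (qf_sum v (trivial_formation P)) (qf_sum w (trivial_formation P'))" by (simp only: qiso_def)
  then show "stably_isomorphic v w" unfolding stably_isomorphic_def using P(1,3) by blast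
qed

lemma qiso_stable: assumes "qiso x y" shows "stably_isomorphic x y"
proof -
  obtain u :: "('a, 'a univ) qformation" where u: "qiso u x" by (rule qiso_univ[OF qiso_qf(1)[OF assms]])
  have "u \<in> UQ" using qiso_qf(1)[OF u] by (simp add: UQ_def)
  then have "Q.steq u u" by (intro Q.steq_R Q.R_refl)
  then show ?thesis using stably_isomorphic_iff[OF u qiso_trans[OF u assms]] by simp
qed

lemma l_equiv_qf: "l_equiv x y \<Longrightarrow> is_qformation x \<and> is_qformation y"
proof (induction rule: l_equiv.induct)
  case (compose M \<theta> K L V z)
  then show ?case by (auto simp: is_qformation.simps)
qed auto

lemma steq_l_equiv: assumes s: "Q.steq x y" shows "l_equiv x y"
proof -
  have q: "is_qformation x" "is_qformation y" using Q.steq_U[OF s] by (auto simp: UQ_def)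
  show ?thesis
    by (rule l_equiv.stable[OF q]) (use stably_isomorphic_iff[OF qiso_refl[OF q(1)] qiso_refl[OF q(2)]] s in simp)
qed

interpretation Q: stab_quot UQ qiso sQ TQ l_equiv
proof
  show "l_equiv x y \<Longrightarrow> x \<in> UQ \<and> y \<in> UQ" for x y unfolding UQ_def using l_equiv_qf by blast
  show "l_equiv x y \<Longrightarrow> l_equiv y x" for x y by (rule l_equiv.sym)
  show "l_equiv x y \<Longrightarrow> l_equiv y z \<Longrightarrow> l_equiv x z" for x y z by (rule l_equiv.trans)
  show "Q.steq x y \<Longrightarrow> l_equiv x y" for x y by (rule steq_l_equiv)
  show "l_equiv (sQ x y) (sQ x' y')" if l: "l_equiv x x'" "l_equiv y y'" for x x' y y'
  proof -
    have q: "is_qformation x" "is_qformation y" "is_qformation x'" "is_qformation y'" using l_equiv_qf[OF l(1)] l_equiv_qf[OF l(2)] by auto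
    note s = sQ[OF q(1,2)] sQ[OF q(3,4)]
    show ?thesis by (rule l_equiv.sum[OF l qiso_qf(1)[OF s(1)] qiso_qf(1)[OF s(2)] qiso_stable[OF s(1)] qiso_stable[OF s(2)]])
  qed
qed

lemma l_class_eq: assumes "qiso u x" shows "l_class x = Q.cls u"
  unfolding l_class_def Q.cls_def
proof (intro Collect_cong iffI)
  fix z assume "\<exists>y. is_qformation y \<and> stably_isomorphic x y \<and> l_equiv y z"
  then obtain y where y: "is_qformation y" "stably_isomorphic x y" "l_equiv y z" by blast
  have "Q.steq u y" using stably_isomorphic_iff[OF assms qiso_refl[OF y(1)]] y(2) by simp
  from l_equiv.trans[OF steq_l_equiv[OF this] y(3)] show "l_equiv u z" .
next
  fix z assume "l_equiv u z"
  then show "\<exists>y. is_qformation y \<and> stably_isomorphic x y \<and> l_equiv y z"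
    using qiso_qf(1)[OF assms] qiso_stable[OF qiso_sym[OF assms]] by blast
qed

lemma l_class_qiso: assumes "qiso x y" shows "l_class x = l_class y"
proof -
  obtain u :: "('a, 'a univ) qformation" where u: "qiso u x" by (rule qiso_univ[OF qiso_qf(1)[OF assms]])
  show ?thesis unfolding l_class_eq[OF u] l_class_eq[OF qiso_trans[OF u assms]] ..
qed

lemma l_carrier: "carrier l_monoid = Q.cls ` UQ"
proof -
  have "carrier l_monoid = l_class ` UQ" by (simp add: l_monoid_def UQ_def)
  also have "\<dots> = Q.cls ` UQ" by (rule image_cong[OF refl l_class_eq[OF qiso_refl]]) (simp add: UQ_def)
  finally show ?thesis .
qed

lemma l_class_carrier: assumes "is_qformation x" shows "l_class x \<in> carrier l_monoid"
proof -
  obtain u :: "('a, 'a univ) qformation" where u: "qiso u x" by (rule qiso_univ[OF assms])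
  have "u \<in> UQ" using qiso_qf(1)[OF u] by (simp add: UQ_def)
  then show ?thesis unfolding l_class_eq[OF u] l_carrier by simp
qed

lemma l_carrierE:
  assumes "X \<in> carrier l_monoid" obtains x :: "('a, 'a univ) qformation" where "is_qformation x" "X = l_class x"
  using assms by (auto simp: l_monoid_def)

lemma l_mult:
  assumes "is_qformation v" "is_qformation w" shows "l_class v \<otimes>\<^bsub>l_monoid\<^esub> l_class w = l_class (qf_sum v w)"
proof -
  obtain u u' :: "('a, 'a univ) qformation" where u: "qiso u v" "qiso u' w"
    by (rule qiso_univ[OF assms(1)], rule qiso_univ[OF assms(2)]) (iprover intro: that)
  have U: "u \<in> UQ" "u' \<in> UQ" using u by (auto simp: UQ_def dest: qiso_qf)
  have "l_class v \<otimes>\<^bsub>l_monoid\<^esub> l_class w = (\<Union>x\<in>Q.cls u. \<Union>y\<in>Q.cls u'. l_class (qf_sum x y))"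
    unfolding l_class_eq[OF u(1)] l_class_eq[OF u(2)] by (simp add: l_monoid_def)
  also have "\<dots> = (\<Union>x\<in>Q.cls u. \<Union>y\<in>Q.cls u'. Q.cls (sQ x y))"
  proof (intro SUP_cong refl)
    fix x y assume "x \<in> Q.cls u" "y \<in> Q.cls u'"
    then have "l_equiv u x" "l_equiv u' y" by (simp_all add: Q.cls_def)
    from l_equiv_qf[OF this(1)] l_equiv_qf[OF this(2)] have "is_qformation x" "is_qformation y" by simp_all
    then show "l_class (qf_sum x y) = Q.cls (sQ x y)" by (rule l_class_eq[OF sQ])
  qed
  also have "\<dots> = Q.cls (sQ u u')" by (rule Q.UN_cls[OF U])
  also have "\<dots> = l_class (qf_sum v w)" by (rule l_class_eq[OF sQ_sum[OF u], symmetric])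
  finally show ?thesis .
qed

lemma l_one: assumes P: "is_based (P :: ('a, 'a univ) based_module)" shows "\<one>\<^bsub>l_monoid\<^esub> = l_class (trivial_formation P)"
proof -
  have eq: "l_class (trivial_formation Q) = l_class (trivial_formation P)" if Q: "is_based (Q :: ('a, 'a univ) based_module)" for Q
  proof -
    obtain p where p: "qiso p (trivial_formation P)" "p \<in> TQ"
      by (rule qiso_univ[OF is_qf_triv[OF P]]) (use P TQ_def in blast)
    obtain p' where p': "qiso p' (trivial_formation Q)" "p' \<in> TQ"
      by (rule qiso_univ[OF is_qf_triv[OF Q]]) (use Q TQ_def in blast)
    show ?thesis unfolding l_class_eq[OF p(1)] l_class_eq[OF p'(1)]
      using Q.cls_eq_iff[OF Q.T_in[OF p'(2)] Q.T_in[OF p(2)]] steq_l_equiv[OF Q.steq_T[OF p'(2) p(2)]] by simp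
  qed
  have "(\<Union>P\<in>{P :: ('a, 'a univ) based_module. is_based P}. l_class (trivial_formation P)) = l_class (trivial_formation P)"
  proof (rule SUP_eq_const)
    show "{P :: ('a, 'a univ) based_module. is_based P} \<noteq> {}" using P by blast
  qed (rule eq, simp)
  then show ?thesis by (simp add: l_monoid_def)
qed

lemma comm_monoid_l: "comm_monoid l_monoid"
proof (rule Q.cls_comm_monoid[OF l_carrier])
  fix x y assume "x \<in> UQ" "y \<in> UQ"
  then have f: "is_qformation x" "is_qformation y" by (auto simp: UQ_def)
  show "Q.cls x \<otimes>\<^bsub>l_monoid\<^esub> Q.cls y = Q.cls (sQ x y)"
    using l_mult[OF f] l_class_eq[OF qiso_refl[OF f(1)]] l_class_eq[OF qiso_refl[OF f(2)]] l_class_eq[OF sQ[OF f]] by simp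
next
  fix t assume "t \<in> TQ"
  then obtain P :: "('a, 'a univ) based_module" where P: "is_based P" "qiso t (trivial_formation P)" unfolding TQ_def by blast
  show "\<one>\<^bsub>l_monoid\<^esub> = Q.cls t" using l_one[OF P(1)] l_class_eq[OF P(2)] by simp
qed

definition lc :: "('a, 'm) based_module \<Rightarrow> ('m \<Rightarrow> 'm \<Rightarrow> 'a) \<Rightarrow> ('a, 'm) based_module \<Rightarrow> ('a, 'm) based_module \<Rightarrow> ('a, 'a univ) qformation set" where
  "lc M \<phi> L V = l_class (M, Qc M \<phi>, L, V)"

lemma lc_carrier: "qfr M \<phi> L V \<Longrightarrow> lc M \<phi> L V \<in> carrier l_monoid"
  unfolding lc_def by (rule l_class_carrier[OF qfI])

lemma lc_qisor: "qfr M \<phi> L V \<Longrightarrow> qfr M' \<phi>' L' V' \<Longrightarrow> qisor M \<phi> L V M' \<phi>' L' V' f \<Longrightarrow> lc M \<phi> L V = lc M' \<phi>' L' V'"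
  unfolding lc_def by (rule l_class_qiso[OF qisoI])

lemma lc_mult:
  "qfr M \<phi> L V \<Longrightarrow> qfr M' \<phi>' L' V' \<Longrightarrow> lc M \<phi> L V \<otimes>\<^bsub>l_monoid\<^esub> lc M' \<phi>' L' V' = lc (bsum M M') (osum \<phi> \<phi>') (bsum L L') (bsum V V')"
  unfolding lc_def using l_mult[OF qfI qfI] qf_sum_Qc by metis

lemma lc_HP: assumes h: "HP M \<phi> K D" shows "lc M \<phi> K D = \<one>\<^bsub>l_monoid\<^esub>"
proof -
  obtain f and R :: "('a, 'a univ) based_module" where R: "is_based R" "smp K R f" by (rule univ_based[OF HPD(9)[OF h]])
  show ?thesis unfolding lc_def l_one[OF R(1)] by (rule l_class_qiso[OF HP_qiso_triv[OF h smp_inv[OF R(2)]], symmetric])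
qed

text \<open>The generating relation concerns quasi-formations in the universe with literally equal
  \<open>M\<close>, form and middle Lagrangian. All three formations are therefore pushed there
  along one and the same \<open>f\<close>.\<close>

lemma lc_compose:
  assumes q: "qfr M \<phi> K L" and q': "qfr M \<phi> L V"
  shows "qfr M \<phi> K V" "lc M \<phi> K L \<otimes>\<^bsub>l_monoid\<^esub> lc M \<phi> L V = lc M \<phi> K V"
proof -
  show q'': "qfr M \<phi> K V" using q q' by (auto simp: qfr_def)
  obtain f and M' :: "('a, 'a univ) based_module" where f: "smp M M' f" by (rule univ_based[OF qfrD(2)[OF q]])
  define \<psi> where "\<psi> = (\<lambda>x y. \<phi> (inv_into (carrier M) f x) (inv_into (carrier M) f y))"
  let ?p = "\<lambda>V. push_based f V M'"
  note p = qfr_push[OF q f, folded \<psi>_def] and p' = qfr_push[OF q' f, folded \<psi>_def] and p'' = qfr_push[OF q'' f, folded \<psi>_def]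
  note qf = qfI[OF p(1)] qfI[OF p'(1)] qfI[OF p''(1)]
  let ?z = "sQ (M', Qc M' \<psi>, ?p K, ?p L) (M', Qc M' \<psi>, ?p L, ?p V)"
  note z = sQ[OF qf(1,2)]
  have "l_equiv ?z (M', Qc M' \<psi>, ?p K, ?p V)"
    by (rule l_equiv.compose[OF qf(1,2) qiso_qf(1)[OF z] qiso_stable[OF z]])
  then have "Q.cls ?z = Q.cls (M', Qc M' \<psi>, ?p K, ?p V)"
    using Q.cls_eq_iff[of ?z "(M', Qc M' \<psi>, ?p K, ?p V)"] qiso_qf(1)[OF z] qf(3) by (simp add: UQ_def)
  then have "l_class ?z = l_class (M', Qc M' \<psi>, ?p K, ?p V)"
    unfolding l_class_eq[OF qiso_refl[OF qf(3)]] l_class_eq[OF qiso_refl[OF qiso_qf(1)[OF z]]] .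
  then have "lc M' \<psi> (?p K) (?p L) \<otimes>\<^bsub>l_monoid\<^esub> lc M' \<psi> (?p L) (?p V) = lc M' \<psi> (?p K) (?p V)"
    unfolding lc_def l_mult[OF qf(1,2)] l_class_qiso[OF z] .
  then show "lc M \<phi> K L \<otimes>\<^bsub>l_monoid\<^esub> lc M \<phi> L V = lc M \<phi> K V"
    unfolding lc_qisor[OF q p] lc_qisor[OF q' p'] lc_qisor[OF q'' p''] .
qed

text \<open>Replacing a Lagrangian by a complementary one adds a trivial formation.\<close>

lemma lc_complement:
  assumes h: "HP M \<phi> K D" and q: "qfr M \<phi> K V" shows "qfr M \<phi> D V" "lc M \<phi> D V = lc M \<phi> K V"
proof -
  interpret l: comm_monoid l_monoid by (rule comm_monoid_l)
  note c = lc_compose[OF HP_qfr[OF HP_sym[OF h]] q]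
  show "qfr M \<phi> D V" by (rule c(1))
  show "lc M \<phi> D V = lc M \<phi> K V"
    using c(2) lc_carrier[OF q] by (simp add: lc_HP[OF HP_sym[OF h]])
qed

subsection \<open>The induced form on the half-rank summand\<close>

fun bform :: "('a, 'm) qformation \<Rightarrow> ('a, 'm) qform" where
  "bform (M, \<theta>, L, V) = (V, Q_pull V (\<lambda>x. x) \<theta>)"

declare bform.simps [simp del]

lemma bform_Qc: assumes q: "qfr M \<phi> L V" shows "bform (M, Qc M \<phi>, L, V) = (V, Qc V \<phi>)"
proof -
  note d = qfrD[OF q]
  show ?thesis unfolding bform.simps
    using Q_pull_Qc[OF is_based_left_module[OF d(4)] is_based_left_module[OF d(2)] d(1,6)] by simp
qed

lemma pr_sub: "pr M M \<phi> \<Longrightarrow> lin V M (\<lambda>x. x) \<Longrightarrow> pr V V \<phi>"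
  using pr_comp[of M M \<phi> V "\<lambda>x. x" V "\<lambda>x. x"] by simp

lemma qfr_form: "qfr M \<phi> L V \<Longrightarrow> is_form (V, Qc V \<phi>)"
  using qfrD formI pr_sub by metis

definition bz :: "('a, 'm) qformation \<Rightarrow> ('a, 'a univ) qform set" where "bz x = zs_class (bform x)"

lemma bz_Qc: "qfr M \<phi> L V \<Longrightarrow> bz (M, Qc M \<phi>, L, V) = zs_class (V, Qc V \<phi>)"
  by (simp add: bz_def bform_Qc)

lemma bz_carrier: assumes "is_qformation x" shows "bz x \<in> carrier Fzs"
proof (rule qfE[OF assms])
  fix M \<phi> L V assume a: "x = (M, Qc M \<phi>, L, V)" "qfr M \<phi> L V"
  show ?thesis unfolding a(1) bz_Qc[OF a(2)] by (rule zs_class_carrier[OF qfr_form[OF a(2)]])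
qed

lemma bz_qiso: assumes "qiso x y" shows "bz x = bz y"
proof (rule qisoE[OF assms])
  fix M \<phi> L V M' \<phi>' L' V' f
  assume a: "x = (M, Qc M \<phi>, L, V)" "qfr M \<phi> L V" and b: "y = (M', Qc M' \<phi>', L', V')" "qfr M' \<phi>' L' V'"
    and f: "qisor M \<phi> L V M' \<phi>' L' V' f"
  note d = qfrD[OF a(2)] and d' = qfrD[OF b(2)]
  have "isom V \<phi> V' \<phi>' f"
    using f qeq_pull[OF isom_qeq d(6)] unfolding qisor_def isom_def by blast
  then have "fiso (V, Qc V \<phi>) (V', Qc V' \<phi>')"
    using fiso_iff[OF d(4) pr_sub[OF d(1,6)] d'(4) pr_sub[OF d'(1,6)]] by blast
  then show ?thesis unfolding a(1) b(1) bz_Qc[OF a(2)] bz_Qc[OF b(2)] by (rule fiso_zs)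
qed

lemma bz_sum: assumes "is_qformation x" "is_qformation y" shows "bz (qf_sum x y) = bz x \<otimes>\<^bsub>Fzs\<^esub> bz y"
proof (rule qfE[OF assms(1)], rule qfE[OF assms(2)])
  fix M \<phi> L V M' \<phi>' L' V'
  assume a: "x = (M, Qc M \<phi>, L, V)" "qfr M \<phi> L V" and b: "y = (M', Qc M' \<phi>', L', V')" "qfr M' \<phi>' L' V'"
  note d = qfrD[OF a(2)] and d' = qfrD[OF b(2)]
  show ?thesis
    unfolding a(1) b(1) qf_sum_Qc[OF a(2) b(2)] bz_Qc[OF a(2)] bz_Qc[OF b(2)] bz_Qc[OF qfr_sum[OF a(2) b(2)]]
      Fzs_mult[OF qfr_form[OF a(2)] qfr_form[OF b(2)]] form_sum_Qc[OF d(4) pr_sub[OF d(1,6)] d'(4) pr_sub[OF d'(1,6)]] ..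
qed

lemma zs_zero: assumes P: "is_based P" shows "zs_class (zero_form P) = \<one>\<^bsub>Fzs\<^esub>"
proof -
  obtain f and R :: "('a, 'a univ) based_module" where R: "is_based R" "smp P R f" by (rule univ_based[OF P])
  show ?thesis unfolding Fzs_one[OF R(1)] by (rule fiso_zs[OF zero_form_iso[OF R(2)]])
qed

lemma nul_form: assumes K: "is_based K" "pr K K \<phi>" "nul K \<phi>" shows "(K, Qc K \<phi>) = zero_form K"
proof -
  have "Qc K \<phi> = Qc K (\<lambda>_ _. 0)"
    by (rule iffD2[OF Qc_eq_iff[OF is_based_left_module[OF K(1)] K(2) pr_0] K(3)[unfolded nul_def]])
  then show ?thesis using K(1) by (simp add: zero_form_eq)
qed

lemma bz_nul: assumes q: "qfr M \<phi> K V" and n: "nul V \<phi>" shows "bz (M, Qc M \<phi>, K, V) = \<one>\<^bsub>Fzs\<^esub>"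
  unfolding bz_Qc[OF q] nul_form[OF qfrD(4)[OF q] pr_sub[OF qfrD(1,6)[OF q]] n] by (rule zs_zero[OF qfrD(4)[OF q]])

lemma bz_triv: assumes P: "is_based P" shows "bz (trivial_formation P) = \<one>\<^bsub>Fzs\<^esub>"
  unfolding trivial_formation_eq by (rule bz_nul[OF qfr_triv[OF P] HPD(7)[OF HP_hyperbolic[OF P]]])

lemma bz_stable:
  fixes x :: "('a, 'm) qformation" and y :: "('a, 'n) qformation"
  assumes q: "is_qformation x" "is_qformation y" and s: "stably_isomorphic x y" shows "bz x = bz y"
proof -
  interpret F: comm_monoid Fzs by (rule comm_monoid_Fzs)
  obtain P P' :: "('a, 'a univ) based_module" where P: "is_based P" "is_based P'"
    "qf_isomorphic (qf_sum x (trivial_formation P)) (qf_sum y (trivial_formation P'))"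
    using s unfolding stably_isomorphic_def by blast
  have "qiso (qf_sum x (trivial_formation P)) (qf_sum y (trivial_formation P'))"
    unfolding qiso_def using P(3) is_qf_sum[OF q(1) is_qf_triv[OF P(1)]] is_qf_sum[OF q(2) is_qf_triv[OF P(2)]] by blast
  from bz_qiso[OF this] show ?thesis
    using bz_carrier[OF q(1)] bz_carrier[OF q(2)]
    by (simp add: bz_sum[OF q(1) is_qf_triv[OF P(1)]] bz_sum[OF q(2) is_qf_triv[OF P(2)]] bz_triv P)
qed

lemma bz_l_equiv: "l_equiv x y \<Longrightarrow> bz x = bz y"
proof (induction rule: l_equiv.induct)
  case (stable x y)
  then show ?case by (rule bz_stable)
next
  case (compose M \<theta> K L V z)
  interpret F: comm_monoid Fzs by (rule comm_monoid_Fzs)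
  note q = compose(1,2)
  obtain \<phi> where p: "\<theta> = Qc M \<phi>" "qfr M \<phi> L V" using q(2) qformation_iff by blast
  \<comment> \<open>\<open>K\<close> must get a complement for the same representative \<phi> that
    comes with \<open>L\<close>; applying \<open>qformation_iff\<close> to the first formation would
    produce another representative.\<close>
  have s: "is_simple_form (M, \<theta>)" "is_simple_lagrangian K (M, \<theta>)" using q(1) by (simp_all add: is_qformation.simps)
  obtain D where "HP M \<phi> K D" by (rule lagrangian_complement[OF s(1)[unfolded p(1)] qfrD(1)[OF p(2)] s(2)[unfolded p(1)]])
  moreover have "ret L M" "2 * rank L = rank M"
    using q(1) ret_iff[OF qfrD(2)[OF p(2)]] by (simp_all add: is_qformation.simps)
  ultimately have KL: "qfr M \<phi> K L" unfolding qfr_def by blast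
  \<comment> \<open>The form vanishes on the Lagrangian \<open>L\<close>, so the first summand
    contributes the unit.\<close>
  have "nul L \<phi>" using p(2) HPD(6) unfolding qfr_def by blast
  then have "bz (M, \<theta>, K, L) = \<one>\<^bsub>Fzs\<^esub>" unfolding p(1) by (rule bz_nul[OF KL])
  moreover have "bz z = bz (M, \<theta>, K, L) \<otimes>\<^bsub>Fzs\<^esub> bz (M, \<theta>, L, V)"
    using bz_stable[OF compose(3) is_qf_sum[OF q] compose(4)] bz_sum[OF q] by simp
  ultimately have "bz z = bz (M, \<theta>, L, V)" using bz_carrier[OF q(2)] by simp
  \<comment> \<open>\<open>bform\<close> depends only on the form and on \<open>V\<close>, so
    exchanging the Lagrangian \<open>L\<close> for \<open>K\<close> changes nothing.\<close>
  then show ?case by (simp add: bz_def bform.simps)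
next
  case (sum x x' y y' z z')
  have q: "is_qformation x" "is_qformation y" "is_qformation x'" "is_qformation y'"
    using l_equiv_qf[OF sum(1)] l_equiv_qf[OF sum(2)] by auto
  show ?case
    using bz_stable[OF sum(3) is_qf_sum[OF q(1,2)] sum(5)] bz_stable[OF sum(4) is_qf_sum[OF q(3,4)] sum(6)]
      bz_sum[OF q(1,2)] bz_sum[OF q(3,4)] sum.IH by simp
qed auto

definition bmap :: "('a, 'a univ) qformation set \<Rightarrow> ('a, 'a univ) qform set" where
  "bmap X = bz (SOME x. x \<in> X)"

lemma bmap_class: assumes "is_qformation x" shows "bmap (l_class x) = bz x"
proof -
  obtain u :: "('a, 'a univ) qformation" where u: "qiso u x" by (rule qiso_univ[OF assms])
  have "u \<in> l_class x" unfolding l_class_eq[OF u] using Q.cls_self[of u] qiso_qf(1)[OF u] by (simp add: UQ_def)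
  then have "(SOME z. z \<in> l_class x) \<in> l_class x" by (rule someI)
  then have "l_equiv u (SOME z. z \<in> l_class x)" unfolding l_class_eq[OF u] by (simp add: Q.cls_def)
  from bz_l_equiv[OF this] bz_qiso[OF u] show ?thesis by (simp add: bmap_def)
qed

lemma bmap_hom: "bmap \<in> hom l_monoid Fzs"
proof (rule homI)
  fix X assume "X \<in> carrier l_monoid"
  then obtain x :: "('a, 'a univ) qformation" where x: "is_qformation x" "X = l_class x" by (rule l_carrierE)
  show "bmap X \<in> carrier Fzs" unfolding x(2) bmap_class[OF x(1)] by (rule bz_carrier[OF x(1)])
next
  fix X Y assume X: "X \<in> carrier l_monoid" and Y: "Y \<in> carrier l_monoid"
  obtain x :: "('a, 'a univ) qformation" where x: "is_qformation x" "X = l_class x" by (rule l_carrierE[OF X])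
  obtain y :: "('a, 'a univ) qformation" where y: "is_qformation y" "Y = l_class y" by (rule l_carrierE[OF Y])
  show "bmap (X \<otimes>\<^bsub>l_monoid\<^esub> Y) = bmap X \<otimes>\<^bsub>Fzs\<^esub> bmap Y"
    unfolding x(2) y(2) l_mult[OF x(1) y(1)] bmap_class[OF x(1)] bmap_class[OF y(1)] bmap_class[OF is_qf_sum[OF x(1) y(1)]]
    by (rule bz_sum[OF x(1) y(1)])
qed

end

context l_setting
begin

subsection \<open>Boundaries\<close>

text \<open>The class of the boundary of \<rho>, made available for modules over every type and for
  \<rho> that is not extensional.\<close>

definition dl :: "('a, 'm) based_module \<Rightarrow> ('m \<Rightarrow> 'm \<Rightarrow> 'a) \<Rightarrow> ('a, 'a univ) qformation set" where
  "dl V \<rho> = lc (Hm V) hyp (iL V) (iG V (ext2 V \<rho>))"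

lemma ext2_mhom: "is_based V \<Longrightarrow> pr V V \<rho> \<Longrightarrow> ext2 V \<rho> \<in> mhom V (dual_module V)"
  using mhom_dual_iff[of V \<rho>] by simp

lemma ext2_lin: assumes "is_based V" "pr V V \<rho>" shows "lin V (dual V) (ext2 V \<rho>)"
  using mhom_lin[OF ext2_mhom[OF assms]] by (simp add: dual_like)

lemma dl_cong: "(\<And>x y. x \<in> carrier V \<Longrightarrow> y \<in> carrier V \<Longrightarrow> \<rho> x y = \<sigma> x y) \<Longrightarrow> dl V \<rho> = dl V \<sigma>"
  using ext2_eq_iff[of V \<rho> \<sigma>] by (simp add: dl_def)

lemma dl_boundary:
  assumes "F \<in> mhom V (dual_module V)" shows "l_class (boundary V F) = dl V F"
  by (simp add: dl_def boundary_eq lc_def mhom_dual_ext2[OF assms])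

lemma dl_qfr: "is_based V \<Longrightarrow> pr V V \<rho> \<Longrightarrow> qfr (Hm V) hyp (iL V) (iG V (ext2 V \<rho>))"
  by (rule qfr_boundary[OF _ ext2_mhom])

lemma dl_carrier: "is_based V \<Longrightarrow> pr V V \<rho> \<Longrightarrow> dl V \<rho> \<in> carrier l_monoid"
  unfolding dl_def by (rule lc_carrier[OF dl_qfr])

text \<open>The criterion by which elements are recognised as elementary: \<open>S\<close> is a
  graph over the Lagrangian \<open>K\<close>, and the form is read off by pairing.\<close>

lemma dl_HP:
  assumes h: "HP M \<phi> K D" and g: "smp R K g" and t: "lin K D t"
    and S: "smp K S (\<lambda>k. k \<oplus>\<^bsub>M\<^esub> t k)" and i: "lin S M (\<lambda>x. x)"
  shows "qfr M \<phi> K S" "lc M \<phi> K S = dl R (\<lambda>x y. lam \<phi> (t (g x)) (g y))"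
proof -
  let ?r = "ext2 R (\<lambda>x y. lam \<phi> (t (g x)) (g y))"
  obtain f where f: "?r \<in> mhom R (dual_module R)" "qisor (Hm R) hyp (iL R) (iG R ?r) M \<phi> K S f"
    by (rule HP_boundary[OF h g t S])
  note b = qfr_boundary[OF smp_based(1)[OF g] f(1)]
  have fs: "smp (Hm R) M f" "smp (iG R ?r) S f" using f(2) isom_smp unfolding qisor_def by blast+
  have "ret (iG R ?r) (Hm R)" "2 * rank (iG R ?r) = rank (Hm R)" using b unfolding qfr_def by blast+
  then show q: "qfr M \<phi> K S"
    unfolding qfr_def using h ret_isom[OF fs(1) _ fs(2) i] rank_smp[OF fs(1)] rank_smp[OF fs(2)] by auto
  show "lc M \<phi> K S = dl R (\<lambda>x y. lam \<phi> (t (g x)) (g y))"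
    unfolding dl_def by (rule lc_qisor[OF b q f(2), symmetric])
qed

lemma iG_fst:
  assumes "is_based V" "pr V V \<rho>" shows "smp (iG V (ext2 V \<rho>)) V fst"
  by (rule smp_inverse[OF iG(1)[OF assms(1) ext2_mhom[OF assms]]]) (auto simp: carrier_iG)

lemma qeq_asymE:
  assumes "qeq V \<sigma> \<rho>" obtains \<chi> where "pr V V \<chi>" "\<And>x y. x \<in> carrier V \<Longrightarrow> y \<in> carrier V \<Longrightarrow> \<sigma> x y = asym \<chi> x y + \<rho> x y"
  using assms unfolding qeq_def by blast

text \<open>By \<open>lc_complement\<close>, \<open>dl V \<rho>\<close> is also represented by the dual Lagrangian and the graph. In
  this form adding an even form to \<open>\<rho>\<close> is realised by a shear of the hyperbolic form.\<close>

lemma dl_qeq: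
  assumes V: "is_based V" and p: "pr V V \<rho>" "pr V V \<sigma>" and e: "qeq V \<sigma> \<rho>"
  shows "dl V \<rho> = dl V \<sigma>"
proof -
  obtain \<chi> where c: "pr V V \<chi>" "\<And>x y. x \<in> carrier V \<Longrightarrow> y \<in> carrier V \<Longrightarrow> \<sigma> x y = asym \<chi> x y + \<rho> x y"
    by (rule qeq_asymE[OF e]) (iprover intro: that)
  let ?r = "ext2 V \<rho>" and ?s = "ext2 V \<sigma>" and ?k = "ext2 V (asym \<chi>)"
  have lm: "left_module V" "left_module (dual V)" using V by simp_all
  note k = ext2_lin[OF V pr_asym[OF c(1)]]
  define u where "u a = (fst a, snd a \<oplus>\<^bsub>dual V\<^esub> ?k (fst a))" for a
  have us: "smp (Hm V) (Hm V) u"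
    unfolding u_def[abs_def] Hm_def by (rule smp_shear[OF V is_based_dual[OF V] k])
  have "qeq (Hm V) (\<lambda>a b. hyp (u a) (u b)) hyp"
  proof (rule qeqI)
    have "lin (Hm V) V fst" by (simp add: Hm_def lin_def)
    from pr_comp[OF c(1) this this] show "pr (Hm V) (Hm V) (\<lambda>a b. \<chi> (fst a) (fst b))" .
    fix a b assume "a \<in> carrier (Hm V)" "b \<in> carrier (Hm V)"
    then show "hyp (u a) (u b) = asym (\<lambda>a b. \<chi> (fst a) (fst b)) a b + hyp a b"
      by (auto simp: carrier_Hm hyp_def u_def asym_def)
  qed
  with us have i: "isom (Hm V) hyp (Hm V) hyp u" by (simp add: isom_def)
  \<comment> \<open>\<open>u\<close> fixes \<open>iD V\<close> pointwise but moves
    \<open>iL V\<close>; this is why the Lagrangians were exchanged.\<close>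
  have D: "smp (iD V) (iD V) u"
  proof (rule smp_cong[OF smp_id[OF smp_based(2)[OF iD(1)[OF V]]]])
    fix a assume "a \<in> carrier (iD V)"
    then obtain g where g: "a = (\<zero>\<^bsub>V\<^esub>, g)" "g \<in> carrier (dual V)" by (auto simp: carrier_iD)
    show "a = u a" using lin_zero[OF lm k] lm_r_zero[OF lm(2) g(2)] by (simp add: u_def g(1) del: dual_simps)
  qed
  have G: "smp (iG V ?r) (iG V ?s) u"
  proof (rule smp_cong[OF smp_comp[OF iG_fst[OF V p(1)] iG(1)[OF V ext2_mhom[OF V p(2)]]]])
    fix a assume "a \<in> carrier (iG V ?r)"
    then obtain x where x: "a = (x, ?r x)" "x \<in> carrier V" by (auto simp: carrier_iG)
    have "?s x = ?r x \<oplus>\<^bsub>dual V\<^esub> ?k x" using x(2) c(2) by (auto simp: ext2_def fun_eq_iff add.commute)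
    then show "(fst a, ?s (fst a)) = u a" by (simp add: u_def x(1) del: dual_simps)
  qed
  note h = HP_hyperbolic[OF V]
  note cr = lc_complement[OF h dl_qfr[OF V p(1)]] and cs = lc_complement[OF h dl_qfr[OF V p(2)]]
  have "lc (Hm V) hyp (iD V) (iG V ?r) = lc (Hm V) hyp (iD V) (iG V ?s)"
    by (rule lc_qisor[OF cr(1) cs(1), of u]) (simp add: qisor_def i D G)
  then show ?thesis unfolding dl_def cr(2) cs(2) .
qed

definition tG :: "('a, 'm) based_module \<Rightarrow> ('m \<Rightarrow> 'm \<Rightarrow> 'a) \<Rightarrow> 'm \<times> ('m \<Rightarrow> 'a) \<Rightarrow> 'm \<times> ('m \<Rightarrow> 'a)" where
  "tG V \<rho> u = (\<zero>\<^bsub>V\<^esub>, ext2 V \<rho> (fst u))"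

lemma tG:
  assumes V: "is_based V" and p: "pr V V \<rho>"
  shows "lin (iL V) (iD V) (tG V \<rho>)" "smp (iL V) (iG V (ext2 V \<rho>)) (\<lambda>k. k \<oplus>\<^bsub>Hm V\<^esub> tG V \<rho> k)"
proof -
  show "lin (iL V) (iD V) (tG V \<rho>)"
    using lin_comp[OF lin_comp[OF smp_lin[OF iL_fst[OF V]] ext2_lin[OF V p]] smp_lin[OF iD(1)[OF V]]]
    by (simp add: tG_def[abs_def])
  show "smp (iL V) (iG V (ext2 V \<rho>)) (\<lambda>k. k \<oplus>\<^bsub>Hm V\<^esub> tG V \<rho> k)"
  proof (rule smp_cong[OF smp_comp[OF iL_fst[OF V] iG(1)[OF V ext2_mhom[OF V p]]]])
    fix k assume "k \<in> carrier (iL V)"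
    then obtain x where x: "k = (x, \<zero>\<^bsub>dual V\<^esub>)" "x \<in> carrier V" by (auto simp: carrier_iL)
    have "\<zero>\<^bsub>dual V\<^esub> \<oplus>\<^bsub>dual V\<^esub> ext2 V \<rho> x = ext2 V \<rho> x"
      by (rule lm_l_zero[OF left_module_dual[OF V] lin_closed[OF ext2_lin[OF V p] x(2)]])
    then show "(fst k, ext2 V \<rho> (fst k)) = k \<oplus>\<^bsub>Hm V\<^esub> tG V \<rho> k"
      unfolding x(1) tG_def Hm_def using x(2) V by (simp del: dual_simps)
  qed
qed

lemma lam_tG: "is_based V \<Longrightarrow> x \<in> carrier V \<Longrightarrow> y \<in> carrier V \<Longrightarrow> lam hyp (tG V \<rho> (x, z)) (y, \<zero>\<^bsub>dual V\<^esub>) = \<rho> x y"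
  by (simp add: lam_def hyp_def tG_def)

text \<open>Instead of extending \<open>f\<close> to hyperbolic forms, the boundary over
  \<open>W\<close> is read by \<open>dl_HP\<close> with \<open>V\<close> as parameter module. This
  gives the pullback of \<sigma>, which agrees with \<rho> up to \<open>qeq\<close>.\<close>

lemma dl_isom:
  assumes p: "pr V V \<rho>" "pr W W \<sigma>" and f: "isom V \<rho> W \<sigma> f" shows "dl V \<rho> = dl W \<sigma>"
proof -
  note s = isom_smp[OF f]
  note b = smp_based[OF s] and fc = smp_closed[OF s]
  let ?r = "\<lambda>x y. \<sigma> (f x) (f y)"
  have e: "lam hyp (tG W \<sigma> (f x, \<zero>\<^bsub>dual W\<^esub>)) (f y, \<zero>\<^bsub>dual W\<^esub>) = ?r x y" if "x \<in> carrier V" "y \<in> carrier V" for x y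
    by (rule lam_tG[OF b(2) fc[OF that(1)] fc[OF that(2)]])
  have "dl W \<sigma> = dl V (\<lambda>x y. lam hyp (tG W \<sigma> (f x, \<zero>\<^bsub>dual W\<^esub>)) (f y, \<zero>\<^bsub>dual W\<^esub>))"
    unfolding dl_def[of W]
    by (rule dl_HP(2)[OF HP_hyperbolic[OF b(2)] smp_comp[OF s iL(1)[OF b(2)]] tG[OF b(2) p(2)] iG(2)[OF b(2) ext2_mhom[OF b(2) p(2)]]])
  also have "\<dots> = dl V ?r" by (rule dl_cong) (rule e)
  also have "\<dots> = dl V \<rho>"
    by (rule dl_qeq[OF b(1) pr_comp[OF p(2) smp_lin[OF s] smp_lin[OF s]] p(1) qeq_sym[OF isom_qeq[OF f]]])
  finally show ?thesis by simp
qed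

text \<open>The sum of the two boundaries is again a graph over a Lagrangian with a complement, so
  \<open>dl_HP\<close> identifies its form.\<close>

lemma dl_sum:
  assumes V: "is_based V" "pr V V \<rho>" and W: "is_based W" "pr W W \<sigma>"
  shows "dl V \<rho> \<otimes>\<^bsub>l_monoid\<^esub> dl W \<sigma> = dl (bsum V W) (osum \<rho> \<sigma>)"
proof -
  let ?g = "map_prod (\<lambda>x. (x, \<zero>\<^bsub>dual V\<^esub>)) (\<lambda>x. (x, \<zero>\<^bsub>dual W\<^esub>))"
  let ?t = "map_prod (tG V \<rho>) (tG W \<sigma>)"
  let ?M = "bsum (Hm V) (Hm W)" and ?S = "bsum (iG V (ext2 V \<rho>)) (iG W (ext2 W \<sigma>))"
  note q = dl_qfr[OF V] dl_qfr[OF W]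
  have t: "lin (bsum (iL V) (iL W)) (bsum (iD V) (iD W)) ?t"
    unfolding lin_bsum by (rule lin_map_prod[OF tG(1)[OF V] tG(1)[OF W]])
  have S: "smp (bsum (iL V) (iL W)) ?S (\<lambda>k. k \<oplus>\<^bsub>?M\<^esub> ?t k)"
    by (rule smp_cong[OF smp_bsum[OF tG(2)[OF V] tG(2)[OF W]]]) auto
  have "dl V \<rho> \<otimes>\<^bsub>l_monoid\<^esub> dl W \<sigma> = lc ?M (osum hyp hyp) (bsum (iL V) (iL W)) ?S"
    unfolding dl_def by (rule lc_mult[OF q])
  also have "\<dots> = dl (bsum V W) (\<lambda>x y. lam (osum hyp hyp) (?t (?g x)) (?g y))"
    by (rule dl_HP(2)[OF HP_sum[OF HP_hyperbolic[OF V(1)] HP_hyperbolic[OF W(1)]]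
      smp_bsum[OF iL(1)[OF V(1)] iL(1)[OF W(1)]] t S qfrD(6)[OF qfr_sum[OF q]]])
  also have "\<dots> = dl (bsum V W) (osum \<rho> \<sigma>)"
    unfolding lam_osum
    by (rule dl_cong) (use lam_tG[OF V(1), of _ _ \<rho>] lam_tG[OF W(1), of _ _ \<sigma>] in \<open>auto simp: osum_def simp del: dual_simps\<close>)
  finally show ?thesis .
qed

text \<open>The graph of the zero map is the Lagrangian itself, and a formation with both entries
  equal is not trivial on its face. After passing to the dual Lagrangian the two entries are
  complementary.\<close>

lemma dl_zero: assumes P: "is_based P" shows "dl P (\<lambda>_ _. 0) = \<one>\<^bsub>l_monoid\<^esub>"
proof -
  note h = HP_hyperbolic[OF P]
  have p: "pr P P (\<lambda>_ _. 0)" by (rule pr_0)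
  let ?G = "iG P (ext2 P (\<lambda>_ _. 0))"
  note c = lc_complement[OF h dl_qfr[OF P p]]
  have G: "smp ?G (iL P) (\<lambda>x. x)"
  proof (rule smp_cong[OF smp_comp[OF iG_fst[OF P p] iL(1)[OF P]]])
    fix u assume "u \<in> carrier ?G"
    then show "(fst u, \<zero>\<^bsub>dual P\<^esub>) = u" by (auto simp: carrier_iG ext2_def)
  qed
  have "qisor (Hm P) hyp (iD P) ?G (Hm P) hyp (iD P) (iL P) (\<lambda>x. x)"
    unfolding qisor_def using G isom_id[OF based_Hm[OF P] qeq_refl] smp_id[OF smp_based(2)[OF iD(1)[OF P]]] by blast
  from lc_qisor[OF c(1) HP_qfr[OF HP_sym[OF h]] this] show ?thesis
    unfolding dl_def c(2) lc_HP[OF HP_sym[OF h]] .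
qed

lemma dl_zs:
  fixes V :: "('a, 'm) based_module" and W :: "('a, 'n) based_module"
  assumes V: "is_based V" "pr V V \<rho>" and W: "is_based W" "pr W W \<sigma>"
    and z: "zs_isometric (V, Qc V \<rho>) (W, Qc W \<sigma>)"
  shows "dl V \<rho> = dl W \<sigma>"
proof -
  interpret l: comm_monoid l_monoid by (rule comm_monoid_l)
  obtain P P' :: "('a, 'a univ) based_module" and f where P: "is_based P" "is_based P'"
    "is_isometry (form_sum (V, Qc V \<rho>) (zero_form P)) (form_sum (W, Qc W \<sigma>) (zero_form P')) f"
    using z unfolding zs_isometric_def by blast
  note pv = pr_osum'[OF V(2) pr_0[of P P]] and pw = pr_osum'[OF W(2) pr_0[of P' P']]
  have "isom (bsum V P) (osum \<rho> (\<lambda>_ _. 0)) (bsum W P') (osum \<sigma> (\<lambda>_ _. 0)) f"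
    by (rule isometryD[OF is_based_bsum[OF V(1) P(1)] is_based_bsum[OF W(1) P(2)] pv pw
      P(3)[unfolded zero_form_eq[OF P(1)] zero_form_eq[OF P(2)] form_sum_Qc[OF V P(1) pr_0] form_sum_Qc[OF W P(2) pr_0]]])
  from dl_isom[OF pv pw this] show ?thesis
    using dl_sum[OF V P(1) pr_0] dl_sum[OF W P(2) pr_0] dl_carrier[OF V] dl_carrier[OF W]
    by (simp add: dl_zero P)
qed

lemma e_map_class:
  fixes V :: "('a, 'm) based_module"
  assumes V: "is_based V" "pr V V \<rho>" shows "e_map (zs_class (V, Qc V \<rho>)) = dl V \<rho>"
proof -
  have eq: "(\<Union>r\<in>\<theta>. l_class (boundary W r)) = dl V \<rho>" if w: "(W, \<theta>) \<in> zs_class (V, Qc V \<rho>)" for W :: "('a, 'a univ) based_module" and \<theta>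
  proof -
    have f: "is_form (W, \<theta>)" "zs_isometric (V, Qc V \<rho>) (W, \<theta>)" using w by (auto simp: zs_class_def)
    obtain \<sigma> where s: "\<theta> = Qc W \<sigma>" "is_based W" "pr W W \<sigma>" by (rule formE[OF f(1)]) auto
    have lW: "left_module W" using s(2) by simp
    show ?thesis
    proof (rule SUP_eq_const)
      show "\<theta> \<noteq> {}" unfolding s(1) using ext2_mem_Qc[OF lW s(3)] by blast
      fix r assume "r \<in> \<theta>"
      then have r: "r \<in> mhom W (dual_module W)" "qeq W r \<sigma>" unfolding s(1) Qc_mem[OF lW s(3)] by auto
      show "l_class (boundary W r) = dl V \<rho>"
        unfolding dl_boundary[OF r(1)] dl_qeq[OF s(2,3) mhom_dual_pr[OF lW r(1)] r(2), symmetric]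
        by (rule dl_zs[OF V s(2,3) f(2)[unfolded s(1)], symmetric])
    qed
  qed
  obtain u :: "('a, 'a univ) qform" where u: "is_form u" "fiso u (V, Qc V \<rho>)" by (rule fiso_univ[OF formI[OF V]])
  have "zs_isometric (V, Qc V \<rho>) u"
    using zs_class_eq_iff[OF formI[OF V] u(1)] fiso_zs[OF u(2)] by simp
  then have "u \<in> zs_class (V, Qc V \<rho>)" using u(1) by (simp add: zs_class_def)
  then have "zs_class (V, Qc V \<rho>) \<noteq> {}" by blast
  then show ?thesis unfolding e_map_def
    by (rule SUP_eq_const) (use eq in \<open>simp add: split_beta\<close>)
qed

text \<open>On the graph \<open>hyp (x, \<rho> x) (y, \<rho> y) = \<rho> x y\<close>, so projection
  to \<open>V\<close> is an isometry from the restricted form to \<rho>.\<close>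

lemma bmap_dl:
  assumes V: "is_based V" "pr V V \<rho>" shows "bmap (dl V \<rho>) = zs_class (V, Qc V \<rho>)"
proof -
  let ?G = "iG V (ext2 V \<rho>)"
  note q = dl_qfr[OF V]
  note d = qfrD[OF q]
  have "isom ?G hyp V \<rho> fst"
    unfolding isom_def using iG_fst[OF V] by (auto intro!: qeq_refl simp: carrier_iG hyp_def)
  then have "fiso (?G, Qc ?G hyp) (V, Qc V \<rho>)"
    using fiso_iff[OF d(4) pr_sub[OF d(1,6)] V] by blast
  then show ?thesis unfolding dl_def lc_def bmap_class[OF qfI[OF q]] bz_Qc[OF q] by (rule fiso_zs)
qed

subsection \<open>Elementary elements\<close>

lemma dl_El: assumes V: "is_based V" "pr V V \<rho>" shows "dl V \<rho> \<in> carrier El_monoid"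
proof -
  obtain f and R :: "('a, 'a univ) based_module" where R: "is_based R" "smp V R f" by (rule univ_based[OF V(1)])
  let ?g = "inv_into (carrier V) f"
  note g = smp_inv[OF R(2)]
  let ?r = "\<lambda>x y. \<rho> (?g x) (?g y)"
  have p: "pr R R ?r" by (rule pr_comp[OF V(2) smp_lin[OF g] smp_lin[OF g]])
  have "isom R ?r V \<rho> ?g" using g by (simp add: isom_def qeq_refl)
  from dl_isom[OF p V(2) this] have "dl V \<rho> = dl R ?r" by simp
  also have "\<dots> = dl R (ext2 R ?r)" by (rule dl_cong) simp
  also have "\<dots> = l_class (boundary R (ext2 R ?r))" by (rule dl_boundary[OF ext2_mhom[OF R(1) p], symmetric])
  finally show ?thesis using R(1) ext2_mhom[OF R(1) p] unfolding El_monoid_def by auto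
qed

lemma El_E:
  assumes "X \<in> carrier El_monoid"
  obtains V :: "('a, 'a univ) based_module" and \<rho> where "is_based V" "pr V V \<rho>" "X = dl V \<rho>"
proof -
  obtain V :: "('a, 'a univ) based_module" and F where V: "X = l_class (boundary V F)" "is_based V" "F \<in> mhom V (dual_module V)"
    using assms unfolding El_monoid_def by auto
  show ?thesis by (rule that[OF V(2) mhom_dual_pr[OF is_based_left_module[OF V(2)] V(3)]]) (simp add: V dl_boundary)
qed

lemma El_mult: "X \<otimes>\<^bsub>El_monoid\<^esub> Y = X \<otimes>\<^bsub>l_monoid\<^esub> Y" and El_one: "\<one>\<^bsub>El_monoid\<^esub> = \<one>\<^bsub>l_monoid\<^esub>"
  by (simp_all add: El_monoid_def)

lemma El_sub: "X \<in> carrier El_monoid \<Longrightarrow> X \<in> carrier l_monoid"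
  by (rule El_E) (auto intro: dl_carrier)

lemma El_closed: assumes X: "X \<in> carrier El_monoid" and Y: "Y \<in> carrier El_monoid" shows "X \<otimes>\<^bsub>l_monoid\<^esub> Y \<in> carrier El_monoid"
proof -
  obtain V :: "('a, 'a univ) based_module" and \<rho> where V: "is_based V" "pr V V \<rho>" "X = dl V \<rho>" by (rule El_E[OF X])
  obtain W :: "('a, 'a univ) based_module" and \<sigma> where W: "is_based W" "pr W W \<sigma>" "Y = dl W \<sigma>" by (rule El_E[OF Y])
  show ?thesis unfolding V(3) W(3) dl_sum[OF V(1,2) W(1,2)]
    by (rule dl_El[OF is_based_bsum[OF V(1) W(1)] pr_osum'[OF V(2) W(2)]])
qed

lemma submonoid_El: "submonoid (carrier El_monoid) l_monoid"
proof
  show "carrier El_monoid \<subseteq> carrier l_monoid" using El_sub by blast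
  show "\<one>\<^bsub>l_monoid\<^esub> \<in> carrier El_monoid"
    using dl_El[OF is_based_std pr_0, of 0] by (simp add: dl_zero)
qed (rule El_closed)

lemma comm_monoid_El: "comm_monoid El_monoid"
proof -
  interpret l: comm_monoid l_monoid by (rule comm_monoid_l)
  interpret s: submonoid "carrier El_monoid" l_monoid by (rule submonoid_El)
  show ?thesis
  proof (rule comm_monoidI)
    show "X \<otimes>\<^bsub>El_monoid\<^esub> Y = Y \<otimes>\<^bsub>El_monoid\<^esub> X" if "X \<in> carrier El_monoid" "Y \<in> carrier El_monoid" for X Y
      unfolding El_mult by (rule l.m_comm[OF El_sub[OF that(1)] El_sub[OF that(2)]])
  qed (simp_all add: El_mult El_one El_closed El_sub l.m_assoc)
qed

lemma e_bmap: "X \<in> carrier El_monoid \<Longrightarrow> e_map (bmap X) = X"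
  by (rule El_E) (auto simp: bmap_dl e_map_class)

lemma Fzs_E:
  assumes "X \<in> carrier Fzs"
  obtains V :: "('a, 'a univ) based_module" and \<rho> where "is_based V" "pr V V \<rho>" "X = zs_class (V, Qc V \<rho>)"
proof -
  obtain v :: "('a, 'a univ) qform" where v: "is_form v" "X = zs_class v" using assms by (auto simp: Fzs_def)
  show ?thesis by (rule formE[OF v(1)]) (use v(2) that in blast)
qed

lemma bmap_e: "X \<in> carrier Fzs \<Longrightarrow> bmap (e_map X) = X"
  by (rule Fzs_E) (auto simp: bmap_dl e_map_class)

lemma e_map_iso: "e_map \<in> iso Fzs El_monoid"
proof (rule isoI)
  have c: "e_map X \<in> carrier El_monoid" if X: "X \<in> carrier Fzs" for X
  proof -
    obtain V :: "('a, 'a univ) based_module" and \<rho> where V: "is_based V" "pr V V \<rho>" "X = zs_class (V, Qc V \<rho>)" by (rule Fzs_E[OF X])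
    show ?thesis unfolding V(3) e_map_class[OF V(1,2)] by (rule dl_El[OF V(1,2)])
  qed
  show "e_map \<in> hom Fzs El_monoid"
  proof (rule homI[OF c])
    fix X Y assume X: "X \<in> carrier Fzs" and Y: "Y \<in> carrier Fzs"
    obtain V :: "('a, 'a univ) based_module" and \<rho> where V: "is_based V" "pr V V \<rho>" "X = zs_class (V, Qc V \<rho>)" by (rule Fzs_E[OF X])
    obtain W :: "('a, 'a univ) based_module" and \<sigma> where W: "is_based W" "pr W W \<sigma>" "Y = zs_class (W, Qc W \<sigma>)" by (rule Fzs_E[OF Y])
    have "X \<otimes>\<^bsub>Fzs\<^esub> Y = zs_class (bsum V W, Qc (bsum V W) (osum \<rho> \<sigma>))"
      unfolding V(3) W(3) Fzs_mult[OF formI[OF V(1,2)] formI[OF W(1,2)]] form_sum_Qc[OF V(1,2) W(1,2)] ..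
    then show "e_map (X \<otimes>\<^bsub>Fzs\<^esub> Y) = e_map X \<otimes>\<^bsub>El_monoid\<^esub> e_map Y"
      unfolding V(3) W(3) e_map_class[OF V(1,2)] e_map_class[OF W(1,2)] El_mult dl_sum[OF V(1,2) W(1,2)]
      using e_map_class[OF is_based_bsum[OF V(1) W(1)] pr_osum'[OF V(2) W(2)]] by simp
  qed
  show "bij_betw e_map (carrier Fzs) (carrier El_monoid)"
  proof (rule bij_betw_byWitness)
    show "bmap ` carrier El_monoid \<subseteq> carrier Fzs" using hom_in_carrier[OF bmap_hom] El_sub by blast
  qed (use c bmap_e e_bmap in auto)
qed

subsection \<open>The difference of two Lagrangians\<close>

lemma sub_ops:
  assumes "lin L M (\<lambda>x. x)" "x \<in> carrier L" "y \<in> carrier L"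
  shows "x \<oplus>\<^bsub>L\<^esub> y = x \<oplus>\<^bsub>M\<^esub> y" "a \<odot>\<^bsub>L\<^esub> x = a \<odot>\<^bsub>M\<^esub> x"
  using lin_add[OF assms] lin_smult[OF assms(1,2)] by simp_all

lemma lin_plus:
  assumes M: "left_module M" and f: "lin A M f" and g: "lin A M g" shows "lin A M (\<lambda>x. f x \<oplus>\<^bsub>M\<^esub> g x)"
proof (rule linI)
  note c = lin_closed[OF f] lin_closed[OF g]
  fix x assume x: "x \<in> carrier A"
  show "f x \<oplus>\<^bsub>M\<^esub> g x \<in> carrier M" using c x M by simp
  show "f (a \<odot>\<^bsub>A\<^esub> x) \<oplus>\<^bsub>M\<^esub> g (a \<odot>\<^bsub>A\<^esub> x) = a \<odot>\<^bsub>M\<^esub> (f x \<oplus>\<^bsub>M\<^esub> g x)" for a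
    using c x M by (simp add: lin_smult[OF f] lin_smult[OF g] lm_smult_add)
  fix y assume y: "y \<in> carrier A"
  show "f (x \<oplus>\<^bsub>A\<^esub> y) \<oplus>\<^bsub>M\<^esub> g (x \<oplus>\<^bsub>A\<^esub> y) = f x \<oplus>\<^bsub>M\<^esub> g x \<oplus>\<^bsub>M\<^esub> (f y \<oplus>\<^bsub>M\<^esub> g y)"
    using c x y M by (simp add: lin_add[OF f] lin_add[OF g] lm_assoc lm_lcomm)
qed

lemma lin_minus: "is_based M \<Longrightarrow> lin A M f \<Longrightarrow> lin A M (\<lambda>x. (- 1) \<odot>\<^bsub>M\<^esub> f x)"
  by (rule lin_comp[OF _ smp_lin[OF smp_neg]])

lemma lin_const_zero: "left_module M \<Longrightarrow> lin A M (\<lambda>_. \<zero>\<^bsub>M\<^esub>)"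
  by (rule linI) simp_all

lemma HP_neg: assumes h: "HP M \<phi> K D" shows "HP M (\<lambda>x y. - \<phi> x y) K D"
proof -
  note H = HPD[OF h]
  have "perfect D K (lam (\<lambda>x y. - \<phi> x y))"
    by (rule perfect_cong[OF perfect_minus[OF H(5)]]) (simp add: lam_def)
  moreover have "nul K (\<lambda>x y. - \<phi> x y)" "nul D (\<lambda>x y. - \<phi> x y)"
    using qeq_minus[OF H(6)[unfolded nul_def]] qeq_minus[OF H(7)[unfolded nul_def]] by (simp_all add: nul_def)
  ultimately show ?thesis using H pr_minus[OF H(1)] by (simp add: HP_def)
qed

lemma push_ret:
  assumes P: "is_based P" and N: "is_based N" and f: "lin P N f" and r: "lin N P r"
    and rf: "\<And>x. x \<in> carrier P \<Longrightarrow> r (f x) = x"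
  shows "smp P (push_based f P N) f" "lin (push_based f P N) N (\<lambda>x. x)" "ret (push_based f P N) N"
    "smp (push_based f P N) P r" "rank (push_based f P N) = rank P"
proof -
  have "inj_on f (carrier P)" using rf by (rule inj_on_inverseI)
  note p = push_based[OF P is_based_left_module[OF N] f this]
  show s: "smp P (push_based f P N) f" and i: "lin (push_based f P N) N (\<lambda>x. x)" by (rule p)+
  show "smp (push_based f P N) P r" by (rule smp_inverse[OF s]) (auto simp: rf)
  show "rank (push_based f P N) = rank P" using rank_smp[OF s] by simp
  have "\<forall>x\<in>carrier (push_based f P N). f (r x) = x" by (auto simp: rf)
  then show "ret (push_based f P N) N"
    unfolding ret_def using p(1) i lin_comp[OF r smp_lin[OF s]] by blast
qed

section \<open>Graphs and the second summand in \<open>M \<oplus> M\<close>\<close>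

definition gph :: "('a, 'm) based_module \<Rightarrow> ('m \<Rightarrow> 'm) \<Rightarrow> ('a, 'm \<times> 'm) based_module" where
  "gph M c = push_based (\<lambda>x. (x, c x)) M (bsum M M)"

definition snd_summand :: "('a, 'm) based_module \<Rightarrow> ('a, 'm \<times> 'm) based_module" where
  "snd_summand M = push_based (\<lambda>x. (\<zero>\<^bsub>M\<^esub>, x)) M (bsum M M)"

lemma lin_fst: "lin (bsum M N) M fst" and lin_snd: "lin (bsum M N) N snd"
  by (simp_all add: lin_def)

lemma gph:
  assumes M: "is_based M" and c: "lin M M c"
  shows "smp M (gph M c) (\<lambda>x. (x, c x))" "lin (gph M c) (bsum M M) (\<lambda>x. x)" "ret (gph M c) (bsum M M)"
    "smp (gph M c) M fst" "rank (gph M c) = rank M"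
proof -
  have "lin M (bsum M M) (\<lambda>x. (x, c x))"
    by (rule linI) (use M c in \<open>auto simp: lin_closed lin_add lin_smult\<close>)
  note p = push_ret[OF M is_based_bsum[OF M M] this lin_fst, folded gph_def]
  show "smp M (gph M c) (\<lambda>x. (x, c x))" "lin (gph M c) (bsum M M) (\<lambda>x. x)" "ret (gph M c) (bsum M M)"
    "smp (gph M c) M fst" "rank (gph M c) = rank M" by (rule p; simp)+
qed

lemma snd_summand:
  assumes M: "is_based M"
  shows "smp M (snd_summand M) (\<lambda>x. (\<zero>\<^bsub>M\<^esub>, x))" "lin (snd_summand M) (bsum M M) (\<lambda>x. x)"
    "ret (snd_summand M) (bsum M M)" "smp (snd_summand M) M snd" "rank (snd_summand M) = rank M"
proof -
  have "lin M (bsum M M) (\<lambda>x. (\<zero>\<^bsub>M\<^esub>, x))"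
    by (rule linI) (use M in auto)
  note p = push_ret[OF M is_based_bsum[OF M M] this lin_snd, folded snd_summand_def]
  show "smp M (snd_summand M) (\<lambda>x. (\<zero>\<^bsub>M\<^esub>, x))" "lin (snd_summand M) (bsum M M) (\<lambda>x. x)"
    "ret (snd_summand M) (bsum M M)" "smp (snd_summand M) M snd" "rank (snd_summand M) = rank M" by (rule p; simp)+
qed

lemma carrier_gph: "carrier (gph M c) = (\<lambda>x. (x, c x)) ` carrier M"
  and carrier_snd_summand: "carrier (snd_summand M) = (\<lambda>x. (\<zero>\<^bsub>M\<^esub>, x)) ` carrier M"
  by (simp_all add: gph_def snd_summand_def)

text \<open>In the coordinates \<open>(k, b)\<close> with \<open>b = m + \<alpha> k\<close> this map is the simple isomorphism \<open>\<delta>\<close> followed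
  by a shear.\<close>

lemma smp_graph_sum:
  assumes M: "is_based M" and a: "lin K M \<alpha>" and d: "smp K M \<delta>" and c: "lin M M c"
  shows "smp (bsum K M) (bsum M M) (\<lambda>u. (snd u \<oplus>\<^bsub>M\<^esub> \<alpha> (fst u), \<delta> (fst u) \<oplus>\<^bsub>M\<^esub> c (snd u \<oplus>\<^bsub>M\<^esub> \<alpha> (fst u))))"
  using smp_comp[OF smp_shear[OF smp_based(1)[OF d] M a] smp_comp[OF smp_bsum[OF d smp_id[OF M]]
    smp_comp[OF smp_swap[OF M M] smp_shear[OF M M c]]]] by simp

lemma smp_diff:
  assumes L: "is_based L" "is_based L'" and s: "smp (bsum L L') M (\<lambda>u. fst u \<oplus>\<^bsub>M\<^esub> snd u)"
    and i: "lin L M (\<lambda>x. x)" "lin L' M (\<lambda>x. x)"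
  shows "smp (bsum L L') M (\<lambda>u. (- 1) \<odot>\<^bsub>M\<^esub> fst u \<oplus>\<^bsub>M\<^esub> snd u)" "smp (bsum L L') M (\<lambda>u. fst u \<oplus>\<^bsub>M\<^esub> (- 1) \<odot>\<^bsub>M\<^esub> snd u)"
proof -
  have e: "(- 1) \<odot>\<^bsub>L\<^esub> x = (- 1) \<odot>\<^bsub>M\<^esub> x" if "x \<in> carrier L" for x
    by (rule sub_ops(2)[OF i(1) that that])
  have e': "(- 1) \<odot>\<^bsub>L'\<^esub> x = (- 1) \<odot>\<^bsub>M\<^esub> x" if "x \<in> carrier L'" for x
    by (rule sub_ops(2)[OF i(2) that that])
  show "smp (bsum L L') M (\<lambda>u. (- 1) \<odot>\<^bsub>M\<^esub> fst u \<oplus>\<^bsub>M\<^esub> snd u)"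
    by (rule smp_cong[OF smp_comp[OF smp_bsum[OF smp_neg[OF L(1)] smp_id[OF L(2)]] s]]) (auto simp: e)
  show "smp (bsum L L') M (\<lambda>u. fst u \<oplus>\<^bsub>M\<^esub> (- 1) \<odot>\<^bsub>M\<^esub> snd u)"
    by (rule smp_cong[OF smp_comp[OF smp_bsum[OF smp_id[OF L(1)] smp_neg[OF L(2)]] s]]) (auto simp: e')
qed

text \<open>The form cancels on the diagonal, and \<open>(a, a)\<close> pairs with
  \<open>(l, l')\<close> to \<open>lam \<phi> a (l - l')\<close>. Complementarity of
  \<open>L\<close> and \<open>L'\<close> makes \<open>l - l'\<close> a simple coordinate on
  \<open>M\<close>, which gives both the splitting and perfectness.\<close>

lemma HP_diag:
  assumes h: "HP M \<phi> L L'"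
  shows "HP (bsum M M) (osum \<phi> (\<lambda>x y. - \<phi> x y)) (bsum L L') (gph M (\<lambda>x. x))"
proof -
  note H = HPD[OF h] and H' = HPD[OF HP_neg[OF h]]
  note M = H(8)
  have lm: "left_module M" "left_module L" "left_module L'" using H by simp_all
  let ?N = "bsum M M" and ?\<Delta> = "gph M (\<lambda>x. x)" and ?\<phi> = "osum \<phi> (\<lambda>x y. - \<phi> x y)"
  note g = gph[OF M lin_id]
  let ?d = "\<lambda>u. (- 1) \<odot>\<^bsub>M\<^esub> fst u \<oplus>\<^bsub>M\<^esub> snd u"
  note d = smp_diff(1)[OF H(9,10,4,2,3)]
  note lc = lin_closed[OF H(2)] and lc' = lin_closed[OF H(3)]
  have K: "lin (bsum L L') ?N (\<lambda>x. x)" using H(2,3) by (auto simp: lin_def)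
  have sm: "smp (bsum (bsum L L') ?\<Delta>) ?N (\<lambda>u. fst u \<oplus>\<^bsub>?N\<^esub> snd u)"
  proof (rule smp_cong[OF smp_comp[OF smp_bsum[OF smp_id[OF is_based_bsum[OF H(9,10)]] g(4)]
      smp_graph_sum[OF M lin_comp[OF lin_fst H(2)] d lin_id]]])
    fix u assume "u \<in> carrier (bsum (bsum L L') ?\<Delta>)"
    then obtain l l' a where u: "u = ((l, l'), (a, a))" "l \<in> carrier L" "l' \<in> carrier L'" "a \<in> carrier M" by (auto simp: carrier_gph)
    note m = lc[OF u(2)] lc'[OF u(3)] u(4)
    have "(- 1) \<odot>\<^bsub>M\<^esub> l \<oplus>\<^bsub>M\<^esub> l' \<oplus>\<^bsub>M\<^esub> (a \<oplus>\<^bsub>M\<^esub> l) = l' \<oplus>\<^bsub>M\<^esub> a"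
    proof -
      have "(- 1) \<odot>\<^bsub>M\<^esub> l \<oplus>\<^bsub>M\<^esub> l' \<oplus>\<^bsub>M\<^esub> (a \<oplus>\<^bsub>M\<^esub> l) = (- 1) \<odot>\<^bsub>M\<^esub> l \<oplus>\<^bsub>M\<^esub> (l \<oplus>\<^bsub>M\<^esub> (l' \<oplus>\<^bsub>M\<^esub> a))"
        using m lm(1) by (simp add: lm_assoc lm_comm[of M _ l] lm_lcomm)
      then show ?thesis using m lm(1) by (simp add: lm_neg3)
    qed
    then show "(snd (map_prod (\<lambda>x. x) fst u) \<oplus>\<^bsub>M\<^esub> fst (fst (map_prod (\<lambda>x. x) fst u)),
        ?d (fst (map_prod (\<lambda>x. x) fst u)) \<oplus>\<^bsub>M\<^esub> (snd (map_prod (\<lambda>x. x) fst u) \<oplus>\<^bsub>M\<^esub> fst (fst (map_prod (\<lambda>x. x) fst u)))) =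
        fst u \<oplus>\<^bsub>?N\<^esub> snd u"
      using m lm(1) by (simp add: u(1) lm_comm[of M a])
  qed
  have pl: "pr M M (lam \<phi>)" by (rule pr_lam[OF H(1)])
  have pf: "perfect ?\<Delta> (bsum L L') (lam ?\<phi>)"
  proof (rule perfect_cong[OF perfect_minus[OF perfect_right[OF perfect_left[OF HP_perfect[OF h] g(4)] d]]])
    fix x y assume "x \<in> carrier ?\<Delta>" "y \<in> carrier (bsum L L')"
    then obtain a l l' where x: "x = (a, a)" "a \<in> carrier M" and y: "y = (l, l')" "l \<in> carrier L" "l' \<in> carrier L'"
      by (auto simp: carrier_gph)
    note m = lc[OF y(2)] lc'[OF y(3)] x(2)
    have "lam \<phi> a ((- 1) \<odot>\<^bsub>M\<^esub> l \<oplus>\<^bsub>M\<^esub> l') = - lam \<phi> a l + lam \<phi> a l'"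
      using m lm(1) by (simp add: pr_add2[OF pl] pr_smult2[OF pl])
    moreover have "lam ?\<phi> x y = lam \<phi> a l - lam \<phi> a l'" by (simp add: lam_osum x(1) y(1) osum_def) (simp add: lam_def)
    ultimately show "- lam \<phi> (fst x) (?d y) = lam ?\<phi> x y" by (simp add: x(1) y(1))
  qed
  have n: "nul (bsum L L') ?\<phi>" by (rule nul_osum[OF lm(2,3) H(6) H'(7)])
  have n': "nul ?\<Delta> ?\<phi>" unfolding nul_def by (rule qeq_refl) (auto simp: carrier_gph osum_def)
  show ?thesis unfolding HP_def using pr_osum'[OF H(1) H'(1)] K g(2) sm pf n n' by blast
qed

lemma HP_elementary:
  assumes h: "HP M \<phi> K D" and t: "lin K D t" and S: "smp K S (\<lambda>k. k \<oplus>\<^bsub>M\<^esub> t k)" and i: "lin S M (\<lambda>x. x)"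
  shows "qfr M \<phi> K S" "lc M \<phi> K S \<in> carrier El_monoid"
proof -
  note H = HPD[OF h]
  note d = dl_HP[OF h smp_id[OF H(9)] t S i]
  show "qfr M \<phi> K S" by (rule d(1))
  show "lc M \<phi> K S \<in> carrier El_monoid"
    unfolding d(2) by (rule dl_El[OF H(9) pr_comp[OF pr_lam[OF H(1)] lin_comp[OF t H(3)] H(2)]])
qed

text \<open>The sum \<open>V \<oplus> W\<close> is the graph of a map from \<open>L \<oplus> L'\<close> to the diagonal, as \<open>M = V + W\<close> allows to
  solve \<open>v - w = l - l'\<close>.\<close>

lemma opposite_elementary:
  assumes h: "HP M \<phi> L L'" and s: "smp (bsum V W) M (\<lambda>u. fst u \<oplus>\<^bsub>M\<^esub> snd u)"
    and q: "qfr M \<phi> L V" and q': "qfr M (\<lambda>x y. - \<phi> x y) L' W"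
  shows "lc M \<phi> L V \<otimes>\<^bsub>l_monoid\<^esub> lc M (\<lambda>x y. - \<phi> x y) L' W \<in> carrier El_monoid"
proof -
  note H = HPD[OF h] and d = qfrD[OF q] and d' = qfrD[OF q']
  note M = H(8)
  have lm: "left_module M" using M by simp
  let ?N = "bsum M M" and ?K = "bsum L L'" and ?S = "bsum V W"
  let ?e = "\<lambda>u. fst u \<oplus>\<^bsub>M\<^esub> (- 1) \<odot>\<^bsub>M\<^esub> snd u"
  note e = smp_diff(2)[OF d(4) d'(4) s d(6) d'(6)] and f = smp_diff(2)[OF H(9,10,4,2,3)]
  let ?i = "inv_into (carrier ?S) ?e"
  define \<sigma> where "\<sigma> k = ?i (?e k)" for k
  have \<sigma>: "smp ?K ?S \<sigma>" unfolding \<sigma>_def[abs_def] by (rule smp_comp[OF f smp_inv[OF e]])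
  \<comment> \<open>With \<open>\<sigma> k = (v, w)\<close> this is \<open>v - l\<close>. The
    equation \<open>v - w = l - l'\<close> then yields \<open>w = l' + a k\<close>, so
    \<open>(v, w)\<close> differs from \<open>(l, l')\<close> by a diagonal element.\<close>
  define a where "a k = fst (\<sigma> k) \<oplus>\<^bsub>M\<^esub> (- 1) \<odot>\<^bsub>M\<^esub> fst k" for k
  have a: "lin ?K M a"
    unfolding a_def[abs_def]
    by (rule lin_plus[OF lm lin_comp[OF lin_comp[OF smp_lin[OF \<sigma>] lin_fst] d(6)] lin_minus[OF M lin_comp[OF lin_fst H(2)]]])
  note g = gph[OF M lin_id]
  have t: "lin ?K (gph M (\<lambda>x. x)) (\<lambda>k. (a k, a k))" by (rule lin_comp[OF a smp_lin[OF g(1)]])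
  have "smp ?K ?S (\<lambda>k. k \<oplus>\<^bsub>?N\<^esub> (a k, a k))"
  proof (rule smp_cong[OF \<sigma>])
    fix k assume k: "k \<in> carrier ?K"
    obtain l l' where l: "k = (l, l')" "l \<in> carrier L" "l' \<in> carrier L'" using k by auto
    obtain v w where v: "\<sigma> k = (v, w)" "v \<in> carrier V" "w \<in> carrier W" using smp_closed[OF \<sigma> k] by auto
    note m = lin_closed[OF H(2) l(2)] lin_closed[OF H(3) l(3)] lin_closed[OF d(6) v(2)] lin_closed[OF d'(6) v(3)]
    have "?e (\<sigma> k) = ?e k" unfolding \<sigma>_def by (rule liso_inv_into(2)[OF smp_liso[OF e] smp_closed[OF f k]])
    then have eq: "v \<oplus>\<^bsub>M\<^esub> (- 1) \<odot>\<^bsub>M\<^esub> w = l \<oplus>\<^bsub>M\<^esub> (- 1) \<odot>\<^bsub>M\<^esub> l'" unfolding v(1) unfolding l(1) by simp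
    have "l \<oplus>\<^bsub>M\<^esub> (v \<oplus>\<^bsub>M\<^esub> (- 1) \<odot>\<^bsub>M\<^esub> l) = v"
      using m lm by (simp add: lm_comm[of M v] lm_neg2)
    moreover have "l' \<oplus>\<^bsub>M\<^esub> (v \<oplus>\<^bsub>M\<^esub> (- 1) \<odot>\<^bsub>M\<^esub> l) = w"
    proof -
      have "v = v \<oplus>\<^bsub>M\<^esub> (- 1) \<odot>\<^bsub>M\<^esub> w \<oplus>\<^bsub>M\<^esub> w" using m lm by (simp add: lm_assoc lm_neg4)
      also have "\<dots> = l \<oplus>\<^bsub>M\<^esub> (- 1) \<odot>\<^bsub>M\<^esub> l' \<oplus>\<^bsub>M\<^esub> w" by (simp only: eq)
      finally have "l' \<oplus>\<^bsub>M\<^esub> (v \<oplus>\<^bsub>M\<^esub> (- 1) \<odot>\<^bsub>M\<^esub> l) = l' \<oplus>\<^bsub>M\<^esub> (l \<oplus>\<^bsub>M\<^esub> (- 1) \<odot>\<^bsub>M\<^esub> l' \<oplus>\<^bsub>M\<^esub> w \<oplus>\<^bsub>M\<^esub> (- 1) \<odot>\<^bsub>M\<^esub> l)"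
        by simp
      also have "\<dots> = l \<oplus>\<^bsub>M\<^esub> ((- 1) \<odot>\<^bsub>M\<^esub> l \<oplus>\<^bsub>M\<^esub> (l' \<oplus>\<^bsub>M\<^esub> ((- 1) \<odot>\<^bsub>M\<^esub> l' \<oplus>\<^bsub>M\<^esub> w)))"
        using m lm by (simp add: lm_assoc lm_comm[of M w] lm_lcomm)
      also have "\<dots> = w" using m lm by (simp add: lm_neg2)
      finally show ?thesis .
    qed
    ultimately show "\<sigma> k = k \<oplus>\<^bsub>?N\<^esub> (a k, a k)" unfolding a_def v(1) unfolding l(1) by simp
  qed
  from HP_elementary(2)[OF HP_diag[OF h] t this qfrD(6)[OF qfr_sum[OF q q']]]
  show ?thesis unfolding lc_mult[OF q q'] .
qed

text \<open>If \<open>h : V \<cong> D\<close> for a complementary Lagrangian \<open>D\<close>, the graph \<open>\<Gamma>\<close> of \<open>h\<close>, extended by zero, is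
  transverse both to \<open>V \<oplus> L\<close> and to \<open>0 \<oplus> M\<close>. The latter is elementary, and \<open>(M, -\<phi>; D, L)\<close>
  is trivial.\<close>

lemma surj_aux:
  assumes hp: "HP M \<phi> L D" and q: "qfr M \<phi> L V" and h: "smp V D h"
  shows "\<exists>A\<in>carrier El_monoid. \<exists>B\<in>carrier El_monoid. lc M \<phi> L V \<otimes>\<^bsub>l_monoid\<^esub> A = B"
proof -
  interpret l: comm_monoid l_monoid by (rule comm_monoid_l)
  note H = HPD[OF hp] and d = qfrD[OF q]
  \<comment> \<open>On the second copy of \<open>M\<close>, with the opposite form, the roles of
    \<open>L\<close> and \<open>D\<close> are exchanged; thus \<open>L\<close> occurs there as the
    second entry of a trivial formation.\<close>
  note M = H(8) and hn = HP_sym[OF HP_neg[OF hp]]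
  have lm: "left_module M" using M by simp
  obtain p where p: "lin M V p" "\<And>x. x \<in> carrier V \<Longrightarrow> p x = x" using q unfolding qfr_def ret_def by blast
  let ?m = "\<lambda>x y. - \<phi> x y"
  let ?N = "bsum M M" and ?f = "osum \<phi> ?m" and ?K = "bsum L D" and ?K' = "bsum D L"
  let ?c = "\<lambda>x. h (p x)"
  have c: "lin M M ?c" by (rule lin_comp[OF lin_comp[OF p(1) smp_lin[OF h]] H(3)])
  note g = gph[OF M c] and z = snd_summand[OF M]
  let ?G = "gph M ?c" and ?Z = "snd_summand M"
  note hN = HP_sum[OF hp hn]
  have rk: "rank ?N = 2 * rank M" using rank_bsum[OF M M] by simp
  have qZ: "qfr ?N ?f ?K ?Z" unfolding qfr_def using hN z(3,5) rk by auto
  have qG: "qfr ?N (\<lambda>x y. - ?f x y) ?K' ?G" unfolding qfr_def using HP_neg[OF HP_sym[OF hN]] g(3,5) rk by auto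
  note q0 = HP_qfr[OF hn]
  note qV = qfr_sum[OF q q0]
  have x0: "lc M ?m D L = \<one>\<^bsub>l_monoid\<^esub>" by (rule lc_HP[OF hn])
  define Y where "Y = lc ?N (\<lambda>x y. - ?f x y) ?K' ?G"
  have Y: "Y \<in> carrier l_monoid" unfolding Y_def by (rule lc_carrier[OF qG])
  \<comment> \<open>Adding the trivial formation given by \<open>q0\<close> enlarges
    \<open>V\<close> to \<open>V \<oplus> L\<close> without changing the class.\<close>
  have X: "lc M \<phi> L V = lc ?N ?f ?K (bsum V L)"
    using lc_mult[OF q q0] lc_carrier[OF q] by (simp add: x0)
  \<comment> \<open>The map \<delta> for \<open>smp_graph_sum\<close>: subtracting the graph element
    over \<open>v\<close> from \<open>(v, l)\<close> leaves \<open>- h v + l\<close> in the second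
    coordinate. It is simple because \<open>h\<close> identifies \<open>V\<close> with the
    complement \<open>D\<close> of \<open>L\<close>.\<close>
  let ?d = "\<lambda>u. (- 1) \<odot>\<^bsub>M\<^esub> h (fst u) \<oplus>\<^bsub>M\<^esub> snd u"
  have dl: "smp (bsum V L) M ?d"
    using smp_comp[OF smp_bsum[OF h smp_id[OF H(9)]] smp_diff(1)[OF H(10,9) HPD(4)[OF HP_sym[OF hp]] H(3,2)]] by simp
  have s1: "smp (bsum (bsum V L) ?G) ?N (\<lambda>u. fst u \<oplus>\<^bsub>?N\<^esub> snd u)"
  proof (rule smp_cong[OF smp_comp[OF smp_bsum[OF smp_id[OF is_based_bsum[OF d(4) H(9)]] g(4)]
      smp_graph_sum[OF M lin_comp[OF lin_fst d(6)] dl c]]])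
    fix u assume "u \<in> carrier (bsum (bsum V L) ?G)"
    then obtain v l m where u: "u = ((v, l), (m, ?c m))" "v \<in> carrier V" "l \<in> carrier L" "m \<in> carrier M" by (auto simp: carrier_gph)
    have k: "v \<in> carrier M" "l \<in> carrier M" "h v \<in> carrier M" "?c m \<in> carrier M"
      using lin_closed[OF d(6) u(2)] lin_closed[OF H(2) u(3)] lin_closed[OF H(3) smp_closed[OF h u(2)]] lin_closed[OF c u(4)] by simp_all
    have "?c (m \<oplus>\<^bsub>M\<^esub> v) = ?c m \<oplus>\<^bsub>M\<^esub> h v" using lin_add[OF c u(4) k(1)] p(2)[OF u(2)] by simp
    moreover have "(- 1) \<odot>\<^bsub>M\<^esub> h v \<oplus>\<^bsub>M\<^esub> l \<oplus>\<^bsub>M\<^esub> (?c m \<oplus>\<^bsub>M\<^esub> h v) = l \<oplus>\<^bsub>M\<^esub> ?c m"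
    proof -
      have "(- 1) \<odot>\<^bsub>M\<^esub> h v \<oplus>\<^bsub>M\<^esub> l \<oplus>\<^bsub>M\<^esub> (?c m \<oplus>\<^bsub>M\<^esub> h v) = (- 1) \<odot>\<^bsub>M\<^esub> h v \<oplus>\<^bsub>M\<^esub> (h v \<oplus>\<^bsub>M\<^esub> (l \<oplus>\<^bsub>M\<^esub> ?c m))"
        using k lm by (simp add: lm_assoc lm_comm[of M _ "h v"] lm_lcomm)
      then show ?thesis using k lm by (simp add: lm_neg3)
    qed
    ultimately show "(snd (map_prod (\<lambda>x. x) fst u) \<oplus>\<^bsub>M\<^esub> fst (fst (map_prod (\<lambda>x. x) fst u)),
        ?d (fst (map_prod (\<lambda>x. x) fst u)) \<oplus>\<^bsub>M\<^esub> ?c (snd (map_prod (\<lambda>x. x) fst u) \<oplus>\<^bsub>M\<^esub> fst (fst (map_prod (\<lambda>x. x) fst u)))) =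
        fst u \<oplus>\<^bsub>?N\<^esub> snd u"
      using k u(4) lm by (simp add: u(1) lm_comm[of M m])
  qed
  have s2: "smp (bsum ?Z ?G) ?N (\<lambda>u. fst u \<oplus>\<^bsub>?N\<^esub> snd u)"
  proof (rule smp_cong[OF smp_comp[OF smp_bsum[OF z(4) g(4)] smp_graph_sum[OF M lin_const_zero[OF lm] smp_id[OF M] c]]])
    fix u assume "u \<in> carrier (bsum ?Z ?G)"
    then obtain b m where u: "u = ((\<zero>\<^bsub>M\<^esub>, b), (m, ?c m))" "b \<in> carrier M" "m \<in> carrier M"
      by (auto simp: carrier_gph carrier_snd_summand)
    then show "(snd (map_prod snd fst u) \<oplus>\<^bsub>M\<^esub> \<zero>\<^bsub>M\<^esub>, fst (map_prod snd fst u) \<oplus>\<^bsub>M\<^esub> ?c (snd (map_prod snd fst u) \<oplus>\<^bsub>M\<^esub> \<zero>\<^bsub>M\<^esub>)) =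
        fst u \<oplus>\<^bsub>?N\<^esub> snd u"
      using lm by simp
  qed
  have E1: "lc M \<phi> L V \<otimes>\<^bsub>l_monoid\<^esub> Y \<in> carrier El_monoid"
    unfolding X Y_def by (rule opposite_elementary[OF hN s1 qV qG])
  have E2: "lc ?N ?f ?K ?Z \<otimes>\<^bsub>l_monoid\<^esub> Y \<in> carrier El_monoid"
    unfolding Y_def by (rule opposite_elementary[OF hN s2 qZ qG])
  \<comment> \<open>Over \<open>L \<oplus> D\<close>, the summand \<open>0 \<oplus> M\<close> is a
    graph with values in the diagonal, as \<open>(x, y) - (x, x) = (0, y - x)\<close>.\<close>
  have E3: "lc ?N ?f ?K ?Z \<in> carrier El_monoid"
  proof (rule HP_elementary(2)[OF HP_diag[OF hp] _ _ z(2)])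
    let ?t = "\<lambda>k. ((- 1) \<odot>\<^bsub>M\<^esub> fst k, (- 1) \<odot>\<^bsub>M\<^esub> fst k)"
    show "lin ?K (gph M (\<lambda>x. x)) ?t"
      by (rule lin_comp[OF lin_minus[OF M lin_comp[OF lin_fst H(2)]] smp_lin[OF gph(1)[OF M lin_id]]])
    show "smp ?K ?Z (\<lambda>k. k \<oplus>\<^bsub>?N\<^esub> ?t k)"
    proof (rule smp_cong[OF smp_comp[OF smp_diff(1)[OF H(9,10,4,2,3)] z(1)]])
      fix k assume "k \<in> carrier ?K"
      then obtain x y where k: "k = (x, y)" "x \<in> carrier L" "y \<in> carrier D" by auto
      show "(\<zero>\<^bsub>M\<^esub>, (- 1) \<odot>\<^bsub>M\<^esub> fst k \<oplus>\<^bsub>M\<^esub> snd k) = k \<oplus>\<^bsub>?N\<^esub> ?t k"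
        using lin_closed[OF H(2) k(2)] lin_closed[OF H(3) k(3)] lm by (simp add: k(1) lm_neg lm_comm[of M y])
    qed
  qed
  have "lc M \<phi> L V \<otimes>\<^bsub>l_monoid\<^esub> (lc ?N ?f ?K ?Z \<otimes>\<^bsub>l_monoid\<^esub> Y) = lc M \<phi> L V \<otimes>\<^bsub>l_monoid\<^esub> Y \<otimes>\<^bsub>l_monoid\<^esub> lc ?N ?f ?K ?Z"
    using lc_carrier[OF q] Y lc_carrier[OF qZ] by (simp add: l.m_ac)
  with El_closed[OF E1 E3] have "lc M \<phi> L V \<otimes>\<^bsub>l_monoid\<^esub> (lc ?N ?f ?K ?Z \<otimes>\<^bsub>l_monoid\<^esub> Y) \<in> carrier El_monoid" by simp
  with E2 show ?thesis by blast
qed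

lemma El_surj:
  assumes "X \<in> carrier l_monoid"
  shows "\<exists>A\<in>carrier El_monoid. \<exists>B\<in>carrier El_monoid. X \<otimes>\<^bsub>l_monoid\<^esub> A = B"
proof -
  interpret l: comm_monoid l_monoid by (rule comm_monoid_l)
  obtain x :: "('a, 'a univ) qformation" where x: "is_qformation x" "X = l_class x" by (rule l_carrierE[OF assms])
  obtain M \<phi> L V where q: "x = (M, Qc M \<phi>, L, V)" "qfr M \<phi> L V" by (rule qfE[OF x(1)])
  have X: "X = lc M \<phi> L V" by (simp add: x(2) q(1) lc_def)
  obtain D where h: "HP M \<phi> L D" using q(2) unfolding qfr_def by blast
  have "rank V = rank D" using q(2) HP_rank[OF h] unfolding qfr_def by auto
  then obtain k g where g: "smp (bsum V (std k)) (bsum D (std k)) g"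
    by (rule rank_eq_stably_simple[OF qfrD(4)[OF q(2)] HPD(10)[OF h]])
  let ?P = "std k"
  note P = is_based_std[of k]
  \<comment> \<open>Stabilisation adds \<open>iD\<close> of \<open>std k\<close> to both
    \<open>V\<close> and \<open>D\<close>. The standard pairing identifies it simply with
    \<open>std k\<close>, the module on which \<open>g\<close> is available.\<close>
  have j: "smp ?P (iD ?P) (\<lambda>x. (\<zero>\<^bsub>?P\<^esub>, \<lambda>y\<in>carrier ?P. ip k x y))"
    by (rule smp_comp[OF perfectD(4)[OF perfect_std] iD(1)[OF P]])
  note s = smp_comp[OF smp_comp[OF smp_bsum[OF smp_id[OF qfrD(4)[OF q(2)]] smp_inv[OF j]] g]
    smp_bsum[OF smp_id[OF HPD(10)[OF h]] j]]
  have "X = lc (bsum M (Hm ?P)) (osum \<phi> hyp) (bsum L (iL ?P)) (bsum V (iD ?P))"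
    using lc_mult[OF q(2) qfr_triv[OF P]] lc_carrier[OF q(2)] by (simp add: X lc_HP[OF HP_hyperbolic[OF P]])
  then show ?thesis
    using surj_aux[OF HP_sum[OF h HP_hyperbolic[OF P]] qfr_sum[OF q(2) qfr_triv[OF P]] s] by simp
qed

lemma Gr_El_iso: "Gr_map l_monoid (\<lambda>x. x) \<in> iso (Gr El_monoid) (Gr l_monoid)"
proof (rule Gr_map_iso[OF comm_monoid_El comm_monoid_l])
  show "(\<lambda>x. x) \<in> hom El_monoid l_monoid" by (rule homI) (simp_all add: El_sub El_mult)
next
  fix a b k assume c: "a \<in> carrier El_monoid" "b \<in> carrier El_monoid" "k \<in> carrier l_monoid"
    and e: "a \<otimes>\<^bsub>l_monoid\<^esub> k = b \<otimes>\<^bsub>l_monoid\<^esub> k"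
  \<comment> \<open>\<open>k\<close> is arbitrary in the \<open>l\<close>-monoid. Applying the
    retraction to the equation fixes \<open>a\<close> and \<open>b\<close> and replaces
    \<open>k\<close> by an elementary element.\<close>
  let ?k = "e_map (bmap k)"
  have k: "bmap k \<in> carrier Fzs" by (rule hom_in_carrier[OF bmap_hom c(3)])
  have r: "e_map (bmap (x \<otimes>\<^bsub>l_monoid\<^esub> k)) = x \<otimes>\<^bsub>El_monoid\<^esub> ?k" if x: "x \<in> carrier El_monoid" for x
    using hom_mult[OF bmap_hom El_sub[OF x] c(3)] e_bmap[OF x]
      hom_mult[OF iso_imp_homomorphism[OF e_map_iso] hom_in_carrier[OF bmap_hom El_sub[OF x]] k] by simp
  show "\<exists>k'\<in>carrier El_monoid. a \<otimes>\<^bsub>El_monoid\<^esub> k' = b \<otimes>\<^bsub>El_monoid\<^esub> k'"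
    using r[OF c(1)] r[OF c(2)] e hom_in_carrier[OF iso_imp_homomorphism[OF e_map_iso] k] by auto
next
  fix x assume "x \<in> carrier l_monoid"
  then show "\<exists>a\<in>carrier El_monoid. \<exists>a'\<in>carrier El_monoid. x \<otimes>\<^bsub>l_monoid\<^esub> a = a'" by (rule El_surj)
qed

lemma Gr_e_map_iso: "Gr_map El_monoid e_map \<in> iso (Gr Fzs) (Gr El_monoid)"
proof (rule Gr_map_iso[OF comm_monoid_Fzs comm_monoid_El iso_imp_homomorphism[OF e_map_iso]])
  interpret F: comm_monoid Fzs by (rule comm_monoid_Fzs)
  interpret E: comm_monoid El_monoid by (rule comm_monoid_El)
  note e = e_map_iso and eh = iso_imp_homomorphism[OF e_map_iso]
  have bij: "bij_betw e_map (carrier Fzs) (carrier El_monoid)" using e by (simp add: iso_def)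
  {
    fix a b k assume c: "a \<in> carrier Fzs" "b \<in> carrier Fzs" "k \<in> carrier El_monoid"
      and eq: "e_map a \<otimes>\<^bsub>El_monoid\<^esub> k = e_map b \<otimes>\<^bsub>El_monoid\<^esub> k"
    obtain k' where k: "k' \<in> carrier Fzs" "k = e_map k'" using bij_betw_imp_surj_on[OF bij] c(3) by auto
    have "a \<otimes>\<^bsub>Fzs\<^esub> k' = b \<otimes>\<^bsub>Fzs\<^esub> k'"
      using eq hom_mult[OF eh c(1) k(1)] hom_mult[OF eh c(2) k(1)]
        inj_onD[OF bij_betw_imp_inj_on[OF bij], of "a \<otimes>\<^bsub>Fzs\<^esub> k'" "b \<otimes>\<^bsub>Fzs\<^esub> k'"] c k by simp
    then show "\<exists>k'\<in>carrier Fzs. a \<otimes>\<^bsub>Fzs\<^esub> k' = b \<otimes>\<^bsub>Fzs\<^esub> k'" using k(1) by blast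
  next
    fix x assume x: "x \<in> carrier El_monoid"
    then obtain a where a: "a \<in> carrier Fzs" "x = e_map a" using bij_betw_imp_surj_on[OF bij] by auto
    have "x \<otimes>\<^bsub>El_monoid\<^esub> e_map \<one>\<^bsub>Fzs\<^esub> = e_map a"
      unfolding a(2) hom_mult[OF eh a(1) F.one_closed, symmetric] F.r_one[OF a(1)] ..
    with a(1) F.one_closed show "\<exists>a\<in>carrier Fzs. \<exists>a'\<in>carrier Fzs. x \<otimes>\<^bsub>El_monoid\<^esub> e_map a = e_map a'"
      by (intro bexI)
  }
qed

end

theorem corollary17:
  fixes bar :: "'a::ring_1 \<Rightarrow> 'a" and q :: nat and Z :: "'a imat set set set"
  assumes "q \<ge> 1"
    and "ring_involution bar"
    and "weakly_finite TYPE('a)"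
    and "subgroup Z K1_red"
    and "star_invariant bar Z"
  defines "F \<equiv> l_theory.Fzs bar q Z"
    and "El \<equiv> l_theory.El_monoid bar q Z"
    and "l \<equiv> l_theory.l_monoid bar q Z"
    and "e \<equiv> l_theory.e_map bar q Z"
  shows "comm_monoid F \<and> comm_monoid l \<and> submonoid (carrier El) l \<and> e \<in> iso F El \<and>
    Gr_map El e \<in> iso (Gr F) (Gr El) \<and>
    Gr_map l (\<lambda>x. x) \<in> iso (Gr El) (Gr l)"
proof -
  interpret l_setting bar q Z by (rule l_setting.intro[OF assms(2,3,4,5)])
  show ?thesis
    unfolding F_def El_def l_def e_def
    by (intro conjI comm_monoid_Fzs comm_monoid_l submonoid_El e_map_iso Gr_e_map_iso Gr_El_iso)
qed

end
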